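(* Let $\alpha>1$, let $U$ satisfy (U), and let the Lévy process $L$ satisfy (L1) and (L2) with this $\alpha$ (super-exponential tails with index $\alpha$), where (U), (L1), (L2) are the hypotheses spelled out in the context. For $\varepsilon>0$ let $q_\varepsilon:=\sup\{u>0:\nu([u,\infty))\ge\varepsilon\}$ be the $\varepsilon$-quantile of $\nu$, and put $$d_\alpha:=\alpha(\alpha-1)^{1/\alpha-1},\qquad D_\varepsilon:=\exp\Big(-d_\alpha\frac{|\ln\varepsilon|}{\varepsilon q_\varepsilon}\Big).$$ Then for any $\delta>0$ there is $\varepsilon_0>0$ such that for all $0<\varepsilon\le\varepsilon_0$ the following inequalities hold for all $t\ge0$ (with $\varepsilon_0$ not depending on $t$): $$(1-\delta)\exp(-D_\varepsilon^{1-\delta}t)\le\inf_{|x|\le1-\delta}\mathbf P(\sigma_x(\varepsilon)>t)\le\sup_{|x|\le1}\mathbf P(\sigma_x(\varepsilon)>t)\le(1+\delta)\exp(-D_\varepsilon^{1+\delta}t).$$ Consequently, for any $|x|<1$, $$d_\alpha^{-1}\lim_{\varepsilon\to0}\frac{\varepsilon q_\varepsilon}{|\ln\varepsilon|}\ln\mathbf E\,\sigma_x(\varepsilon)=1.$$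
   Context: $(\Omega,\mathcal F,(\mathcal F_t)_{t\ge0},\mathbf P)$ is a filtered probability space satisfying the usual hypotheses. (U): $U:\mathbb R\to\mathbb R$ is continuously differentiable, $U'$ is Lipschitz continuous, $U'(0)=0$, and $U'(x)x>0$ for $x\in(-1,1)\setminus\{0\}$. (L1): $L$ is a real-valued Lévy process with generating triplet $(d,\nu,\mu)$, where $d\ge0$ is the Gaussian variance, $\mu\in\mathbb R$ is an arbitrary drift, and $\nu$ is a symmetric Lévy measure, $\int_{\mathbb R\setminus\{0\}}(y^2\wedge1)\,\nu(dy)<\infty$. (L2): with $f(u):=-\ln\nu([u,+\infty))$, $u>0$, one has $f(u)=u^\alpha l(u)$ for $u\ge1$, where $l$ is slowly varying at $+\infty$ (a positive Lebesgue measurable function with $\lim_{u\to\infty}l(\lambda u)/l(u)=1$ for every $\lambda>0$). For $\varepsilon>0$ and $x\in\mathbb R$, $X^\varepsilon(x)=(X^\varepsilon_t(x))_{t\ge0}$ is the strong solution of $$X_t^\varepsilon(x)=x-\int_0^tU'(X^\varepsilon_{s-}(x))\,ds+\varepsilon L_t,\qquad t\ge0,$$ and $\sigma_x(\varepsilon):=\inf\{t\ge0:|X_t^\varepsilon(x)|\ge1\}$. For $\delta>1$ the set $\{|x|\le1-\delta\}$ is empty and the inequalities involving the infimum are regarded as void. *)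

theory Defs
  imports "HOL-Probability.Probability"
begin

section \<open>Filtered probability spaces and cadlag processes\<close>

text \<open>Processes and filtrations are indexed by \<^typ>\<open>real\<close>; only times \<open>t \<ge> 0\<close> are constrained.\<close>

locale usual_filtered_prob_space = prob_space M + complete_measure M
  for M :: "'a measure" +
  fixes F :: "real \<Rightarrow> 'a measure"
  assumes subalg: "\<And>t. 0 \<le> t \<Longrightarrow> subalgebra M (F t)"
    and mono: "\<And>s t. 0 \<le> s \<Longrightarrow> s \<le> t \<Longrightarrow> sets (F s) \<subseteq> sets (F t)"
    and null_sets_F: "null_sets M \<subseteq> sets (F 0)"
    and right_cont: "\<And>t. 0 \<le> t \<Longrightarrow> sets (F t) = (\<Inter>s\<in>{t<..}. sets (F s))"

definition cadlag :: "(real \<Rightarrow> real) \<Rightarrow> bool" where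
  "cadlag g \<longleftrightarrow>
     (\<forall>t\<ge>0. (g \<longlongrightarrow> g t) (at_right t)) \<and> (\<forall>t>0. \<exists>l. (g \<longlongrightarrow> l) (at_left t))"

definition adapted :: "(real \<Rightarrow> 'a measure) \<Rightarrow> (real \<Rightarrow> 'a \<Rightarrow> real) \<Rightarrow> bool" where
  "adapted F X \<longleftrightarrow> (\<forall>t\<ge>0. X t \<in> borel_measurable (F t))"


section \<open>Levy processes\<close>

text \<open>Stochastic continuity is not listed: it follows from right-continuity of the paths
  and stationarity of the increments.\<close>

definition levy_process ::
    "'a measure \<Rightarrow> (real \<Rightarrow> 'a measure) \<Rightarrow> (real \<Rightarrow> 'a \<Rightarrow> real) \<Rightarrow> bool" where
  "levy_process M F L \<longleftrightarrow>
     adapted F L \<and>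
     (AE \<omega> in M. L 0 \<omega> = 0) \<and>
     (\<forall>s t. 0 \<le> s \<longrightarrow> s \<le> t \<longrightarrow>
        prob_space.indep_set M (sets (F s))
          (sets (vimage_algebra (space M) (\<lambda>\<omega>. L t \<omega> - L s \<omega>) borel))) \<and>
     (\<forall>s t. 0 \<le> s \<longrightarrow> 0 \<le> t \<longrightarrow>
        distr M borel (\<lambda>\<omega>. L (s + t) \<omega> - L s \<omega>) = distr M borel (L t)) \<and>
     (AE \<omega> in M. cadlag (\<lambda>t. L t \<omega>))"

text \<open>A measure on \<open>\<real> - {0}\<close> is represented by a Borel measure on \<open>\<real>\<close> without mass at \<open>0\<close>.\<close>

definition levy_measure :: "real measure \<Rightarrow> bool" where
  "levy_measure \<nu> \<longleftrightarrow>
     sets \<nu> = sets borel \<and> emeasure \<nu> {0} = 0 \<and>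
     (\<integral>\<^sup>+ y. ennreal (min (y\<^sup>2) 1) \<partial>\<nu>) < \<infinity>"

definition symmetric_measure :: "real measure \<Rightarrow> bool" where
  "symmetric_measure \<nu> \<longleftrightarrow> (\<forall>A\<in>sets borel. emeasure \<nu> (uminus ` A) = emeasure \<nu> A)"

definition levy_exponent :: "real \<Rightarrow> real measure \<Rightarrow> real \<Rightarrow> real \<Rightarrow> complex" where
  "levy_exponent d \<nu> \<mu> z =
     - of_real (d * z\<^sup>2 / 2) + \<i> * of_real (\<mu> * z) +
     (CLINT y|\<nu>. iexp (z * y) - 1 - \<i> * of_real (z * y * indicator {-1..1} y))"

definition generating_triplet ::
    "'a measure \<Rightarrow> (real \<Rightarrow> 'a \<Rightarrow> real) \<Rightarrow> real \<Rightarrow> real measure \<Rightarrow> real \<Rightarrow> bool" where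
  "generating_triplet M L d \<nu> \<mu> \<longleftrightarrow>
     (\<forall>z. char (distr M borel (L 1)) z = exp (levy_exponent d \<nu> \<mu> z))"

definition L1 :: "'a measure \<Rightarrow> (real \<Rightarrow> 'a measure) \<Rightarrow> (real \<Rightarrow> 'a \<Rightarrow> real) \<Rightarrow>
    real \<Rightarrow> real measure \<Rightarrow> real \<Rightarrow> bool" where
  "L1 M F L d \<nu> \<mu> \<longleftrightarrow>
     levy_process M F L \<and> 0 \<le> d \<and> levy_measure \<nu> \<and> symmetric_measure \<nu> \<and>
     generating_triplet M L d \<nu> \<mu>"


section \<open>Super-exponential tails\<close>

definition slowly_varying :: "(real \<Rightarrow> real) \<Rightarrow> bool" where
  "slowly_varying l \<longleftrightarrow>
     (\<forall>u>0. l u > 0) \<and> l \<in> borel_measurable (lebesgue_on {0<..}) \<and>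
     (\<forall>c>0. ((\<lambda>u. l (c * u) / l u) \<longlongrightarrow> 1) at_top)"

definition log_tail :: "real measure \<Rightarrow> real \<Rightarrow> real" where
  "log_tail \<nu> u = - ln (measure \<nu> {u..})"

text \<open>Positivity of the tails is what makes \<^const>\<open>log_tail\<close> the mathematical
  \<open>f : (0,\<infinity>) \<rightarrow> \<real>\<close>, since \<open>ln 0 = 0\<close> in HOL.\<close>

definition L2 :: "real measure \<Rightarrow> real \<Rightarrow> bool" where
  "L2 \<nu> \<alpha> \<longleftrightarrow>
     (\<forall>u>0. measure \<nu> {u..} > 0) \<and>
     (\<exists>l. slowly_varying l \<and> (\<forall>u\<ge>1. log_tail \<nu> u = u powr \<alpha> * l u))"

definition quantile :: "real measure \<Rightarrow> real \<Rightarrow> real" where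
  "quantile \<nu> \<epsilon> = Sup {u. u > 0 \<and> measure \<nu> {u..} \<ge> \<epsilon>}"

definition d_const :: "real \<Rightarrow> real" where
  "d_const \<alpha> = \<alpha> * (\<alpha> - 1) powr (1 / \<alpha> - 1)"

definition D_rate :: "real measure \<Rightarrow> real \<Rightarrow> real \<Rightarrow> real" where
  "D_rate \<nu> \<alpha> \<epsilon> = exp (- d_const \<alpha> * (\<bar>ln \<epsilon>\<bar> / (\<epsilon> * quantile \<nu> \<epsilon>)))"


section \<open>The stochastic equation and its exit time\<close>

definition potential :: "(real \<Rightarrow> real) \<Rightarrow> bool" where
  "potential U \<longleftrightarrow>
     U C1_differentiable_on UNIV \<and> (\<exists>C. C-lipschitz_on UNIV (deriv U)) \<and>
     deriv U 0 = 0 \<and> (\<forall>x\<in>{-1<..<1} - {0}. deriv U x * x > 0)"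

text \<open>The left limit at \<open>s = 0\<close> is irrelevant, \<open>{0}\<close> being a Lebesgue null set.\<close>

definition strong_solution ::
    "'a measure \<Rightarrow> (real \<Rightarrow> 'a measure) \<Rightarrow> (real \<Rightarrow> real) \<Rightarrow> (real \<Rightarrow> 'a \<Rightarrow> real) \<Rightarrow>
     real \<Rightarrow> real \<Rightarrow> (real \<Rightarrow> 'a \<Rightarrow> real) \<Rightarrow> bool" where
  "strong_solution M F U L \<epsilon> x X \<longleftrightarrow>
     adapted F X \<and>
     (AE \<omega> in M. cadlag (\<lambda>t. X t \<omega>)) \<and>
     (AE \<omega> in M. \<forall>t\<ge>0.
        X t \<omega> = x - (LBINT s:{0..t}. deriv U (Lim (at_left s) (\<lambda>r. X r \<omega>))) + \<epsilon> * L t \<omega>)"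

definition exit_time :: "(real \<Rightarrow> 'a \<Rightarrow> real) \<Rightarrow> 'a \<Rightarrow> ereal" where
  "exit_time X \<omega> = Inf (ereal ` {t. 0 \<le> t \<and> \<bar>X t \<omega>\<bar> \<ge> 1})"

definition survival_prob :: "'a measure \<Rightarrow> (real \<Rightarrow> 'a \<Rightarrow> real) \<Rightarrow> real \<Rightarrow> real" where
  "survival_prob M X t = measure M {\<omega> \<in> space M. exit_time X \<omega> > ereal t}"

definition mean_exit_time :: "'a measure \<Rightarrow> (real \<Rightarrow> 'a \<Rightarrow> real) \<Rightarrow> ennreal" where
  "mean_exit_time M X = (\<integral>\<^sup>+ \<omega>. e2ennreal (exit_time X \<omega>) \<partial>M)"

text \<open>The logarithm on \<open>[0,\<infinity>]\<close>, so that \<open>ln (E \<sigma>)\<close> is correct even when the mean is infinite.\<close>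

definition ln_ext :: "ennreal \<Rightarrow> ereal" where
  "ln_ext y = (if y = 0 then -\<infinity> else if y = \<infinity> then \<infinity> else ereal (ln (enn2real y)))"

end

theory Submission
  imports Defs "HOL-Real_Asymp.Real_Asymp"
begin

text \<open>
  A unit distance is travelled most cheaply by about \<open>n = 1 / (\<epsilon> y)\<close> jumps of equal size \<open>y\<close> within
  a bounded time, which costs \<open>n (f y + ln n)\<close> with \<open>f = - ln \<nu>[y,\<infinity>)\<close> and \<open>ln n \<approx> \<bar>ln \<epsilon>\<bar>\<close>. Writing
  \<open>y = c q\<close> with the quantile \<open>q\<close> and \<open>f (c q) \<approx> c\<^sup>\<alpha> \<bar>ln \<epsilon>\<bar>\<close>, the minimum over \<open>c\<close> is
  \<open>d\<^sub>\<alpha> \<bar>ln \<epsilon>\<bar> / (\<epsilon> q)\<close>.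

  The exit probability over a fixed short time is bounded below by splitting that time into \<open>n\<close>
  pieces and asking each increment of \<open>L\<close> to exceed \<open>y\<close>; the drift only costs a small constant.
  Conversely, the Laplace exponent of \<open>L\<close> at \<open>s = (1 - \<delta>) d\<^sub>\<alpha> \<bar>ln \<epsilon>\<bar> / q\<close> is \<open>o(1/\<epsilon>)\<close>, hence dominated by
  the drift term \<open>c s / \<epsilon>\<close>: after the last visit near \<open>0\<close>, the path stays below the noise increment
  with a linear drift \<open>-c\<close> added, whose exponential moments of order \<open>s / \<epsilon>\<close> decay. A union bound over
  a polynomially fine time grid confines the path during a block of length \<open>D powr -(1 - \<delta>)\<close>, and
  blocks are concatenated through the independence of increments from the past.

  Estimates for the law of \<open>L (1/m)\<close> come from weak approximation by compound Poisson laws. Survival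
  events are measurable because the path cannot touch the level \<open>1\<close> by a left limit at a jump time.
\<close>

section \<open>Super-exponential tails\<close>

text \<open>Both halves meet in the same constant by convex duality. With \<open>y = c * q\<close>
  the cost per unit distance is \<open>(c powr \<alpha> + 1) / c\<close> in units of
  \<open>\<bar>ln \<epsilon>\<bar> / (\<epsilon> * q)\<close>: the power pays for the size of a
  jump, the \<open>1\<close> for confining it to a time piece of length about \<epsilon>. The
  minimum over \<open>c\<close> is \<open>d_const \<alpha>\<close>; equivalently
  \<open>d_const \<alpha> * c \<le> c powr \<alpha> + 1\<close>, which says that jumps of size
  \<open>c * q\<close> contribute at most about \<open>1 / \<epsilon>\<close> to the Laplace
  exponent at \<open>d_const \<alpha> * \<bar>ln \<epsilon>\<bar> / q\<close>. Since
  \<open>\<epsilon> * q\<close> tends to 0, factors polynomial in \<open>1 / \<epsilon>\<close> are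
  negligible on this scale; this pays for fine grids, union bounds and constants. The obstacle is
  how little is given about \<open>L\<close>: its law at time 1 and the independence of increments
  from the past. Weights measurable in the past therefore take the role of conditioning, exponential
  moments are obtained at rational times, and every statement about \<open>X\<close> is a pathwise
  consequence of one about increments of \<open>L\<close>.\<close>

lemma levy_measure_finite_away:
  assumes "levy_measure \<nu>" "e > 0"
  shows "emeasure \<nu> {y. e \<le> \<bar>y\<bar>} < \<infinity>"
proof -
  have [measurable_cong]: "sets \<nu> = sets borel" using assms by (simp add: levy_measure_def)
  define c where "c = min (e\<^sup>2) 1"
  have c: "c > 0" using assms by (simp add: c_def)
  have "ennreal c * emeasure \<nu> {y. e \<le> \<bar>y\<bar>} = (\<integral>\<^sup>+ y. ennreal c * indicator {y. e \<le> \<bar>y\<bar>} y \<partial>\<nu>)"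
    by (subst nn_integral_cmult_indicator) auto
  also have "\<dots> \<le> (\<integral>\<^sup>+ y. ennreal (min (y\<^sup>2) 1) \<partial>\<nu>)"
  proof (intro nn_integral_mono)
    fix y :: real
    have "e\<^sup>2 \<le> y\<^sup>2" if "e \<le> \<bar>y\<bar>"
      using that \<open>e > 0\<close> power2_le_iff_abs_le[of e y] by (metis abs_ge_zero abs_le_square_iff abs_of_pos)
    then show "ennreal c * indicator {y. e \<le> \<bar>y\<bar>} y \<le> ennreal (min (y\<^sup>2) 1)"
      by (auto simp: c_def indicator_def intro!: ennreal_leI)
  qed
  also have "\<dots> < \<infinity>" using assms by (simp add: levy_measure_def)
  finally show ?thesis using c by (auto simp: ennreal_mult_less_top)
qed

locale light_tailed_levy_measure =
  fixes \<nu> :: "real measure" and \<alpha> :: real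
  assumes alpha: "\<alpha> > 1" and levy: "levy_measure \<nu>"
    and symm: "symmetric_measure \<nu>" and tails: "L2 \<nu> \<alpha>"
begin

lemma sets_nu [measurable_cong]: "sets \<nu> = sets borel"
  using levy by (simp add: levy_measure_def)

lemma tail_finite: "u > 0 \<Longrightarrow> emeasure \<nu> {u..} < \<infinity>"
  by (rule le_less_trans[OF emeasure_mono levy_measure_finite_away[OF levy, of u]]) auto

lemma tail_emeasure: "u > 0 \<Longrightarrow> emeasure \<nu> {u..} = ennreal (measure \<nu> {u..})"
  using tail_finite[of u] by (intro emeasure_eq_ennreal_measure) auto

lemma tail_pos: "u > 0 \<Longrightarrow> measure \<nu> {u..} > 0"
  using tails by (simp add: L2_def)

lemma tail_antimono: "0 < u \<Longrightarrow> u \<le> v \<Longrightarrow> measure \<nu> {v..} \<le> measure \<nu> {u..}"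
  using tail_finite[of u] by (intro measure_mono_fmeasurable) (auto simp: fmeasurable_def)

lemma tail_eq_exp: "u > 0 \<Longrightarrow> measure \<nu> {u..} = exp (- log_tail \<nu> u)"
  using tail_pos[of u] by (simp add: log_tail_def)

lemma log_tail_mono: "0 < u \<Longrightarrow> u \<le> v \<Longrightarrow> log_tail \<nu> u \<le> log_tail \<nu> v"
  using tail_antimono[of u v] tail_pos[of v] by (simp add: log_tail_def)

lemma log_tail_pos: "u \<ge> 1 \<Longrightarrow> log_tail \<nu> u > 0"
  using tails by (force simp: L2_def slowly_varying_def)

lemma log_tail_ratio:
  assumes "c > 0"
  shows "((\<lambda>u. log_tail \<nu> (c * u) / log_tail \<nu> u) \<longlongrightarrow> c powr \<alpha>) at_top"
proof -
  obtain l where l: "slowly_varying l" "\<And>u. u \<ge> 1 \<Longrightarrow> log_tail \<nu> u = u powr \<alpha> * l u"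
    using tails by (auto simp: L2_def)
  have lim: "((\<lambda>u. c powr \<alpha> * (l (c * u) / l u)) \<longlongrightarrow> c powr \<alpha> * 1) at_top"
    using l(1) assms by (intro tendsto_intros) (auto simp: slowly_varying_def)
  have "\<forall>\<^sub>F u in at_top. c powr \<alpha> * (l (c * u) / l u) = log_tail \<nu> (c * u) / log_tail \<nu> u"
    using eventually_ge_at_top[of "max 1 (1 / c)"]
  proof eventually_elim
    case (elim u)
    then have "u \<ge> 1" "c * u \<ge> 1" using assms by (auto simp: field_simps)
    then show ?case using l(2) assms by (simp add: powr_mult)
  qed
  from Lim_transform_eventually[OF lim this] show ?thesis by simp
qed

text \<open>By regular variation and \<open>2 powr \<alpha> > 2\<close>, doubling \<open>u\<close> eventually at least doubles \<open>log_tail \<nu> u\<close>.\<close>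

lemma log_tail_linear_growth:
  "\<exists>u\<^sub>0\<ge>1. \<forall>u\<ge>u\<^sub>0. \<forall>y\<ge>u. y / (2 * u) * log_tail \<nu> u \<le> log_tail \<nu> y"
proof -
  have "2 powr 1 < 2 powr \<alpha>" using alpha by (intro powr_less_mono) auto
  then have "\<forall>\<^sub>F u in at_top. 2 < log_tail \<nu> (2 * u) / log_tail \<nu> u"
    using order_tendstoD(1)[OF log_tail_ratio[of 2], of 2] by simp
  then obtain u0 where u0: "\<And>u. u \<ge> u0 \<Longrightarrow> 2 < log_tail \<nu> (2 * u) / log_tail \<nu> u"
    by (auto simp: eventually_at_top_linorder)
  define u1 where "u1 = max 1 u0"
  have dbl: "2 * log_tail \<nu> u \<le> log_tail \<nu> (2 * u)" if "u \<ge> u1" for u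
    using u0[of u] log_tail_pos[of u] that by (auto simp: u1_def field_simps)
  have pow: "2 ^ k * log_tail \<nu> u \<le> log_tail \<nu> (2 ^ k * u)" if "u \<ge> u1" for u k
  proof (induction k)
    case (Suc k)
    have "u1 \<le> 1 * u" using that by simp
    also have "\<dots> \<le> 2 ^ k * u" using that by (intro mult_right_mono) (auto simp: u1_def)
    finally show ?case using Suc dbl[of "2 ^ k * u"] by (simp add: mult.assoc)
  qed simp
  have "y / (2 * u) * log_tail \<nu> u \<le> log_tail \<nu> y" if uy: "u \<ge> u1" "y \<ge> u" for u y
  proof -
    have u: "u \<ge> 1" using uy by (simp add: u1_def)
    \<comment> \<open>The number of doublings that fit below \<open>y\<close>; rounding it down
      costs the factor 2 in the claim.\<close>
    define k where "k = nat \<lfloor>log 2 (y / u)\<rfloor>"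
    have nn: "log 2 (y / u) \<ge> 0" using u uy by simp
    have k1: "real k \<le> log 2 (y / u)" "log 2 (y / u) < real k + 1"
      using nn by (auto simp: k_def)
    have "2 powr real k \<le> y / u" using k1(1) u uy by (simp add: le_log_iff)
    then have a: "2 ^ k * u \<le> y" using u by (simp add: powr_realpow field_simps)
    have "y / u < 2 powr (real k + 1)" using k1(2) u uy by (simp add: log_less_iff)
    then have b: "y / (2 * u) \<le> 2 ^ k" using u by (simp add: powr_realpow powr_add field_simps)
    have "y / (2 * u) * log_tail \<nu> u \<le> 2 ^ k * log_tail \<nu> u"
      using b log_tail_pos[OF u] by (intro mult_right_mono) auto
    also have "\<dots> \<le> log_tail \<nu> (2 ^ k * u)" using pow uy by simp
    also have "\<dots> \<le> log_tail \<nu> y" using a u by (intro log_tail_mono) auto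
    finally show ?thesis .
  qed
  then show ?thesis by (intro exI[of _ u1]) (auto simp: u1_def)
qed

text \<open>A linear lower bound with some slope \<open>m\<close> holds far out. Passing from
  \<open>u\<close> to \<open>k * u\<close> multiplies the log-tail by about
  \<open>k powr \<alpha>\<close> but the argument only by \<open>k\<close>, so the slope improves by
  \<open>k powr (\<alpha> - 1) / 2\<close>, which is as large as desired.\<close>

lemma log_tail_superlinear: "\<forall>\<^sub>F y in at_top. A * y \<le> log_tail \<nu> y"
proof -
  obtain u0 where u0: "u0 \<ge> 1" "\<And>y. y \<ge> u0 \<Longrightarrow> y / (2 * u0) * log_tail \<nu> u0 \<le> log_tail \<nu> y"
    using log_tail_linear_growth by blast
  define m where "m = log_tail \<nu> u0 / (2 * u0)"
  have m: "m > 0" using u0 log_tail_pos[of u0] by (simp add: m_def)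
  have lin: "m * y \<le> log_tail \<nu> y" if "y \<ge> u0" for y
    using u0(2)[OF that] by (simp add: m_def mult.commute)
  have "filterlim (\<lambda>k::real. k powr (\<alpha> - 1)) at_top at_top" using alpha by real_asymp
  then have "\<forall>\<^sub>F k in at_top. 2 * \<bar>A\<bar> / m + 1 \<le> k powr (\<alpha> - 1)"
    by (simp add: filterlim_at_top)
  then obtain k where k: "2 * \<bar>A\<bar> / m + 1 \<le> k powr (\<alpha> - 1)" "k \<ge> 1"
    using eventually_conj[OF _ eventually_ge_at_top[of "1::real"]] eventually_happens'
    by (metis (no_types, lifting) trivial_limit_at_top_linorder)
  have "k powr \<alpha> / 2 < k powr \<alpha>" using k by simp
  from order_tendstoD(1)[OF log_tail_ratio[of k] this]
  have "\<forall>\<^sub>F u in at_top. k powr \<alpha> / 2 < log_tail \<nu> (k * u) / log_tail \<nu> u"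
    using k by simp
  then obtain u1 where u1: "\<And>u. u \<ge> u1 \<Longrightarrow> k powr \<alpha> / 2 < log_tail \<nu> (k * u) / log_tail \<nu> u"
    by (auto simp: eventually_at_top_linorder)
  have "A * y \<le> log_tail \<nu> y" if y: "y \<ge> k * max u1 u0" for y
  proof -
    define u where "u = y / k"
    have "u \<ge> max u1 u0" using y k unfolding u_def
      by (metis mult.commute mult_imp_le_div_pos order_less_le_trans zero_less_one)
    moreover have "y = k * u" using k by (simp add: u_def)
    ultimately have u: "u \<ge> u1" "u \<ge> u0" "u \<ge> 1" "y = k * u"
      using u0(1) by auto
    have "\<bar>A\<bar> \<le> k powr (\<alpha> - 1) / 2 * m" using k m by (simp add: field_simps)
    then have "\<bar>A\<bar> * (k * u) \<le> (k powr (\<alpha> - 1) / 2 * m) * (k * u)"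
      using k u by (intro mult_right_mono) auto
    also have "\<dots> = k powr \<alpha> / 2 * (m * u)"
      using k by (simp add: powr_diff)
    also have "\<dots> \<le> k powr \<alpha> / 2 * log_tail \<nu> u" using lin u by (intro mult_left_mono) auto
    also have "\<dots> \<le> log_tail \<nu> (k * u)"
      using u1[OF u(1)] log_tail_pos[of u] u by (simp add: field_simps)
    finally have *: "\<bar>A\<bar> * y \<le> log_tail \<nu> y" using u by simp
    have "A * y \<le> \<bar>A\<bar> * y" using u k by (intro mult_right_mono) auto
    with * show ?thesis by simp
  qed
  then show ?thesis unfolding eventually_at_top_linorder by blast
qed

lemma log_tail_at_top: "filterlim (log_tail \<nu>) at_top at_top"
  by (rule filterlim_at_top_mono[OF filterlim_ident, of "log_tail \<nu>"])
     (use log_tail_superlinear[of 1] in simp)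

section \<open>The quantile as the natural unit of jump size\<close>

lemma quantile_bdd: "\<epsilon> > 0 \<Longrightarrow> bdd_above {u. u > 0 \<and> measure \<nu> {u..} \<ge> \<epsilon>}"
proof -
  assume e: "\<epsilon> > 0"
  have "\<forall>\<^sub>F y in at_top. - ln \<epsilon> + 1 \<le> log_tail \<nu> y"
    using log_tail_at_top by (simp add: filterlim_at_top)
  then obtain y0 where y0: "\<And>y. y \<ge> y0 \<Longrightarrow> - ln \<epsilon> + 1 \<le> log_tail \<nu> y"
    by (auto simp: eventually_at_top_linorder)
  have "u \<le> y0" if "u > 0" "measure \<nu> {u..} \<ge> \<epsilon>" for u
  proof (rule ccontr)
    assume "\<not> u \<le> y0"
    then have "ln \<epsilon> \<ge> 1 + ln (measure \<nu> {u..})" using y0[of u] by (simp add: log_tail_def)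
    moreover have "ln \<epsilon> \<le> ln (measure \<nu> {u..})" using that e by simp
    ultimately show False by simp
  qed
  then show ?thesis by (auto simp: bdd_above_def)
qed

lemma quantile_ge: "\<epsilon> > 0 \<Longrightarrow> u > 0 \<Longrightarrow> measure \<nu> {u..} \<ge> \<epsilon> \<Longrightarrow> u \<le> quantile \<nu> \<epsilon>"
  unfolding quantile_def by (rule cSup_upper[OF _ quantile_bdd]) auto

lemma quantile_at_top: "filterlim (quantile \<nu>) at_top (at_right 0)"
  unfolding filterlim_at_top
proof
  fix Z :: real
  have "\<forall>\<^sub>F \<epsilon> in at_right 0. 0 < \<epsilon> \<and> \<epsilon> < measure \<nu> {max Z 1..}"
    unfolding eventually_at_right_field
    by (rule exI[of _ "measure \<nu> {max Z 1..}"]) (use tail_pos[of "max Z 1"] in auto)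
  then show "\<forall>\<^sub>F \<epsilon> in at_right 0. Z \<le> quantile \<nu> \<epsilon>"
    by eventually_elim (use quantile_ge[of _ "max Z 1"] in auto)
qed

text \<open>The condition on \<open>measure \<nu> {1..}\<close> makes the set defining the quantile
  nonempty. This lemma and the next one say that the log-tail crosses the level
  \<open>\<bar>ln \<epsilon>\<bar>\<close> at the quantile; strict inequalities avoid the quantile
  itself, where \<nu> may have an atom.\<close>

lemma log_tail_below_quantile:
  assumes "0 < \<epsilon>" "\<epsilon> < 1" "\<epsilon> \<le> measure \<nu> {1..}" "0 < u" "u < quantile \<nu> \<epsilon>"
  shows "log_tail \<nu> u \<le> \<bar>ln \<epsilon>\<bar>"
proof -
  have "1 \<in> {u. u > 0 \<and> measure \<nu> {u..} \<ge> \<epsilon>}" using assms by simp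
  then obtain v where "v > u" "v > 0" "measure \<nu> {v..} \<ge> \<epsilon>"
    using assms(5) unfolding quantile_def by (subst (asm) less_cSup_iff[OF _ quantile_bdd[OF assms(1)]]) blast+
  then have "measure \<nu> {u..} \<ge> \<epsilon>" using tail_antimono[of u v] assms by simp
  then have "ln \<epsilon> \<le> ln (measure \<nu> {u..})" using assms by simp
  then show ?thesis using assms by (simp add: log_tail_def)
qed

lemma log_tail_above_quantile:
  assumes "0 < \<epsilon>" "\<epsilon> < 1" "0 < u" "quantile \<nu> \<epsilon> < u"
  shows "\<bar>ln \<epsilon>\<bar> \<le> log_tail \<nu> u"
proof -
  have "measure \<nu> {u..} < \<epsilon>" using quantile_ge[of \<epsilon> u] assms by fastforce
  then have "ln (measure \<nu> {u..}) \<le> ln \<epsilon>" using tail_pos[OF assms(3)] assms by simp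
  then show ?thesis using assms by (simp add: log_tail_def)
qed

text \<open>One eventual statement for the recurring smallness conditions; at each use
  \<open>Z\<close> is taken as the sum of the thresholds needed there.\<close>

lemma eventually_quantile_setup:
  "\<forall>\<^sub>F \<epsilon> in at_right 0. 0 < \<epsilon> \<and> \<epsilon> < 1 \<and> \<epsilon> \<le> measure \<nu> {1..} \<and> Z \<le> quantile \<nu> \<epsilon> \<and> Z \<le> \<bar>ln \<epsilon>\<bar>"
proof -
  have 1: "\<forall>\<^sub>F \<epsilon> in at_right 0. 0 < \<epsilon> \<and> \<epsilon> < 1 \<and> \<epsilon> \<le> measure \<nu> {1..}"
    unfolding eventually_at_right_field
    by (rule exI[of _ "min 1 (measure \<nu> {1..})"]) (use tail_pos[of "1"] in auto)
  have 2: "\<forall>\<^sub>F \<epsilon> in at_right 0. Z \<le> quantile \<nu> \<epsilon>"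
    using quantile_at_top by (simp add: filterlim_at_top)
  have "filterlim (\<lambda>\<epsilon>::real. \<bar>ln \<epsilon>\<bar>) at_top (at_right 0)" by real_asymp
  then have 3: "\<forall>\<^sub>F \<epsilon> in at_right 0. Z \<le> \<bar>ln \<epsilon>\<bar>" by (simp add: filterlim_at_top)
  from 1 2 3 show ?thesis by eventually_elim auto
qed

lemma mult_quantile_at_top: "b > 0 \<Longrightarrow> filterlim (\<lambda>\<epsilon>. b * quantile \<nu> \<epsilon>) at_top (at_right 0)"
  by (intro filterlim_tendsto_pos_mult_at_top[OF tendsto_const _ quantile_at_top])

text \<open>The log-tail at the quantile is not known exactly, but at
  \<open>b * quantile \<nu> \<epsilon>\<close> it is at least
  \<open>\<bar>ln \<epsilon>\<bar>\<close> for \<open>b > 1\<close> and at most that for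
  \<open>b < 1\<close>. Regular variation compares \<open>c\<close> with \<open>b\<close> and gives
  the limit \<open>(c / b) powr \<alpha>\<close>; then \<open>b\<close> is moved to 1.\<close>

lemma log_tail_quantile:
  assumes "c > 0"
  shows "((\<lambda>\<epsilon>. log_tail \<nu> (c * quantile \<nu> \<epsilon>) / \<bar>ln \<epsilon>\<bar>) \<longlongrightarrow> c powr \<alpha>) (at_right 0)"
proof -
  have lim: "((\<lambda>\<epsilon>. log_tail \<nu> (c * quantile \<nu> \<epsilon>) / log_tail \<nu> (b * quantile \<nu> \<epsilon>)) \<longlongrightarrow> (c / b) powr \<alpha>) (at_right 0)"
    if "b > 0" for b
    using filterlim_compose[OF log_tail_ratio[of "c / b"] mult_quantile_at_top[OF that]] that assms
    by (simp add: field_simps)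
  have cont: "((\<lambda>b. (c / b) powr \<alpha>) \<longlongrightarrow> (c / 1) powr \<alpha>) (at 1)"
    using assms by (intro tendsto_intros) auto
  show ?thesis
  proof (rule order_tendstoI)
    fix a assume a: "a < c powr \<alpha>"
    have "((\<lambda>b. (c / b) powr \<alpha>) \<longlongrightarrow> (c / 1) powr \<alpha>) (at_right 1)"
      using cont by (rule filterlim_mono) (auto simp: at_le)
    from order_tendstoD(1)[OF this, of a] a have "\<forall>\<^sub>F b in at_right 1. a < (c / b) powr \<alpha> \<and> b > 1"
      by (auto intro: eventually_conj eventually_at_right_less)
    then obtain b where b: "a < (c / b) powr \<alpha>" "b > 1"
      using eventually_happens'[of "at_right (1::real)"] by (auto simp: trivial_limit_at_right_real)
    have "\<forall>\<^sub>F \<epsilon> in at_right 0. a < log_tail \<nu> (c * quantile \<nu> \<epsilon>) / log_tail \<nu> (b * quantile \<nu> \<epsilon>)"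
      using order_tendstoD(1)[OF lim b(1)] b by simp
    then show "\<forall>\<^sub>F \<epsilon> in at_right 0. a < log_tail \<nu> (c * quantile \<nu> \<epsilon>) / \<bar>ln \<epsilon>\<bar>"
      using eventually_quantile_setup[of "1 + 1 / c"]
    proof eventually_elim
      case (elim \<epsilon>)
      let ?q = "quantile \<nu> \<epsilon>"
      have q: "?q \<ge> 1" using elim assms by (auto intro: order_trans[rotated])
      have "c * (1 + 1 / c) \<le> c * ?q" using elim assms by (intro mult_left_mono) auto
      then have cq: "c * ?q \<ge> 1" using assms by (simp add: distrib_left)
      have "1 / c > 0" using assms by simp
      then have "\<bar>ln \<epsilon>\<bar> > 0" using elim by linarith
      moreover have "\<bar>ln \<epsilon>\<bar> \<le> log_tail \<nu> (b * ?q)" using log_tail_above_quantile[of \<epsilon> "b * ?q"] elim q b by simp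
      ultimately have "log_tail \<nu> (c * ?q) / log_tail \<nu> (b * ?q) \<le> log_tail \<nu> (c * ?q) / \<bar>ln \<epsilon>\<bar>"
        using elim log_tail_pos[OF cq] by (intro divide_left_mono mult_pos_pos) linarith+
      then show ?case using elim by linarith
    qed
  next
    fix a assume a: "a > c powr \<alpha>"
    have "((\<lambda>b. (c / b) powr \<alpha>) \<longlongrightarrow> (c / 1) powr \<alpha>) (at_left 1)"
      using cont by (rule filterlim_mono) (auto simp: at_le)
    from order_tendstoD(2)[OF this, of a] a have "\<forall>\<^sub>F b in at_left 1. a > (c / b) powr \<alpha> \<and> b > 0 \<and> b < 1"
      using eventually_at_left_real[of 0 "1::real"] by (auto elim: eventually_elim2)
    then obtain b where b: "a > (c / b) powr \<alpha>" "b > 0" "b < 1"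
      using eventually_happens'[of "at_left (1::real)"] by (auto simp: trivial_limit_at_left_real)
    have "\<forall>\<^sub>F \<epsilon> in at_right 0. a > log_tail \<nu> (c * quantile \<nu> \<epsilon>) / log_tail \<nu> (b * quantile \<nu> \<epsilon>)"
      using order_tendstoD(2)[OF lim b(1)] b by simp
    then show "\<forall>\<^sub>F \<epsilon> in at_right 0. a > log_tail \<nu> (c * quantile \<nu> \<epsilon>) / \<bar>ln \<epsilon>\<bar>"
      using eventually_quantile_setup[of "1 + 1 / c + 1 / b"]
    proof eventually_elim
      case (elim \<epsilon>)
      let ?q = "quantile \<nu> \<epsilon>"
      have "c * (1 + 1 / c) \<le> c * ?q" "b * (1 + 1 / b) \<le> b * ?q"
        using elim assms b by (intro mult_left_mono; auto intro: order_trans[rotated])+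
      then have cq: "c * ?q \<ge> 1" "b * ?q \<ge> 1" using assms b by (simp_all add: distrib_left)
      then have "?q > 0" using b by (metis less_le_trans zero_less_mult_pos zero_less_one)
      then have "log_tail \<nu> (b * ?q) \<le> \<bar>ln \<epsilon>\<bar>"
        using log_tail_below_quantile[of \<epsilon> "b * ?q"] elim cq b by simp
      then have "log_tail \<nu> (c * ?q) / \<bar>ln \<epsilon>\<bar> \<le> log_tail \<nu> (c * ?q) / log_tail \<nu> (b * ?q)"
        using elim log_tail_pos[OF cq(1)] log_tail_pos[OF cq(2)] by (intro divide_left_mono mult_pos_pos) auto
      then show ?case using elim by linarith
    qed
  qed
qed

text \<open>Superlinearity is applied at half the quantile, where the log-tail is still at most
  \<open>\<bar>ln \<epsilon>\<bar>\<close>.\<close>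

lemma log_over_quantile_at_top: "filterlim (\<lambda>\<epsilon>. \<bar>ln \<epsilon>\<bar> / quantile \<nu> \<epsilon>) at_top (at_right 0)"
  unfolding filterlim_at_top
proof
  fix Z :: real
  have "filterlim (\<lambda>\<epsilon>. (1/2) * quantile \<nu> \<epsilon>) at_top (at_right 0)" by (rule mult_quantile_at_top) simp
  from eventually_compose_filterlim[OF log_tail_superlinear[of "2 * Z"] this]
  show "\<forall>\<^sub>F \<epsilon> in at_right 0. Z \<le> \<bar>ln \<epsilon>\<bar> / quantile \<nu> \<epsilon>"
    using eventually_quantile_setup[of 1]
  proof eventually_elim
    case (elim \<epsilon>)
    then show ?case using log_tail_below_quantile[of \<epsilon> "(1/2) * quantile \<nu> \<epsilon>"] by (simp add: field_simps)
  qed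
qed

text \<open>The hypothesis is the limiting inequality in units
  \<open>y = c * quantile \<nu> \<epsilon>\<close>. Convergence is only pointwise in
  \<open>c\<close>; uniformity comes from a finite grid of values \<open>c\<close> with monotonicity
  in between, and from linear growth beyond the last grid point.\<close>

lemma log_tail_uniform:
  assumes A: "A \<ge> 0" "\<And>c. c \<ge> 0 \<Longrightarrow> A * c \<le> c powr \<alpha> + B\<^sub>0" and B: "B\<^sub>0 < B"
  shows "\<forall>\<^sub>F \<epsilon> in at_right 0. \<forall>y\<ge>1. A * (\<bar>ln \<epsilon>\<bar> / quantile \<nu> \<epsilon>) * y \<le> log_tail \<nu> y + B * \<bar>ln \<epsilon>\<bar>"
proof -
  have B0: "B\<^sub>0 \<ge> 0" using A(2)[of 0] by simp
  define g where "g = (B - B\<^sub>0) / 2"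
  have g: "g > 0" using B by (simp add: g_def)
  \<comment> \<open>Mesh of the grid: moving within a cell changes \<open>A * c\<close> by at most
    \<open>g\<close>, half of the gap between \<open>B\<^sub>0\<close> and \<open>B\<close>. The
    other half absorbs the convergence error at the grid points.\<close>
  define w where "w = g / (A + 1)"
  have w: "w > 0" "A * w \<le> g" using g A(1) by (auto simp: w_def field_simps)
  \<comment> \<open>Beyond \<open>C = J * w\<close> the log-tail has slope at least
    \<open>C powr (\<alpha> - 1) / 4\<close> in units of
    \<open>\<bar>ln \<epsilon>\<bar> / quantile \<nu> \<epsilon>\<close>: one factor 1/2 is lost in
    the growth lemma, the other in the limit at \<open>C\<close>.\<close>
  have "filterlim (\<lambda>j::nat. (real j * w) powr (\<alpha> - 1)) at_top at_top"
    using alpha w(1) by real_asymp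
  then have "\<forall>\<^sub>F j in at_top. 4 * A \<le> (real j * w) powr (\<alpha> - 1)" by (simp add: filterlim_at_top)
  then obtain J where J: "4 * A \<le> (real J * w) powr (\<alpha> - 1)" "J \<ge> 1"
    using eventually_conj[OF _ eventually_ge_at_top[of "1::nat"]] eventually_happens'
    by (metis (no_types, lifting) trivial_limit_at_top_linorder)
  define C where "C = real J * w"
  have C: "C > 0" "4 * A \<le> C powr (\<alpha> - 1)" using J w by (auto simp: C_def)
  obtain u0 where u0: "u0 \<ge> 1" "\<And>u y. u \<ge> u0 \<Longrightarrow> y \<ge> u \<Longrightarrow> y / (2 * u) * log_tail \<nu> u \<le> log_tail \<nu> y"
    using log_tail_linear_growth by blast
  have "\<forall>\<^sub>F \<epsilon> in at_right 0. \<forall>j\<in>{1..J}. (real j * w) powr \<alpha> - g < log_tail \<nu> (real j * w * quantile \<nu> \<epsilon>) / \<bar>ln \<epsilon>\<bar>"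
    using w g by (intro eventually_ball_finite ballI order_tendstoD(1)[OF log_tail_quantile]) auto
  moreover have "\<forall>\<^sub>F \<epsilon> in at_right 0. C powr \<alpha> / 2 < log_tail \<nu> (C * quantile \<nu> \<epsilon>) / \<bar>ln \<epsilon>\<bar>"
    using C by (intro order_tendstoD(1)[OF log_tail_quantile]) auto
  ultimately show ?thesis
    using eventually_quantile_setup[of "1 + u0 / C"]
  proof eventually_elim
    case (elim \<epsilon>)
    let ?q = "quantile \<nu> \<epsilon>" and ?l = "\<bar>ln \<epsilon>\<bar>"
    have q: "?q > 0" "?q \<ge> u0 / C" using elim u0 C by (auto intro: order_trans[rotated] less_le_trans[rotated] simp: add_pos_nonneg)
    have l: "?l > 0" using elim by auto
    show ?case
    proof (intro allI impI)
      fix y :: real assume y: "y \<ge> 1"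
      show "A * (?l / ?q) * y \<le> log_tail \<nu> y + B * ?l"
      proof (cases "y \<ge> C * ?q")
        case True
        have "A * (?l / ?q) * y \<le> (C powr (\<alpha> - 1) / 4) * (?l / ?q) * y"
          using C q l y by (intro mult_right_mono) auto
        also have "\<dots> = y / (2 * (C * ?q)) * (C powr \<alpha> / 2 * ?l)"
          using C q by (simp add: powr_diff field_simps)
        also have "\<dots> \<le> y / (2 * (C * ?q)) * log_tail \<nu> (C * ?q)"
          using elim l y q C by (intro mult_left_mono) (auto simp: field_simps)
        also have "\<dots> \<le> log_tail \<nu> y" using True q C by (intro u0(2)) (auto simp: field_simps)
        finally show ?thesis using B B0 l by (smt (verit) mult_nonneg_nonneg)
      next
        case False
        define j where "j = nat \<lfloor>y / (w * ?q)\<rfloor>"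
        have nn: "y / (w * ?q) \<ge> 0" using y w q by simp
        have j: "real j \<le> y / (w * ?q)" "y / (w * ?q) < real j + 1" using nn by (auto simp: j_def)
        have j1: "real j * w * ?q \<le> y" using j(1) w q by (simp add: field_simps)
        have j2: "y / ?q \<le> real j * w + w" using j(2) w q by (simp add: field_simps)
        have "real j < real J"
        proof -
          have "real j * w * ?q < real J * w * ?q" using j1 False by (simp add: C_def)
          then show ?thesis using w q by simp
        qed
        have "A * (?l / ?q) * y = A * (y / ?q) * ?l" by simp
        also have "\<dots> \<le> A * (real j * w + w) * ?l" using j2 A(1) l by (intro mult_right_mono mult_left_mono) auto
        also have "\<dots> \<le> ((real j * w) powr \<alpha> + B\<^sub>0 + g) * ?l"
          using A(2)[of "real j * w"] w l by (intro mult_right_mono) (auto simp: algebra_simps)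
        also have "\<dots> \<le> log_tail \<nu> y + B * ?l"
        proof (cases "j = 0")
          case True
          have "(B\<^sub>0 + g) * ?l \<le> B * ?l" using g B l by (intro mult_right_mono) (auto simp: g_def field_simps)
          then show ?thesis using True log_tail_pos[OF y] by simp
        next
          case False
          then have "(real j * w) powr \<alpha> - g < log_tail \<nu> (real j * w * ?q) / ?l"
            using elim(1) \<open>real j < real J\<close> by auto
          then have "((real j * w) powr \<alpha> - g) * ?l \<le> log_tail \<nu> (real j * w * ?q)"
            using l by (simp add: field_simps)
          also have "\<dots> \<le> log_tail \<nu> y" using j1 False w q by (intro log_tail_mono) auto
          finally show ?thesis by (simp add: g_def field_simps)
        qed
        finally show ?thesis .
      qed
    qed
  qed
qed

lemma log_tail_affine_minorant: "\<exists>b. \<forall>y\<ge>1. A * y \<le> log_tail \<nu> y + b"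
proof -
  obtain y0 where y0: "\<And>y. y \<ge> y0 \<Longrightarrow> A * y \<le> log_tail \<nu> y"
    using log_tail_superlinear[of A] by (auto simp: eventually_at_top_linorder)
  have "A * y \<le> log_tail \<nu> y + \<bar>A\<bar> * \<bar>y0\<bar>" if "y \<ge> 1" for y
  proof (cases "y \<ge> y0")
    case True then show ?thesis using y0[of y] by (smt (verit) abs_ge_zero mult_nonneg_nonneg)
  next
    case False
    then have "A * y \<le> \<bar>A\<bar> * \<bar>y0\<bar>" using that by (intro mult_mono) auto
    then show ?thesis using log_tail_pos[OF that] by simp
  qed
  then show ?thesis by blast
qed

section \<open>Exponential moments of the large jumps\<close>

definition exp_tail :: "real \<Rightarrow> real" where
  "exp_tail s = enn2real (\<integral>\<^sup>+ y. ennreal (exp (s * y)) * indicator {1..} y \<partial>\<nu>)"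

text \<open>Jumps are grouped into unit layers: the layer from \<open>k + 1\<close> to
  \<open>k + 2\<close> contributes at most \<open>exp (s * (k + 2))\<close> times the tail at
  \<open>k + 1\<close>. The slope \<open>s + 1\<close> in the hypothesis, one more than
  \<open>s\<close>, leaves a summable factor \<open>exp (- (k + 1))\<close>.\<close>

lemma exp_tail_le:
  assumes s: "s \<ge> 0" and b: "\<And>y. y \<ge> 1 \<Longrightarrow> (s + 1) * y \<le> log_tail \<nu> y + b"
  shows "(\<integral>\<^sup>+ y. ennreal (exp (s * y)) * indicator {1..} y \<partial>\<nu>) \<le> ennreal (exp (s + b))"
proof -
  have "(\<integral>\<^sup>+ y. ennreal (exp (s * y)) * indicator {1..} y \<partial>\<nu>)
      \<le> (\<integral>\<^sup>+ y. (\<Sum>k. ennreal (exp (s * (real k + 2))) * indicator {real k + 1..} y) \<partial>\<nu>)"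
  proof (intro nn_integral_mono)
    fix y :: real
    show "ennreal (exp (s * y)) * indicator {1..} y \<le> (\<Sum>k. ennreal (exp (s * (real k + 2))) * indicator {real k + 1..} y)"
    proof (cases "y \<ge> 1")
      case True
      define k where "k = nat \<lfloor>y - 1\<rfloor>"
      have k: "real k \<le> y - 1" "y - 1 < real k + 1" using True by (auto simp: k_def)
      have "ennreal (exp (s * y)) * indicator {1..} y \<le> ennreal (exp (s * (real k + 2))) * indicator {real k + 1..} y"
        using k s True by (auto simp: indicator_def intro!: ennreal_leI mult_left_mono)
      also have "\<dots> = (\<Sum>j\<in>{k}. ennreal (exp (s * (real j + 2))) * indicator {real j + 1..} y)"
        by (subst sum.insert) auto
      also have "\<dots> \<le> (\<Sum>k. ennreal (exp (s * (real k + 2))) * indicator {real k + 1..} y)"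
        by (intro sum_le_suminf) auto
      finally show ?thesis .
    qed auto
  qed
  also have "\<dots> = (\<Sum>k. ennreal (exp (s * (real k + 2))) * emeasure \<nu> {real k + 1..})"
    by (subst nn_integral_suminf) (auto simp: nn_integral_cmult_indicator)
  also have "\<dots> \<le> (\<Sum>k. ennreal (exp (s + b) * (1/2) ^ Suc k))"
  proof (intro suminf_le allI)
    fix k
    have "ennreal (exp (s * (real k + 2))) * emeasure \<nu> {real k + 1..} = ennreal (exp (s * (real k + 2) - log_tail \<nu> (real k + 1)))"
      by (simp add: tail_emeasure tail_eq_exp ennreal_mult[symmetric] exp_diff exp_minus field_simps)
    also have "\<dots> \<le> ennreal (exp (s + b - real (Suc k)))"
      using b[of "real k + 1"] by (intro ennreal_leI) (simp add: algebra_simps)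
    also have "\<dots> \<le> ennreal (exp (s + b) * (1/2) ^ Suc k)"
    proof (intro ennreal_leI)
      have "(2::real) ^ Suc k \<le> exp 1 ^ Suc k" using exp_ge_add_one_self[of 1] by (intro power_mono) auto
      then have "2 ^ Suc k \<le> exp (real (Suc k))" by (metis exp_of_nat_mult mult.right_neutral)
      then show "exp (s + b - real (Suc k)) \<le> exp (s + b) * (1/2) ^ Suc k"
        by (simp add: exp_diff power_divide field_simps)
    qed
    finally show "ennreal (exp (s * (real k + 2))) * emeasure \<nu> {real k + 1..} \<le> ennreal (exp (s + b) * (1/2) ^ Suc k)" .
  qed auto
  also have "\<dots> = ennreal (exp (s + b))"
    using sums_mult[OF power_half_series, of "exp (s + b)"]
    by (subst suminf_ennreal2) (auto simp: sums_iff)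
  finally show ?thesis .
qed

lemma exp_tail_finite: "s \<ge> 0 \<Longrightarrow> (\<integral>\<^sup>+ y. ennreal (exp (s * y)) * indicator {1..} y \<partial>\<nu>) < \<infinity>"
proof -
  assume s: "s \<ge> 0"
  obtain b where "\<And>y. y \<ge> 1 \<Longrightarrow> (s + 1) * y \<le> log_tail \<nu> y + b"
    using log_tail_affine_minorant[of "s + 1"] by blast
  from exp_tail_le[OF s this] show ?thesis by (rule le_less_trans) auto
qed

text \<open>A crude majorant of the log moment generating function of \<open>L 1\<close> at both
  \<open>s\<close> and \<open>- s\<close>. The factor \<open>exp s\<close> on drift, Gaussian part
  and small jumps is harmless, because in the regime of interest \<open>exp_tail\<close>
  dominates.\<close>

definition laplace_bound :: "real \<Rightarrow> real \<Rightarrow> real \<Rightarrow> real" where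
  "laplace_bound d \<mu> s =
     exp s * (\<bar>\<mu>\<bar> * s + d * s\<^sup>2 + enn2real (\<integral>\<^sup>+ y. ennreal (min (y\<^sup>2) 1) \<partial>\<nu>) * s\<^sup>2) + 2 * exp_tail s"

text \<open>The uniform tail inequality bounds \<open>exp_tail\<close> by
  \<open>exp (s + B1 * \<bar>ln \<epsilon>\<bar>)\<close>. As the quantile diverges,
  \<open>s\<close> is negligible against \<open>\<bar>ln \<epsilon>\<bar>\<close>, so all remaining
  factors fit into an arbitrarily small power of \<epsilon>.\<close>

lemma laplace_bound_asymp:
  assumes A: "0 \<le> A\<^sub>0" "A\<^sub>0 < A" "\<And>c. c \<ge> 0 \<Longrightarrow> A * c \<le> c powr \<alpha> + B\<^sub>0" and B: "B\<^sub>0 < B" and d: "d \<ge> 0"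
  shows "\<forall>\<^sub>F \<epsilon> in at_right 0. laplace_bound d \<mu> (A\<^sub>0 * (\<bar>ln \<epsilon>\<bar> / quantile \<nu> \<epsilon>)) \<le> \<epsilon> powr (- B)"
proof -
  \<comment> \<open>\<open>B1\<close> is paid for the tail. Of the rest \<gamma>, three quarters
    absorb \<open>exp (3 * s)\<close> and one quarter absorbs the constant
    \<open>K + 2\<close>.\<close>
  define B1 where "B1 = (B\<^sub>0 + B) / 2"
  define \<gamma> where "\<gamma> = B - B1"
  have g: "\<gamma> > 0" using B by (simp add: B1_def \<gamma>_def field_simps)
  have B0: "B\<^sub>0 \<ge> 0" using A(3)[of 0] by simp
  define K where "K = \<bar>\<mu>\<bar> + d + enn2real (\<integral>\<^sup>+ y. ennreal (min (y\<^sup>2) 1) \<partial>\<nu>)"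
  have K: "K \<ge> 0" using d by (simp add: K_def)
  have "\<forall>\<^sub>F \<epsilon> in at_right 0. \<forall>y\<ge>1. A * (\<bar>ln \<epsilon>\<bar> / quantile \<nu> \<epsilon>) * y \<le> log_tail \<nu> y + B1 * \<bar>ln \<epsilon>\<bar>"
    using A B by (intro log_tail_uniform[where B\<^sub>0 = B\<^sub>0]) (auto simp: B1_def)
  moreover have "\<forall>\<^sub>F \<epsilon> in at_right 0. 1 / (A - A\<^sub>0) \<le> \<bar>ln \<epsilon>\<bar> / quantile \<nu> \<epsilon>"
    using log_over_quantile_at_top by (simp add: filterlim_at_top)
  ultimately show ?thesis
    using eventually_quantile_setup[of "1 + 4 * A\<^sub>0 / \<gamma> + 4 * ln (K + 2) / \<gamma>"]
  proof eventually_elim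
    case (elim \<epsilon>)
    let ?q = "quantile \<nu> \<epsilon>" and ?l = "\<bar>ln \<epsilon>\<bar>"
    define s where "s = A\<^sub>0 * (?l / ?q)"
    have lnK: "ln (K + 2) \<ge> 0" using K by simp
    have nn: "4 * A\<^sub>0 / \<gamma> \<ge> 0" "4 * ln (K + 2) / \<gamma> \<ge> 0" using A g lnK by auto
    have q: "?q \<ge> 1" "?q \<ge> 4 * A\<^sub>0 / \<gamma>" "?l \<ge> 4 * ln (K + 2) / \<gamma>" using elim nn by linarith+
    have s: "s \<ge> 0" using A q by (simp add: s_def)
    have sl: "s \<le> \<gamma> / 4 * ?l"
    proof -
      have "A\<^sub>0 * ?l \<le> (\<gamma> / 4 * ?q) * ?l" using q(2) g by (intro mult_right_mono) (auto simp: field_simps)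
      then show ?thesis using q by (simp add: s_def field_simps)
    qed
    have tail: "exp_tail s \<le> exp (s + B1 * ?l)"
    proof -
      have "(s + 1) * y \<le> log_tail \<nu> y + B1 * ?l" if "y \<ge> 1" for y
      proof -
        \<comment> \<open>The gap between \<open>A\<^sub>0\<close> and \<open>A\<close> supplies the
          extra unit of slope that \<open>exp_tail_le\<close> asks for.\<close>
        have "1 \<le> (A - A\<^sub>0) * (?l / ?q)" using elim(2) A(2) by (simp add: pos_divide_le_eq mult.commute)
        then have "s + 1 \<le> A * (?l / ?q)" unfolding s_def left_diff_distrib by linarith
        then have "(s + 1) * y \<le> A * (?l / ?q) * y" using that by (intro mult_right_mono) auto
        then show ?thesis using elim(1) that by fastforce
      qed
      from exp_tail_le[OF s this] show ?thesis by (auto simp: exp_tail_def intro: enn2real_leI)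
    qed
    have e1: "s \<le> exp s" "1 \<le> exp s" using exp_ge_add_one_self[of s] s by linarith+
    have s2: "s \<le> exp s * exp s" "s\<^sup>2 \<le> exp s * exp s"
      using e1 s mult_mono[of s "exp s" s "exp s"] mult_mono[of s "exp s" 1 "exp s"] by (auto simp: power2_eq_square)
    have "\<bar>\<mu>\<bar> * s + d * s\<^sup>2 + enn2real (\<integral>\<^sup>+ y. ennreal (min (y\<^sup>2) 1) \<partial>\<nu>) * s\<^sup>2 \<le> K * (exp s * exp s)"
      unfolding K_def distrib_right using s2 d by (intro add_mono mult_left_mono) auto
    then have "laplace_bound d \<mu> s \<le> exp s * (K * (exp s * exp s)) + 2 * exp (s + B1 * ?l)"
      unfolding laplace_bound_def using tail by (intro add_mono mult_left_mono) auto
    also have "\<dots> = K * exp (3 * s) + 2 * exp (s + B1 * ?l)" by (simp add: exp_add[symmetric])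
    also have "\<dots> \<le> K * exp (3 * s + B1 * ?l) + 2 * exp (3 * s + B1 * ?l)"
      using s K B B0 by (intro add_mono mult_left_mono) (auto simp: B1_def)
    also have "\<dots> = exp (ln (K + 2)) * exp (3 * s + B1 * ?l)" using K by (simp add: algebra_simps)
    also have "\<dots> \<le> exp (B * ?l)"
    proof -
      have "ln (K + 2) \<le> \<gamma> / 4 * ?l" using q(3) g by (simp add: field_simps)
      then have "ln (K + 2) + (3 * s + B1 * ?l) \<le> \<gamma> * ?l + B1 * ?l" using sl by (simp add: algebra_simps)
      also have "\<dots> = B * ?l" by (simp add: \<gamma>_def algebra_simps)
      finally show ?thesis by (simp add: exp_add[symmetric])
    qed
    also have "exp (B * ?l) = \<epsilon> powr (- B)" using elim by (simp add: powr_def)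
    finally show ?case by (simp add: s_def)
  qed
qed

section \<open>The constant as a convex dual\<close>

lemma d_const_pos: "d_const \<alpha> > 0"
  using alpha by (simp add: d_const_def)

text \<open>Young's inequality for \<open>k * c\<close> and 1 with exponents \<alpha> and
  \<open>\<alpha> / (\<alpha> - 1)\<close>; the scaling \<open>k\<close> equalises the two
  coefficients. Equality holds at the optimal jump size, so the constant cannot be enlarged and
  matches the one from the jump strategy.\<close>

lemma d_const_le:
  assumes "c \<ge> 0"
  shows "d_const \<alpha> * c \<le> c powr \<alpha> + 1"
proof -
  define k where "k = (\<alpha> - 1) powr (1 / \<alpha>)"
  have k: "k > 0" "k powr \<alpha> = \<alpha> - 1" using alpha by (auto simp: k_def powr_powr)
  have d: "d_const \<alpha> = \<alpha> * k / (\<alpha> - 1)"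
    using alpha by (simp add: d_const_def k_def powr_diff)
  have "(k * c) * 1 \<le> (k * c) powr \<alpha> / \<alpha> + 1 powr (\<alpha> / (\<alpha> - 1)) / (\<alpha> / (\<alpha> - 1))"
    using alpha k assms by (intro Youngs_inequality) (auto simp: field_simps)
  also have "\<dots> = (\<alpha> - 1) / \<alpha> * (c powr \<alpha> + 1)"
    using alpha k assms by (simp add: powr_mult add_divide_distrib) (simp add: field_simps)
  finally have "\<alpha> / (\<alpha> - 1) * (k * c) \<le> \<alpha> / (\<alpha> - 1) * ((\<alpha> - 1) / \<alpha> * (c powr \<alpha> + 1))"
    using alpha by (intro mult_left_mono) auto
  then show ?thesis using alpha by (simp add: d)
qed

text \<open>Feeds \<open>laplace_bound_asymp\<close> with an arbitrary slope when the size of the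
  resulting power of \<epsilon> does not matter.\<close>

lemma power_dominates_linear: "\<exists>B. \<forall>c\<ge>0. A * c \<le> c powr \<alpha> + B"
proof -
  define x where "x = \<bar>A\<bar> powr (1 / (\<alpha> - 1))"
  have "A * c \<le> c powr \<alpha> + \<bar>A\<bar> * x" if "c \<ge> 0" for c
  proof (cases "c \<le> x")
    case True
    have "A * c \<le> \<bar>A\<bar> * x" using True that by (intro mult_mono) auto
    then show ?thesis by (simp add: add_increasing)
  next
    case False
    have x: "x \<ge> 0" by (simp add: x_def)
    then have "x powr (\<alpha> - 1) \<le> c powr (\<alpha> - 1)" using False alpha by (intro powr_mono2) auto
    then have "A \<le> c powr (\<alpha> - 1)" using alpha by (cases "A = 0") (auto simp: x_def powr_powr)
    then have "A * c \<le> c powr (\<alpha> - 1) * c" using that by (rule mult_right_mono)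
    also have "\<dots> = c powr \<alpha>" using False x by (simp add: powr_diff)
    finally show ?thesis using x by (simp add: add_increasing2)
  qed
  then show ?thesis by blast
qed

end

section \<open>Compound Poisson and normal laws\<close>

lemma char_convolution:
  assumes "real_distribution M" "real_distribution N"
  shows "char (M \<star> N) z = char M z * char N z"
proof -
  interpret M: real_distribution M by fact
  interpret N: real_distribution N by fact
  interpret P: pair_prob_space M N ..
  have [measurable_cong]: "sets M = sets borel" "sets N = sets borel" by simp_all
  have "char (M \<star> N) z = (CLINT p|M \<Otimes>\<^sub>M N. iexp (z * (fst p + snd p)))"
    unfolding char_def convolution_def by (subst integral_distr) (auto simp: split_beta')
  also have "\<dots> = (CLINT x|M. CLINT y|N. iexp (z * (x + y)))"
    by (subst P.integral_fst'[symmetric]) (auto intro!: P.integrable_const_bound[of _ 1])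
  also have "\<dots> = (CLINT x|M. CLINT y|N. iexp (z * x) * iexp (z * y))"
    by (simp add: exp_add[symmetric] algebra_simps)
  also have "\<dots> = char M z * char N z"
    by (simp add: char_def)
  finally show ?thesis .
qed

lemma real_distribution_convolution:
  assumes "real_distribution M" "real_distribution N"
  shows "real_distribution (M \<star> N)"
proof -
  interpret M: real_distribution M by fact
  interpret N: real_distribution N by fact
  interpret P: pair_prob_space M N ..
  have [measurable_cong]: "sets M = sets borel" "sets N = sets borel" by simp_all
  show ?thesis unfolding convolution_def by (rule P.real_distribution_distr) (auto simp: split_beta')
qed

lemma nn_integral_exp_convolution:
  assumes "real_distribution M" "real_distribution N"
  shows "(\<integral>\<^sup>+ x. ennreal (exp (s * x)) \<partial>(M \<star> N)) = (\<integral>\<^sup>+ x. ennreal (exp (s * x)) \<partial>M) * (\<integral>\<^sup>+ x. ennreal (exp (s * x)) \<partial>N)"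
proof -
  interpret M: real_distribution M by fact
  interpret N: real_distribution N by fact
  show ?thesis
    by (subst nn_integral_convolution)
       (auto simp: M.finite_measure_axioms N.finite_measure_axioms distrib_left exp_add ennreal_mult
          nn_integral_cmult nn_integral_multc)
qed

lemma convolution_tail_ge:
  assumes "real_distribution M" "real_distribution N"
  shows "measure (M \<star> N) {a + b..} \<ge> measure M {a..} * measure N {b..}"
proof -
  interpret M: real_distribution M by fact
  interpret N: real_distribution N by fact
  interpret MN: real_distribution "M \<star> N" by (rule real_distribution_convolution) fact+
  have [measurable_cong]: "sets M = sets borel" "sets N = sets borel" by simp_all
  have "ennreal (measure M {a..} * measure N {b..}) = emeasure M {a..} * emeasure N {b..}"
    by (simp add: M.emeasure_eq_measure N.emeasure_eq_measure ennreal_mult)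
  also have "\<dots> = (\<integral>\<^sup>+ x. \<integral>\<^sup>+ y. indicator {a..} x * indicator {b..} y \<partial>N \<partial>M)"
    by (simp add: nn_integral_cmult nn_integral_multc)
  also have "\<dots> \<le> (\<integral>\<^sup>+ x. \<integral>\<^sup>+ y. indicator {a + b..} (x + y) \<partial>N \<partial>M)"
    by (intro nn_integral_mono) (auto simp: indicator_def)
  also have "\<dots> = emeasure (M \<star> N) {a + b..}"
    by (subst convolution_emeasure') (auto simp: M.finite_measure_axioms N.finite_measure_axioms)
  finally show ?thesis by (simp add: MN.emeasure_eq_measure)
qed

text \<open>The random sum is realised on the product of the Poisson count and an infinite sequence
  of jumps, so that transforms and tails follow by integrating first over the jumps with the count
  fixed.\<close>

definition compound_poisson :: "real \<Rightarrow> real measure \<Rightarrow> real measure" where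
  "compound_poisson r J =
     distr (measure_pmf (poisson_pmf r) \<Otimes>\<^sub>M PiM UNIV (\<lambda>_::nat. J)) borel (\<lambda>(n, Y). \<Sum>i<n. Y i)"

locale compound_poisson_law =
  fixes r :: real and J :: "real measure"
  assumes rate: "r > 0" and J: "real_distribution J"
begin

sublocale J: real_distribution J by (rule J)

lemma sets_J [measurable_cong]: "sets J = sets borel" by simp

abbreviation "\<Pi>J \<equiv> PiM UNIV (\<lambda>_::nat. J)"

sublocale P: prob_space \<Pi>J by (rule prob_space_PiM) (rule J.prob_space_axioms)

sublocale PJ: product_prob_space "\<lambda>_::nat. J" UNIV ..

sublocale N: prob_space "measure_pmf (poisson_pmf r)" by (rule measure_pmf.prob_space_axioms)

sublocale NP: pair_prob_space "measure_pmf (poisson_pmf r)" \<Pi>J ..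

lemma random_sum_measurable [measurable]:
  "(\<lambda>p. \<Sum>i<fst p. snd p i) \<in> borel_measurable (measure_pmf (poisson_pmf r) \<Otimes>\<^sub>M \<Pi>J)"
  by (rule measurable_compose_countable[where g = fst and f = "\<lambda>n p. \<Sum>i<n. snd p i"]) measurable

lemma distr_coordinate: "distr \<Pi>J borel (\<lambda>Y. Y i) = J"
proof -
  have "distr \<Pi>J borel (\<lambda>Y. Y i) = distr \<Pi>J J (\<lambda>Y. Y i)" by (intro distr_cong) auto
  then show ?thesis by (simp add: PJ.PiM_component)
qed

lemma indep_coordinates: "P.indep_vars (\<lambda>_. borel) (\<lambda>i Y. Y i) UNIV"
proof (subst P.indep_vars_iff_distr_eq_PiM')
  show "distr \<Pi>J (\<Pi>\<^sub>M i\<in>UNIV. borel) (\<lambda>x. \<lambda>i\<in>UNIV. x i) = (\<Pi>\<^sub>M i\<in>UNIV. distr \<Pi>J borel (\<lambda>Y. Y i))"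
    unfolding distr_coordinate
    using distr_id2[of "\<Pi>\<^sub>M i\<in>(UNIV::nat set). (borel::real measure)" \<Pi>J] sets_PiM_cong[of UNIV UNIV "\<lambda>_::nat. borel::real measure" "\<lambda>_. J"]
    by (simp add: restrict_UNIV id_def)
qed auto

lemma indep_coordinates': "P.indep_vars (\<lambda>_. borel) (\<lambda>i Y. Y i) A"
  using indep_coordinates by (rule P.indep_vars_subset) auto

lemma char_sum_coordinates: "(CLINT Y|\<Pi>J. iexp (z * (\<Sum>i<n. Y i))) = char J z ^ n"
proof -
  have "(CLINT Y|\<Pi>J. iexp (z * (\<Sum>i<n. Y i))) = char (distr \<Pi>J borel (\<lambda>Y. \<Sum>i<n. Y i)) z"
    unfolding char_def by (subst integral_distr) auto
  also have "\<dots> = char J z ^ n"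
    by (subst P.char_distr_sum[OF indep_coordinates']) (simp add: distr_coordinate)
  finally show ?thesis .
qed

lemma nn_integral_exp_sum_coordinates:
  "(\<integral>\<^sup>+ Y. ennreal (exp (s * (\<Sum>i<n. Y i))) \<partial>\<Pi>J) = (\<integral>\<^sup>+ y. ennreal (exp (s * y)) \<partial>J) ^ n"
proof -
  have "(\<integral>\<^sup>+ Y. ennreal (exp (s * (\<Sum>i<n. Y i))) \<partial>\<Pi>J) = (\<integral>\<^sup>+ Y. (\<Prod>i<n. ennreal (exp (s * Y i))) \<partial>\<Pi>J)"
    by (simp add: sum_distrib_left exp_sum prod_ennreal)
  also have "\<dots> = (\<Prod>i<n. \<integral>\<^sup>+ Y. ennreal (exp (s * Y i)) \<partial>\<Pi>J)"
    by (rule P.indep_vars_nn_integral)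
       (auto intro!: P.indep_vars_compose2[OF indep_coordinates', of _ "\<lambda>_ y. ennreal (exp (s * y))"])
  also have "\<dots> = (\<Prod>i<n. \<integral>\<^sup>+ y. ennreal (exp (s * y)) \<partial>J)"
  proof (rule prod.cong)
    fix i
    have "(\<integral>\<^sup>+ y. ennreal (exp (s * y)) \<partial>distr \<Pi>J borel (\<lambda>Y. Y i)) = (\<integral>\<^sup>+ Y. ennreal (exp (s * Y i)) \<partial>\<Pi>J)"
      by (subst nn_integral_distr) auto
    then show "(\<integral>\<^sup>+ Y. ennreal (exp (s * Y i)) \<partial>\<Pi>J) = (\<integral>\<^sup>+ y. ennreal (exp (s * y)) \<partial>J)"
      by (simp add: distr_coordinate)
  qed simp
  finally show ?thesis by simp
qed

lemma real_distribution_compound_poisson: "real_distribution (compound_poisson r J)"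
  unfolding compound_poisson_def by (rule NP.real_distribution_distr) (simp add: split_beta')

lemma char_compound_poisson: "char (compound_poisson r J) z = exp (of_real r * (char J z - 1))"
proof -
  have "char (compound_poisson r J) z =
      (CLINT p|measure_pmf (poisson_pmf r) \<Otimes>\<^sub>M \<Pi>J. iexp (z * (\<Sum>i<fst p. snd p i)))"
    unfolding char_def compound_poisson_def by (subst integral_distr) (auto simp: split_beta')
  also have "\<dots> = (CLINT n|measure_pmf (poisson_pmf r). CLINT Y|\<Pi>J. iexp (z * (\<Sum>i<n. Y i)))"
    by (subst NP.integral_fst'[symmetric]) (auto intro!: NP.integrable_const_bound[of _ 1])
  also have "\<dots> = (CLINT n|measure_pmf (poisson_pmf r). char J z ^ n)"
    by (simp only: char_sum_coordinates)
  also have "\<dots> = (CLINT n|count_space UNIV. pmf (poisson_pmf r) n *\<^sub>R char J z ^ n)"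
    unfolding measure_pmf_eq_density by (subst integral_density) auto
  also have "\<dots> = exp (of_real r * (char J z - 1))"
  proof (rule sums_unique2[OF sums_integral_count_space_nat])
    have n: "norm (char J z) \<le> 1" by (rule J.cmod_char_le_1)
    have *: "(\<lambda>n. pmf (poisson_pmf r) n *\<^sub>R char J z ^ n) = (\<lambda>n. exp (- r) *\<^sub>R ((of_real r * char J z) ^ n /\<^sub>R fact n))"
      by (auto simp: fun_eq_iff rate power_mult_distrib scaleR_conv_of_real field_simps)
    show "integrable (count_space UNIV) (\<lambda>n. pmf (poisson_pmf r) n *\<^sub>R char J z ^ n)"
    proof (rule Bochner_Integration.integrable_bound)
      show "integrable (count_space UNIV) (\<lambda>n. pmf (poisson_pmf r) n)" by (rule integrable_pmf)
      show "AE n in count_space UNIV. norm (pmf (poisson_pmf r) n *\<^sub>R char J z ^ n) \<le> norm (pmf (poisson_pmf r) n)"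
        using n by (auto simp: norm_power power_le_one mult_left_le)
    qed simp
    have "(\<lambda>n. exp (- r) *\<^sub>R ((of_real r * char J z) ^ n /\<^sub>R fact n)) sums (exp (- r) *\<^sub>R exp (of_real r * char J z))"
      by (intro sums_scaleR_right exp_converges)
    also have "exp (- r) *\<^sub>R exp (of_real r * char J z) = exp (of_real r * (char J z - 1))"
      by (simp add: scaleR_conv_of_real exp_of_real[symmetric] exp_add[symmetric] algebra_simps)
    finally show "(\<lambda>n. pmf (poisson_pmf r) n *\<^sub>R char J z ^ n) sums exp (of_real r * (char J z - 1))"
      unfolding * .
  qed
  finally show ?thesis .
qed

lemma nn_integral_exp_compound_poisson:
  assumes m: "(\<integral>\<^sup>+ y. ennreal (exp (s * y)) \<partial>J) = ennreal m" "m \<ge> 0"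
  shows "(\<integral>\<^sup>+ x. ennreal (exp (s * x)) \<partial>compound_poisson r J) = ennreal (exp (r * (m - 1)))"
proof -
  have "(\<integral>\<^sup>+ x. ennreal (exp (s * x)) \<partial>compound_poisson r J) =
      (\<integral>\<^sup>+ p. ennreal (exp (s * (\<Sum>i<fst p. snd p i))) \<partial>(measure_pmf (poisson_pmf r) \<Otimes>\<^sub>M \<Pi>J))"
    unfolding compound_poisson_def by (subst nn_integral_distr) (auto simp: split_beta')
  also have "\<dots> = (\<integral>\<^sup>+ n. \<integral>\<^sup>+ Y. ennreal (exp (s * (\<Sum>i<n. Y i))) \<partial>\<Pi>J \<partial>measure_pmf (poisson_pmf r))"
    by (subst P.nn_integral_fst[symmetric]) auto
  also have "\<dots> = (\<integral>\<^sup>+ n. ennreal (m ^ n) \<partial>measure_pmf (poisson_pmf r))"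
    using m by (simp only: nn_integral_exp_sum_coordinates) (simp add: ennreal_power)
  also have "\<dots> = (\<Sum>n. ennreal (pmf (poisson_pmf r) n) * ennreal (m ^ n))"
    by (simp add: nn_integral_measure_pmf nn_integral_count_space_nat)
  also have "\<dots> = (\<Sum>n. ennreal (exp (- r) * ((r * m) ^ n /\<^sub>R fact n)))"
    using m rate by (auto simp: ennreal_mult[symmetric] power_mult_distrib field_simps intro!: suminf_cong)
  also have "\<dots> = ennreal (exp (- r) * exp (r * m))"
    using m rate sums_mult[OF exp_converges[of "r * m"], of "exp (- r)"]
    by (subst suminf_ennreal2) (auto simp: sums_iff)
  also have "exp (- r) * exp (r * m) = exp (r * (m - 1))"
    by (simp add: exp_add[symmetric] algebra_simps)
  finally show ?thesis .
qed

text \<open>One jump already lifts the sum to \<open>y\<close>, and further jumps do not lower it;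
  at least one jump occurs with probability \<open>1 - exp (- r)\<close>.\<close>

lemma compound_poisson_tail_ge:
  assumes y: "y \<ge> 0" "AE x in J. x \<ge> y"
  shows "measure (compound_poisson r J) {y..} \<ge> 1 - exp (- r)"
proof -
  interpret C: real_distribution "compound_poisson r J" by (rule real_distribution_compound_poisson)
  have 1: "AE Y in \<Pi>J. \<forall>i. Y i \<ge> y"
    unfolding AE_all_countable using y(2) by (auto intro!: AE_PiM_component[of UNIV "\<lambda>_. J"] J.prob_space_axioms)
  have "1 - exp (- r) = measure (poisson_pmf r) (- {0})"
    using measure_pmf.prob_compl[of "{0}" "poisson_pmf r"]
    by (simp add: measure_pmf_single rate Compl_eq_Diff_UNIV)
  also have "ennreal \<dots> = emeasure (poisson_pmf r) (- {0})"
    by (simp add: measure_pmf.emeasure_eq_measure)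
  also have "\<dots> = (\<integral>\<^sup>+ n. \<integral>\<^sup>+ Y. indicator (- {0}) n \<partial>\<Pi>J \<partial>measure_pmf (poisson_pmf r))"
    by (simp add: P.emeasure_space_1)
  also have "\<dots> \<le> (\<integral>\<^sup>+ n. \<integral>\<^sup>+ Y. indicator {y..} (\<Sum>i<n. Y i) \<partial>\<Pi>J \<partial>measure_pmf (poisson_pmf r))"
  proof (rule nn_integral_mono)
    fix n
    show "(\<integral>\<^sup>+ Y. indicator (- {0}) n \<partial>\<Pi>J) \<le> (\<integral>\<^sup>+ Y. indicator {y..} (\<Sum>i<n. Y i) \<partial>\<Pi>J)"
    proof (intro nn_integral_mono_AE, use 1 in eventually_elim)
      case (elim Y)
      show ?case
      proof (cases "n = 0")
        case False
        have "y \<le> real n * y" using False y(1) by (cases n) (auto simp: algebra_simps)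
        also have "\<dots> \<le> (\<Sum>i<n. Y i)" using sum_mono[of "{..<n}" "\<lambda>_. y" Y] elim by simp
        finally show ?thesis by (simp add: indicator_def)
      qed auto
    qed
  qed
  also have "\<dots> = (\<integral>\<^sup>+ p. indicator {y..} (\<Sum>i<fst p. snd p i) \<partial>(measure_pmf (poisson_pmf r) \<Otimes>\<^sub>M \<Pi>J))"
    by (subst P.nn_integral_fst[symmetric]) auto
  also have "\<dots> = (\<integral>\<^sup>+ x. indicator {y..} x \<partial>compound_poisson r J)"
    unfolding compound_poisson_def by (subst nn_integral_distr) (auto simp: split_beta')
  also have "\<dots> = ennreal (measure (compound_poisson r J) {y..})"
    by (simp add: C.emeasure_eq_measure)
  finally show ?thesis by simp
qed

end

section \<open>Normal laws\<close>

lemma nn_integral_exp_std_normal: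
  "(\<integral>\<^sup>+ x. ennreal (exp (t * x)) \<partial>std_normal_distribution) = ennreal (exp (t\<^sup>2 / 2))"
proof -
  have "(\<integral>\<^sup>+ x. ennreal (exp (t * x)) \<partial>std_normal_distribution)
      = (\<integral>\<^sup>+ x. ennreal (normal_density 0 1 x) * ennreal (exp (t * x)) \<partial>lborel)"
    by (subst nn_integral_density) auto
  also have "\<dots> = (\<integral>\<^sup>+ x. ennreal (exp (t\<^sup>2 / 2)) * ennreal (normal_density t 1 x) \<partial>lborel)"
    by (intro nn_integral_cong)
       (simp add: ennreal_mult[symmetric] normal_density_def exp_add[symmetric] power2_eq_square field_simps)
  also have "\<dots> = ennreal (exp (t\<^sup>2 / 2)) * (\<integral>\<^sup>+ x. ennreal (normal_density t 1 x) \<partial>lborel)"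
    by (rule nn_integral_cmult) auto
  also have "(\<integral>\<^sup>+ x. ennreal (normal_density t 1 x) \<partial>lborel) = 1"
    using prob_space.emeasure_space_1[OF prob_space_normal_density[of 1 t]]
    by (simp add: emeasure_density)
  finally show ?thesis by simp
qed

text \<open>An image of the standard normal law rather than a density, so that a vanishing Gaussian
  variance gives a point mass.\<close>

definition normal_law :: "real \<Rightarrow> real \<Rightarrow> real measure" where
  "normal_law a v = distr std_normal_distribution borel (\<lambda>x. a + sqrt v * x)"

lemma real_distribution_normal_law: "real_distribution (normal_law a v)"
proof -
  interpret real_distribution std_normal_distribution by (rule real_dist_normal_dist)
  show ?thesis unfolding normal_law_def by (rule real_distribution_distr) auto
qed

lemma char_normal_law: "v \<ge> 0 \<Longrightarrow> char (normal_law a v) z = exp (\<i> * of_real (z * a) - of_real (v * z\<^sup>2 / 2))"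
proof -
  assume v: "v \<ge> 0"
  have "char (normal_law a v) z = (CLINT x|std_normal_distribution. iexp (z * (a + sqrt v * x)))"
    unfolding char_def normal_law_def by (subst integral_distr) auto
  also have "\<dots> = (CLINT x|std_normal_distribution. iexp (z * a) * iexp (z * sqrt v * x))"
    by (simp add: exp_add[symmetric] algebra_simps)
  also have "\<dots> = iexp (z * a) * char std_normal_distribution (z * sqrt v)"
    by (simp add: char_def)
  also have "char std_normal_distribution (z * sqrt v) = exp (- of_real (v * z\<^sup>2 / 2))"
    using v unfolding char_std_normal_distribution
    by (simp add: power_mult_distrib exp_of_real[symmetric] mult.commute flip: of_real_power)
  finally show ?thesis by (simp add: exp_add[symmetric])
qed

lemma nn_integral_exp_normal_law:
  "v \<ge> 0 \<Longrightarrow> (\<integral>\<^sup>+ x. ennreal (exp (s * x)) \<partial>normal_law a v) = ennreal (exp (s * a + v * s\<^sup>2 / 2))"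
proof -
  assume v: "v \<ge> 0"
  have "(\<integral>\<^sup>+ x. ennreal (exp (s * x)) \<partial>normal_law a v) = (\<integral>\<^sup>+ x. ennreal (exp (s * (a + sqrt v * x))) \<partial>std_normal_distribution)"
    unfolding normal_law_def by (subst nn_integral_distr) auto
  also have "\<dots> = (\<integral>\<^sup>+ x. ennreal (exp (s * a)) * ennreal (exp ((s * sqrt v) * x)) \<partial>std_normal_distribution)"
    by (simp add: ennreal_mult[symmetric] exp_add[symmetric] algebra_simps)
  also have "\<dots> = ennreal (exp (s * a)) * ennreal (exp ((s * sqrt v)\<^sup>2 / 2))"
    by (subst nn_integral_cmult) (auto simp: nn_integral_exp_std_normal)
  also have "\<dots> = ennreal (exp (s * a + v * s\<^sup>2 / 2))"
    using v by (simp add: ennreal_mult[symmetric] exp_add power_mult_distrib mult.commute)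
  finally show ?thesis .
qed

section \<open>Laws with a given Levy triplet\<close>

text \<open>The exponential is unbounded, so weak convergence is applied to its truncations at
  \<open>K\<close>, and Fatou's lemma removes the truncation; an upper bound survives both
  limits.\<close>

lemma nn_integral_exp_weak_limit:
  assumes w: "weak_conv_m Pn P" and Pn: "\<And>n. real_distribution (Pn n)" and P: "real_distribution P"
    and B: "\<And>n. (\<integral>\<^sup>+ x. ennreal (exp (s * x)) \<partial>Pn n) \<le> ennreal B" "B \<ge> 0"
  shows "(\<integral>\<^sup>+ x. ennreal (exp (s * x)) \<partial>P) \<le> ennreal B"
proof -
  interpret P: real_distribution P by fact
  interpret Pn: real_distribution "Pn n" for n by (rule Pn)
  have le: "(\<integral>\<^sup>+ x. ennreal (min (exp (s * x)) (real K)) \<partial>P) \<le> ennreal B" for K :: nat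
  proof -
    have "(\<lambda>n. LINT x|Pn n. min (exp (s * x)) (real K)) \<longlonglongrightarrow> (LINT x|P. min (exp (s * x)) (real K))"
      by (intro weak_conv_imp_integral_bdd_continuous_conv[OF Pn P w, where B = "real K"]) (auto intro!: continuous_intros)
    moreover have "(LINT x|Pn n. min (exp (s * x)) (real K)) \<le> B" for n
    proof -
      have "ennreal (LINT x|Pn n. min (exp (s * x)) (real K)) = (\<integral>\<^sup>+ x. ennreal (min (exp (s * x)) (real K)) \<partial>Pn n)"
        by (intro nn_integral_eq_integral[symmetric] Pn.integrable_const_bound[of _ "real K"]) auto
      also have "\<dots> \<le> (\<integral>\<^sup>+ x. ennreal (exp (s * x)) \<partial>Pn n)" by (intro nn_integral_mono ennreal_leI) auto
      also note B(1)
      finally show ?thesis using B(2) by simp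
    qed
    ultimately have "(LINT x|P. min (exp (s * x)) (real K)) \<le> B" by (intro LIMSEQ_le_const2) auto
    moreover have "(\<integral>\<^sup>+ x. ennreal (min (exp (s * x)) (real K)) \<partial>P) = ennreal (LINT x|P. min (exp (s * x)) (real K))"
      by (intro nn_integral_eq_integral P.integrable_const_bound[of _ "real K"]) auto
    ultimately show ?thesis by (simp add: ennreal_leI)
  qed
  have "(\<integral>\<^sup>+ x. ennreal (exp (s * x)) \<partial>P) = (\<integral>\<^sup>+ x. liminf (\<lambda>K. ennreal (min (exp (s * x)) (real K))) \<partial>P)"
  proof (intro nn_integral_cong lim_imp_Liminf[symmetric] tendsto_ennrealI)
    fix x
    have "\<forall>\<^sub>F K in sequentially. exp (s * x) \<le> real K"
      using filterlim_real_sequentially by (simp add: filterlim_at_top)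
    then have "\<forall>\<^sub>F K in sequentially. exp (s * x) = min (exp (s * x)) (real K)"
      by eventually_elim auto
    then show "(\<lambda>K. min (exp (s * x)) (real K)) \<longlonglongrightarrow> exp (s * x)"
      by (rule Lim_transform_eventually[OF tendsto_const])
  qed simp
  also have "\<dots> \<le> liminf (\<lambda>K. \<integral>\<^sup>+ x. ennreal (min (exp (s * x)) (real K)) \<partial>P)"
    by (rule nn_integral_liminf) auto
  also have "\<dots> \<le> liminf (\<lambda>K::nat. ennreal B)" by (intro Liminf_mono always_eventually allI le)
  also have "\<dots> = ennreal B" by (simp add: Liminf_const)
  finally show ?thesis .
qed

text \<open>A continuous ramp lies between the indicators of \<open>{b + 1..}\<close> and
  \<open>{b..}\<close>; its width is the unit lost in the level.\<close>

lemma tail_weak_limit: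
  assumes w: "weak_conv_m Pn P" and Pn: "\<And>n. real_distribution (Pn n)" and P: "real_distribution P"
    and p: "\<And>n. p \<le> measure (Pn n) {b + 1..}"
  shows "p \<le> measure P {b..}"
proof -
  interpret P: real_distribution P by fact
  interpret Pn: real_distribution "Pn n" for n by (rule Pn)
  define f where "f x = max 0 (min 1 (x - b))" for x :: real
  have [measurable]: "f \<in> borel_measurable borel" unfolding f_def by measurable
  have bd: "norm (f x) \<le> 1" for x by (auto simp: f_def)
  have "(\<lambda>n. LINT x|Pn n. f x) \<longlonglongrightarrow> (LINT x|P. f x)"
    using bd by (intro weak_conv_imp_integral_bdd_continuous_conv[OF Pn P w, where B = 1]) (auto simp: f_def[abs_def] intro!: continuous_intros)
  moreover have "p \<le> (LINT x|Pn n. f x)" for n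
  proof -
    have "measure (Pn n) {b + 1..} = (LINT x|Pn n. indicator {b + 1..} x)" by simp
    also have "\<dots> \<le> (LINT x|Pn n. f x)"
      by (intro integral_mono Pn.integrable_const_bound[of _ 1]) (auto simp: f_def indicator_def)
    finally show ?thesis using p[of n] by simp
  qed
  ultimately have "p \<le> (LINT x|P. f x)" by (intro LIMSEQ_le_const) auto
  also have "\<dots> \<le> (LINT x|P. indicator {b..} x)"
    by (intro integral_mono P.integrable_const_bound[of _ 1]) (auto simp: f_def indicator_def)
  finally show ?thesis by simp
qed

lemma exp_taylor2_bound: "exp t - 1 - t \<le> t\<^sup>2 * exp \<bar>t\<bar>" for t :: real
proof -
  obtain u where u: "\<bar>u\<bar> \<le> \<bar>t\<bar>" "exp t = (\<Sum>m<2. t ^ m / fact m) + exp u / fact 2 * t ^ 2"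
    using Maclaurin_exp_le[of t 2] by blast
  have "exp t - 1 - t = exp u / 2 * t\<^sup>2" using u(2) by (simp add: numeral_2_eq_2)
  also have "\<dots> \<le> exp \<bar>t\<bar> * t\<^sup>2"
  proof (rule mult_right_mono)
    have "exp u \<le> exp \<bar>t\<bar>" using u(1) by simp
    then show "exp u / 2 \<le> exp \<bar>t\<bar>" using exp_gt_zero[of u] by linarith
  qed simp
  finally show ?thesis by (simp add: mult.commute)
qed

context light_tailed_levy_measure
begin

section \<open>Integration against the symmetric jump measure\<close>

lemma distr_uminus: "distr \<nu> borel uminus = \<nu>"
proof (rule measure_eqI)
  fix A assume "A \<in> sets (distr \<nu> borel uminus)"
  then have A [measurable]: "A \<in> sets borel" by simp
  have "uminus -` A = uminus ` A" by force
  moreover have "space \<nu> = UNIV" using sets_eq_imp_space_eq[OF sets_nu] by simp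
  ultimately have "emeasure (distr \<nu> borel uminus) A = emeasure \<nu> (uminus ` A)"
    by (subst emeasure_distr) auto
  then show "emeasure (distr \<nu> borel uminus) A = emeasure \<nu> A"
    using symm A by (simp add: symmetric_measure_def)
qed (simp add: sets_nu)

lemma integral_uminus:
  fixes f :: "real \<Rightarrow> 'b::{banach, second_countable_topology}"
  assumes "f \<in> borel_measurable borel"
  shows "(LINT y|\<nu>. f (- y)) = (LINT y|\<nu>. f y)"
  using integral_distr[of uminus \<nu> borel f] assms by (simp add: distr_uminus)

lemma nn_integral_uminus:
  "f \<in> borel_measurable borel \<Longrightarrow> (\<integral>\<^sup>+ y. f (- y) \<partial>\<nu>) = (\<integral>\<^sup>+ y. f y \<partial>\<nu>)"
  using nn_integral_distr[of uminus \<nu> borel f] by (simp add: distr_uminus)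

lemma space_nu [simp]: "space \<nu> = UNIV"
  using sets_eq_imp_space_eq[OF sets_nu] by simp

abbreviation jump_var :: real where
  "jump_var \<equiv> enn2real (\<integral>\<^sup>+ y. ennreal (min (y\<^sup>2) 1) \<partial>\<nu>)"

lemma integrable_jump_var: "integrable \<nu> (\<lambda>y. min (y\<^sup>2) 1)"
  using levy by (intro integrableI_nonneg) (auto simp: levy_measure_def)

lemma integral_jump_var: "(LINT y|\<nu>. min (y\<^sup>2) 1) = jump_var"
  by (simp add: integral_eq_nn_integral)

definition symmetric_exp_tail :: "real \<Rightarrow> real \<Rightarrow> real" where
  "symmetric_exp_tail s y = exp (s * \<bar>y\<bar>) * indicator {y. 1 \<le> \<bar>y\<bar>} y"

lemma symmetric_exp_tail_measurable [measurable]: "symmetric_exp_tail s \<in> borel_measurable borel"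
  unfolding symmetric_exp_tail_def by measurable

lemma nn_integral_symmetric_exp_tail:
  assumes "s \<ge> 0"
  shows "(\<integral>\<^sup>+ y. ennreal (symmetric_exp_tail s y) \<partial>\<nu>) = ennreal (2 * exp_tail s)"
proof -
  let ?I = "\<integral>\<^sup>+ y. ennreal (exp (s * y)) * indicator {1..} y \<partial>\<nu>"
  have "(\<integral>\<^sup>+ y. ennreal (symmetric_exp_tail s y) \<partial>\<nu>) =
      (\<integral>\<^sup>+ y. ennreal (exp (s * y)) * indicator {1..} y + ennreal (exp (s * (- y))) * indicator {1..} (- y) \<partial>\<nu>)"
    by (intro nn_integral_cong) (auto simp: symmetric_exp_tail_def indicator_def)
  also have "\<dots> = ?I + (\<integral>\<^sup>+ y. ennreal (exp (s * (- y))) * indicator {1..} (- y) \<partial>\<nu>)"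
    by (intro nn_integral_add) auto
  also have "(\<integral>\<^sup>+ y. ennreal (exp (s * (- y))) * indicator {1..} (- y) \<partial>\<nu>) = ?I"
    by (rule nn_integral_uminus) auto
  also have "?I = ennreal (exp_tail s)"
    using exp_tail_finite[OF assms] by (simp add: exp_tail_def)
  finally show ?thesis by (simp add: ennreal_plus[symmetric] exp_tail_def del: ennreal_plus)
qed

lemma exp_tail_nonneg: "exp_tail s \<ge> 0" by (simp add: exp_tail_def)

lemma integrable_symmetric_exp_tail: "s \<ge> 0 \<Longrightarrow> integrable \<nu> (symmetric_exp_tail s)"
  using nn_integral_symmetric_exp_tail[of s]
  by (intro integrableI_nonneg) (auto simp: symmetric_exp_tail_def)

lemma integral_symmetric_exp_tail: "s \<ge> 0 \<Longrightarrow> (LINT y|\<nu>. symmetric_exp_tail s y) = 2 * exp_tail s"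
  using nn_integral_symmetric_exp_tail[of s]
  by (subst integral_eq_nn_integral) (auto simp: symmetric_exp_tail_def exp_tail_nonneg)

lemma integrable_exp_minus_one:
  assumes [measurable]: "A \<in> sets borel" and A: "emeasure \<nu> A < \<infinity>"
  shows "integrable \<nu> (\<lambda>y. indicator A y * (exp (s * y) - 1))" "integrable \<nu> (\<lambda>y. indicator A y * exp (s * y))"
proof -
  have i: "integrable \<nu> (indicator A :: real \<Rightarrow> real)" using A by simp
  have bnd: "exp (s * y) \<le> exp \<bar>s\<bar> + symmetric_exp_tail \<bar>s\<bar> y" for y
  proof (cases "\<bar>y\<bar> \<ge> 1")
    case True
    have "s * y \<le> \<bar>s\<bar> * \<bar>y\<bar>" by (metis abs_ge_self abs_mult)
    then show ?thesis using True by (simp add: symmetric_exp_tail_def add_increasing)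
  next
    case False
    have "s * y \<le> \<bar>s\<bar> * \<bar>y\<bar>" by (metis abs_ge_self abs_mult)
    also have "\<dots> \<le> \<bar>s\<bar>" using False by (intro mult_left_le) auto
    finally show ?thesis using False by (simp add: symmetric_exp_tail_def)
  qed
  show *: "integrable \<nu> (\<lambda>y. indicator A y * exp (s * y))"
  proof (rule Bochner_Integration.integrable_bound)
    show "integrable \<nu> (\<lambda>y. exp \<bar>s\<bar> * indicator A y + symmetric_exp_tail \<bar>s\<bar> y)"
      using i integrable_symmetric_exp_tail[of "\<bar>s\<bar>"] by simp
    show "AE y in \<nu>. norm (indicator A y * exp (s * y)) \<le> norm (exp \<bar>s\<bar> * indicator A y + symmetric_exp_tail \<bar>s\<bar> y)"
      using bnd by (auto simp: indicator_def symmetric_exp_tail_def)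
  qed simp
  from Bochner_Integration.integrable_diff[OF * i]
  show "integrable \<nu> (\<lambda>y. indicator A y * (exp (s * y) - 1))" by (simp add: right_diff_distrib)
qed

lemma integrable_iexp_minus_one:
  assumes [measurable]: "A \<in> sets borel" and A: "emeasure \<nu> A < \<infinity>"
  shows "integrable \<nu> (\<lambda>y. indicator A y *\<^sub>R (iexp (z * y) - 1))" "integrable \<nu> (\<lambda>y. indicator A y *\<^sub>R iexp (z * y))"
proof -
  have i: "integrable \<nu> (indicator A :: real \<Rightarrow> real)" using A by simp
  show "integrable \<nu> (\<lambda>y. indicator A y *\<^sub>R (iexp (z * y) - 1))"
  proof (rule Bochner_Integration.integrable_bound)
    show "integrable \<nu> (\<lambda>y. 2 * indicator A y :: real)" using i by simp
    show "AE y in \<nu>. norm (indicator A y *\<^sub>R (iexp (z * y) - 1)) \<le> norm (2 * indicator A y :: real)"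
      by (auto simp: indicator_def intro!: order_trans[OF norm_triangle_ineq4])
  qed simp
  show "integrable \<nu> (\<lambda>y. indicator A y *\<^sub>R iexp (z * y))"
    by (rule Bochner_Integration.integrable_bound[OF i]) (auto simp: indicator_def)
qed

text \<open>The law at time \<open>h\<close> of the compound Poisson process whose jump measure is
  \<nu> restricted to \<open>A\<close>, split into its total mass (the rate) and its normalisation
  (the law of a jump).\<close>

definition jump_law :: "real \<Rightarrow> real set \<Rightarrow> real measure" where
  "jump_law h A = compound_poisson (h * measure \<nu> A) (uniform_measure \<nu> A)"

lemma compound_poisson_law_jump_law:
  assumes "A \<in> sets borel" "0 < emeasure \<nu> A" "emeasure \<nu> A < \<infinity>" "h > 0"
  shows "compound_poisson_law (h * measure \<nu> A) (uniform_measure \<nu> A)"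
proof -
  have "prob_space (uniform_measure \<nu> A)"
    using assms by (intro prob_space_uniform_measure) auto
  moreover have "measure \<nu> A > 0"
    using assms by (simp add: measure_def enn2real_positive_iff)
  ultimately show ?thesis using assms
    by (simp add: compound_poisson_law_def real_distribution_def real_distribution_axioms_def sets_nu)
qed

lemma integral_uniform_measure:
  fixes f :: "real \<Rightarrow> 'b::{banach, second_countable_topology}"
  assumes [measurable]: "A \<in> sets borel" "f \<in> borel_measurable borel"
    and A: "0 < emeasure \<nu> A" "emeasure \<nu> A < \<infinity>"
  shows "integral\<^sup>L (uniform_measure \<nu> A) f = (LINT y|\<nu>. indicator A y *\<^sub>R f y) /\<^sub>R measure \<nu> A"
proof -
  have pos: "measure \<nu> A > 0" using A by (simp add: measure_def enn2real_positive_iff)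
  have "uniform_measure \<nu> A = density \<nu> (\<lambda>y. ennreal (indicator A y / measure \<nu> A))"
    unfolding uniform_measure_def using A pos
    by (intro density_cong) (auto simp: emeasure_eq_ennreal_measure divide_ennreal[symmetric] ennreal_indicator)
  then have "integral\<^sup>L (uniform_measure \<nu> A) f = (LINT y|\<nu>. (indicator A y / measure \<nu> A) *\<^sub>R f y)"
    by (simp add: integral_density)
  also have "\<dots> = (LINT y|\<nu>. (1 / measure \<nu> A) *\<^sub>R (indicator A y *\<^sub>R f y))" by simp
  also have "\<dots> = (LINT y|\<nu>. indicator A y *\<^sub>R f y) /\<^sub>R measure \<nu> A"
    by (subst integral_scaleR_right) (simp add: divide_inverse)
  finally show ?thesis .
qed

lemma char_jump_law:
  assumes [measurable]: "A \<in> sets borel" and A: "0 < emeasure \<nu> A" "emeasure \<nu> A < \<infinity>" and h: "h > 0"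
  shows "char (jump_law h A) z = exp (of_real h * (CLINT y|\<nu>. indicator A y *\<^sub>R (iexp (z * y) - 1)))"
proof -
  interpret compound_poisson_law "h * measure \<nu> A" "uniform_measure \<nu> A"
    using assms by (intro compound_poisson_law_jump_law) auto
  have pos: "measure \<nu> A > 0" using A by (simp add: measure_def enn2real_positive_iff)
  have "(CLINT y|\<nu>. indicator A y *\<^sub>R (iexp (z * y) - 1)) = (CLINT y|\<nu>. indicator A y *\<^sub>R iexp (z * y) - of_real (indicator A y))"
    by (intro Bochner_Integration.integral_cong) (auto simp: indicator_def)
  also have "\<dots> = (CLINT y|\<nu>. indicator A y *\<^sub>R iexp (z * y)) - of_real (measure \<nu> A)"
    using A integrable_iexp_minus_one(2)[OF assms(1) A(2), of z]
    by (subst Bochner_Integration.integral_diff) auto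
  also have "\<dots> = of_real (measure \<nu> A) * (char (uniform_measure \<nu> A) z - 1)"
    using A pos by (simp add: char_def integral_uniform_measure scaleR_conv_of_real field_simps)
  finally show ?thesis unfolding jump_law_def char_compound_poisson by (simp add: mult.assoc)
qed

lemma nn_integral_exp_jump_law:
  assumes [measurable]: "A \<in> sets borel" and A: "0 < emeasure \<nu> A" "emeasure \<nu> A < \<infinity>" and h: "h > 0"
  shows "(\<integral>\<^sup>+ x. ennreal (exp (s * x)) \<partial>jump_law h A) = ennreal (exp (h * (LINT y|\<nu>. indicator A y * (exp (s * y) - 1))))"
proof -
  interpret compound_poisson_law "h * measure \<nu> A" "uniform_measure \<nu> A"
    using assms by (intro compound_poisson_law_jump_law) auto
  have pos: "measure \<nu> A > 0" using A by (simp add: measure_def enn2real_positive_iff)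
  note int = integrable_exp_minus_one[OF assms(1) A(2), of s]
  define m where "m = (LINT y|\<nu>. indicator A y * exp (s * y)) / measure \<nu> A"
  have m: "m \<ge> 0" by (simp add: m_def)
  have "(\<integral>\<^sup>+ y. ennreal (exp (s * y)) \<partial>uniform_measure \<nu> A) = (\<integral>\<^sup>+ y. ennreal (exp (s * y)) * indicator A y \<partial>\<nu>) / emeasure \<nu> A"
    by (intro nn_integral_uniform_measure) auto
  also have "(\<integral>\<^sup>+ y. ennreal (exp (s * y)) * indicator A y \<partial>\<nu>) = (\<integral>\<^sup>+ y. ennreal (indicator A y * exp (s * y)) \<partial>\<nu>)"
    by (intro nn_integral_cong) (auto simp: indicator_def)
  also have "\<dots> = ennreal (LINT y|\<nu>. indicator A y * exp (s * y))"
    using int by (intro nn_integral_eq_integral) auto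
  also have "\<dots> / emeasure \<nu> A = ennreal m"
    using A pos by (simp add: m_def emeasure_eq_ennreal_measure divide_ennreal)
  finally have "(\<integral>\<^sup>+ x. ennreal (exp (s * x)) \<partial>jump_law h A) = ennreal (exp (h * measure \<nu> A * (m - 1)))"
    unfolding jump_law_def using m by (rule nn_integral_exp_compound_poisson)
  also have "h * measure \<nu> A * (m - 1) = h * ((LINT y|\<nu>. indicator A y * exp (s * y)) - measure \<nu> A)"
    using pos by (simp add: m_def field_simps)
  also have "(LINT y|\<nu>. indicator A y * exp (s * y)) - measure \<nu> A = (LINT y|\<nu>. indicator A y * (exp (s * y) - 1))"
    using int(2) A by (simp add: right_diff_distrib Bochner_Integration.integral_diff)
  finally show ?thesis .
qed

section \<open>Symmetric truncation of the small jumps\<close>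

definition away :: "nat \<Rightarrow> real set" where
  "away n = {y. 1 / real (Suc n) \<le> \<bar>y\<bar>}"

lemma away_measurable [measurable]: "away n \<in> sets borel"
  unfolding away_def by measurable

lemma away_finite: "emeasure \<nu> (away n) < \<infinity>"
  unfolding away_def by (rule levy_measure_finite_away[OF levy]) simp

text \<open>Symmetry of \<nu> makes the compensator vanish on each truncation, so the approximating
  compound Poisson processes carry no diverging drift.\<close>

lemma integral_away_odd:
  fixes f :: "real \<Rightarrow> 'b::{banach, second_countable_topology}"
  assumes [measurable]: "f \<in> borel_measurable borel" and "\<And>y. f (- y) = - f y"
  shows "(LINT y|\<nu>. indicator (away n) y *\<^sub>R f y) = 0"
proof -
  have "(LINT y|\<nu>. indicator (away n) y *\<^sub>R f y) = (LINT y|\<nu>. indicator (away n) (- y) *\<^sub>R f (- y))"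
    by (subst integral_uminus) auto
  also have "\<dots> = (LINT y|\<nu>. - (indicator (away n) y *\<^sub>R f y))"
    using assms by (intro Bochner_Integration.integral_cong) (auto simp: away_def indicator_def)
  also have "\<dots> = - (LINT y|\<nu>. indicator (away n) y *\<^sub>R f y)" by simp
  finally show ?thesis by (metis (no_types, lifting) eq_neg_iff_add_eq_0 scaleR_2 scaleR_eq_0_iff zero_neq_numeral)
qed

text \<open>The linear compensator can be inserted for free because it is odd. What remains is of
  second order near 0, hence controlled by \<open>jump_var\<close> uniformly in \<open>n\<close>,
  and an exponential tail beyond 1.\<close>

lemma integral_exp_away_le:
  "(LINT y|\<nu>. indicator (away n) y * (exp (s * y) - 1)) \<le> exp \<bar>s\<bar> * (jump_var * s\<^sup>2) + 2 * exp_tail \<bar>s\<bar>"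
proof -
  let ?c = "\<lambda>y. s * y * indicator {-1..1} y"
  have i1: "integrable \<nu> (\<lambda>y. indicator (away n) y * (exp (s * y) - 1))"
    by (intro integrable_exp_minus_one away_measurable away_finite)
  have i2: "integrable \<nu> (\<lambda>y. indicator (away n) y * ?c y)"
  proof (rule Bochner_Integration.integrable_bound)
      show "integrable \<nu> (\<lambda>y. \<bar>s\<bar> * indicator (away n) y)"
        using away_finite[of n] by (intro integrable_mult_right) simp
      show "AE y in \<nu>. norm (indicator (away n) y * ?c y) \<le> norm (\<bar>s\<bar> * indicator (away n) y)"
        by (intro always_eventually allI) (auto simp: indicator_def abs_mult norm_mult intro!: mult_left_le)
    qed simp
  have "(LINT y|\<nu>. indicator (away n) y * (exp (s * y) - 1)) =
      (LINT y|\<nu>. indicator (away n) y * (exp (s * y) - 1)) - (LINT y|\<nu>. indicator (away n) y *\<^sub>R ?c y)"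
    by (subst integral_away_odd) (auto simp: indicator_def)
  also have "\<dots> = (LINT y|\<nu>. indicator (away n) y * (exp (s * y) - 1) - indicator (away n) y * ?c y)"
    using i1 i2 by (subst Bochner_Integration.integral_diff) auto
  also have "\<dots> \<le> (LINT y|\<nu>. (s\<^sup>2 * exp \<bar>s\<bar>) * min (y\<^sup>2) 1 + symmetric_exp_tail \<bar>s\<bar> y)"
  proof (rule integral_mono)
    show "integrable \<nu> (\<lambda>y. indicator (away n) y * (exp (s * y) - 1) - indicator (away n) y * ?c y)"
      using i1 i2 by simp
    show "integrable \<nu> (\<lambda>y. (s\<^sup>2 * exp \<bar>s\<bar>) * min (y\<^sup>2) 1 + symmetric_exp_tail \<bar>s\<bar> y)"
      using integrable_jump_var integrable_symmetric_exp_tail[of "\<bar>s\<bar>"] by simp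
    fix y :: real
    have sy: "\<bar>s * y\<bar> = \<bar>s\<bar> * \<bar>y\<bar>" by (simp add: abs_mult)
    have nn: "(s\<^sup>2 * exp \<bar>s\<bar>) * min (y\<^sup>2) 1 \<ge> 0" "symmetric_exp_tail \<bar>s\<bar> y \<ge> 0" by (auto simp: symmetric_exp_tail_def)
    show "indicator (away n) y * (exp (s * y) - 1) - indicator (away n) y * ?c y
        \<le> (s\<^sup>2 * exp \<bar>s\<bar>) * min (y\<^sup>2) 1 + symmetric_exp_tail \<bar>s\<bar> y"
    proof (cases "y \<in> away n")
      case True
      show ?thesis
      proof (cases "\<bar>y\<bar> \<le> 1")
        case y: True
        then have "y\<^sup>2 \<le> 1" by (simp add: abs_square_le_1)
        have "exp (s * y) - 1 - s * y \<le> (s * y)\<^sup>2 * exp \<bar>s * y\<bar>" by (rule exp_taylor2_bound)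
        also have "\<dots> \<le> (s * y)\<^sup>2 * exp \<bar>s\<bar>"
          unfolding sy using y by (intro mult_left_mono) (auto intro: mult_left_le)
        also have "\<dots> = (s\<^sup>2 * exp \<bar>s\<bar>) * min (y\<^sup>2) 1" using \<open>y\<^sup>2 \<le> 1\<close> by (simp add: power_mult_distrib)
        finally show ?thesis using True y nn by (auto simp: indicator_def abs_le_iff)
      next
        case y: False
        have *: "exp (s * y) \<le> exp (\<bar>s\<bar> * \<bar>y\<bar>)" by (metis abs_ge_self abs_mult exp_le_cancel_iff)
        have "y \<notin> {-1..1}" "1 \<le> \<bar>y\<bar>" using y by auto
        then have "indicator (away n) y * (exp (s * y) - 1) - indicator (away n) y * ?c y = exp (s * y) - 1"
          "symmetric_exp_tail \<bar>s\<bar> y = exp (\<bar>s\<bar> * \<bar>y\<bar>)"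
          using True by (auto simp: symmetric_exp_tail_def)
        then show ?thesis using * nn(1) by linarith
      qed
    qed (use nn in simp)
  qed
  also have "\<dots> = (s\<^sup>2 * exp \<bar>s\<bar>) * jump_var + 2 * exp_tail \<bar>s\<bar>"
    using integrable_jump_var integrable_symmetric_exp_tail[of "\<bar>s\<bar>"]
    by (subst Bochner_Integration.integral_add) (auto simp: integral_jump_var integral_symmetric_exp_tail)
  finally show ?thesis by (simp add: mult_ac)
qed

section \<open>The Levy exponent\<close>

definition exponent_integrand :: "real \<Rightarrow> real \<Rightarrow> complex" where
  "exponent_integrand z y = iexp (z * y) - 1 - \<i> * of_real (z * y * indicator {-1..1} y)"

lemma exponent_integrand_measurable [measurable]: "exponent_integrand z \<in> borel_measurable borel"
  unfolding exponent_integrand_def by measurable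

lemma norm_exponent_integrand: "norm (exponent_integrand z y) \<le> (z\<^sup>2 + 2) * min (y\<^sup>2) 1"
proof (cases "\<bar>y\<bar> \<le> 1")
  case True
  then have y: "y\<^sup>2 \<le> 1" by (simp add: abs_square_le_1)
  have "norm (exponent_integrand z y) = norm (iexp (z * y) - (\<Sum>k\<le>1. (\<i> * (z * y)) ^ k / fact k))"
    using True by (simp add: exponent_integrand_def indicator_def abs_le_iff diff_diff_eq)
  also have "\<dots> \<le> (z * y)\<^sup>2 / 2" using iexp_approx1[of "z * y" 1] by (simp add: numeral_2_eq_2)
  also have "\<dots> \<le> (z\<^sup>2 + 2) * y\<^sup>2" by (simp add: power_mult_distrib algebra_simps)
  finally show ?thesis using y by (simp add: min_absorb1)
next
  case False
  then have y: "y\<^sup>2 \<ge> 1" using abs_square_le_1[of y] by linarith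
  have "norm (exponent_integrand z y) \<le> 2"
    using False norm_triangle_ineq4[of "iexp (z * y)" 1] by (auto simp: exponent_integrand_def indicator_def)
  then show ?thesis using y by (simp add: min_absorb2 add_increasing)
qed

lemma integrable_exponent_integrand: "integrable \<nu> (exponent_integrand z)"
  by (rule Bochner_Integration.integrable_bound[where f = "\<lambda>y. (z\<^sup>2 + 2) * min (y\<^sup>2) 1"])
     (use integrable_jump_var norm_exponent_integrand in \<open>auto intro: order_trans\<close>)

lemma levy_exponent_eq:
  "levy_exponent d \<nu> \<mu> z = - of_real (d * z\<^sup>2 / 2) + \<i> * of_real (\<mu> * z) + (CLINT y|\<nu>. exponent_integrand z y)"
  unfolding levy_exponent_def exponent_integrand_def ..

text \<open>Needed to select the correct root of the characteristic function at times
  \<open>1 / m\<close>. A convergent sequence of arguments is bounded, which provides the common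
  majorant for dominated convergence.\<close>

lemma continuous_levy_exponent: "isCont (levy_exponent d \<nu> \<mu>) z"
proof -
  have "isCont (\<lambda>z. CLINT y|\<nu>. exponent_integrand z y) z"
    unfolding continuous_at_sequentially
  proof safe
    fix X assume X: "X \<longlonglongrightarrow> z"
    then obtain K where K: "\<And>n. \<bar>X n\<bar> \<le> K"
      using convergent_imp_Bseq[of X] by (auto simp: Bseq_def convergent_def)
    show "((\<lambda>z. CLINT y|\<nu>. exponent_integrand z y) \<circ> X) \<longlonglongrightarrow> (CLINT y|\<nu>. exponent_integrand z y)"
      unfolding comp_def
    proof (rule integral_dominated_convergence[where w = "\<lambda>y. (K\<^sup>2 + 2) * min (y\<^sup>2) 1"])
      show "AE y in \<nu>. (\<lambda>n. exponent_integrand (X n) y) \<longlonglongrightarrow> exponent_integrand z y"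
        unfolding exponent_integrand_def using X by (intro always_eventually allI tendsto_intros)
      show "AE y in \<nu>. norm (exponent_integrand (X n) y) \<le> (K\<^sup>2 + 2) * min (y\<^sup>2) 1" for n
      proof (intro always_eventually allI)
        fix y
        have "(X n)\<^sup>2 \<le> K\<^sup>2" using K[of n] by (metis abs_ge_zero abs_le_square_iff abs_of_nonneg order_trans)
        then show "norm (exponent_integrand (X n) y) \<le> (K\<^sup>2 + 2) * min (y\<^sup>2) 1"
          by (intro order_trans[OF norm_exponent_integrand] mult_right_mono) auto
      qed
    qed (use integrable_jump_var in auto)
  qed
  then show ?thesis unfolding levy_exponent_eq[abs_def] by (intro continuous_intros) auto
qed

text \<open>On a symmetric truncation the integrand may be replaced by its compensated form, which
  is dominated by a multiple of \<open>min (y\<^sup>2) 1\<close>.\<close>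

lemma integral_away_tendsto:
  "(\<lambda>n. CLINT y|\<nu>. indicator (away n) y *\<^sub>R (iexp (z * y) - 1)) \<longlonglongrightarrow> (CLINT y|\<nu>. exponent_integrand z y)"
proof -
  let ?c = "\<lambda>y. \<i> * of_real (z * y * indicator {-1..1} y)"
  have "(CLINT y|\<nu>. indicator (away n) y *\<^sub>R (iexp (z * y) - 1)) = (CLINT y|\<nu>. indicator (away n) y *\<^sub>R exponent_integrand z y)" for n
  proof -
    have i1: "integrable \<nu> (\<lambda>y. indicator (away n) y *\<^sub>R exponent_integrand z y)"
      by (rule Bochner_Integration.integrable_bound[OF integrable_exponent_integrand[of z]]) (auto simp: indicator_def)
    have i2: "integrable \<nu> (\<lambda>y. indicator (away n) y *\<^sub>R ?c y)"
    proof (rule Bochner_Integration.integrable_bound)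
      show "integrable \<nu> (\<lambda>y. \<bar>z\<bar> * indicator (away n) y)"
        using away_finite[of n] by (intro integrable_mult_right) simp
      show "AE y in \<nu>. norm (indicator (away n) y *\<^sub>R ?c y) \<le> norm (\<bar>z\<bar> * indicator (away n) y)"
        by (intro always_eventually allI) (auto simp: indicator_def abs_mult norm_mult intro!: mult_left_le)
    qed simp
    have "(CLINT y|\<nu>. indicator (away n) y *\<^sub>R (iexp (z * y) - 1)) =
        (CLINT y|\<nu>. indicator (away n) y *\<^sub>R exponent_integrand z y + indicator (away n) y *\<^sub>R ?c y)"
      by (intro Bochner_Integration.integral_cong) (auto simp: exponent_integrand_def indicator_def)
    also have "\<dots> = (CLINT y|\<nu>. indicator (away n) y *\<^sub>R exponent_integrand z y) + (CLINT y|\<nu>. indicator (away n) y *\<^sub>R ?c y)"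
      using i1 i2 by (rule Bochner_Integration.integral_add)
    also have "(CLINT y|\<nu>. indicator (away n) y *\<^sub>R ?c y) = 0"
      by (rule integral_away_odd) (auto simp: indicator_def)
    finally show ?thesis by simp
  qed
  moreover have "(\<lambda>n. CLINT y|\<nu>. indicator (away n) y *\<^sub>R exponent_integrand z y) \<longlonglongrightarrow> (CLINT y|\<nu>. exponent_integrand z y)"
  proof (rule integral_dominated_convergence[where w = "\<lambda>y. (z\<^sup>2 + 2) * min (y\<^sup>2) 1"])
    show "AE y in \<nu>. (\<lambda>n. indicator (away n) y *\<^sub>R exponent_integrand z y) \<longlonglongrightarrow> exponent_integrand z y"
    proof (intro always_eventually allI)
      fix y :: real
      show "(\<lambda>n. indicator (away n) y *\<^sub>R exponent_integrand z y) \<longlonglongrightarrow> exponent_integrand z y"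
      proof (cases "y = 0")
        case False
        have "(\<lambda>n. 1 / real (Suc n)) \<longlonglongrightarrow> 0" by (rule LIMSEQ_Suc[OF lim_1_over_n])
        then have "\<forall>\<^sub>F n in sequentially. 1 / real (Suc n) < \<bar>y\<bar>" using False by (intro order_tendstoD) auto
        then have "\<forall>\<^sub>F n in sequentially. exponent_integrand z y = indicator (away n) y *\<^sub>R exponent_integrand z y"
          by eventually_elim (auto simp: away_def)
        then show ?thesis by (rule Lim_transform_eventually[OF tendsto_const])
      qed (simp add: exponent_integrand_def)
    qed
    show "AE y in \<nu>. norm (indicator (away n) y *\<^sub>R exponent_integrand z y) \<le> (z\<^sup>2 + 2) * min (y\<^sup>2) 1" for n
      using norm_exponent_integrand by (auto simp: indicator_def)
  qed (use integrable_jump_var in auto)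
  ultimately show ?thesis by simp
qed

text \<open>The law at time \<open>h\<close> of the process whose jumps smaller than \<open>1 / Suc n\<close> are removed;
  jumps \<open>\<ge> y\<close> are kept as a separate convolution factor.\<close>

definition approx_law :: "real \<Rightarrow> real \<Rightarrow> real \<Rightarrow> real \<Rightarrow> nat \<Rightarrow> real measure" where
  "approx_law d \<mu> h y n = (jump_law h {y..} \<star> (jump_law h (away n - {y..}) \<star> normal_law (h * \<mu>) (h * d)))"

text \<open>A depth below which everything except the jumps of size at least \<open>y\<close> falls
  with probability at most 1/2 (\<open>remainder_not_very_negative\<close>). It depends neither on
  \<open>y\<close>, nor on the time \<open>h \<le> 1\<close>, nor on the truncation.\<close>

definition tail_shift :: "real \<Rightarrow> real \<Rightarrow> real" where
  "tail_shift d \<mu> = laplace_bound d \<mu> 1 + measure \<nu> {1..} + 1"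

context
  fixes d \<mu> h y :: real
  assumes d: "d \<ge> 0" and h: "h > 0" and y: "y \<ge> 1"
begin

lemma tail_pos_finite: "0 < emeasure \<nu> {y..}" "emeasure \<nu> {y..} < \<infinity>"
  using tail_pos[of y] tail_finite[of y] y by (auto simp: tail_emeasure)

text \<open>Normalising the jump law requires positive mass. By symmetry the mirror image of
  \<open>{y..}\<close> provides it.\<close>

lemma away_minus_tail: "0 < emeasure \<nu> (away n - {y..})" "emeasure \<nu> (away n - {y..}) < \<infinity>"
proof -
  have "emeasure \<nu> {y..} = emeasure \<nu> (uminus ` {y..})"
    using symm unfolding symmetric_measure_def by (metis atLeast_borel)
  also have "\<dots> \<le> emeasure \<nu> (away n - {y..})"
  proof (rule emeasure_mono)
    have "1 / real (Suc n) \<le> 1" by simp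
    then have "x \<in> away n" if "x \<le> - y" for x using that y unfolding away_def mem_Collect_eq by linarith
    then show "uminus ` {y..} \<subseteq> away n - {y..}" using y by auto
  qed (simp add: sets_nu)
  finally show "0 < emeasure \<nu> (away n - {y..})" using tail_pos_finite(1) by order
  show "emeasure \<nu> (away n - {y..}) < \<infinity>"
    by (rule le_less_trans[OF emeasure_mono away_finite[of n]]) (auto simp: sets_nu)
qed

lemma real_distribution_jump_laws:
  "real_distribution (jump_law h {y..})" "real_distribution (jump_law h (away n - {y..}))"
  "real_distribution (jump_law h (away n - {y..}) \<star> normal_law (h * \<mu>) (h * d))"
  "real_distribution (approx_law d \<mu> h y n)"
proof -
  show 1: "real_distribution (jump_law h {y..})"
    unfolding jump_law_def using tail_pos_finite h
    by (intro compound_poisson_law.real_distribution_compound_poisson compound_poisson_law_jump_law) auto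
  show 2: "real_distribution (jump_law h (away n - {y..}))"
    unfolding jump_law_def using away_minus_tail h
    by (intro compound_poisson_law.real_distribution_compound_poisson compound_poisson_law_jump_law) auto
  show 3: "real_distribution (jump_law h (away n - {y..}) \<star> normal_law (h * \<mu>) (h * d))"
    by (intro real_distribution_convolution 2 real_distribution_normal_law)
  show "real_distribution (approx_law d \<mu> h y n)"
    unfolding approx_law_def by (intro real_distribution_convolution 1 3)
qed

lemma indicator_away_split: "indicator (away n) x = indicator {y..} x + (indicator (away n - {y..}) x :: real)"
proof -
  have "x \<in> away n" if "y \<le> x"
  proof -
    have "1 / real (Suc n) \<le> 1" by simp
    then show ?thesis using that y unfolding away_def mem_Collect_eq by linarith
  qed
  then show ?thesis by (auto simp: indicator_def)
qed

lemma char_approx_law: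
  "char (approx_law d \<mu> h y n) z =
     exp (of_real h * (- of_real (d * z\<^sup>2 / 2) + \<i> * of_real (\<mu> * z) + (CLINT y|\<nu>. indicator (away n) y *\<^sub>R (iexp (z * y) - 1))))"
proof -
  have "(CLINT x|\<nu>. indicator (away n) x *\<^sub>R (iexp (z * x) - 1)) =
      (CLINT x|\<nu>. indicator {y..} x *\<^sub>R (iexp (z * x) - 1) + indicator (away n - {y..}) x *\<^sub>R (iexp (z * x) - 1))"
    by (simp only: indicator_away_split scaleR_add_left)
  also have "\<dots> = (CLINT x|\<nu>. indicator {y..} x *\<^sub>R (iexp (z * x) - 1)) + (CLINT x|\<nu>. indicator (away n - {y..}) x *\<^sub>R (iexp (z * x) - 1))"
    using tail_pos_finite away_minus_tail[of n]
    by (intro Bochner_Integration.integral_add integrable_iexp_minus_one) auto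
  finally show ?thesis
    unfolding approx_law_def using tail_pos_finite away_minus_tail[of n] h d
    by (simp add: char_convolution real_distribution_jump_laws real_distribution_normal_law char_jump_law char_normal_law
        exp_add[symmetric]) (simp add: algebra_simps)
qed

lemma approx_law_weak_conv:
  assumes P: "real_distribution P" "\<And>z. char P z = exp (of_real h * levy_exponent d \<nu> \<mu> z)"
  shows "weak_conv_m (approx_law d \<mu> h y) P"
proof (rule levy_continuity[OF real_distribution_jump_laws(4) P(1)])
  fix z
  show "(\<lambda>n. char (approx_law d \<mu> h y n) z) \<longlonglongrightarrow> char P z"
    unfolding char_approx_law P(2) levy_exponent_eq by (intro tendsto_intros integral_away_tendsto)
qed

lemma nn_integral_exp_remainder:
  "(\<integral>\<^sup>+ x. ennreal (exp (s * x)) \<partial>(jump_law h (away n - {y..}) \<star> normal_law (h * \<mu>) (h * d))) =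
     ennreal (exp (h * ((LINT x|\<nu>. indicator (away n - {y..}) x * (exp (s * x) - 1)) + s * \<mu> + d * s\<^sup>2 / 2)))"
  using away_minus_tail[of n] h d
  by (simp add: nn_integral_exp_convolution real_distribution_jump_laws real_distribution_normal_law
      nn_integral_exp_jump_law nn_integral_exp_normal_law ennreal_mult[symmetric] exp_add[symmetric])
     (simp add: algebra_simps)

lemma integral_exp_away_split:
  "(LINT x|\<nu>. indicator (away n) x * (exp (s * x) - 1)) =
     (LINT x|\<nu>. indicator {y..} x * (exp (s * x) - 1)) + (LINT x|\<nu>. indicator (away n - {y..}) x * (exp (s * x) - 1))"
  unfolding indicator_away_split distrib_right using tail_pos_finite away_minus_tail[of n]
  by (intro Bochner_Integration.integral_add integrable_exp_minus_one) auto

lemma laplace_bound_ge: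
  "(LINT x|\<nu>. indicator (away n) x * (exp (s * x) - 1)) + s * \<mu> + d * s\<^sup>2 / 2 \<le> laplace_bound d \<mu> \<bar>s\<bar>"
proof -
  have e: "exp \<bar>s\<bar> \<ge> 1" by simp
  have "s * \<mu> \<le> 1 * (\<bar>\<mu>\<bar> * \<bar>s\<bar>)" by (simp add: abs_mult[symmetric] mult.commute)
  also have "\<dots> \<le> exp \<bar>s\<bar> * (\<bar>\<mu>\<bar> * \<bar>s\<bar>)" using e by (intro mult_right_mono) auto
  finally have 1: "s * \<mu> \<le> exp \<bar>s\<bar> * (\<bar>\<mu>\<bar> * \<bar>s\<bar>)" .
  have "d * s\<^sup>2 / 2 \<le> 1 * (d * s\<^sup>2)" using d by simp
  also have "\<dots> \<le> exp \<bar>s\<bar> * (d * s\<^sup>2)" using e d by (intro mult_right_mono) auto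
  finally have 2: "d * s\<^sup>2 / 2 \<le> exp \<bar>s\<bar> * (d * s\<^sup>2)" .
  show ?thesis using integral_exp_away_le[of n s] 1 2 by (simp add: laplace_bound_def distrib_left)
qed

lemma nn_integral_exp_approx_law:
  "(\<integral>\<^sup>+ x. ennreal (exp (s * x)) \<partial>approx_law d \<mu> h y n) \<le> ennreal (exp (h * laplace_bound d \<mu> \<bar>s\<bar>))"
proof -
  have "(\<integral>\<^sup>+ x. ennreal (exp (s * x)) \<partial>approx_law d \<mu> h y n) =
      ennreal (exp (h * ((LINT x|\<nu>. indicator (away n) x * (exp (s * x) - 1)) + s * \<mu> + d * s\<^sup>2 / 2)))"
    unfolding approx_law_def using tail_pos_finite h
    by (simp add: nn_integral_exp_convolution real_distribution_jump_laws nn_integral_exp_jump_law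
        nn_integral_exp_remainder ennreal_mult[symmetric] exp_add[symmetric] integral_exp_away_split)
       (simp add: algebra_simps)
  also have "\<dots> \<le> ennreal (exp (h * laplace_bound d \<mu> \<bar>s\<bar>))"
    using laplace_bound_ge[of n s] h by (intro ennreal_leI) simp
  finally show ?thesis .
qed

lemma nn_integral_exp_levy_law:
  assumes P: "real_distribution P" "\<And>z. char P z = exp (of_real h * levy_exponent d \<nu> \<mu> z)"
  shows "(\<integral>\<^sup>+ x. ennreal (exp (s * x)) \<partial>P) \<le> ennreal (exp (h * laplace_bound d \<mu> \<bar>s\<bar>))"
  by (rule nn_integral_exp_weak_limit[OF approx_law_weak_conv[OF P] real_distribution_jump_laws(4) P(1) nn_integral_exp_approx_law])
     simp

text \<open>A Chernoff bound with exponent -1. Leaving out the jumps in \<open>{y..}\<close> raises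
  the exponent by at most their total mass, which explains \<open>measure \<nu> {1..}\<close> in
  \<open>tail_shift\<close>; the summand 1 there yields
  \<open>exp (- 1) \<le> 1 / 2\<close>.\<close>

lemma remainder_not_very_negative:
  assumes h1: "h \<le> 1"
  shows "measure (jump_law h (away n - {y..}) \<star> normal_law (h * \<mu>) (h * d)) {- tail_shift d \<mu>..} \<ge> 1 / 2"
proof -
  let ?R = "jump_law h (away n - {y..}) \<star> normal_law (h * \<mu>) (h * d)"
  define k where "k = (LINT x|\<nu>. indicator (away n - {y..}) x * (exp ((- 1) * x) - 1)) + (- 1) * \<mu> + d * (- 1)\<^sup>2 / 2"
  interpret R: real_distribution ?R by (rule real_distribution_jump_laws)
  have i: "integrable \<nu> (indicator {y..} :: real \<Rightarrow> real)" using tail_pos_finite by simp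
  have "- measure \<nu> {1..} \<le> - measure \<nu> {y..}" using tail_antimono[of 1 y] y by simp
  also have "\<dots> = (LINT x|\<nu>. - indicator {y..} x)" by simp
  also have "\<dots> \<le> (LINT x|\<nu>. indicator {y..} x * (exp ((- 1) * x) - 1))"
  proof (rule integral_mono)
    show "integrable \<nu> (\<lambda>x. - indicator {y..} x :: real)" using i by (rule integrable_minus)
    show "integrable \<nu> (\<lambda>x. indicator {y..} x * (exp ((- 1) * x) - 1))"
      using tail_pos_finite by (intro integrable_exp_minus_one) auto
  qed (auto simp: indicator_def)
  finally have k: "k \<le> laplace_bound d \<mu> 1 + measure \<nu> {1..}"
    using integral_exp_away_split[of n "- 1"] laplace_bound_ge[of n "- 1"] by (simp add: k_def)
  have "h * k \<le> tail_shift d \<mu> - 1"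
  proof (cases "k \<ge> 0")
    case True
    then show ?thesis using mult_right_mono[OF h1, of k] k by (simp add: tail_shift_def)
  next
    case False
    have "laplace_bound d \<mu> 1 \<ge> 0" using d exp_tail_nonneg[of 1] by (simp add: laplace_bound_def)
    moreover have "h * k \<le> 0" using False h by (simp add: mult_nonneg_nonpos)
    ultimately show ?thesis using measure_nonneg[of \<nu> "{1..}"] unfolding tail_shift_def by linarith
  qed
  have "ennreal (exp (tail_shift d \<mu>)) * emeasure ?R {..<- tail_shift d \<mu>} = (\<integral>\<^sup>+ x. ennreal (exp (tail_shift d \<mu>)) * indicator {..<- tail_shift d \<mu>} x \<partial>?R)"
    by (simp add: nn_integral_cmult_indicator)
  also have "\<dots> \<le> (\<integral>\<^sup>+ x. ennreal (exp ((- 1) * x)) \<partial>?R)"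
    by (intro nn_integral_mono) (auto simp: indicator_def intro!: ennreal_leI)
  also have "\<dots> = ennreal (exp (h * k))" unfolding k_def by (rule nn_integral_exp_remainder)
  also have "\<dots> \<le> ennreal (exp (tail_shift d \<mu> - 1))" using \<open>h * k \<le> tail_shift d \<mu> - 1\<close> by (intro ennreal_leI) simp
  finally have "exp (tail_shift d \<mu>) * measure ?R {..<- tail_shift d \<mu>} \<le> exp (tail_shift d \<mu> - 1)"
    by (simp add: R.emeasure_eq_measure ennreal_mult[symmetric])
  then have "measure ?R {..<- tail_shift d \<mu>} \<le> exp (- 1)"
    by (simp add: exp_diff exp_minus field_simps)
  also have "exp (- 1 :: real) \<le> 1 / 2" using exp_ge_add_one_self[of 1] by (simp add: exp_minus field_simps)
  finally have "measure ?R {..<- tail_shift d \<mu>} \<le> 1 / 2" .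
  moreover have "measure ?R {- tail_shift d \<mu>..} = 1 - measure ?R {..<- tail_shift d \<mu>}"
    using R.prob_compl[of "{..<- tail_shift d \<mu>}"] by (simp add: Compl_eq_Diff_UNIV[symmetric])
  ultimately show ?thesis by simp
qed

text \<open>One large jump together with a remainder that is not very negative, these being
  independent factors of the convolution. The additional -1 in the level is the price of the weak
  limit.\<close>

lemma levy_law_tail_ge:
  assumes P: "real_distribution P" "\<And>z. char P z = exp (of_real h * levy_exponent d \<nu> \<mu> z)"
    and h1: "h \<le> 1"
  shows "measure P {y - tail_shift d \<mu> - 1..} \<ge> (1 - exp (- h * measure \<nu> {y..})) / 2"
proof (rule tail_weak_limit[OF approx_law_weak_conv[OF P] real_distribution_jump_laws(4) P(1)])
  fix n
  interpret C: compound_poisson_law "h * measure \<nu> {y..}" "uniform_measure \<nu> {y..}"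
    using tail_pos_finite h by (intro compound_poisson_law_jump_law) auto
  have "1 - exp (- (h * measure \<nu> {y..})) \<le> measure (jump_law h {y..}) {y..}"
    unfolding jump_law_def using y by (intro C.compound_poisson_tail_ge AE_uniform_measureI) (auto simp: sets_nu)
  then have "(1 - exp (- h * measure \<nu> {y..})) * (1 / 2) \<le>
      measure (jump_law h {y..}) {y..} * measure (jump_law h (away n - {y..}) \<star> normal_law (h * \<mu>) (h * d)) {- tail_shift d \<mu>..}"
    using remainder_not_very_negative[OF h1] by (intro mult_mono) auto
  also have "\<dots> \<le> measure (approx_law d \<mu> h y n) {y + - tail_shift d \<mu>..}"
    unfolding approx_law_def by (intro convolution_tail_ge real_distribution_jump_laws)
  finally show "(1 - exp (- h * measure \<nu> {y..})) / 2 \<le> measure (approx_law d \<mu> h y n) {y - tail_shift d \<mu> - 1 + 1..}" by simp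
qed

end

end

section \<open>Exponential inequalities for the Levy process\<close>

locale light_tailed_levy_process =
  usual_filtered_prob_space M F + light_tailed_levy_measure \<nu> \<alpha>
  for M :: "'a measure" and F :: "real \<Rightarrow> 'a measure" and \<nu> :: "real measure" and \<alpha> :: real +
  fixes L :: "real \<Rightarrow> 'a \<Rightarrow> real" and d \<mu> :: real
  assumes L1: "L1 M F L d \<nu> \<mu>"
begin

section \<open>Filtration and independence of increments\<close>

lemma d_nonneg: "d \<ge> 0" using L1 by (simp add: L1_def)

lemma levy_process: "levy_process M F L" using L1 by (simp add: L1_def)

lemma space_F [simp]: "t \<ge> 0 \<Longrightarrow> space (F t) = space M"
  using subalg[of t] by (simp add: subalgebra_def)

lemma sets_F_subset: "t \<ge> 0 \<Longrightarrow> sets (F t) \<subseteq> sets M"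
  using subalg[of t] by (simp add: subalgebra_def)

lemma sets_F_D: "A \<in> sets (F t) \<Longrightarrow> t \<ge> 0 \<Longrightarrow> A \<in> sets M"
  using sets_F_subset by blast

lemma measurable_F_M: "f \<in> borel_measurable (F t) \<Longrightarrow> t \<ge> 0 \<Longrightarrow> f \<in> borel_measurable M"
  using measurable_from_subalg[OF subalg] .

lemma subalgebra_F: "0 \<le> s \<Longrightarrow> s \<le> t \<Longrightarrow> subalgebra (F t) (F s)"
  using mono[of s t] by (simp add: subalgebra_def)

lemma measurable_F_mono: "f \<in> borel_measurable (F s) \<Longrightarrow> 0 \<le> s \<Longrightarrow> s \<le> t \<Longrightarrow> f \<in> borel_measurable (F t)"
  using measurable_from_subalg[OF subalgebra_F] .

lemma L_measurable_F: "0 \<le> s \<Longrightarrow> s \<le> t \<Longrightarrow> L s \<in> borel_measurable (F t)"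
proof -
  assume st: "0 \<le> s" "s \<le> t"
  have "adapted F L" using levy_process by (simp add: levy_process_def)
  then show ?thesis using st by (auto simp: adapted_def intro: measurable_F_mono[of _ s t])
qed

lemma L_measurable [measurable]: "0 \<le> s \<Longrightarrow> L s \<in> borel_measurable M"
  using L_measurable_F[of s s] measurable_F_M by blast

lemma increment_measurable_F:
  "0 \<le> s \<Longrightarrow> 0 \<le> t \<Longrightarrow> s \<le> u \<Longrightarrow> t \<le> u \<Longrightarrow> (\<lambda>\<omega>. L t \<omega> - L s \<omega>) \<in> borel_measurable (F u)"
  by (intro borel_measurable_diff L_measurable_F)

lemma increment_measurable [measurable]: "0 \<le> s \<Longrightarrow> 0 \<le> t \<Longrightarrow> (\<lambda>\<omega>. L t \<omega> - L s \<omega>) \<in> borel_measurable M"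
  by (intro borel_measurable_diff L_measurable)

lemma distr_increment:
  assumes "0 \<le> s" "s \<le> t"
  shows "distr M borel (\<lambda>\<omega>. L t \<omega> - L s \<omega>) = distr M borel (L (t - s))"
proof -
  have "\<forall>s t. 0 \<le> s \<longrightarrow> 0 \<le> t \<longrightarrow> distr M borel (\<lambda>\<omega>. L (s + t) \<omega> - L s \<omega>) = distr M borel (L t)"
    using levy_process unfolding levy_process_def by (elim conjE)
  from this[rule_format, of s "t - s"] show ?thesis using assms by simp
qed

lemma L_zero: "AE \<omega> in M. L 0 \<omega> = 0"
  using levy_process by (simp add: levy_process_def)

lemma L_cadlag: "AE \<omega> in M. cadlag (\<lambda>t. L t \<omega>)"
  using levy_process by (simp add: levy_process_def)

lemma prob_increment_vimage:
  assumes "0 \<le> s" "s \<le> t" "G \<in> sets (F s)" "A \<in> sets borel"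
  shows "prob (G \<inter> ((\<lambda>\<omega>. L t \<omega> - L s \<omega>) -` A \<inter> space M)) = prob G * prob ((\<lambda>\<omega>. L t \<omega> - L s \<omega>) -` A \<inter> space M)"
proof (rule indep_setD)
  show "indep_set (sets (F s)) (sets (vimage_algebra (space M) (\<lambda>\<omega>. L t \<omega> - L s \<omega>) borel))"
    using levy_process assms by (simp add: levy_process_def)
  show "(\<lambda>\<omega>. L t \<omega> - L s \<omega>) -` A \<inter> space M \<in> sets (vimage_algebra (space M) (\<lambda>\<omega>. L t \<omega> - L s \<omega>) borel)"
    using assms by (intro in_vimage_algebra)
qed fact

lemma identity_measurable_F: "0 \<le> s \<Longrightarrow> (\<lambda>\<omega>. \<omega>) \<in> measurable M (F s)"
  using subalg[of s] sets.sets_into_space[of _ "F s"]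
  by (auto simp: subalgebra_def measurable_def Int_absorb2)

text \<open>Independence as a product formula: the past is represented by the identity map into the
  smaller sigma-algebra \<open>F s\<close>, so Fubini's theorem applies to every weight measurable
  in the past.\<close>

lemma distr_past_increment:
  assumes st: "0 \<le> s" "s \<le> t"
  shows "distr M (F s) (\<lambda>\<omega>. \<omega>) \<Otimes>\<^sub>M distr M borel (\<lambda>\<omega>. L t \<omega> - L s \<omega>)
       = distr M (F s \<Otimes>\<^sub>M borel) (\<lambda>\<omega>. (\<omega>, L t \<omega> - L s \<omega>))"
proof (rule pair_measure_eqI)
  have m [measurable]: "(\<lambda>\<omega>. \<omega>) \<in> measurable M (F s)" "(\<lambda>\<omega>. L t \<omega> - L s \<omega>) \<in> borel_measurable M"
    using st identity_measurable_F by auto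
  show "sigma_finite_measure (distr M (F s) (\<lambda>\<omega>. \<omega>))" "sigma_finite_measure (distr M borel (\<lambda>\<omega>. L t \<omega> - L s \<omega>))"
    by (intro prob_space_imp_sigma_finite prob_space_distr m)+
  show "sets (distr M (F s) (\<lambda>\<omega>. \<omega>) \<Otimes>\<^sub>M distr M borel (\<lambda>\<omega>. L t \<omega> - L s \<omega>))
      = sets (distr M (F s \<Otimes>\<^sub>M borel) (\<lambda>\<omega>. (\<omega>, L t \<omega> - L s \<omega>)))"
    by (simp cong: sets_pair_measure_cong)
  fix A B assume "A \<in> sets (distr M (F s) (\<lambda>\<omega>. \<omega>))" "B \<in> sets (distr M borel (\<lambda>\<omega>. L t \<omega> - L s \<omega>))"
  then have AB [measurable]: "A \<in> sets (F s)" "B \<in> sets borel" by auto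
  have "A \<subseteq> space M" using sets.sets_into_space[OF AB(1)] st by simp
  moreover have "(\<lambda>\<omega>. (\<omega>, L t \<omega> - L s \<omega>)) -` (A \<times> B) \<inter> space M = A \<inter> ((\<lambda>\<omega>. L t \<omega> - L s \<omega>) -` B \<inter> space M)"
    using \<open>A \<subseteq> space M\<close> by auto
  ultimately show "emeasure (distr M (F s) (\<lambda>\<omega>. \<omega>)) A * emeasure (distr M borel (\<lambda>\<omega>. L t \<omega> - L s \<omega>)) B
      = emeasure (distr M (F s \<Otimes>\<^sub>M borel) (\<lambda>\<omega>. (\<omega>, L t \<omega> - L s \<omega>))) (A \<times> B)"
    using prob_increment_vimage[OF st AB]
    by (subst (1 2 3) emeasure_distr) (auto simp: emeasure_eq_measure ennreal_mult[symmetric] Int_absorb2)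
qed

lemma nn_integral_increment:
  fixes W :: "'a \<Rightarrow> ennreal" and g :: "real \<Rightarrow> ennreal"
  assumes st: "0 \<le> s" "s \<le> t" and [measurable]: "W \<in> borel_measurable (F s)" "g \<in> borel_measurable borel"
  shows "(\<integral>\<^sup>+ \<omega>. W \<omega> * g (L t \<omega> - L s \<omega>) \<partial>M) = (\<integral>\<^sup>+ \<omega>. W \<omega> \<partial>M) * (\<integral>\<^sup>+ \<omega>. g (L (t - s) \<omega>) \<partial>M)"
proof -
  have m [measurable]: "(\<lambda>\<omega>. \<omega>) \<in> measurable M (F s)" "(\<lambda>\<omega>. L t \<omega> - L s \<omega>) \<in> borel_measurable M"
    using st identity_measurable_F by auto
  interpret D2: prob_space "distr M borel (\<lambda>\<omega>. L t \<omega> - L s \<omega>)" by (rule prob_space_distr) simp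
  have "(\<integral>\<^sup>+ \<omega>. W \<omega> * g (L t \<omega> - L s \<omega>) \<partial>M) = (\<integral>\<^sup>+ p. W (fst p) * g (snd p) \<partial>distr M (F s \<Otimes>\<^sub>M borel) (\<lambda>\<omega>. (\<omega>, L t \<omega> - L s \<omega>)))"
    by (subst nn_integral_distr) auto
  also have "\<dots> = (\<integral>\<^sup>+ p. W (fst p) * g (snd p) \<partial>(distr M (F s) (\<lambda>\<omega>. \<omega>) \<Otimes>\<^sub>M distr M borel (\<lambda>\<omega>. L t \<omega> - L s \<omega>)))"
    by (simp only: distr_past_increment[OF st])
  also have "\<dots> = (\<integral>\<^sup>+ \<omega>. \<integral>\<^sup>+ x. W \<omega> * g x \<partial>distr M borel (\<lambda>\<omega>. L t \<omega> - L s \<omega>) \<partial>distr M (F s) (\<lambda>\<omega>. \<omega>))"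
    by (subst D2.nn_integral_fst[symmetric]) (auto cong: measurable_cong_sets sets_pair_measure_cong)
  also have "\<dots> = (\<integral>\<^sup>+ \<omega>. W \<omega> \<partial>distr M (F s) (\<lambda>\<omega>. \<omega>)) * (\<integral>\<^sup>+ x. g x \<partial>distr M borel (\<lambda>\<omega>. L t \<omega> - L s \<omega>))"
    by (simp add: nn_integral_cmult nn_integral_multc)
  also have "(\<integral>\<^sup>+ \<omega>. W \<omega> \<partial>distr M (F s) (\<lambda>\<omega>. \<omega>)) = (\<integral>\<^sup>+ \<omega>. W \<omega> \<partial>M)"
    by (subst nn_integral_distr) auto
  also have "(\<integral>\<^sup>+ x. g x \<partial>distr M borel (\<lambda>\<omega>. L t \<omega> - L s \<omega>)) = (\<integral>\<^sup>+ \<omega>. g (L (t - s) \<omega>) \<partial>M)"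
    using st by (subst distr_increment) (auto simp: nn_integral_distr)
  finally show ?thesis .
qed

lemma prob_increment:
  assumes st: "0 \<le> s" "s \<le> t" and G: "G \<in> sets (F s)" and A: "A \<in> sets borel"
  shows "prob (G \<inter> {\<omega>\<in>space M. L t \<omega> - L s \<omega> \<in> A}) = prob G * prob {\<omega>\<in>space M. L (t - s) \<omega> \<in> A}"
proof -
  have e: "{\<omega>\<in>space M. X \<omega> \<in> A} = X -` A \<inter> space M" for X :: "'a \<Rightarrow> real" by auto
  have "prob {\<omega>\<in>space M. L (t - s) \<omega> \<in> A} = measure (distr M borel (L (t - s))) A"
    unfolding e using st A by (intro measure_distr[symmetric] L_measurable) auto
  also have "\<dots> = prob ((\<lambda>\<omega>. L t \<omega> - L s \<omega>) -` A \<inter> space M)"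
    unfolding distr_increment[OF st, symmetric] using st A by (intro measure_distr increment_measurable) auto
  finally show ?thesis unfolding e using prob_increment_vimage[OF st G A] by simp
qed

section \<open>Characteristic functions at times \<open>1 / m\<close>\<close>

lemma char_add:
  assumes "0 \<le> s" "0 \<le> t"
  shows "char (distr M borel (L (s + t))) z = char (distr M borel (L s)) z * char (distr M borel (L t)) z"
proof -
  have m: "L s \<in> borel_measurable M" "(\<lambda>\<omega>. L (s + t) \<omega> - L s \<omega>) \<in> borel_measurable M" using assms by auto
  have sig: "sigma_sets (space M) {X -` A \<inter> space M |A. A \<in> sets borel} = {X -` A \<inter> space M |A. A \<in> sets borel}"
    for X :: "'a \<Rightarrow> real"
    by (rule sets_vimage_algebra2[unfolded sets_vimage_algebra]) simp
  have "indep_var borel (L s) borel (\<lambda>\<omega>. L (s + t) \<omega> - L s \<omega>)"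
    unfolding indep_var_eq sig
  proof (intro conjI m indep_setI)
    fix a b assume "a \<in> {L s -` A \<inter> space M |A. A \<in> sets borel}" "b \<in> {(\<lambda>\<omega>. L (s + t) \<omega> - L s \<omega>) -` A \<inter> space M |A. A \<in> sets borel}"
    then obtain A B where A: "a = L s -` A \<inter> space M" "A \<in> sets borel" and B: "b = (\<lambda>\<omega>. L (s + t) \<omega> - L s \<omega>) -` B \<inter> space M" "B \<in> sets borel" by auto
    have "a \<in> sets (F s)" using measurable_sets[OF L_measurable_F[of s s] A(2)] assms A by simp
    then show "prob (a \<inter> b) = prob a * prob b" using prob_increment_vimage[of s "s + t" a B] assms B by simp
  qed (use m in \<open>auto intro: measurable_sets\<close>)
  from char_distr_add[OF this, of z] show ?thesis
    using distr_increment[of s "s + t"] assms by simp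
qed

lemma char_zero_time: "char (distr M borel (L 0)) z = 1"
proof -
  have "char (distr M borel (L 0)) z = (CLINT \<omega>|M. iexp (z * L 0 \<omega>))"
    unfolding char_def by (subst integral_distr) auto
  also have "\<dots> = (CLINT \<omega>|M. 1)"
    using L_zero by (intro integral_cong_AE) (auto elim: AE_mp)
  finally show ?thesis by (simp add: prob_space)
qed

lemma char_mult: "0 \<le> h \<Longrightarrow> char (distr M borel (L (real k * h))) z = char (distr M borel (L h)) z ^ k"
proof (induction k)
  case (Suc k)
  then show ?case using char_add[of h "real k * h" z] by (simp add: algebra_simps)
qed (simp add: char_zero_time)

lemma levy_exponent_zero: "levy_exponent d \<nu> \<mu> 0 = 0"
  by (simp add: levy_exponent_def)

text \<open>The quotient of the characteristic function of \<open>L (1/m)\<close> by the expected one is a continuous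
  function with values in the \<open>m\<close>-th roots of unity, hence constant.\<close>

lemma char_L_inverse_nat:
  assumes m: "m \<ge> 1"
  shows "char (distr M borel (L (1 / real m))) z = exp (of_real (1 / real m) * levy_exponent d \<nu> \<mu> z)"
proof -
  interpret D: real_distribution "distr M borel (L (1 / real m))" by (rule real_distribution_distr) simp
  define r where "r z = char (distr M borel (L (1 / real m))) z * exp (- (of_real (1 / real m) * levy_exponent d \<nu> \<mu> z))" for z
  have r: "r z ^ m = 1" for z
  proof -
    have "char (distr M borel (L (1 / real m))) z ^ m = char (distr M borel (L 1)) z"
      using char_mult[of "1 / real m" m z] m by simp
    also have "\<dots> = exp (levy_exponent d \<nu> \<mu> z)"
      using L1 by (simp add: L1_def generating_triplet_def)
    finally show ?thesis
      using m by (simp add: r_def power_mult_distrib exp_of_nat_mult[symmetric] exp_add[symmetric])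
  qed
  have "continuous_on UNIV r"
    unfolding r_def
    by (intro continuous_at_imp_continuous_on ballI continuous_intros D.isCont_char continuous_levy_exponent)
  moreover have "finite (range r)"
    by (rule finite_subset[OF _ finite_roots_unity[OF m, where 'a = complex]]) (use r in auto)
  ultimately have "r constant_on UNIV"
    by (intro continuous_finite_range_constant) auto
  then have "r z = r 0" by (auto simp: constant_on_def)
  also have "r 0 = 1" using D.char_zero by (simp add: r_def levy_exponent_zero)
  finally have "char (distr M borel (L (1 / real m))) z * (exp (- (of_real (1 / real m) * levy_exponent d \<nu> \<mu> z)) * exp (of_real (1 / real m) * levy_exponent d \<nu> \<mu> z)) = exp (of_real (1 / real m) * levy_exponent d \<nu> \<mu> z)"
    by (simp add: r_def)
  then show ?thesis by (simp add: exp_add[symmetric])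
qed

section \<open>Exponential moments and maximal inequalities\<close>

abbreviation "\<Psi> \<equiv> laplace_bound d \<mu>"

lemma laplace_bound_nonneg: "s \<ge> 0 \<Longrightarrow> \<Psi> s \<ge> 0"
  using d_nonneg exp_tail_nonneg[of s] by (simp add: laplace_bound_def)

lemma mgf_inverse_nat:
  assumes m: "m \<ge> 1"
  shows "(\<integral>\<^sup>+ \<omega>. ennreal (exp (s * L (1 / real m) \<omega>)) \<partial>M) \<le> ennreal (exp (1 / real m * \<Psi> \<bar>s\<bar>))"
proof -
  have "(\<integral>\<^sup>+ \<omega>. ennreal (exp (s * L (1 / real m) \<omega>)) \<partial>M) = (\<integral>\<^sup>+ x. ennreal (exp (s * x)) \<partial>distr M borel (L (1 / real m)))"
    by (subst nn_integral_distr) auto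
  also have "\<dots> \<le> ennreal (exp (1 / real m * \<Psi> \<bar>s\<bar>))"
    \<comment> \<open>The approximating laws need some level \<open>y \<ge> 1\<close>; the
      exponential bound does not depend on it.\<close>
    using m d_nonneg by (intro nn_integral_exp_levy_law[where y = 1] real_distribution_distr char_L_inverse_nat) auto
  finally show ?thesis .
qed

lemma mgf_mult:
  assumes m: "m \<ge> 1"
  shows "(\<integral>\<^sup>+ \<omega>. ennreal (exp (s * L (real k * (1 / real m)) \<omega>)) \<partial>M) \<le> ennreal (exp (real k * (1 / real m) * \<Psi> \<bar>s\<bar>))"
proof (induction k)
  case 0
  have "(\<integral>\<^sup>+ \<omega>. ennreal (exp (s * L 0 \<omega>)) \<partial>M) = (\<integral>\<^sup>+ \<omega>. 1 \<partial>M)"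
    using L_zero by (intro nn_integral_cong_AE) auto
  then show ?case by (simp add: emeasure_space_1)
next
  case (Suc k)
  let ?h = "1 / real m" let ?t = "real k * ?h"
  have e: "real (Suc k) * ?h = ?t + ?h" unfolding of_nat_Suc distrib_right by linarith
  have "(\<integral>\<^sup>+ \<omega>. ennreal (exp (s * L (?t + ?h) \<omega>)) \<partial>M) =
      (\<integral>\<^sup>+ \<omega>. ennreal (exp (s * L ?t \<omega>)) * ennreal (exp (s * (L (?t + ?h) \<omega> - L ?t \<omega>))) \<partial>M)"
    by (simp add: ennreal_mult[symmetric] exp_add[symmetric] right_diff_distrib)
  also have "\<dots> = (\<integral>\<^sup>+ \<omega>. ennreal (exp (s * L ?t \<omega>)) \<partial>M) * (\<integral>\<^sup>+ \<omega>. ennreal (exp (s * L (?t + ?h - ?t) \<omega>)) \<partial>M)"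
    using L_measurable_F[of ?t ?t] by (intro nn_integral_increment[where g = "\<lambda>x. ennreal (exp (s * x))"]) auto
  also have "\<dots> \<le> ennreal (exp (?t * \<Psi> \<bar>s\<bar>)) * ennreal (exp (?h * \<Psi> \<bar>s\<bar>))"
    using Suc mgf_inverse_nat[OF m, of s] by (intro mult_mono) auto
  also have "\<dots> = ennreal (exp ((?t + ?h) * \<Psi> \<bar>s\<bar>))"
    by (simp add: ennreal_mult[symmetric] exp_add[symmetric] algebra_simps)
  finally show ?case unfolding e .
qed

text \<open>Rational times suffice below because every grid has a rational step, and dyadic
  refinement keeps it rational.\<close>

lemma mgf_rational:
  assumes "t \<in> \<rat>" "t \<ge> 0"
  shows "(\<integral>\<^sup>+ \<omega>. ennreal (exp (s * L t \<omega>)) \<partial>M) \<le> ennreal (exp (t * \<Psi> \<bar>s\<bar>))"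
proof -
  obtain k m :: nat where "m \<noteq> 0" "\<bar>t\<bar> = real k / real m" using Rats_abs_nat_div_natE[OF assms(1)] by metis
  then show ?thesis using mgf_mult[of m s k] assms(2) by simp
qed

text \<open>A Chernoff bound. The sign \<sigma> treats both directions at once, and the event
  \<open>G\<close> from an earlier time \<open>u\<close> is carried along so that bounds multiply
  over successive blocks.\<close>

lemma increment_tail_le:
  assumes "0 \<le> u" "u \<le> s" "s \<le> t" "t - s \<in> \<rat>" "G \<in> sets (F u)" "\<theta> \<ge> 0" "\<bar>\<sigma>\<bar> = 1"
  shows "prob (G \<inter> {\<omega>\<in>space M. \<sigma> * (L t \<omega> - L s \<omega>) \<ge> x}) \<le> prob G * exp (- \<theta> * x + (t - s) * \<Psi> \<theta>)"
proof -
  have G: "G \<in> sets (F s)" using assms mono[of u s] by auto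
  have "prob (G \<inter> {\<omega>\<in>space M. L t \<omega> - L s \<omega> \<in> {y. \<sigma> * y \<ge> x}}) = prob G * prob {\<omega>\<in>space M. L (t - s) \<omega> \<in> {y. \<sigma> * y \<ge> x}}"
    using assms G by (intro prob_increment) auto
  also have "prob {\<omega>\<in>space M. L (t - s) \<omega> \<in> {y. \<sigma> * y \<ge> x}} \<le> exp (- \<theta> * x + (t - s) * \<Psi> \<theta>)"
  proof -
    have "emeasure M {\<omega>\<in>space M. L (t - s) \<omega> \<in> {y. \<sigma> * y \<ge> x}} = (\<integral>\<^sup>+ \<omega>. indicator {\<omega>\<in>space M. L (t - s) \<omega> \<in> {y. \<sigma> * y \<ge> x}} \<omega> \<partial>M)"
      using assms by (subst nn_integral_indicator) auto
    also have "\<dots> \<le> (\<integral>\<^sup>+ \<omega>. ennreal (exp (- \<theta> * x)) * ennreal (exp ((\<theta> * \<sigma>) * L (t - s) \<omega>)) \<partial>M)"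
    proof (intro nn_integral_mono)
      fix \<omega>
      have "1 \<le> exp (- \<theta> * x) * exp ((\<theta> * \<sigma>) * L (t - s) \<omega>)" if "\<sigma> * L (t - s) \<omega> \<ge> x"
        using mult_left_mono[OF that assms(6)] by (simp add: exp_add[symmetric] mult.assoc)
      then show "indicator {\<omega>\<in>space M. L (t - s) \<omega> \<in> {y. \<sigma> * y \<ge> x}} \<omega> \<le> ennreal (exp (- \<theta> * x)) * ennreal (exp ((\<theta> * \<sigma>) * L (t - s) \<omega>))"
        by (auto simp: indicator_def ennreal_mult[symmetric])
    qed
    also have "\<dots> = ennreal (exp (- \<theta> * x)) * (\<integral>\<^sup>+ \<omega>. ennreal (exp ((\<theta> * \<sigma>) * L (t - s) \<omega>)) \<partial>M)"
      using assms by (intro nn_integral_cmult) auto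
    also have "\<dots> \<le> ennreal (exp (- \<theta> * x)) * ennreal (exp ((t - s) * \<Psi> \<bar>\<theta> * \<sigma>\<bar>))"
      using assms by (intro mult_left_mono mgf_rational) auto
    also have "\<dots> = ennreal (exp (- \<theta> * x + (t - s) * \<Psi> \<theta>))"
      using assms by (simp add: abs_mult ennreal_mult[symmetric] exp_add[symmetric] algebra_simps)
    finally show ?thesis by (simp add: emeasure_eq_measure)
  qed
  finally show ?thesis by (simp add: mult_left_mono)
qed

text \<open>The past-measurable weight \<open>W\<close> makes the induction on the number of steps work, and with
  \<open>W\<close> an indicator it replaces the Markov property below.\<close>

lemma exponential_maximal_inequality:
  fixes W :: "'a \<Rightarrow> ennreal"
  assumes h: "h \<ge> 0" and k: "(\<integral>\<^sup>+ \<omega>. ennreal (exp (a * L h \<omega> - k)) \<partial>M) \<le> 1"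
  shows "s \<ge> 0 \<Longrightarrow> W \<in> borel_measurable (F s) \<Longrightarrow>
     emeasure M {\<omega>\<in>space M. \<exists>j\<le>n. 1 \<le> W \<omega> * ennreal (exp (a * (L (s + real j * h) \<omega> - L s \<omega>) - k * real j))} \<le> (\<integral>\<^sup>+ \<omega>. W \<omega> \<partial>M)"
proof (induction n arbitrary: s W)
  case 0
  have [measurable]: "W \<in> borel_measurable M" by (rule measurable_F_M[OF 0(2,1)])
  have "emeasure M {\<omega>\<in>space M. 1 \<le> W \<omega>} = (\<integral>\<^sup>+ \<omega>. indicator {\<omega>\<in>space M. 1 \<le> W \<omega>} \<omega> \<partial>M)"
    by (subst nn_integral_indicator) auto
  also have "\<dots> \<le> (\<integral>\<^sup>+ \<omega>. W \<omega> \<partial>M)" by (intro nn_integral_mono) (auto simp: indicator_def)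
  finally show ?case by simp
next
  case (Suc n)
  have W [measurable]: "W \<in> borel_measurable M" by (rule measurable_F_M[OF Suc.prems(2,1)])
  let ?s = "s + h"
  have s: "0 \<le> s" "s \<le> ?s" "0 \<le> ?s" using Suc.prems h by auto
  \<comment> \<open>Optional stopping by hand: where the weight has reached 1 the event is counted
    now and the weight is set to 0; elsewhere the weight is passed on, multiplied by the first
    factor.\<close>
  define W1 where "W1 \<omega> = (if W \<omega> < 1 then W \<omega> else 0)" for \<omega>
  define W' where "W' \<omega> = W1 \<omega> * ennreal (exp (a * (L ?s \<omega> - L s \<omega>) - k))" for \<omega>
  have W1F: "W1 \<in> borel_measurable (F s)" unfolding W1_def
    by (intro measurable_If Suc.prems(2) measurable_const borel_measurable_less) simp_all
  have W1M [measurable]: "W1 \<in> borel_measurable M" unfolding W1_def by measurable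
  have incF: "(\<lambda>\<omega>. L ?s \<omega> - L s \<omega>) \<in> borel_measurable (F ?s)"
    using s by (intro increment_measurable_F) simp_all
  have W'F: "W' \<in> borel_measurable (F ?s)" unfolding W'_def
    by (intro borel_measurable_times_ennreal measurable_F_mono[OF W1F s(1,2)]
        measurable_compose[OF incF, of "\<lambda>x. ennreal (exp (a * x - k))"]) measurable
  let ?E = "{\<omega>\<in>space M. \<exists>j\<le>n. 1 \<le> W' \<omega> * ennreal (exp (a * (L (?s + real j * h) \<omega> - L ?s \<omega>) - k * real j))}"
  have W'M [measurable]: "W' \<in> borel_measurable M" by (rule measurable_F_M[OF W'F s(3)])
  have inc [measurable]: "(\<lambda>\<omega>. L (?s + real j * h) \<omega> - L ?s \<omega>) \<in> borel_measurable M" for j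
    using s h by (intro increment_measurable) auto
  have E [measurable]: "?E \<in> sets M" by measurable
  have "{\<omega>\<in>space M. \<exists>j\<le>Suc n. 1 \<le> W \<omega> * ennreal (exp (a * (L (s + real j * h) \<omega> - L s \<omega>) - k * real j))}
      \<subseteq> {\<omega>\<in>space M. 1 \<le> W \<omega>} \<union> ?E"
  proof safe
    fix \<omega> j assume *: "\<omega> \<in> space M" "j \<le> Suc n" "1 \<le> W \<omega> * ennreal (exp (a * (L (s + real j * h) \<omega> - L s \<omega>) - k * real j))"
      and nE: "\<not> (\<exists>j\<le>n. 1 \<le> W' \<omega> * ennreal (exp (a * (L (?s + real j * h) \<omega> - L ?s \<omega>) - k * real j)))"
    show "1 \<le> W \<omega>"
    proof (rule ccontr)
      assume W: "\<not> 1 \<le> W \<omega>"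
      then obtain i where i: "j = Suc i" using * by (cases j) auto
      have "W' \<omega> * ennreal (exp (a * (L (?s + real i * h) \<omega> - L ?s \<omega>) - k * real i)) =
          W \<omega> * (ennreal (exp (a * (L ?s \<omega> - L s \<omega>) - k)) * ennreal (exp (a * (L (?s + real i * h) \<omega> - L ?s \<omega>) - k * real i)))"
        using W by (simp add: W'_def W1_def mult.assoc)
      also have "ennreal (exp (a * (L ?s \<omega> - L s \<omega>) - k)) * ennreal (exp (a * (L (?s + real i * h) \<omega> - L ?s \<omega>) - k * real i))
          = ennreal (exp (a * (L (s + real j * h) \<omega> - L s \<omega>) - k * real j))"
        by (simp add: i ennreal_mult[symmetric] exp_add[symmetric] algebra_simps)
      finally show False using * nE i by auto
    qed
  qed
  then have "emeasure M {\<omega>\<in>space M. \<exists>j\<le>Suc n. 1 \<le> W \<omega> * ennreal (exp (a * (L (s + real j * h) \<omega> - L s \<omega>) - k * real j))}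
      \<le> emeasure M ({\<omega>\<in>space M. 1 \<le> W \<omega>} \<union> ?E)"
    by (intro emeasure_mono) auto
  also have "\<dots> \<le> emeasure M {\<omega>\<in>space M. 1 \<le> W \<omega>} + emeasure M ?E"
    by (intro emeasure_subadditive) auto
  also have "emeasure M {\<omega>\<in>space M. 1 \<le> W \<omega>} = (\<integral>\<^sup>+ \<omega>. indicator {\<omega>\<in>space M. 1 \<le> W \<omega>} \<omega> \<partial>M)"
    by (subst nn_integral_indicator) auto
  also have "emeasure M ?E \<le> (\<integral>\<^sup>+ \<omega>. W' \<omega> \<partial>M)"
    by (rule Suc.IH[OF s(3) W'F])
  also have "(\<integral>\<^sup>+ \<omega>. W' \<omega> \<partial>M) = (\<integral>\<^sup>+ \<omega>. W1 \<omega> \<partial>M) * (\<integral>\<^sup>+ \<omega>. ennreal (exp (a * L (?s - s) \<omega> - k)) \<partial>M)"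
    unfolding W'_def by (rule nn_integral_increment[where g = "\<lambda>x. ennreal (exp (a * x - k))", OF s(1,2) W1F]) measurable
  also have "\<dots> \<le> (\<integral>\<^sup>+ \<omega>. W1 \<omega> \<partial>M) * 1" using k by (intro mult_left_mono) auto
  also have "(\<integral>\<^sup>+ \<omega>. indicator {\<omega>\<in>space M. 1 \<le> W \<omega>} \<omega> \<partial>M) + (\<integral>\<^sup>+ \<omega>. W1 \<omega> \<partial>M) * 1
      = (\<integral>\<^sup>+ \<omega>. indicator {\<omega>\<in>space M. 1 \<le> W \<omega>} \<omega> + W1 \<omega> \<partial>M)"
    by (subst nn_integral_add) auto
  also have "\<dots> \<le> (\<integral>\<^sup>+ \<omega>. W \<omega> \<partial>M)"
    by (intro nn_integral_mono) (auto simp: indicator_def W1_def)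
  finally show ?case by (simp add: add_left_mono)
qed

text \<open>Only dyadic fractions of \<open>h\<close> enter, which makes this an event; right
  continuity extends the bound to all times in between.\<close>

definition oscillation :: "real \<Rightarrow> real \<Rightarrow> real \<Rightarrow> 'a set" where
  "oscillation s h b = {\<omega>\<in>space M. \<exists>n. \<exists>j\<le>2 ^ n. b < \<bar>L (s + real j * (h / 2 ^ n)) \<omega> - L s \<omega>\<bar>}"

lemma oscillation_in_F:
  assumes "0 \<le> s" "0 \<le> h" "s + h \<le> t"
  shows "oscillation s h b \<in> sets (F t)"
proof -
  have "(\<lambda>\<omega>. L (s + real j * (h / 2 ^ n)) \<omega> - L s \<omega>) \<in> borel_measurable (F t)" if "j \<le> 2 ^ n" for n j
  proof -
    have "real j \<le> 2 ^ n" using that by (metis of_nat_le_iff of_nat_numeral of_nat_power)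
    then have "real j * (h / 2 ^ n) \<le> h" using assms by (simp add: field_simps mult_left_mono)
    then show ?thesis using assms by (intro increment_measurable_F) auto
  qed
  then have ev: "{\<omega>\<in>space (F t). b < \<bar>L (s + real j * (h / 2 ^ n)) \<omega> - L s \<omega>\<bar>} \<in> sets (F t)" if "j \<le> 2 ^ n" for n j
    using that by (intro borel_measurable_less borel_measurable_abs) auto
  have "oscillation s h b = (\<Union>n. \<Union>j\<in>{..2 ^ n}. {\<omega>\<in>space (F t). b < \<bar>L (s + real j * (h / 2 ^ n)) \<omega> - L s \<omega>\<bar>})"
    using assms by (auto simp: oscillation_def)
  also have "\<dots> \<in> sets (F t)"
    by (intro sets.countable_nat_UN subsetI) (auto intro!: sets.finite_UN ev simp del: times_divide_eq_right)
  finally show ?thesis .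
qed

text \<open>The maximal inequality on the dyadic grid of level \<open>n\<close> gives a bound free
  of \<open>n\<close>. The events increase with \<open>n\<close> because each grid contains the
  coarser ones, so the bound passes to the union.\<close>

lemma prob_oscillation_le:
  assumes s: "s \<ge> 0" and h: "h > 0" "h \<in> \<rat>" and G: "G \<in> sets (F s)" and \<theta>: "\<theta> \<ge> 0"
  shows "prob (G \<inter> oscillation s h b) \<le> prob G * (2 * exp (- \<theta> * b + h * \<Psi> \<theta>))"
proof -
  have [measurable]: "G \<in> sets M" by (rule sets_F_D[OF G s])
  define D where "D \<sigma> n = G \<inter> {\<omega>\<in>space M. \<exists>j\<le>2 ^ n. b < \<sigma> * (L (s + real j * (h / 2 ^ n)) \<omega> - L s \<omega>)}" for \<sigma> :: real and n
  have incr: "(\<lambda>\<omega>. L (s + real j * (h / 2 ^ n)) \<omega> - L s \<omega>) \<in> borel_measurable M" for j n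
    using s h by (intro increment_measurable) auto
  note [measurable] = incr
  have DM [measurable]: "D \<sigma> n \<in> sets M" for \<sigma> n unfolding D_def by measurable
  have D_le: "emeasure M (D \<sigma> n) \<le> ennreal (prob G * exp (- \<theta> * b + h * \<Psi> \<theta>))" if "\<bar>\<sigma>\<bar> = 1" for \<sigma> n
  proof -
    \<comment> \<open>The starting weight is tuned so that an increment above \<open>b\<close> makes
      the weighted exponential at least 1 at every grid time, even at the last one.\<close>
    define W :: "'a \<Rightarrow> ennreal" where "W \<omega> = indicator G \<omega> * ennreal (exp (- \<theta> * b + h * \<Psi> \<theta>))" for \<omega>
    define k where "k = h / 2 ^ n * \<Psi> \<theta>"
    have k: "(\<integral>\<^sup>+ \<omega>. ennreal (exp ((\<theta> * \<sigma>) * L (h / 2 ^ n) \<omega> - k)) \<partial>M) \<le> 1"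
    proof -
      have "(\<integral>\<^sup>+ \<omega>. ennreal (exp ((\<theta> * \<sigma>) * L (h / 2 ^ n) \<omega> - k)) \<partial>M) = (\<integral>\<^sup>+ \<omega>. ennreal (exp (- k)) * ennreal (exp ((\<theta> * \<sigma>) * L (h / 2 ^ n) \<omega>)) \<partial>M)"
        by (simp add: ennreal_mult[symmetric] exp_add[symmetric])
      also have "\<dots> = ennreal (exp (- k)) * (\<integral>\<^sup>+ \<omega>. ennreal (exp ((\<theta> * \<sigma>) * L (h / 2 ^ n) \<omega>)) \<partial>M)"
        using h by (intro nn_integral_cmult) auto
      also have "\<dots> \<le> ennreal (exp (- k)) * ennreal (exp (h / 2 ^ n * \<Psi> \<bar>\<theta> * \<sigma>\<bar>))"
        using h by (intro mult_left_mono mgf_rational) auto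
      also have "\<dots> = 1" using that \<theta> by (simp add: k_def abs_mult ennreal_mult[symmetric] exp_add[symmetric])
      finally show ?thesis .
    qed
    have k0: "k \<ge> 0" using h \<theta> laplace_bound_nonneg by (simp add: k_def)
    have "D \<sigma> n \<subseteq> {\<omega>\<in>space M. \<exists>j\<le>2 ^ n. 1 \<le> W \<omega> * ennreal (exp ((\<theta> * \<sigma>) * (L (s + real j * (h / 2 ^ n)) \<omega> - L s \<omega>) - k * real j))}"
    proof (clarsimp simp: D_def)
      fix \<omega> j assume *: "\<omega> \<in> G" "\<omega> \<in> space M" "j \<le> 2 ^ n" "b < \<sigma> * (L (s + real j * h / 2 ^ n) \<omega> - L s \<omega>)"
      have "real j \<le> 2 ^ n" using *(3) by (metis of_nat_le_iff of_nat_numeral of_nat_power)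
      then have "k * real j \<le> k * 2 ^ n" using k0 by (intro mult_left_mono) auto
      also have "\<dots> = h * \<Psi> \<theta>" by (simp add: k_def)
      finally have kj: "k * real j \<le> h * \<Psi> \<theta>" .
      have "\<theta> * b \<le> \<theta> * (\<sigma> * (L (s + real j * h / 2 ^ n) \<omega> - L s \<omega>))" using * \<theta> by (intro mult_left_mono) auto
      then have "0 \<le> - \<theta> * b + h * \<Psi> \<theta> + (\<theta> * \<sigma> * (L (s + real j * h / 2 ^ n) \<omega> - L s \<omega>) - k * real j)"
        using kj by (simp add: mult.assoc)
      then have "1 \<le> W \<omega> * ennreal (exp (\<theta> * \<sigma> * (L (s + real j * h / 2 ^ n) \<omega> - L s \<omega>) - k * real j))"
        using *(1) by (simp add: W_def ennreal_mult[symmetric] exp_add[symmetric])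
      then show "\<exists>j\<le>2 ^ n. 1 \<le> W \<omega> * ennreal (exp (\<theta> * \<sigma> * (L (s + real j * h / 2 ^ n) \<omega> - L s \<omega>) - k * real j))"
        using * by blast
    qed
    moreover have WF: "W \<in> borel_measurable (F s)" unfolding W_def
      by (intro borel_measurable_times_ennreal borel_measurable_indicator G measurable_const) simp
    moreover have [measurable]: "W \<in> borel_measurable M" by (rule measurable_F_M[OF WF s])
    ultimately have "emeasure M (D \<sigma> n) \<le> emeasure M {\<omega>\<in>space M. \<exists>j\<le>2 ^ n. 1 \<le> W \<omega> * ennreal (exp ((\<theta> * \<sigma>) * (L (s + real j * (h / 2 ^ n)) \<omega> - L s \<omega>) - k * real j))}"
      by (intro emeasure_mono) measurable
    also have "\<dots> \<le> (\<integral>\<^sup>+ \<omega>. W \<omega> \<partial>M)"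
      using h by (intro exponential_maximal_inequality[OF _ k s WF]) simp
    also have "\<dots> = ennreal (prob G * exp (- \<theta> * b + h * \<Psi> \<theta>))"
      unfolding W_def by (subst nn_integral_multc) (auto simp: emeasure_eq_measure ennreal_mult)
    finally show ?thesis .
  qed
  have inc: "incseq (D \<sigma>)" for \<sigma>
  proof (rule incseq_SucI, clarsimp simp: D_def)
    fix n \<omega> j assume "j \<le> 2 ^ n" "b < \<sigma> * (L (s + real j * h / 2 ^ n) \<omega> - L s \<omega>)"
    then show "\<exists>j\<le>2 * 2 ^ n. b < \<sigma> * (L (s + real j * h / (2 * 2 ^ n)) \<omega> - L s \<omega>)"
      by (intro exI[of _ "2 * j"]) auto
  qed
  have U: "prob (\<Union>n. D \<sigma> n) \<le> prob G * exp (- \<theta> * b + h * \<Psi> \<theta>)" if "\<bar>\<sigma>\<bar> = 1" for \<sigma>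
  proof -
    have "emeasure M (\<Union>n. D \<sigma> n) = (SUP n. emeasure M (D \<sigma> n))"
      using inc by (intro SUP_emeasure_incseq[symmetric]) auto
    also have "\<dots> \<le> ennreal (prob G * exp (- \<theta> * b + h * \<Psi> \<theta>))" using D_le[OF that] by (intro SUP_least)
    finally show ?thesis by (simp add: emeasure_eq_measure)
  qed
  have "G \<inter> oscillation s h b \<subseteq> (\<Union>n. D 1 n) \<union> (\<Union>n. D (-1) n)"
    by (force simp: oscillation_def D_def abs_if split: if_splits)
  then have "prob (G \<inter> oscillation s h b) \<le> prob ((\<Union>n. D 1 n) \<union> (\<Union>n. D (-1) n))"
    by (intro finite_measure_mono) auto
  also have "\<dots> \<le> prob (\<Union>n. D 1 n) + prob (\<Union>n. D (-1) n)"
    by (intro measure_Un_le) auto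
  also have "\<dots> \<le> prob G * (2 * exp (- \<theta> * b + h * \<Psi> \<theta>))"
    using U[of 1] U[of "-1"] by simp
  finally show ?thesis .
qed

end

lemma dyadic_approx_right:
  assumes "0 \<le> r" "r < h"
  obtains a :: "nat \<Rightarrow> real" where "a \<longlonglongrightarrow> r" "\<And>n. a n > r" "\<And>n. \<exists>j\<le>2 ^ n. a n = real j * (h / 2 ^ n)"
proof -
  \<comment> \<open>Adding 1 puts the dyadic point strictly to the right of \<open>r\<close>; since
    \<open>r < h\<close> it still does not pass \<open>h\<close>.\<close>
  define j where "j n = nat \<lfloor>r / h * 2 ^ n\<rfloor> + 1" for n
  define a where "a n = real (j n) * (h / 2 ^ n)" for n
  have h: "h > 0" using assms by simp
  have j: "r / h * 2 ^ n < real (j n)" "real (j n) \<le> r / h * 2 ^ n + 1" for n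
    using assms h by (auto simp: j_def) linarith+
  have gt: "a n > r" for n using j(1)[of n] h by (simp add: a_def field_simps)
  have le: "a n \<le> r + h * (1 / 2) ^ n" for n
    using j(2)[of n] h by (simp add: a_def field_simps power_divide)
  have "(\<lambda>n. r + h * (1 / 2) ^ n) \<longlonglongrightarrow> r + h * 0" by (intro tendsto_intros LIMSEQ_realpow_zero) auto
  then have lim: "a \<longlonglongrightarrow> r" by (intro tendsto_sandwich[of "\<lambda>_. r" a _ "\<lambda>n. r + h * (1 / 2) ^ n"]) (use gt le in \<open>auto intro: less_imp_le always_eventually\<close>)
  have jle: "j n \<le> 2 ^ n" for n
  proof -
    have "r / h < 1" using assms h by simp
    then have "r / h * 2 ^ n < 1 * 2 ^ n" by (intro mult_strict_right_mono) auto
    then have "\<lfloor>r / h * 2 ^ n\<rfloor> < 2 ^ n" by (simp add: floor_less_iff)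
    then show ?thesis using assms h by (simp add: j_def nat_less_iff Suc_le_eq)
  qed
  show ?thesis using that[of a] lim gt jle by (auto simp: a_def)
qed

context light_tailed_levy_process
begin

text \<open>Right continuity along dyadic points decreasing to \<open>r\<close>. The end
  \<open>r = h\<close> has none to its right within the window, but it is itself the dyadic point of
  level 0.\<close>

lemma oscillation_bound:
  assumes c: "cadlag (\<lambda>t. L t \<omega>)" and w: "\<omega> \<in> space M" "\<omega> \<notin> oscillation s h b" and s: "s \<ge> 0" and r: "0 \<le> r" "r \<le> h"
  shows "\<bar>L (s + r) \<omega> - L s \<omega>\<bar> \<le> b"
proof (cases "r = h")
  case True
  have "\<not> b < \<bar>L (s + real 1 * (h / 2 ^ 0)) \<omega> - L s \<omega>\<bar>"
    using w unfolding oscillation_def by (metis (mono_tags, lifting) le_refl mem_Collect_eq power_0)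
  then show ?thesis using True by simp
next
  case False
  then obtain a where a: "a \<longlonglongrightarrow> r" "\<And>n. a n > r" "\<And>n. \<exists>j\<le>2 ^ n. a n = real j * (h / 2 ^ n)"
    using dyadic_approx_right[of r h] r by auto
  have "((\<lambda>t. L t \<omega>) \<longlongrightarrow> L (s + r) \<omega>) (at_right (s + r))"
    using c s r by (simp add: cadlag_def)
  moreover have "filterlim (\<lambda>n. s + a n) (at_right (s + r)) sequentially"
    unfolding filterlim_at using a(1,2) by (auto intro!: tendsto_intros always_eventually simp: less_imp_neq[symmetric] order_less_imp_not_eq2)
  ultimately have "(\<lambda>n. L (s + a n) \<omega>) \<longlonglongrightarrow> L (s + r) \<omega>"
    by (rule filterlim_compose)
  then have "(\<lambda>n. \<bar>L (s + a n) \<omega> - L s \<omega>\<bar>) \<longlonglongrightarrow> \<bar>L (s + r) \<omega> - L s \<omega>\<bar>" by (intro tendsto_intros)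
  moreover have "\<bar>L (s + a n) \<omega> - L s \<omega>\<bar> \<le> b" for n
    using a(3)[of n] w by (auto simp: oscillation_def not_less)
  ultimately show ?thesis by (intro LIMSEQ_le_const2) auto
qed

lemma levy_exponent_uminus: "levy_exponent d \<nu> (- \<mu>) z = levy_exponent d \<nu> \<mu> (- z)"
proof -
  have "exponent_integrand (- z) y = exponent_integrand z (- y)" for y
    by (auto simp: exponent_integrand_def indicator_def)
  then show ?thesis using integral_uminus[of "exponent_integrand z"] by (simp add: levy_exponent_eq)
qed

text \<open>For the downward direction \<open>- L\<close> is used: by symmetry of \<nu> only the
  sign of its drift changes, and \<open>tail_shift\<close> depends on \<mu> through its absolute
  value.\<close>

lemma L_tail_ge:
  assumes m: "m \<ge> 1" and y: "y \<ge> 1" and \<sigma>: "\<bar>\<sigma>\<bar> = 1"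
  shows "prob {\<omega>\<in>space M. \<sigma> * L (1 / real m) \<omega> \<ge> y - tail_shift d \<mu> - 1} \<ge> (1 - exp (- (1 / real m) * measure \<nu> {y..})) / 2"
proof -
  have h: "1 / real m > 0" "1 / real m \<le> 1" using m by auto
  consider "\<sigma> = 1" | "\<sigma> = - 1" using \<sigma> by linarith
  then show ?thesis
  proof cases
    case 1
    have "(1 - exp (- (1 / real m) * measure \<nu> {y..})) / 2 \<le> measure (distr M borel (L (1 / real m))) {y - tail_shift d \<mu> - 1..}"
      using d_nonneg h y m by (intro levy_law_tail_ge real_distribution_distr char_L_inverse_nat) auto
    also have "\<dots> = prob {\<omega>\<in>space M. \<sigma> * L (1 / real m) \<omega> \<ge> y - tail_shift d \<mu> - 1}"
      by (subst measure_distr) (auto simp: 1 intro!: arg_cong[where f = prob])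
    finally show ?thesis .
  next
    case 2
    have sh: "tail_shift d (- \<mu>) = tail_shift d \<mu>" by (simp add: tail_shift_def laplace_bound_def)
    have ch: "char (distr M borel (\<lambda>\<omega>. - L (1 / real m) \<omega>)) z = exp (of_real (1 / real m) * levy_exponent d \<nu> (- \<mu>) z)" for z
    proof -
      have "char (distr M borel (\<lambda>\<omega>. - L (1 / real m) \<omega>)) z = char (distr M borel (L (1 / real m))) (- z)"
        unfolding char_def by (subst (1 2) integral_distr) auto
      then show ?thesis using char_L_inverse_nat[OF m, of "- z"] by (simp add: levy_exponent_uminus)
    qed
    have "(1 - exp (- (1 / real m) * measure \<nu> {y..})) / 2 \<le> measure (distr M borel (\<lambda>\<omega>. - L (1 / real m) \<omega>)) {y - tail_shift d (- \<mu>) - 1..}"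
      using d_nonneg h y m by (intro levy_law_tail_ge real_distribution_distr ch) auto
    also have "\<dots> = prob {\<omega>\<in>space M. \<sigma> * L (1 / real m) \<omega> \<ge> y - tail_shift d \<mu> - 1}"
      by (subst measure_distr) (auto simp: 2 sh intro!: arg_cong[where f = prob])
    finally show ?thesis .
  qed
qed

end

section \<open>Paths with inward drift\<close>

text \<open>Rounding the argument up strictly to the next multiple of \<open>1 / Suc n\<close> gives
  step functions that converge pointwise.\<close>

lemma right_continuous_borel_measurable:
  fixes g :: "real \<Rightarrow> real"
  assumes "\<And>t. (g \<longlongrightarrow> g t) (at_right t)"
  shows "g \<in> borel_measurable borel"
proof (rule borel_measurable_LIMSEQ_real)
  fix t
  define a where "a n = (of_int \<lfloor>real (Suc n) * t\<rfloor> + 1) / real (Suc n)" for n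
  have gt: "a n > t" for n
  proof -
    have "real (Suc n) * t < of_int \<lfloor>real (Suc n) * t\<rfloor> + 1" by linarith
    then show ?thesis by (simp add: a_def pos_less_divide_eq mult.commute)
  qed
  have le: "a n \<le> t + 1 / real (Suc n)" for n
  proof -
    have "of_int \<lfloor>real (Suc n) * t\<rfloor> + 1 \<le> real (Suc n) * t + 1" by linarith
    then have "a n \<le> (real (Suc n) * t + 1) / real (Suc n)" unfolding a_def by (rule divide_right_mono) simp
    also have "\<dots> = t + 1 / real (Suc n)" by (simp add: add_divide_distrib del: of_nat_Suc)
    finally show ?thesis .
  qed
  have "(\<lambda>n. t + 1 / real (Suc n)) \<longlonglongrightarrow> t + 0" by (intro tendsto_intros LIMSEQ_Suc[OF lim_1_over_n])
  then have "a \<longlonglongrightarrow> t"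
    by (intro tendsto_sandwich[of "\<lambda>_. t" a _ "\<lambda>n. t + 1 / real (Suc n)"])
       (use gt le in \<open>auto intro: less_imp_le always_eventually\<close>)
  then have "filterlim a (at_right t) sequentially"
    unfolding filterlim_at using gt by (auto intro!: always_eventually simp: order_less_imp_not_eq2)
  from filterlim_compose[OF assms this] show "(\<lambda>n. g (a n)) \<longlonglongrightarrow> g t" .
next
  fix n
  show "(\<lambda>t. g ((of_int \<lfloor>real (Suc n) * t\<rfloor> + 1) / real (Suc n))) \<in> borel_measurable borel"
    by (rule measurable_compose[of "\<lambda>t. \<lfloor>real (Suc n) * t\<rfloor>" _ "count_space UNIV" "\<lambda>k. g ((of_int k + 1) / real (Suc n))"]) measurable
qed

lemma cadlag_left_limit:
  assumes "cadlag x" "s > 0"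
  shows "(x \<longlongrightarrow> Lim (at_left s) x) (at_left s)"
proof -
  obtain l where "(x \<longlongrightarrow> l) (at_left s)" using assms by (auto simp: cadlag_def)
  moreover have "Lim (at_left s) x = l"
    by (rule tendsto_Lim[OF _ calculation]) (simp add: trivial_limit_at_left_real)
  ultimately show ?thesis by simp
qed

lemma left_limit_ge:
  fixes x :: "real \<Rightarrow> real"
  assumes "(x \<longlongrightarrow> l) (at_left s)" "a < s" "\<And>r. a < r \<Longrightarrow> r < s \<Longrightarrow> \<eta> \<le> x r"
  shows "\<eta> \<le> l"
proof (rule tendsto_lowerbound[OF assms(1)])
  show "\<forall>\<^sub>F r in at_left s. \<eta> \<le> x r"
    using eventually_at_left_real[OF assms(2)] by eventually_elim (use assms(3) in auto)
qed (simp add: trivial_limit_at_left_real)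

lemma left_limit_le:
  fixes x :: "real \<Rightarrow> real"
  assumes "(x \<longlongrightarrow> l) (at_left s)" "a < s" "\<And>r. a < r \<Longrightarrow> r < s \<Longrightarrow> x r \<le> \<eta>"
  shows "l \<le> \<eta>"
proof (rule tendsto_upperbound[OF assms(1)])
  show "\<forall>\<^sub>F r in at_left s. x r \<le> \<eta>"
    using eventually_at_left_real[OF assms(2)] by eventually_elim (use assms(3) in auto)
qed (simp add: trivial_limit_at_left_real)

text \<open>Nothing is known about the path at negative times, so at times \<open>s \<le> 0\<close>
  a fixed value takes the place of the limit; this makes it a Borel function on the whole
  line.\<close>

definition left_limit :: "(real \<Rightarrow> real) \<Rightarrow> real \<Rightarrow> real" where
  "left_limit x s = (if s > 0 then Lim (at_left s) x else 0)"

lemma left_limit_borel_measurable: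
  assumes "cadlag x"
  shows "left_limit x \<in> borel_measurable borel"
proof -
  define g where "g r = (if r < 0 then x 0 else x r)" for r
  have "(g \<longlongrightarrow> g t) (at_right t)" for t
  proof (cases "t \<ge> 0")
    case True
    then have "(x \<longlongrightarrow> g t) (at_right t)" using assms by (simp add: cadlag_def g_def)
    moreover have "\<forall>\<^sub>F r in at_right t. x r = g r"
      using eventually_at_right_less[of t] by eventually_elim (use True in \<open>auto simp: g_def\<close>)
    ultimately show ?thesis by (rule Lim_transform_eventually)
  next
    case False
    then have "\<forall>\<^sub>F r in at_right t. g t = g r"
      using eventually_at_right_real[of t 0] by (auto simp: g_def elim!: eventually_mono)
    then show ?thesis by (rule Lim_transform_eventually[OF tendsto_const])
  qed
  then have [measurable]: "g \<in> borel_measurable borel" by (rule right_continuous_borel_measurable)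
  show ?thesis
  proof (rule borel_measurable_LIMSEQ_real)
    fix s
    show "(\<lambda>n. if s > 0 then g (s - 1 / real (Suc n)) else 0) \<longlonglongrightarrow> left_limit x s"
    proof (cases "s > 0")
      case True
      have "(x \<longlongrightarrow> left_limit x s) (at_left s)" using cadlag_left_limit[OF assms True] True by (simp add: left_limit_def)
      moreover have "\<forall>\<^sub>F r in at_left s. x r = g r"
        using eventually_at_left_real[OF True] by eventually_elim (auto simp: g_def)
      ultimately have "(g \<longlongrightarrow> left_limit x s) (at_left s)" by (rule Lim_transform_eventually)
      moreover have "(\<lambda>n. s - 1 / real (Suc n)) \<longlonglongrightarrow> s - 0" by (intro tendsto_intros LIMSEQ_Suc[OF lim_1_over_n])
      then have "filterlim (\<lambda>n. s - 1 / real (Suc n)) (at_left s) sequentially"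
        unfolding filterlim_at by auto
      ultimately have "(\<lambda>n. g (s - 1 / real (Suc n))) \<longlonglongrightarrow> left_limit x s" by (rule filterlim_compose)
      then show ?thesis using True by simp
    qed (simp add: left_limit_def)
  qed measurable
qed

text \<open>\<open>x\<close> follows \<open>l\<close> up to time \<open>R\<close> with a drift of speed at most \<open>C\<close>, which pulls \<open>x\<close>
  towards the origin with speed at least \<open>c\<close> outside \<open>(-\<eta>, \<eta>)\<close>.\<close>

definition drift_bounds :: "(real \<Rightarrow> real) \<Rightarrow> (real \<Rightarrow> real) \<Rightarrow> real \<Rightarrow> real \<Rightarrow> real \<Rightarrow> real \<Rightarrow> bool" where
  "drift_bounds x l R C c \<eta> \<longleftrightarrow>
     (\<forall>s t. 0 \<le> s \<longrightarrow> s \<le> t \<longrightarrow> t \<le> R \<longrightarrow>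
        \<bar>x t - x s - (l t - l s)\<bar> \<le> C * (t - s) \<and>
        ((\<forall>r\<in>{s<..<t}. \<eta> \<le> x r) \<longrightarrow> x t - x s \<le> l t - l s - c * (t - s)) \<and>
        ((\<forall>r\<in>{s<..<t}. x r \<le> - \<eta>) \<longrightarrow> l t - l s + c * (t - s) \<le> x t - x s))"

lemma drift_bounds_uminus:
  "drift_bounds x l R C c \<eta> \<Longrightarrow> drift_bounds (\<lambda>t. - x t) (\<lambda>t. - l t) R C c \<eta>"
  unfolding drift_bounds_def by (smt (verit, ccfv_threshold))

text \<open>The bound \<rho> is assumed strictly before \<open>R\<close> only, so that
  \<open>R\<close> may be a hitting time: the drift sees left limits, and these inherit the bound up
  to and including \<open>R\<close>.\<close>

lemma drift_boundsI:
  fixes b :: "real \<Rightarrow> real"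
  assumes x: "cadlag x" and b: "continuous_on UNIV b"
    and eq: "\<And>t. t \<ge> 0 \<Longrightarrow> x t = x0 - (LBINT s:{0..t}. b (Lim (at_left s) x)) + l t"
    and R: "\<And>r. 0 \<le> r \<Longrightarrow> r < R \<Longrightarrow> \<bar>x r\<bar> \<le> \<rho>"
    and C: "\<And>v. \<bar>v\<bar> \<le> \<rho> \<Longrightarrow> \<bar>b v\<bar> \<le> C"
    and c: "\<And>v. \<eta> \<le> v \<Longrightarrow> v \<le> \<rho> \<Longrightarrow> c \<le> b v" "\<And>v. \<eta> \<le> v \<Longrightarrow> v \<le> \<rho> \<Longrightarrow> b (- v) \<le> - c"
  shows "drift_bounds x l R C c \<eta>"
  unfolding drift_bounds_def
proof (intro allI impI)
  fix s t :: real assume st: "0 \<le> s" "s \<le> t" "t \<le> R"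
  define \<beta> where "\<beta> r = b (left_limit x r)" for r
  have [measurable]: "b \<in> borel_measurable borel" using b by (rule borel_measurable_continuous_onI)
  have [measurable]: "left_limit x \<in> borel_measurable borel" using x by (rule left_limit_borel_measurable)
  have \<beta>m [measurable]: "\<beta> \<in> borel_measurable borel" unfolding \<beta>_def by measurable
  have ll: "(x \<longlongrightarrow> left_limit x r) (at_left r)" if "r > 0" for r
    using cadlag_left_limit[OF x that] that by (simp add: left_limit_def)
  have ll_le: "\<bar>left_limit x r\<bar> \<le> \<rho>" if "0 < r" "r \<le> t" for r
  proof -
    have "left_limit x r \<le> \<rho>" by (rule left_limit_le[OF ll[OF that(1)] that(1)]) (use R that st in \<open>smt (verit)\<close>)
    moreover have "- \<rho> \<le> left_limit x r" by (rule left_limit_ge[OF ll[OF that(1)] that(1)]) (use R that st in \<open>smt (verit)\<close>)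
    ultimately show ?thesis by (simp add: abs_le_iff)
  qed
  have int: "set_integrable lborel {p<..q} \<beta>" if "0 \<le> p" "q \<le> t" for p q
    unfolding set_integrable_def
  proof (rule Bochner_Integration.integrable_bound)
    show "integrable lborel (\<lambda>r. C * indicator {p<..q} r :: real)" by (cases "p \<le> q") auto
    show "AE r in lborel. norm (indicator {p<..q} r *\<^sub>R \<beta> r) \<le> norm (C * indicator {p<..q} r :: real)"
    proof (intro always_eventually allI)
      fix r
      show "norm (indicator {p<..q} r *\<^sub>R \<beta> r) \<le> norm (C * indicator {p<..q} r :: real)"
        using C[OF ll_le[of r]] that by (cases "r \<in> {p<..q}") (auto simp: \<beta>_def)
    qed
  qed simp
  \<comment> \<open>The two versions of the left limit agree at positive times; the integrals
    therefore differ at most at the null set \<open>{0}\<close>.\<close>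
  have eq0: "(LBINT r:{0..q}. b (Lim (at_left r) x)) = (LBINT r:{0<..q}. \<beta> r)" for q
    unfolding set_lebesgue_integral_def
  proof (rule integral_cong_AE)
    have "(\<lambda>r. indicator {0..q} r *\<^sub>R b (Lim (at_left r) x)) =
        (\<lambda>r. indicator {0<..q} r *\<^sub>R \<beta> r + indicator ({0} \<inter> {0..q}) r *\<^sub>R b (Lim (at_left 0) x))"
      by (auto simp: fun_eq_iff indicator_def \<beta>_def left_limit_def)
    then show "(\<lambda>r. indicator {0..q} r *\<^sub>R b (Lim (at_left r) x)) \<in> borel_measurable lborel" by simp
    show "AE r in lborel. indicator {0..q} r *\<^sub>R b (Lim (at_left r) x) = indicator {0<..q} r *\<^sub>R \<beta> r"
      using AE_lborel_singleton[of 0] by eventually_elim (auto simp: indicator_def \<beta>_def left_limit_def)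
  qed simp
  have split: "(LBINT r:{0<..t}. \<beta> r) = (LBINT r:{0<..s}. \<beta> r) + (LBINT r:{s<..t}. \<beta> r)"
    using st int by (subst set_integral_Un[symmetric]) (auto simp: ivl_disj_un)
  have inc: "x t - x s = l t - l s - (LBINT r:{s<..t}. \<beta> r)"
    using eq[of t] eq[of s] st by (simp add: eq0 split)
  have const: "(LBINT r:{s<..t}. k) = k * (t - s)" for k :: real
    using st by (simp add: set_lebesgue_integral_def)
  have ci: "set_integrable lborel {s<..t} (\<lambda>_. k)" for k :: real
    using st by (simp add: set_integrable_def)
  have lo: "k * (t - s) \<le> (LBINT r:{s<..t}. \<beta> r)" if "\<And>r. s < r \<Longrightarrow> r \<le> t \<Longrightarrow> k \<le> \<beta> r" for k
    unfolding const[symmetric] using that by (intro set_integral_mono ci int st) auto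
  have hi: "(LBINT r:{s<..t}. \<beta> r) \<le> k * (t - s)" if "\<And>r. s < r \<Longrightarrow> r \<le> t \<Longrightarrow> \<beta> r \<le> k" for k
    unfolding const[symmetric] using that by (intro set_integral_mono ci int st) auto
  have \<beta>C: "\<bar>\<beta> r\<bar> \<le> C" if "s < r" "r \<le> t" for r
    unfolding \<beta>_def using that st by (intro C ll_le) auto
  show "\<bar>x t - x s - (l t - l s)\<bar> \<le> C * (t - s) \<and>
        ((\<forall>r\<in>{s<..<t}. \<eta> \<le> x r) \<longrightarrow> x t - x s \<le> l t - l s - c * (t - s)) \<and>
        ((\<forall>r\<in>{s<..<t}. x r \<le> - \<eta>) \<longrightarrow> l t - l s + c * (t - s) \<le> x t - x s)"
  proof (intro conjI impI)
    have "- C * (t - s) \<le> (LBINT r:{s<..t}. \<beta> r)" using \<beta>C by (intro lo) (auto simp: abs_le_iff minus_le_iff)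
    moreover have "(LBINT r:{s<..t}. \<beta> r) \<le> C * (t - s)" using \<beta>C by (intro hi) (auto simp: abs_le_iff)
    ultimately show "\<bar>x t - x s - (l t - l s)\<bar> \<le> C * (t - s)" using inc by (simp add: abs_le_iff)
  next
    assume *: "\<forall>r\<in>{s<..<t}. \<eta> \<le> x r"
    have "c \<le> \<beta> r" if "s < r" "r \<le> t" for r
    proof -
      have "\<eta> \<le> left_limit x r" by (rule left_limit_ge[OF ll that(1)]) (use * that st in auto)
      then show ?thesis using ll_le[of r] that st unfolding \<beta>_def by (intro c(1)) auto
    qed
    from lo[OF this] show "x t - x s \<le> l t - l s - c * (t - s)" using inc by simp
  next
    assume *: "\<forall>r\<in>{s<..<t}. x r \<le> - \<eta>"
    have "\<beta> r \<le> - c" if "s < r" "r \<le> t" for r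
    proof -
      have "left_limit x r \<le> - \<eta>" by (rule left_limit_le[OF ll that(1)]) (use * that st in auto)
      then show ?thesis using ll_le[of r] that st c(2)[of "- left_limit x r"] unfolding \<beta>_def by auto
    qed
    from hi[OF this] show "l t - l s + c * (t - s) \<le> x t - x s" using inc by simp
  qed
qed

text \<open>After the last time below \<eta> the drift pushes down at speed at least
  \<open>c\<close>, so the path is bounded by the noise increment from that time with slope
  \<open>- c\<close> added. In the first alternative the path has not been below \<eta> since
  \<open>u\<close>.\<close>

lemma last_exit_decomposition:
  assumes D: "drift_bounds x l R C c \<eta>" and uR: "0 \<le> u" "u \<le> R" and C: "C \<ge> 0" "c > 0"
  shows "x R \<le> x u + (l R - l u - c * (R - u)) \<or>
     (\<forall>e>0. \<exists>g\<in>{u..R}. x R \<le> \<eta> + e + (l R - l g - c * (R - g)))"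
proof (cases "\<forall>r\<in>{u<..<R}. \<eta> \<le> x r")
  case True
  then have "x R - x u \<le> l R - l u - c * (R - u)" using D uR unfolding drift_bounds_def by blast
  then show ?thesis by simp
next
  case False
  define A where "A = {r\<in>{u<..<R}. x r < \<eta>}"
  have A: "A \<noteq> {}" using False by (auto simp: A_def not_le)
  have "bdd_above A" by (rule bdd_aboveI[of _ R]) (auto simp: A_def)
  note A = A this
  define g where "g = Sup A"
  have gR: "g \<le> R" unfolding g_def using A by (intro cSup_least) (auto simp: A_def)
  have gA: "r \<le> g" if "r \<in> A" for r unfolding g_def using that A by (intro cSup_upper)
  have "\<exists>g'\<in>{u..R}. x R \<le> \<eta> + e + (l R - l g' - c * (R - g'))" if "e > 0" for e
  proof -
    \<comment> \<open>The path may jump at \<open>g\<close>, so \<open>x g\<close> need not be below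
      \<eta>. A point \<open>s\<close> of \<open>A\<close> shortly before \<open>g\<close> is used
      instead; the drift on the short piece costs at most \<open>e\<close>.\<close>
    have "g - e / (C + c) < g" using that C by simp
    then obtain s where s: "s \<in> A" "g - e / (C + c) < s" unfolding g_def using A by (auto simp: less_cSup_iff)
    have su: "u < s" "s < R" "x s < \<eta>" "s \<le> g" using s gA by (auto simp: A_def)
    have "(g - s) * (C + c) \<le> e" using s(2) C by (simp add: field_simps)
    moreover have "x g - x s \<le> l g - l s + C * (g - s)"
      using D su gR uR unfolding drift_bounds_def by (smt (verit))
    moreover have "x R - x g \<le> l R - l g - c * (R - g)"
    proof -
      have "\<forall>r\<in>{g<..<R}. \<eta> \<le> x r"
      proof (rule ballI, rule ccontr)
        fix r assume r: "r \<in> {g<..<R}" "\<not> \<eta> \<le> x r"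
        then have "r \<in> A" using su by (auto simp: A_def)
        then show False using gA[of r] r by simp
      qed
      then show ?thesis using D su gR uR unfolding drift_bounds_def by (smt (verit))
    qed
    ultimately show ?thesis using su by (intro bexI[of _ s]) (auto simp: algebra_simps)
  qed
  then show ?thesis by blast
qed

text \<open>Were the path inside at the infimum, right continuity would keep it inside for some time
  afterwards.\<close>

lemma first_hit_attained:
  assumes x: "cadlag x" and t: "0 \<le> t" "\<bar>x t\<bar> \<ge> \<rho>"
  obtains R where "0 \<le> R" "R \<le> t" "\<bar>x R\<bar> \<ge> \<rho>" "\<And>r. 0 \<le> r \<Longrightarrow> r < R \<Longrightarrow> \<bar>x r\<bar> < \<rho>"
proof -
  define A where "A = {r. 0 \<le> r \<and> \<bar>x r\<bar> \<ge> \<rho>}"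
  define R where "R = Inf A"
  have A: "A \<noteq> {}" "bdd_below A" "t \<in> A" using t by (auto simp: A_def bdd_below_def)
  have R0: "0 \<le> R" "R \<le> t" unfolding R_def using A by (auto intro!: cInf_greatest cInf_lower simp: A_def)
  have below: "\<bar>x r\<bar> < \<rho>" if "0 \<le> r" "r < R" for r
    using that cInf_lower[of r A] A by (force simp: A_def R_def not_le)
  have "\<bar>x R\<bar> \<ge> \<rho>"
  proof (rule ccontr)
    assume "\<not> \<bar>x R\<bar> \<ge> \<rho>"
    moreover have "((\<lambda>r. \<bar>x r\<bar>) \<longlongrightarrow> \<bar>x R\<bar>) (at_right R)" using x R0 by (intro tendsto_rabs) (simp add: cadlag_def)
    ultimately have "\<forall>\<^sub>F r in at_right R. \<bar>x r\<bar> < \<rho>" by (intro order_tendstoD) auto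
    then obtain b where b: "b > R" "\<And>r. R < r \<Longrightarrow> r < b \<Longrightarrow> \<bar>x r\<bar> < \<rho>" by (auto simp: eventually_at_right_field)
    have "b \<le> R" unfolding R_def
    proof (rule cInf_greatest[OF A(1)])
      fix r assume r: "r \<in> A"
      show "b \<le> r"
      proof (rule ccontr)
        assume "\<not> b \<le> r"
        moreover have "R \<le> r" unfolding R_def using r A by (intro cInf_lower)
        moreover have "r \<noteq> R" using r \<open>\<not> \<bar>x R\<bar> \<ge> \<rho>\<close> by (auto simp: A_def)
        ultimately show False using b(2)[of r] r by (auto simp: A_def)
      qed
    qed
    then show False using b by simp
  qed
  then show ?thesis using that R0 below by blast
qed

section \<open>Reduction to a time grid\<close>

lemma grid_point:
  fixes u h :: real and l :: "real \<Rightarrow> real"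
  assumes h: "h > 0" and w: "u \<le> w" "w \<le> u + real N * h"
    and osc: "\<forall>i<N. \<forall>r\<in>{0..h}. \<bar>l (u + real i * h + r) - l (u + real i * h)\<bar> \<le> \<kappa>" and \<kappa>: "\<kappa> \<ge> 0"
  defines "i \<equiv> nat \<lfloor>(w - u) / h\<rfloor>"
  shows "i \<le> N" "u + real i * h \<le> w" "w \<le> u + real i * h + h" "\<bar>l w - l (u + real i * h)\<bar> \<le> \<kappa>"
proof -
  have nn: "(w - u) / h \<ge> 0" using h w by simp
  have i: "real i \<le> (w - u) / h" "(w - u) / h < real i + 1" using nn by (auto simp: i_def)
  show lo: "u + real i * h \<le> w" using i(1) h by (simp add: field_simps)
  show hi: "w \<le> u + real i * h + h" using i(2) h by (simp add: field_simps)
  have "real i * h \<le> real N * h" using lo w by linarith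
  then show iN: "i \<le> N" using h by simp
  show "\<bar>l w - l (u + real i * h)\<bar> \<le> \<kappa>"
  proof (cases "i < N")
    case True
    then show ?thesis using osc[rule_format, OF True, of "w - (u + real i * h)"] lo hi by simp
  next
    \<comment> \<open>Now \<open>w\<close> is the right end of the block, itself a grid point, where
      no oscillation control is available or required.\<close>
    case False
    then have "w = u + real i * h" using iN w lo by simp
    then show ?thesis using \<kappa> by (simp)
  qed
qed

text \<open>Rounding both times down costs \<kappa> at each end, and \<open>c * h\<close> because
  the rounded distance may exceed the true one by up to \<open>h\<close>. The endpoint clauses
  preserve the start and the end of the block.\<close>

lemma grid_increment:
  fixes u h :: real and l :: "real \<Rightarrow> real"
  assumes h: "h > 0" and w: "u \<le> g" "g \<le> w" "w \<le> u + real N * h"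
    and osc: "\<forall>i<N. \<forall>r\<in>{0..h}. \<bar>l (u + real i * h + r) - l (u + real i * h)\<bar> \<le> \<kappa>" and \<kappa>: "\<kappa> \<ge> 0" and c: "c > 0"
  obtains i j where "i \<le> j" "j \<le> N" "g = u \<Longrightarrow> i = 0" "w = u + real N * h \<Longrightarrow> j = N"
    "l w - l g - c * (w - g) \<le> l (u + real j * h) - l (u + real i * h) - c * (real (j - i) * h) + (2 * \<kappa> + c * h)"
proof -
  define i where "i = nat \<lfloor>(g - u) / h\<rfloor>"
  define j where "j = nat \<lfloor>(w - u) / h\<rfloor>"
  note gi = grid_point[OF h w(1) order_trans[OF w(2,3)] osc \<kappa>, folded i_def]
  note wj = grid_point[OF h order_trans[OF w(1,2)] w(3) osc \<kappa>, folded j_def]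
  have ij: "i \<le> j" unfolding i_def j_def using w h by (intro nat_mono floor_mono divide_right_mono) auto
  have "real (j - i) * h - h \<le> w - g" using gi(3) wj(2) ij by (simp add: of_nat_diff algebra_simps)
  then have "c * (real (j - i) * h - h) \<le> c * (w - g)" using c by (intro mult_left_mono) auto
  moreover have "l w \<le> l (u + real j * h) + \<kappa>" "l (u + real i * h) - \<kappa> \<le> l g" using gi(4) wj(4) by linarith+
  ultimately have "l w - l g - c * (w - g) \<le> l (u + real j * h) - l (u + real i * h) - c * (real (j - i) * h) + (2 * \<kappa> + c * h)"
    by (simp add: right_diff_distrib)
  moreover have "g = u \<Longrightarrow> i = 0" by (simp add: i_def)
  moreover have "w = u + real N * h \<Longrightarrow> j = N" using h by (simp add: j_def)
  ultimately show ?thesis using that ij wj(1) by blast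
qed

text \<open>The error of the last exit decomposition is taken as \<open>\<kappa> / 2\<close>, so
  that the total error stays strictly below the \<open>3 * \<kappa> + c * h\<close> reserved in
  \<open>block_confinement\<close>.\<close>

lemma block_upper_bound:
  fixes u h :: real and l :: "real \<Rightarrow> real"
  assumes D: "drift_bounds x l w C c \<eta>" and C: "C \<ge> 0" "c > 0"
    and h: "h > 0" and w: "0 \<le> u" "u \<le> w" "w \<le> u + real N * h"
    and osc: "\<forall>i<N. \<forall>r\<in>{0..h}. \<bar>l (u + real i * h + r) - l (u + real i * h)\<bar> \<le> \<kappa>" and \<kappa>: "\<kappa> > 0"
  defines "\<gamma> \<equiv> 2 * \<kappa> + c * h"
  shows "(\<exists>j\<le>N. (w = u + real N * h \<longrightarrow> j = N) \<and> x w \<le> x u + (l (u + real j * h) - l u - c * (real j * h)) + \<gamma>) \<or>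
     (\<exists>i j. i \<le> j \<and> j \<le> N \<and> (w = u + real N * h \<longrightarrow> j = N) \<and>
        x w \<le> \<eta> + (l (u + real j * h) - l (u + real i * h) - c * (real (j - i) * h)) + (\<gamma> + \<kappa> / 2))"
  using last_exit_decomposition[OF D w(1,2) C]
proof
  assume *: "x w \<le> x u + (l w - l u - c * (w - u))"
  obtain i j where "i \<le> j" "j \<le> N" "i = 0" "w = u + real N * h \<Longrightarrow> j = N"
    "l w - l u - c * (w - u) \<le> l (u + real j * h) - l (u + real i * h) - c * (real (j - i) * h) + \<gamma>"
    using grid_increment[OF h order_refl w(2,3) osc less_imp_le[OF \<kappa>] C(2)] unfolding \<gamma>_def by metis
  then show ?thesis using * by (intro disjI1 exI[of _ j]) auto
next
  assume "\<forall>e>0. \<exists>g\<in>{u..w}. x w \<le> \<eta> + e + (l w - l g - c * (w - g))"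
  from this[rule_format, of "\<kappa> / 2"] \<kappa> obtain g where g: "u \<le> g" "g \<le> w" "x w \<le> \<eta> + \<kappa> / 2 + (l w - l g - c * (w - g))"
    by auto
  obtain i j where "i \<le> j" "j \<le> N" "w = u + real N * h \<Longrightarrow> j = N"
    "l w - l g - c * (w - g) \<le> l (u + real j * h) - l (u + real i * h) - c * (real (j - i) * h) + \<gamma>"
    using grid_increment[OF h g(1,2) w(3) osc less_imp_le[OF \<kappa>] C(2)] unfolding \<gamma>_def by metis
  then show ?thesis using g(3) by (intro disjI2 exI[of _ i] exI[of _ j]) auto
qed

text \<open>The conditions on \<open>l\<close> involve only increments after time \<open>u\<close>, so that for \<open>l = \<epsilon> L\<close> they are
  independent of the past.\<close>

lemma block_confinement:
  fixes u h :: real and l :: "real \<Rightarrow> real"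
  assumes x: "cadlag x" and D: "\<And>R. (\<And>r. 0 \<le> r \<Longrightarrow> r < R \<Longrightarrow> \<bar>x r\<bar> < \<rho>) \<Longrightarrow> drift_bounds x l R C c \<eta>"
    and C: "C \<ge> 0" "c > 0" and h: "h > 0" and u: "0 \<le> u" and \<kappa>: "\<kappa> > 0" and a: "a < \<rho>"
    and osc: "\<forall>i<N. \<forall>r\<in>{0..h}. \<bar>l (u + real i * h + r) - l (u + real i * h)\<bar> \<le> \<kappa>"
    and B2: "\<And>i j \<sigma>. i \<le> j \<Longrightarrow> j \<le> N \<Longrightarrow> \<bar>\<sigma>\<bar> = 1 \<Longrightarrow> \<sigma> * (l (u + real j * h) - l (u + real i * h)) - c * (real (j - i) * h) \<le> \<rho> - \<eta> - (3 * \<kappa> + c * h)"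
    and B3: "\<And>j \<sigma>. j \<le> N \<Longrightarrow> \<bar>\<sigma>\<bar> = 1 \<Longrightarrow> \<sigma> * (l (u + real j * h) - l u) - c * (real j * h) \<le> \<rho> - a - (3 * \<kappa> + c * h)"
    and B4: "\<And>i \<sigma>. i \<le> N \<Longrightarrow> \<bar>\<sigma>\<bar> = 1 \<Longrightarrow> \<sigma> * (l (u + real N * h) - l (u + real i * h)) - c * (real (N - i) * h) \<le> a - \<eta> - (3 * \<kappa> + c * h)"
    and B5: "\<And>\<sigma>. \<bar>\<sigma>\<bar> = 1 \<Longrightarrow> \<sigma> * (l (u + real N * h) - l u) - c * (real N * h) \<le> - (3 * \<kappa> + c * h)"
    and xu: "\<bar>x u\<bar> \<le> a" and before: "\<And>r. 0 \<le> r \<Longrightarrow> r < u \<Longrightarrow> \<bar>x r\<bar> < \<rho>"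
  shows "\<And>r. 0 \<le> r \<Longrightarrow> r \<le> u + real N * h \<Longrightarrow> \<bar>x r\<bar> < \<rho>" "\<bar>x (u + real N * h)\<bar> \<le> a"
proof -
  \<comment> \<open>\<open>B2\<close> and \<open>B3\<close> keep a path below \<rho> that was last
    near \<eta>, respectively away from there since the block started. \<open>B4\<close> and
    \<open>B5\<close> do the same at the block end with target \<open>a\<close>, which lets blocks
    be chained.\<close>
  have main: "\<sigma> * x w < \<rho>" "w = u + real N * h \<Longrightarrow> \<sigma> * x w \<le> a"
    if w: "u \<le> w" "w \<le> u + real N * h" and Dw: "drift_bounds x l w C c \<eta>" and \<sigma>: "\<bar>\<sigma>\<bar> = 1" for w \<sigma>
  proof -
    let ?x = "\<lambda>t. \<sigma> * x t" and ?l = "\<lambda>t. \<sigma> * l t"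
    have ab: "\<bar>\<sigma> * v\<bar> = \<bar>v\<bar>" for v using \<sigma> by (simp add: abs_mult)
    have D': "drift_bounds ?x ?l w C c \<eta>"
    proof -
      consider "\<sigma> = 1" | "\<sigma> = - 1" using \<sigma> by linarith
      then show ?thesis using Dw drift_bounds_uminus[OF Dw] by cases auto
    qed
    have osc': "\<forall>i<N. \<forall>r\<in>{0..h}. \<bar>?l (u + real i * h + r) - ?l (u + real i * h)\<bar> \<le> \<kappa>"
      using osc by (simp add: right_diff_distrib[symmetric] ab)
    have xu': "?x u \<le> a" using xu ab[of "x u"] by linarith
    have \<kappa>2: "2 * \<kappa> + c * h + \<kappa> / 2 < 3 * \<kappa> + c * h" using \<kappa> by simp
    note B = block_upper_bound[OF D' C h u w osc' \<kappa>]
    show "\<sigma> * x w < \<rho>"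
      using B
    proof (elim disjE exE conjE)
      fix j assume j: "j \<le> N" "?x w \<le> ?x u + (?l (u + real j * h) - ?l u - c * (real j * h)) + (2 * \<kappa> + c * h)"
      then show ?thesis using B3[OF j(1) \<sigma>] xu' \<kappa> by (simp add: right_diff_distrib)
    next
      fix i j assume j: "i \<le> j" "j \<le> N" "?x w \<le> \<eta> + (?l (u + real j * h) - ?l (u + real i * h) - c * (real (j - i) * h)) + (2 * \<kappa> + c * h + \<kappa> / 2)"
      then show ?thesis using B2[OF j(1,2) \<sigma>] \<kappa> by (simp add: right_diff_distrib)
    qed
    show "\<sigma> * x w \<le> a" if "w = u + real N * h"
      using B
    proof (elim disjE exE conjE)
      fix j assume j: "j \<le> N" "w = u + real N * h \<longrightarrow> j = N" "?x w \<le> ?x u + (?l (u + real j * h) - ?l u - c * (real j * h)) + (2 * \<kappa> + c * h)"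
      then show ?thesis using B5[OF \<sigma>] xu' \<kappa> that by (simp add: right_diff_distrib)
    next
      fix i j assume j: "i \<le> j" "j \<le> N" "w = u + real N * h \<longrightarrow> j = N" "?x w \<le> \<eta> + (?l (u + real j * h) - ?l (u + real i * h) - c * (real (j - i) * h)) + (2 * \<kappa> + c * h + \<kappa> / 2)"
      then show ?thesis using B4[of i, OF _ \<sigma>] \<kappa> that by (simp add: right_diff_distrib)
    qed
  qed
  show in\<rho>: "\<bar>x r\<bar> < \<rho>" if r: "0 \<le> r" "r \<le> u + real N * h" for r
  proof (rule ccontr)
    assume "\<not> \<bar>x r\<bar> < \<rho>"
    then have "\<bar>x r\<bar> \<ge> \<rho>" by simp
    \<comment> \<open>Up to and including the first hit of level \<rho> the drift bounds are
      available, and \<open>main\<close> then places the path strictly below \<rho> at that very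
      time.\<close>
    from first_hit_attained[OF x r(1) this] obtain R where
      R: "0 \<le> R" "R \<le> r" "\<bar>x R\<bar> \<ge> \<rho>" "\<And>s. 0 \<le> s \<Longrightarrow> s < R \<Longrightarrow> \<bar>x s\<bar> < \<rho>" by blast
    have "u \<le> R" using before[of R] R by force
    from main(1)[OF this _ D[OF R(4)], of 1] main(1)[OF this _ D[OF R(4)], of "-1"] R r
    show False by (auto simp: abs_if split: if_splits)
  qed
  have "u \<le> u + real N * h" using h by simp
  from main(2)[OF this order_refl D, of 1] main(2)[OF this order_refl D, of "-1"] in\<rho>
  show "\<bar>x (u + real N * h)\<bar> \<le> a" by (simp add: abs_le_iff)
qed

section \<open>The exit time\<close>

lemma potential_deriv_continuous: "potential U \<Longrightarrow> continuous_on UNIV (deriv U)"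
  unfolding potential_def using lipschitz_on_continuous_on by blast

lemma potential_drift_bounded: "potential U \<Longrightarrow> \<exists>C\<ge>0. \<forall>v. \<bar>v\<bar> \<le> 1 \<longrightarrow> \<bar>deriv U v\<bar> \<le> C"
proof -
  assume "potential U"
  then have "continuous_on {-1..1} (deriv U)" using potential_deriv_continuous continuous_on_subset by blast
  then have "bounded (deriv U ` {-1..1})" by (intro compact_imp_bounded compact_continuous_image) auto
  then obtain C where C: "\<And>v. v \<in> {-1..1} \<Longrightarrow> \<bar>deriv U v\<bar> \<le> C" unfolding bounded_iff by (metis imageI real_norm_def)
  have "\<bar>deriv U v\<bar> \<le> max C 0" if "\<bar>v\<bar> \<le> 1" for v
  proof -
    have "v \<in> {-1..1}" using that by (simp add: abs_le_iff)
    then show ?thesis using C[of v] by linarith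
  qed
  then show ?thesis by (intro exI[of _ "max C 0"]) auto
qed

text \<open>Compactness of the interval from \<eta> to \<rho>, on which the inward drift is
  continuous and positive.\<close>

lemma potential_drift_inward:
  assumes U: "potential U" and \<eta>: "0 < \<eta>" "\<eta> \<le> \<rho>" "\<rho> < 1"
  shows "\<exists>c>0. \<forall>v. \<eta> \<le> v \<longrightarrow> v \<le> \<rho> \<longrightarrow> c \<le> deriv U v \<and> deriv U (- v) \<le> - c"
proof -
  note cont = potential_deriv_continuous[OF U]
  have pos: "deriv U v * v > 0" if "v \<in> {-1<..<1} - {0}" for v using U that by (simp add: potential_def)
  have c1: "continuous_on {\<eta>..\<rho>} (deriv U)" using cont continuous_on_subset by blast
  have c2: "continuous_on {\<eta>..\<rho>} (\<lambda>v. - deriv U (- v))"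
    by (intro continuous_on_minus continuous_on_compose2[OF cont] continuous_intros) auto
  obtain v1 where v1: "v1 \<in> {\<eta>..\<rho>}" "\<And>v. v \<in> {\<eta>..\<rho>} \<Longrightarrow> deriv U v1 \<le> deriv U v"
    using continuous_attains_inf[OF _ _ c1] \<eta> by auto
  obtain v2 where v2: "v2 \<in> {\<eta>..\<rho>}" "\<And>v. v \<in> {\<eta>..\<rho>} \<Longrightarrow> - deriv U (- v2) \<le> - deriv U (- v)"
    using continuous_attains_inf[OF _ _ c2] \<eta> by auto
  have "deriv U v1 > 0" using pos[of v1] v1(1) \<eta> by (auto simp: zero_less_mult_iff)
  moreover have "- deriv U (- v2) > 0" using pos[of "- v2"] v2(1) \<eta> by (auto simp: zero_less_mult_iff mult_less_0_iff)
  ultimately show ?thesis using v1(2) v2(2)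
    by (intro exI[of _ "min (deriv U v1) (- deriv U (- v2))"]) (force simp: min_def)
qed

text \<open>The strict inequality matters: the infimum in \<open>exit_time\<close> is attained by
  right continuity, so exiting exactly at \<open>t\<close> is excluded on both sides.\<close>

lemma exit_time_gt_iff:
  assumes c: "cadlag (\<lambda>t. X t \<omega>)" and t: "t \<ge> 0"
  shows "exit_time X \<omega> > ereal t \<longleftrightarrow> (\<forall>s. 0 \<le> s \<longrightarrow> s \<le> t \<longrightarrow> \<bar>X s \<omega>\<bar> < 1)"
proof
  assume *: "exit_time X \<omega> > ereal t"
  show "\<forall>s. 0 \<le> s \<longrightarrow> s \<le> t \<longrightarrow> \<bar>X s \<omega>\<bar> < 1"
  proof (intro allI impI, rule ccontr)
    fix s assume s: "0 \<le> s" "s \<le> t" "\<not> \<bar>X s \<omega>\<bar> < 1"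
    have "exit_time X \<omega> \<le> ereal s" using s unfolding exit_time_def by (intro Inf_lower) auto
    also have "ereal s \<le> ereal t" using s by simp
    finally show False using * by simp
  qed
next
  assume *: "\<forall>s. 0 \<le> s \<longrightarrow> s \<le> t \<longrightarrow> \<bar>X s \<omega>\<bar> < 1"
  show "exit_time X \<omega> > ereal t"
  proof (cases "\<exists>r\<ge>0. \<bar>X r \<omega>\<bar> \<ge> 1")
    case True
    then obtain r where r: "0 \<le> r" "1 \<le> \<bar>X r \<omega>\<bar>" by auto
    obtain R where R: "0 \<le> R" "R \<le> r" "1 \<le> \<bar>X R \<omega>\<bar>" "\<And>r. 0 \<le> r \<Longrightarrow> r < R \<Longrightarrow> \<bar>X r \<omega>\<bar> < 1"
      by (rule first_hit_attained[OF c r]) (rule that; assumption)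
    have "R \<le> r" if "0 \<le> r" "1 \<le> \<bar>X r \<omega>\<bar>" for r using R(4)[OF that(1)] that(2) by linarith
    then have "ereal R \<le> exit_time X \<omega>" unfolding exit_time_def by (intro Inf_greatest) auto
    moreover have "t < R" using *[rule_format, of R] R(1,3) by linarith
    then have "ereal t < ereal R" by simp
    ultimately show ?thesis by (rule less_le_trans[rotated])
  next
    case False
    then have e: "{r. 0 \<le> r \<and> \<bar>X r \<omega>\<bar> \<ge> 1} = {}" by auto
    have "exit_time X \<omega> = \<infinity>" unfolding exit_time_def e by (simp add: top_ereal_def)
    then show ?thesis by simp
  qed
qed

lemma exit_time_nonneg: "exit_time X \<omega> \<ge> 0"
  unfolding exit_time_def by (intro Inf_greatest) auto

lemma (in prob_space) prob_eventually_le: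
  assumes D: "\<And>n::nat. D n \<in> events" "\<And>n. prob (D n) \<le> p"
  shows "prob (\<Union>m. \<Inter>n\<in>{m..}. D n) \<le> p"
proof -
  define I where "I m = (\<Inter>n\<in>{m..}. D n)" for m
  have m: "I m \<in> events" for m unfolding I_def using D(1) by (intro sets.countable_INT image_subsetI) simp_all
  have "incseq I" unfolding I_def by (intro incseq_SucI INT_anti_mono) simp_all
  then have lim: "(\<lambda>m. prob (I m)) \<longlonglongrightarrow> prob (\<Union>m. I m)"
    by (rule finite_Lim_measure_incseq[rotated]) (rule image_subsetI, rule m)
  have le: "prob (I m) \<le> p" for m
  proof -
    have "I m \<subseteq> D m" unfolding I_def by (rule INT_lower) simp
    from finite_measure_mono[OF this D(1)] D(2)[of m] show ?thesis by linarith
  qed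
  have "prob (\<Union>m. I m) \<le> p" by (rule LIMSEQ_le_const2[OF lim]) (use le in blast)
  then show ?thesis by (simp only: I_def)
qed

locale exit_problem = light_tailed_levy_process M F \<nu> \<alpha> L d \<mu>
  for M :: "'a measure" and F :: "real \<Rightarrow> 'a measure" and \<nu> :: "real measure" and \<alpha> :: real
    and L :: "real \<Rightarrow> 'a \<Rightarrow> real" and d \<mu> :: real +
  fixes U :: "real \<Rightarrow> real" and \<epsilon> x :: real and X :: "real \<Rightarrow> 'a \<Rightarrow> real"
  assumes U: "potential U" and eps: "\<epsilon> > 0" and solution: "strong_solution M F U L \<epsilon> x X"
begin

definition solves :: "'a \<Rightarrow> bool" where
  "solves \<omega> \<longleftrightarrow>
     (\<forall>t\<ge>0. X t \<omega> = x - (LBINT s:{0..t}. deriv U (Lim (at_left s) (\<lambda>r. X r \<omega>))) + \<epsilon> * L t \<omega>)"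

definition regular :: "'a \<Rightarrow> bool" where
  "regular \<omega> \<longleftrightarrow> \<omega> \<in> space M \<and> L 0 \<omega> = 0 \<and> cadlag (\<lambda>t. L t \<omega>) \<and> cadlag (\<lambda>t. X t \<omega>) \<and> solves \<omega>"

lemma AE_regular: "AE \<omega> in M. regular \<omega>"
proof -
  have "AE \<omega> in M. cadlag (\<lambda>t. X t \<omega>)" "AE \<omega> in M. solves \<omega>"
    using solution unfolding strong_solution_def solves_def by - (elim conjE, assumption)+
  then show ?thesis using L_zero L_cadlag AE_space by eventually_elim (simp add: regular_def)
qed

lemma X_measurable_F: "0 \<le> s \<Longrightarrow> s \<le> t \<Longrightarrow> X s \<in> borel_measurable (F t)"
proof -
  assume st: "0 \<le> s" "s \<le> t"
  have "adapted F X" using solution unfolding strong_solution_def by (elim conjE)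
  then have "X s \<in> borel_measurable (F s)" using st(1) unfolding adapted_def by blast
  then show ?thesis by (rule measurable_F_mono[OF _ st])
qed

lemma X_measurable: "0 \<le> s \<Longrightarrow> X s \<in> borel_measurable M"
  by (rule measurable_F_M[OF X_measurable_F[OF _ order_refl]])

lemma regular_start: "regular \<omega> \<Longrightarrow> X 0 \<omega> = x"
proof -
  assume r: "regular \<omega>"
  have z: "(LBINT s:{0..0}. g s) = 0" for g :: "real \<Rightarrow> real"
  proof -
    have "(\<lambda>s. indicator {0..0} s *\<^sub>R g s) = (\<lambda>s. indicator {0} s *\<^sub>R g 0)"
      by (auto simp: fun_eq_iff indicator_def)
    then show ?thesis by (simp add: set_lebesgue_integral_def)
  qed
  have s: "solves \<omega>" and L0: "L 0 \<omega> = 0" using r by (auto simp: regular_def)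
  have "X 0 \<omega> = x - (LBINT s:{0..0}. deriv U (Lim (at_left s) (\<lambda>r. X r \<omega>))) + \<epsilon> * L 0 \<omega>"
    by (rule s[unfolded solves_def, rule_format]) simp
  also have "\<dots> = x" unfolding z L0 by simp
  finally show ?thesis .
qed

lemma regular_drift_bounds:
  assumes r: "regular \<omega>" and R: "\<And>s. 0 \<le> s \<Longrightarrow> s < R \<Longrightarrow> \<bar>X s \<omega>\<bar> \<le> \<rho>"
    and C: "\<And>v. \<bar>v\<bar> \<le> \<rho> \<Longrightarrow> \<bar>deriv U v\<bar> \<le> C"
    and c: "\<And>v. \<eta> \<le> v \<Longrightarrow> v \<le> \<rho> \<Longrightarrow> c \<le> deriv U v" "\<And>v. \<eta> \<le> v \<Longrightarrow> v \<le> \<rho> \<Longrightarrow> deriv U (- v) \<le> - c"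
  shows "drift_bounds (\<lambda>t. X t \<omega>) (\<lambda>t. \<epsilon> * L t \<omega>) R C c \<eta>"
proof (rule drift_boundsI[OF _ potential_deriv_continuous[OF U] _ R C c])
  show "cadlag (\<lambda>t. X t \<omega>)" using r by (simp add: regular_def)
  have s: "solves \<omega>" using r by (simp add: regular_def)
  show "X t \<omega> = x - (LBINT s:{0..t}. deriv U (Lim (at_left s) (\<lambda>r. X r \<omega>))) + \<epsilon> * L t \<omega>" if "t \<ge> 0" for t
    by (rule s[unfolded solves_def, rule_format, OF that])
qed assumption+

lemma regular_lipschitz:
  assumes r: "regular \<omega>" and R: "\<And>s. 0 \<le> s \<Longrightarrow> s < R \<Longrightarrow> \<bar>X s \<omega>\<bar> < 1"
    and C: "\<And>v. \<bar>v\<bar> \<le> 1 \<Longrightarrow> \<bar>deriv U v\<bar> \<le> C" and st: "0 \<le> s" "s \<le> t" "t \<le> R"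
  shows "\<bar>X t \<omega> - X s \<omega> - (\<epsilon> * L t \<omega> - \<epsilon> * L s \<omega>)\<bar> \<le> C * (t - s)"
proof -
  \<comment> \<open>With \<open>\<eta> = 2\<close> above \<open>\<rho> = 1\<close> the conditions on
    inward drift are vacuous, and only the speed bound is extracted.\<close>
  have "drift_bounds (\<lambda>t. X t \<omega>) (\<lambda>t. \<epsilon> * L t \<omega>) R C 0 2"
  proof (rule regular_drift_bounds[OF r, where \<rho> = 1])
    show "\<bar>X s \<omega>\<bar> \<le> 1" if "0 \<le> s" "s < R" for s using R[OF that] by simp
    show "\<bar>deriv U v\<bar> \<le> C" if "\<bar>v\<bar> \<le> 1" for v by (rule C[OF that])
    show "0 \<le> deriv U v" "deriv U (- v) \<le> - 0" if "2 \<le> v" "v \<le> 1" for v using that by linarith+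
  qed
  then have "\<forall>s t. 0 \<le> s \<longrightarrow> s \<le> t \<longrightarrow> t \<le> R \<longrightarrow> \<bar>X t \<omega> - X s \<omega> - (\<epsilon> * L t \<omega> - \<epsilon> * L s \<omega>)\<bar> \<le> C * (t - s)"
    unfolding drift_bounds_def by blast
  then show ?thesis using st by blast
qed

section \<open>Measurability of the survival events\<close>

definition level_event :: "nat \<Rightarrow> real \<Rightarrow> 'a set" where
  "level_event n t = {\<omega>\<in>space M. \<exists>q\<in>\<rat>. 0 \<le> q \<and> q \<le> t \<and> 1 - 1 / real (Suc n) < \<bar>X q \<omega>\<bar>}"

lemma level_event_in_F: "0 \<le> t \<Longrightarrow> t \<le> u \<Longrightarrow> level_event n t \<in> sets (F u)"
proof -
  assume t: "0 \<le> t" "t \<le> u"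
  have "level_event n t = (\<Union>q\<in>\<rat> \<inter> {0..t}. {\<omega>\<in>space (F u). 1 - 1 / real (Suc n) < \<bar>X q \<omega>\<bar>})"
    using t by (auto simp: level_event_def)
  also have "\<dots> \<in> sets (F u)"
    using t by (intro sets.countable_UN'' borel_measurable_less borel_measurable_abs X_measurable_F
        borel_measurable_const countable_subset[OF _ countable_rat]) auto
  finally show ?thesis .
qed

lemma level_event_mono: "s \<le> t \<Longrightarrow> level_event n s \<subseteq> level_event n t"
  by (force simp: level_event_def)

text \<open>Dyadic discretisation of the passage time over the level \<open>1 - 1 / Suc n\<close>:
  the event that the passage is first noticed at time \<open>j / 2 ^ m\<close>.\<close>

definition first_level :: "nat \<Rightarrow> nat \<Rightarrow> nat \<Rightarrow> 'a set" where
  "first_level n m j = (if j = 0 then level_event n 0 else level_event n (real j / 2 ^ m) - level_event n (real (j - 1) / 2 ^ m))"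

lemma first_level_in_F: "first_level n m j \<in> sets (F (real j / 2 ^ m))"
  unfolding first_level_def by (auto intro!: sets.Diff level_event_in_F divide_right_mono)

lemma first_level_disjoint: "i < j \<Longrightarrow> first_level n m i \<inter> first_level n m j = {}"
proof -
  assume ij: "i < j"
  have "level_event n (real i / 2 ^ m) \<subseteq> level_event n (real (j - 1) / 2 ^ m)"
    using ij by (intro level_event_mono divide_right_mono) auto
  then show ?thesis using ij by (auto simp: first_level_def split: if_splits)
qed

definition jump_after_level :: "real \<Rightarrow> real \<Rightarrow> nat \<Rightarrow> nat \<Rightarrow> nat \<Rightarrow> 'a set" where
  "jump_after_level h b n m T = (\<Union>j\<le>T * 2 ^ m. first_level n m j \<inter> oscillation (real j / 2 ^ m) h b)"

text \<open>The strong Markov property at the discretised passage time: the events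
  \<open>first_level\<close> are disjoint and known at their own time, so summing over
  \<open>j\<close> yields the bound for a single window, independent of level, mesh and
  horizon.\<close>

lemma prob_jump_after_level:
  assumes h: "h > 0" "h \<in> \<rat>" and \<theta>: "\<theta> \<ge> 0"
  shows "jump_after_level h b n m T \<in> sets M"
    "prob (jump_after_level h b n m T) \<le> 2 * exp (- \<theta> * b + h * \<Psi> \<theta>)"
proof -
  have ev: "first_level n m j \<in> sets M" for j by (rule sets_F_D[OF first_level_in_F]) simp
  have ev2: "first_level n m j \<inter> oscillation (real j / 2 ^ m) h b \<in> sets M" for j
    using h by (intro sets.Int ev sets_F_D[OF oscillation_in_F[OF _ _ order_refl]]) auto
  show "jump_after_level h b n m T \<in> sets M" unfolding jump_after_level_def by (intro sets.finite_UN ev2) auto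
  have "prob (jump_after_level h b n m T) \<le> (\<Sum>j\<le>T * 2 ^ m. prob (first_level n m j \<inter> oscillation (real j / 2 ^ m) h b))"
    unfolding jump_after_level_def by (intro finite_measure_subadditive_finite) (use ev2 in auto)
  also have "\<dots> \<le> (\<Sum>j\<le>T * 2 ^ m. prob (first_level n m j) * (2 * exp (- \<theta> * b + h * \<Psi> \<theta>)))"
    using h \<theta> by (intro sum_mono prob_oscillation_le first_level_in_F) auto
  also have "\<dots> = prob (\<Union>j\<le>T * 2 ^ m. first_level n m j) * (2 * exp (- \<theta> * b + h * \<Psi> \<theta>))"
  proof -
    have "disjoint_family_on (first_level n m) {..T * 2 ^ m}"
      unfolding disjoint_family_on_def using first_level_disjoint by (metis inf_commute linorder_neqE_nat)
    then have "(\<Sum>j\<le>T * 2 ^ m. prob (first_level n m j)) = prob (\<Union>j\<le>T * 2 ^ m. first_level n m j)"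
      using ev by (intro finite_measure_finite_Union[symmetric]) auto
    then show ?thesis by (simp only: sum_distrib_right[symmetric])
  qed
  also have "\<dots> \<le> 1 * (2 * exp (- \<theta> * b + h * \<Psi> \<theta>))" by (intro mult_right_mono prob_le_1) auto
  finally show "prob (jump_after_level h b n m T) \<le> 2 * exp (- \<theta> * b + h * \<Psi> \<theta>)" by simp
qed

text \<open>\<open>r\<close> is the first time at which the left limit of \<open>\<bar>X\<bar>\<close> reaches the level \<open>1\<close>, and \<open>L\<close> jumps
  at \<open>r\<close>. Such a time is announced by the passage times over \<open>1 - 1/n\<close>, so it cannot be a jump time.\<close>

definition predictable_jump :: "nat \<Rightarrow> nat \<Rightarrow> 'a \<Rightarrow> bool" where
  "predictable_jump K T \<omega> \<longleftrightarrow> (\<exists>r. 0 < r \<and> r \<le> real T \<and>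
     (\<exists>s<r. \<forall>u. s < u \<longrightarrow> u < r \<longrightarrow> 1 / real (Suc K) < \<bar>L r \<omega> - L u \<omega>\<bar>) \<and>
     (\<forall>s<r. \<exists>n. \<forall>u. 0 \<le> u \<longrightarrow> u \<le> s \<longrightarrow> \<bar>X u \<omega>\<bar> \<le> 1 - 1 / real (Suc n)) \<and>
     (\<forall>n. \<exists>s. 0 \<le> s \<and> s < r \<and> 1 - 1 / real (Suc n) < \<bar>X s \<omega>\<bar>))"

lemma right_continuous_rational:
  assumes c: "cadlag y" and s: "0 \<le> s" "s < r" "k < \<bar>y s\<bar>"
  shows "\<exists>q\<in>\<rat>. s \<le> q \<and> q < r \<and> k < \<bar>y q\<bar>"
proof -
  have "((\<lambda>u. \<bar>y u\<bar>) \<longlongrightarrow> \<bar>y s\<bar>) (at_right s)" using c s by (intro tendsto_rabs) (simp add: cadlag_def)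
  then have "\<forall>\<^sub>F u in at_right s. k < \<bar>y u\<bar>" using s by (intro order_tendstoD)
  then obtain b where b: "b > s" "\<And>u. s < u \<Longrightarrow> u < b \<Longrightarrow> k < \<bar>y u\<bar>" by (auto simp: eventually_at_right_field)
  obtain q where "q \<in> \<rat>" "s < q" "q < min b r" using Rats_dense_in_real[of s "min b r"] b s by auto
  then show ?thesis using b by (intro bexI[of _ q]) auto
qed

text \<open>For large \<open>n\<close> the level is not crossed before \<open>\<rho> - h\<close>,
  but it is crossed before \<rho>. For large \<open>m\<close> the discretised passage also precedes
  \<rho>. The jump at \<rho> then falls into the window of length \<open>h\<close> after the
  announcement.\<close>

lemma predictable_jump_covered:
  assumes r: "regular \<omega>" and p: "predictable_jump K T \<omega>" and h: "h > 0"
  shows "\<exists>n0. \<forall>n\<ge>n0. \<exists>m0. \<forall>m\<ge>m0. \<omega> \<in> jump_after_level h (1 / (2 * real (Suc K))) n m T"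
proof -
  have cX: "cadlag (\<lambda>t. X t \<omega>)" and cL: "cadlag (\<lambda>t. L t \<omega>)" and sp: "\<omega> \<in> space M" using r by (auto simp: regular_def)
  obtain \<rho> s0 where \<rho>: "0 < \<rho>" "\<rho> \<le> real T" "s0 < \<rho>"
    and jmp: "\<And>u. s0 < u \<Longrightarrow> u < \<rho> \<Longrightarrow> 1 / real (Suc K) < \<bar>L \<rho> \<omega> - L u \<omega>\<bar>"
    and below: "\<And>s. s < \<rho> \<Longrightarrow> \<exists>n. \<forall>u. 0 \<le> u \<longrightarrow> u \<le> s \<longrightarrow> \<bar>X u \<omega>\<bar> \<le> 1 - 1 / real (Suc n)"
    and near: "\<And>n. \<exists>s. 0 \<le> s \<and> s < \<rho> \<and> 1 - 1 / real (Suc n) < \<bar>X s \<omega>\<bar>"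
    using p unfolding predictable_jump_def by blast
  obtain n0 where n0: "\<And>u. 0 \<le> u \<Longrightarrow> u \<le> \<rho> - h \<Longrightarrow> \<bar>X u \<omega>\<bar> \<le> 1 - 1 / real (Suc n0)"
    using below[of "\<rho> - h"] h by auto
  have "\<exists>m0. \<forall>m\<ge>m0. \<omega> \<in> jump_after_level h (1 / (2 * real (Suc K))) n m T" if n: "n \<ge> n0" for n
  proof -
    have nn: "1 - 1 / real (Suc n0) \<le> 1 - 1 / real (Suc n)" using n by (simp add: frac_le)
    obtain s where s: "0 \<le> s" "s < \<rho>" "1 - 1 / real (Suc n) < \<bar>X s \<omega>\<bar>" using near by blast
    obtain q where q: "q \<in> \<rat>" "s \<le> q" "q < \<rho>" "1 - 1 / real (Suc n) < \<bar>X q \<omega>\<bar>"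
      using right_continuous_rational[OF cX s] by auto
    have "(\<lambda>m. (1/2 :: real) ^ m) \<longlonglongrightarrow> 0" by (intro LIMSEQ_realpow_zero) auto
    then have "\<forall>\<^sub>F m in sequentially. (1/2 :: real) ^ m < \<rho> - q" using q by (intro order_tendstoD) auto
    then obtain m0 where m0: "\<And>m. m \<ge> m0 \<Longrightarrow> (1/2 :: real) ^ m < \<rho> - q" by (auto simp: eventually_sequentially)
    have "\<omega> \<in> jump_after_level h (1 / (2 * real (Suc K))) n m T" if m: "m \<ge> m0" for m
    proof -
      define J where "J = nat \<lceil>q * 2 ^ m\<rceil>"
      have J: "q * 2 ^ m \<le> real J" "real J < q * 2 ^ m + 1" using q s by (auto simp: J_def) linarith+
      have J1: "q \<le> real J / 2 ^ m" using J(1) by (simp add: pos_le_divide_eq)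
      have "real J / 2 ^ m < (q * 2 ^ m + 1) / 2 ^ m" using J(2) by (intro divide_strict_right_mono) auto
      also have "\<dots> = q + (1/2) ^ m" by (simp add: add_divide_distrib power_divide)
      finally have J2: "real J / 2 ^ m < \<rho>" using m0[OF m] by simp
      have ex: "\<omega> \<in> level_event n (real J / 2 ^ m)" using q s J1 sp unfolding level_event_def mem_Collect_eq by (intro conjI bexI[of _ q]) auto
      define j where "j = (LEAST j. \<omega> \<in> level_event n (real j / 2 ^ m))"
      have j: "\<omega> \<in> level_event n (real j / 2 ^ m)" unfolding j_def by (rule LeastI[of _ J]) (rule ex)
      have jJ: "j \<le> J" unfolding j_def by (rule Least_le) (rule ex)
      have fl: "\<omega> \<in> first_level n m j"
      proof (cases "j = 0")
        case False
        then have "\<omega> \<notin> level_event n (real (j - 1) / 2 ^ m)" using not_less_Least[of "j - 1" "\<lambda>j. \<omega> \<in> level_event n (real j / 2 ^ m)"] by (simp add: j_def)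
        then show ?thesis using j False by (simp add: first_level_def)
      qed (use j in \<open>simp add: first_level_def\<close>)
      have j\<rho>: "real j / 2 ^ m < \<rho>" using jJ J2 by (meson divide_right_mono of_nat_le_iff order_le_less_trans zero_le_numeral zero_le_power)
      have "\<rho> - h < real j / 2 ^ m"
      proof -
        obtain q' where q': "0 \<le> q'" "q' \<le> real j / 2 ^ m" "1 - 1 / real (Suc n) < \<bar>X q' \<omega>\<bar>" using j by (auto simp: level_event_def)
        have "\<not> q' \<le> \<rho> - h" using n0[OF q'(1)] q'(3) nn by force
        then show ?thesis using q'(2) by simp
      qed
      then have \<rho>h: "0 \<le> \<rho> - real j / 2 ^ m" "\<rho> - real j / 2 ^ m \<le> h" using j\<rho> by auto
      have osc: "\<omega> \<in> oscillation (real j / 2 ^ m) h (1 / (2 * real (Suc K)))"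
      proof (rule ccontr)
        assume no: "\<omega> \<notin> oscillation (real j / 2 ^ m) h (1 / (2 * real (Suc K)))"
        \<comment> \<open>A time inside the window shortly before the jump. If the increments from
          the window start to \<open>u\<close> and to \<rho> were both at most half of
          \<open>1 / real (Suc K)\<close>, the jump would be too small.\<close>
        define u where "u = (max s0 (real j / 2 ^ m) + \<rho>) / 2"
        have u: "s0 < u" "u < \<rho>" "real j / 2 ^ m \<le> u"
        proof -
          have mid: "a < (b + c) / 2 \<and> (b + c) / 2 < c" if "a \<le> b" "b < c" for a b c :: real
            using that by (simp add: field_simps)
          have m: "max s0 (real j / 2 ^ m) < \<rho>" using \<rho> j\<rho> by simp
          show "s0 < u" "u < \<rho>" unfolding u_def using mid[OF _ m, of s0] by auto
          show "real j / 2 ^ m \<le> u" unfolding u_def using mid[OF _ m, of "real j / 2 ^ m"] by auto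
        qed
        note ob = oscillation_bound[OF cL sp no]
        have "\<bar>L (real j / 2 ^ m + (\<rho> - real j / 2 ^ m)) \<omega> - L (real j / 2 ^ m) \<omega>\<bar> \<le> 1 / (2 * real (Suc K))"
          using \<rho>h by (intro ob) auto
        moreover have "\<bar>L (real j / 2 ^ m + (u - real j / 2 ^ m)) \<omega> - L (real j / 2 ^ m) \<omega>\<bar> \<le> 1 / (2 * real (Suc K))"
          using \<rho>h u by (intro ob) auto
        ultimately have "\<bar>L \<rho> \<omega> - L u \<omega>\<bar> \<le> 1 / (2 * real (Suc K)) + 1 / (2 * real (Suc K))" by simp
        also have "\<dots> = 1 / real (Suc K)" by (simp add: field_simps)
        finally show False using jmp[OF u(1,2)] by simp
      qed
      have "real j < real T * 2 ^ m" using j\<rho> \<rho>(2) by (simp add: pos_divide_less_eq) (smt (verit) mult_right_mono zero_le_power)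
      then have "j \<le> T * 2 ^ m" by (metis less_imp_le of_nat_less_iff of_nat_mult of_nat_numeral of_nat_power)
      then show ?thesis unfolding jump_after_level_def using fl osc by auto
    qed
    then show ?thesis by blast
  qed
  then show ?thesis by blast
qed

text \<open>With windows of length \<open>1 / Suc k\<close>, letting \<open>k\<close> grow removes
  the term with \<open>\<Psi> \<theta>\<close> for each \<theta>, and then letting \<theta> grow
  sends \<open>exp (- \<theta> * b)\<close> to 0.\<close>

lemma AE_not_predictable_jump: "AE \<omega> in M. \<not> predictable_jump K T \<omega>"
proof -
  define b where "b = 1 / (2 * real (Suc K))"
  have b: "b > 0" by (simp add: b_def)
  define D where "D k n m = jump_after_level (1 / real (Suc k)) b n m T" for k n m
  define E where "E k = (\<Union>n0. \<Inter>n\<in>{n0..}. \<Union>m0. \<Inter>m\<in>{m0..}. D k n m)" for k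
  have Dm: "D k n m \<in> sets M" for k n m unfolding D_def by (rule prob_jump_after_level[of _ 0]) auto
  have E1m: "(\<Union>m0. \<Inter>m\<in>{m0..}. D k n m) \<in> sets M" for k n
    by (intro sets.countable_nat_UN subsetI) (auto intro!: sets.countable_INT' Dm)
  have Em: "E k \<in> sets M" for k unfolding E_def
    by (intro sets.countable_nat_UN subsetI) (auto intro!: sets.countable_INT' E1m simp del: UN_iff)
  have E_le: "prob (E k) \<le> 2 * exp (- \<theta> * b + 1 / real (Suc k) * \<Psi> \<theta>)" if "\<theta> \<ge> 0" for k \<theta>
  proof -
    have "prob (D k n m) \<le> 2 * exp (- \<theta> * b + 1 / real (Suc k) * \<Psi> \<theta>)" for n m
      unfolding D_def using that by (intro prob_jump_after_level) auto
    then show ?thesis unfolding E_def by (intro prob_eventually_le E1m Dm)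
  qed
  have le0: "prob (\<Inter>k. E k) \<le> 2 * exp (- \<theta> * b + 1)" if "\<theta> \<ge> 0" for \<theta>
  proof -
    define k where "k = nat \<lceil>\<Psi> \<theta>\<rceil>"
    have "\<Psi> \<theta> \<le> real (Suc k)" by (simp add: k_def) linarith
    then have "1 / real (Suc k) * \<Psi> \<theta> \<le> 1" by (simp add: field_simps)
    then have "prob (E k) \<le> 2 * exp (- \<theta> * b + 1)" using E_le[OF that, of k] by (smt (verit) exp_le_cancel_iff)
    moreover have "prob (\<Inter>k. E k) \<le> prob (E k)" using Em by (intro finite_measure_mono) auto
    ultimately show ?thesis by simp
  qed
  have "((\<lambda>\<theta>. 2 * exp (- \<theta> * b + 1)) \<longlongrightarrow> 0) at_top" using b by real_asymp
  then have "prob (\<Inter>k. E k) \<le> 0"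
    by (rule tendsto_lowerbound) (use le0 in \<open>auto intro: eventually_mono[OF eventually_ge_at_top[of 0]]\<close>)
  then have "prob (\<Inter>k. E k) = 0" by (simp add: measure_le_0_iff)
  then have "(\<Inter>k. E k) \<in> null_sets M" using Em by (auto simp: null_sets_def emeasure_eq_measure)
  from AE_not_in[OF this] AE_regular show ?thesis
  proof eventually_elim
    case (elim \<omega>)
    show ?case
    proof
      assume p: "predictable_jump K T \<omega>"
      have "\<omega> \<in> E k" for k
        using predictable_jump_covered[OF elim(2) p, of "1 / real (Suc k)"]
        by (force simp: E_def D_def b_def)
      then show False using elim(1) by auto
    qed
  qed
qed

text \<open>Otherwise take the supremum \<rho> of the times up to which the path keeps a distance
  from level 1. Right continuity shows that \<rho> itself is not such a time, so the left limit at
  \<rho> has modulus at least 1 while the value is inside: the path jumps, and it does so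
  predictably.\<close>

lemma interior_sup_less_one:
  assumes r: "regular \<omega>" and np: "\<And>K T. \<not> predictable_jump K T \<omega>"
    and t: "t \<ge> 0" and in1: "\<And>s. 0 \<le> s \<Longrightarrow> s \<le> t \<Longrightarrow> \<bar>X s \<omega>\<bar> < 1"
  shows "\<exists>n. \<forall>s. 0 \<le> s \<longrightarrow> s \<le> t \<longrightarrow> \<bar>X s \<omega>\<bar> \<le> 1 - 1 / real (Suc n)"
proof (rule ccontr)
  assume not: "\<not> (\<exists>n. \<forall>s. 0 \<le> s \<longrightarrow> s \<le> t \<longrightarrow> \<bar>X s \<omega>\<bar> \<le> 1 - 1 / real (Suc n))"
  have cX: "cadlag (\<lambda>t. X t \<omega>)" and cL: "cadlag (\<lambda>t. L t \<omega>)" and sp: "\<omega> \<in> space M" using r by (auto simp: regular_def)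
  obtain C where C: "C \<ge> 0" "\<And>v. \<bar>v\<bar> \<le> 1 \<Longrightarrow> \<bar>deriv U v\<bar> \<le> C" using potential_drift_bounded[OF U] by auto
  have arch: "\<exists>n. v \<le> 1 - 1 / real (Suc n)" if "v < 1" for v
  proof -
    have "0 < 1 - v" using that by simp
    from reals_Archimedean[OF this] obtain n where "inverse (real (Suc n)) < 1 - v" ..
    then show ?thesis by (intro exI[of _ n]) (simp add: inverse_eq_divide)
  qed
  have anti: "1 - 1 / real (Suc n) \<le> 1 - 1 / real (Suc m)" if "n \<le> m" for n m using that by (simp add: frac_le)
  define A where "A = {r. 0 \<le> r \<and> r \<le> t \<and> (\<exists>n. \<forall>s. 0 \<le> s \<longrightarrow> s \<le> r \<longrightarrow> \<bar>X s \<omega>\<bar> \<le> 1 - 1 / real (Suc n))}"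
  define \<rho> where "\<rho> = Sup A"
  have 0: "0 \<in> A"
  proof -
    obtain n where n: "\<bar>X 0 \<omega>\<bar> \<le> 1 - 1 / real (Suc n)" using arch[OF in1[OF order_refl t]] by auto
    have "\<bar>X s \<omega>\<bar> \<le> 1 - 1 / real (Suc n)" if "0 \<le> s" "s \<le> 0" for s
    proof -
      have "s = 0" using that by simp
      then show ?thesis using n by simp
    qed
    then show ?thesis using t unfolding A_def by blast
  qed
  have bdd: "bdd_above A" by (rule bdd_aboveI[of _ t]) (auto simp: A_def)
  have "0 \<le> \<rho>" unfolding \<rho>_def by (rule cSup_upper[OF 0 bdd])
  moreover have "\<rho> \<le> t" unfolding \<rho>_def
  proof (rule cSup_least)
    show "A \<noteq> {}" using 0 by blast
  qed (simp add: A_def)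
  ultimately have \<rho>t: "0 \<le> \<rho>" "\<rho> \<le> t" by auto
  have before: "s \<in> A" if "0 \<le> s" "s < \<rho>" for s
  proof -
    have "A \<noteq> {}" "s < Sup A" using 0 that by (auto simp: \<rho>_def)
    then obtain a where a: "a \<in> A" "s < a" using less_cSup_iff[OF _ bdd] by blast
    from a(1) obtain n where "a \<le> t" "\<forall>s. 0 \<le> s \<longrightarrow> s \<le> a \<longrightarrow> \<bar>X s \<omega>\<bar> \<le> 1 - 1 / real (Suc n)"
      by (auto simp: A_def)
    then show ?thesis using that a(2) by (auto simp: A_def intro!: exI[of _ n])
  qed
  have \<rho>A: "\<rho> \<notin> A"
  proof
    assume inA: "\<rho> \<in> A"
    then obtain n where n: "\<And>s. 0 \<le> s \<Longrightarrow> s \<le> \<rho> \<Longrightarrow> \<bar>X s \<omega>\<bar> \<le> 1 - 1 / real (Suc n)" by (auto simp: A_def)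
    have "\<rho> \<noteq> t" using not n by auto
    then have lt: "\<rho> < t" using \<rho>t by simp
    define v where "v = (\<bar>X \<rho> \<omega>\<bar> + 1) / 2"
    have v: "\<bar>X \<rho> \<omega>\<bar> < v" "v < 1" using in1[of \<rho>] \<rho>t by (auto simp: v_def)
    have "((\<lambda>u. \<bar>X u \<omega>\<bar>) \<longlongrightarrow> \<bar>X \<rho> \<omega>\<bar>) (at_right \<rho>)" using cX \<rho>t by (intro tendsto_rabs) (simp add: cadlag_def)
    then have "\<forall>\<^sub>F u in at_right \<rho>. \<bar>X u \<omega>\<bar> < v" using v by (intro order_tendstoD)
    then obtain b where b: "b > \<rho>" "\<And>u. \<rho> < u \<Longrightarrow> u < b \<Longrightarrow> \<bar>X u \<omega>\<bar> < v" by (auto simp: eventually_at_right_field)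
    obtain n' where n': "v \<le> 1 - 1 / real (Suc n')" using arch[OF v(2)] by auto
    define u where "u = min t ((\<rho> + b) / 2)"
    have u: "\<rho> < u" "u \<le> t" "u < b" using lt b by (auto simp: u_def min_def)
    have "\<bar>X s \<omega>\<bar> \<le> 1 - 1 / real (Suc (max n n'))" if "0 \<le> s" "s \<le> u" for s
    proof (cases "s \<le> \<rho>")
      case True then show ?thesis using n[OF that(1)] anti[of n "max n n'"] by simp
    next
      case False then show ?thesis using b(2)[of s] that u n' anti[of n' "max n n'"] by simp
    qed
    then have "u \<in> A" using u \<rho>t by (auto simp: A_def)
    then have "u \<le> \<rho>" unfolding \<rho>_def using bdd by (rule cSup_upper)
    then show False using u by simp
  qed
  then have \<rho>0: "\<rho> > 0" using 0 \<rho>t by (cases "\<rho> = 0") auto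
  have hit: "\<exists>s. 0 \<le> s \<and> s < \<rho> \<and> s0 < s \<and> v < \<bar>X s \<omega>\<bar>" if "s0 < \<rho>" "v < 1" for s0 v
  proof -
    have "max 0 s0 \<in> A" using that \<rho>0 by (intro before) auto
    then obtain n1 where n1: "\<And>s. 0 \<le> s \<Longrightarrow> s \<le> max 0 s0 \<Longrightarrow> \<bar>X s \<omega>\<bar> \<le> 1 - 1 / real (Suc n1)" by (auto simp: A_def)
    have "max v \<bar>X \<rho> \<omega>\<bar> < 1" using that in1[OF \<rho>t] by simp
    from arch[OF this] obtain n2 where n2: "max v \<bar>X \<rho> \<omega>\<bar> \<le> 1 - 1 / real (Suc n2)" by blast
    obtain s where s: "0 \<le> s" "s \<le> \<rho>" "1 - 1 / real (Suc (max n1 n2)) < \<bar>X s \<omega>\<bar>"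
      using \<rho>A \<rho>t by (auto simp: A_def not_le)
    have "s \<noteq> \<rho>" using s(3) n2 anti[of n2 "max n1 n2"] by auto
    moreover have "\<not> s \<le> max 0 s0" using n1[OF s(1)] s(3) anti[of n1 "max n1 n2"] by force
    moreover have "v < \<bar>X s \<omega>\<bar>" using s(3) n2 anti[of n2 "max n1 n2"] by auto
    ultimately show ?thesis using s by (intro exI[of _ s]) auto
  qed
  obtain l where l: "((\<lambda>u. X u \<omega>) \<longlongrightarrow> l) (at_left \<rho>)" using cX \<rho>0 by (auto simp: cadlag_def)
  have l1: "\<bar>l\<bar> \<ge> 1"
  proof (rule ccontr)
    assume "\<not> \<bar>l\<bar> \<ge> 1"
    define v where "v = (\<bar>l\<bar> + 1) / 2"
    have v: "\<bar>l\<bar> < v" "v < 1" using \<open>\<not> \<bar>l\<bar> \<ge> 1\<close> by (auto simp: v_def)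
    have "\<forall>\<^sub>F u in at_left \<rho>. \<bar>X u \<omega>\<bar> < v" using tendsto_rabs[OF l] v by (intro order_tendstoD)
    then obtain b where "b < \<rho>" "\<And>u. b < u \<Longrightarrow> u < \<rho> \<Longrightarrow> \<bar>X u \<omega>\<bar> < v" by (auto simp: eventually_at_left_field)
    then show False using hit[of b v] v by force
  qed
  \<comment> \<open>The size of the jump of \<open>X\<close>. The drift moves little over short
    intervals, so \<open>\<epsilon> * L\<close> performs at least half of this jump.\<close>
  define g where "g = \<bar>X \<rho> \<omega> - l\<bar>"
  have g: "g > 0" using l1 in1[OF \<rho>t] by (auto simp: g_def)
  obtain K where K: "inverse (real (Suc K)) < g / (2 * \<epsilon>)" using reals_Archimedean[of "g / (2 * \<epsilon>)"] g eps by auto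
  have "((\<lambda>u. \<bar>X \<rho> \<omega> - X u \<omega>\<bar> - C * (\<rho> - u)) \<longlongrightarrow> \<bar>X \<rho> \<omega> - l\<bar> - C * (\<rho> - \<rho>)) (at_left \<rho>)"
    by (intro tendsto_intros l)
  then have "\<forall>\<^sub>F u in at_left \<rho>. g / 2 < \<bar>X \<rho> \<omega> - X u \<omega>\<bar> - C * (\<rho> - u)"
    using g by (intro order_tendstoD) (auto simp: g_def)
  then obtain b where b: "b < \<rho>" "\<And>u. b < u \<Longrightarrow> u < \<rho> \<Longrightarrow> g / 2 < \<bar>X \<rho> \<omega> - X u \<omega>\<bar> - C * (\<rho> - u)" by (auto simp: eventually_at_left_field)
  have jmp: "1 / real (Suc K) < \<bar>L \<rho> \<omega> - L u \<omega>\<bar>" if u: "max b 0 < u" "u < \<rho>" for u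
  proof -
    have "\<bar>X \<rho> \<omega> - X u \<omega> - (\<epsilon> * L \<rho> \<omega> - \<epsilon> * L u \<omega>)\<bar> \<le> C * (\<rho> - u)"
      by (rule regular_lipschitz[OF r, where R = \<rho>]) (use in1 C u \<rho>t in auto)
    then have "g / 2 < \<bar>\<epsilon> * L \<rho> \<omega> - \<epsilon> * L u \<omega>\<bar>" using b(2)[of u] u by (auto simp: abs_if split: if_splits)
    also have "\<dots> = \<epsilon> * \<bar>L \<rho> \<omega> - L u \<omega>\<bar>" using eps by (simp add: right_diff_distrib[symmetric] abs_mult)
    finally have "g / (2 * \<epsilon>) < \<bar>L \<rho> \<omega> - L u \<omega>\<bar>" using eps by (simp add: field_simps)
    then show ?thesis using K by (simp add: inverse_eq_divide)
  qed
  have "predictable_jump K (nat \<lceil>t\<rceil>) \<omega>"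
    unfolding predictable_jump_def
  proof (rule exI[of _ \<rho>], intro conjI)
    show "\<rho> \<le> real (nat \<lceil>t\<rceil>)" using \<rho>t by linarith
    show "\<exists>s<\<rho>. \<forall>u. s < u \<longrightarrow> u < \<rho> \<longrightarrow> 1 / real (Suc K) < \<bar>L \<rho> \<omega> - L u \<omega>\<bar>"
      using jmp b(1) \<rho>0 by (intro exI[of _ "max b 0"]) auto
    show "\<forall>s<\<rho>. \<exists>n. \<forall>u. 0 \<le> u \<longrightarrow> u \<le> s \<longrightarrow> \<bar>X u \<omega>\<bar> \<le> 1 - 1 / real (Suc n)"
    proof (intro allI impI)
      fix s assume "s < \<rho>"
      show "\<exists>n. \<forall>u. 0 \<le> u \<longrightarrow> u \<le> s \<longrightarrow> \<bar>X u \<omega>\<bar> \<le> 1 - 1 / real (Suc n)"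
        using before[of s] \<open>s < \<rho>\<close> by (cases "s \<ge> 0") (auto simp: A_def)
    qed
    show "\<forall>n. \<exists>s\<ge>0. s < \<rho> \<and> 1 - 1 / real (Suc n) < \<bar>X s \<omega>\<bar>"
    proof
      fix n
      have "1 - 1 / real (Suc n) < (1::real)" by simp
      from hit[OF \<rho>0 this] show "\<exists>s\<ge>0. s < \<rho> \<and> 1 - 1 / real (Suc n) < \<bar>X s \<omega>\<bar>" by blast
    qed
  qed (rule \<rho>0)
  then show False using np by blast
qed

text \<open>Up to a null set survival means that the path is inside at time \<open>t\<close> and
  stays below some level \<open>1 - 1 / Suc n\<close> at all rational times up to \<open>t\<close>;
  completeness of \<open>M\<close> takes care of the null set.\<close>

lemma survival_event: "t \<ge> 0 \<Longrightarrow> {\<omega>\<in>space M. exit_time X \<omega> > ereal t} \<in> sets M"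
proof -
  assume t: "t \<ge> 0"
  let ?S = "{\<omega>\<in>space M. exit_time X \<omega> > ereal t}"
  define B where "B = {\<omega>\<in>space M. \<bar>X t \<omega>\<bar> < 1} - (\<Inter>n. level_event n t)"
  have B: "B \<in> sets M"
  proof -
    have "level_event n t \<in> sets M" for n using level_event_in_F[OF t order_refl] t by (rule sets_F_D)
    moreover have "{\<omega>\<in>space M. \<bar>X t \<omega>\<bar> < 1} \<in> sets M"
      using X_measurable[OF t] by (intro borel_measurable_less borel_measurable_abs) auto
    ultimately show ?thesis unfolding B_def by (intro sets.Diff sets.countable_INT') auto
  qed
  have "AE \<omega> in M. \<forall>K T. \<not> predictable_jump K T \<omega>"
    unfolding AE_all_countable using AE_not_predictable_jump by auto
  then have "AE \<omega> in M. \<omega> \<in> ?S \<longleftrightarrow> \<omega> \<in> B" using AE_regular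
  proof eventually_elim
    case (elim \<omega>)
    have cX: "cadlag (\<lambda>t. X t \<omega>)" and sp: "\<omega> \<in> space M" using elim by (auto simp: regular_def)
    have "\<omega> \<in> ?S \<longleftrightarrow> (\<forall>s. 0 \<le> s \<longrightarrow> s \<le> t \<longrightarrow> \<bar>X s \<omega>\<bar> < 1)"
      using exit_time_gt_iff[where X = X, OF cX t] sp by simp
    also have "\<dots> \<longleftrightarrow> \<omega> \<in> B"
    proof
      assume in1: "\<forall>s. 0 \<le> s \<longrightarrow> s \<le> t \<longrightarrow> \<bar>X s \<omega>\<bar> < 1"
      then obtain n where "\<forall>s. 0 \<le> s \<longrightarrow> s \<le> t \<longrightarrow> \<bar>X s \<omega>\<bar> \<le> 1 - 1 / real (Suc n)"
        using interior_sup_less_one[OF elim(2) _ t] elim(1) by auto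
      then have "\<omega> \<notin> level_event n t" by (auto simp: level_event_def not_less)
      then show "\<omega> \<in> B" using in1 t sp by (auto simp: B_def)
    next
      assume "\<omega> \<in> B"
      then obtain n where n: "\<omega> \<notin> level_event n t" and Xt: "\<bar>X t \<omega>\<bar> < 1" by (auto simp: B_def)
      show "\<forall>s. 0 \<le> s \<longrightarrow> s \<le> t \<longrightarrow> \<bar>X s \<omega>\<bar> < 1"
      proof (intro allI impI, rule ccontr)
        fix s assume s: "0 \<le> s" "s \<le> t" "\<not> \<bar>X s \<omega>\<bar> < 1"
        then have "s < t" using Xt by (cases "s = t") auto
        moreover have "1 - 1 / real (Suc n) < \<bar>X s \<omega>\<bar>" using s(3) by (smt (verit) divide_pos_pos of_nat_0_less_iff zero_less_Suc)
        ultimately obtain q where "q \<in> \<rat>" "s \<le> q" "q < t" "1 - 1 / real (Suc n) < \<bar>X q \<omega>\<bar>"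
          using right_continuous_rational[OF cX s(1)] by blast
        then show False using n s(1) sp by (auto simp: level_event_def)
      qed
    qed
    finally show ?case .
  qed
  then obtain N where N: "\<And>\<omega>. \<omega> \<in> space M - N \<Longrightarrow> \<omega> \<in> ?S \<longleftrightarrow> \<omega> \<in> B" "N \<in> null_sets M"
    by (erule AE_E3)
  have SN: "?S \<inter> N \<in> sets M" by (rule complete[OF _ N(2)]) simp
  have e: "?S = (B - N) \<union> (?S \<inter> N)"
  proof (rule set_eqI)
    fix \<omega>
    have "B \<subseteq> space M" by (rule sets.sets_into_space[OF B])
    then show "\<omega> \<in> ?S \<longleftrightarrow> \<omega> \<in> (B - N) \<union> (?S \<inter> N)" using N(1)[of \<omega>] by auto
  qed
  show ?thesis by (subst e) (intro sets.Un sets.Diff B SN null_setsD2[OF N(2)])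
qed

end

section \<open>Bounds at a fixed noise intensity\<close>

lemma sum_exp_geometric_le:
  assumes h: "0 < h" "h \<le> 1"
  shows "(\<Sum>k\<le>n. exp (- (real k * h))) \<le> 2 / h"
proof -
  define r where "r = exp (- h)"
  have "exp (- h) \<le> 1 / (1 + h)" using exp_ge_add_one_self[of h] h by (simp add: exp_minus field_simps)
  also have "\<dots> \<le> 1 - h / 2"
  proof -
    have "1 \<le> (1 - h / 2) * (1 + h)" using h mult_left_le[of h h] by (simp add: algebra_simps)
    then show ?thesis using h by (simp add: pos_divide_le_eq)
  qed
  finally have r: "0 < r" "r < 1" "h / 2 \<le> 1 - r" using h by (auto simp: r_def)
  have "(\<Sum>k\<le>n. exp (- (real k * h))) = (\<Sum>k\<le>n. r ^ k)"
    by (simp add: r_def exp_of_nat_mult[symmetric])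
  also have "\<dots> = (1 - r ^ Suc n) / (1 - r)" using r by (simp add: sum_gp0)
  also have "\<dots> \<le> 1 / (1 - r)" using r by (intro divide_right_mono) auto
  also have "\<dots> \<le> 1 / (h / 2)" using r h by (intro divide_left_mono) auto
  finally show ?thesis by simp
qed

context light_tailed_levy_process
begin

lemma tail_of_sum_ge:
  assumes h: "h \<ge> 0"
  shows "prob {\<omega>\<in>space M. \<sigma> * L h \<omega> \<ge> y} ^ k \<le> prob {\<omega>\<in>space M. \<sigma> * L (real k * h) \<omega> \<ge> real k * y}"
proof (induction k)
  case 0
  have "AE \<omega> in M. \<omega> \<in> {\<omega>\<in>space M. \<sigma> * L (real 0 * h) \<omega> \<ge> real 0 * y}"
    using L_zero AE_space by eventually_elim simp
  moreover have "{\<omega>\<in>space M. \<sigma> * L (real 0 * h) \<omega> \<ge> real 0 * y} \<in> events"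
    by (intro borel_measurable_le) simp_all
  ultimately show ?case by (subst prob_eq_1[THEN iffD2]) simp_all
next
  case (Suc k)
  let ?t = "real k * h" let ?A = "{v. y \<le> \<sigma> * v}"
  let ?G = "{\<omega>\<in>space M. \<sigma> * L ?t \<omega> \<ge> real k * y}"
  have t: "0 \<le> ?t" "?t \<le> ?t + h" using h by auto
  have e: "real (Suc k) * h = ?t + h" by (simp add: algebra_simps)
  have GF: "?G \<in> sets (F ?t)"
  proof -
    have "{\<omega>\<in>space (F ?t). \<sigma> * L ?t \<omega> \<ge> real k * y} \<in> sets (F ?t)"
      by (intro borel_measurable_le borel_measurable_times borel_measurable_const L_measurable_F t(1) order_refl)
    then show ?thesis using t(1) by simp
  qed
  have A: "?A \<in> sets borel" by measurable
  have "prob {\<omega>\<in>space M. \<sigma> * L h \<omega> \<ge> y} ^ Suc k \<le> prob ?G * prob {\<omega>\<in>space M. L h \<omega> \<in> ?A}"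
    unfolding power_Suc2 mem_Collect_eq by (rule mult_right_mono[OF Suc]) simp
  also have "\<dots> = prob (?G \<inter> {\<omega>\<in>space M. L (?t + h) \<omega> - L ?t \<omega> \<in> ?A})"
    using prob_increment[OF t GF A] by simp
  also have "\<dots> \<le> prob {\<omega>\<in>space M. \<sigma> * L (real (Suc k) * h) \<omega> \<ge> real (Suc k) * y}"
  proof (rule finite_measure_mono)
    show "?G \<inter> {\<omega>\<in>space M. L (?t + h) \<omega> - L ?t \<omega> \<in> ?A} \<subseteq> {\<omega>\<in>space M. \<sigma> * L (real (Suc k) * h) \<omega> \<ge> real (Suc k) * y}"
    proof
      fix \<omega> assume "\<omega> \<in> ?G \<inter> {\<omega>\<in>space M. L (?t + h) \<omega> - L ?t \<omega> \<in> ?A}"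
      then have w: "\<omega> \<in> space M" "real k * y \<le> \<sigma> * L ?t \<omega>" "y \<le> \<sigma> * (L (?t + h) \<omega> - L ?t \<omega>)" by auto
      have "real (Suc k) * y = real k * y + y" by (simp add: algebra_simps)
      also have "\<dots> \<le> \<sigma> * L ?t \<omega> + \<sigma> * (L (?t + h) \<omega> - L ?t \<omega>)" using w by linarith
      also have "\<dots> = \<sigma> * L (real (Suc k) * h) \<omega>" unfolding e by (simp add: algebra_simps)
      finally show "\<omega> \<in> {\<omega>\<in>space M. \<sigma> * L (real (Suc k) * h) \<omega> \<ge> real (Suc k) * y}" using w(1) by simp
    qed
    show "{\<omega>\<in>space M. \<sigma> * L (real (Suc k) * h) \<omega> \<ge> real (Suc k) * y} \<in> events"
      using h by (intro borel_measurable_le borel_measurable_times borel_measurable_const L_measurable) simp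
  qed
  finally show ?case .
qed

end

section \<open>Upper bound for the survival probability\<close>

context exit_problem
begin

text \<open>In each period only the direction given by the sign of \<open>X\<close> is tested: an
  increment of size \<open>a\<close> in that direction forces an exit. Travelling distance 1 then
  suffices, where a fixed direction would need distance 2 and spoil the constant in the
  exponent.\<close>

primrec stay :: "real \<Rightarrow> real \<Rightarrow> nat \<Rightarrow> 'a set" where
  "stay \<tau> a 0 = space M"
| "stay \<tau> a (Suc k) =
     (stay \<tau> a k \<inter> {\<omega>\<in>space M. 0 \<le> X (real k * \<tau>) \<omega>}) \<inter> {\<omega>\<in>space M. L (real k * \<tau> + \<tau>) \<omega> - L (real k * \<tau>) \<omega> \<in> {..<a}} \<union>
     (stay \<tau> a k \<inter> {\<omega>\<in>space M. X (real k * \<tau>) \<omega> < 0}) \<inter> {\<omega>\<in>space M. L (real k * \<tau> + \<tau>) \<omega> - L (real k * \<tau>) \<omega> \<in> {-a<..}}"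

lemma X_halfspaces_in_F:
  "0 \<le> t \<Longrightarrow> {\<omega>\<in>space M. 0 \<le> X t \<omega>} \<in> sets (F t)" "0 \<le> t \<Longrightarrow> {\<omega>\<in>space M. X t \<omega> < 0} \<in> sets (F t)"
proof -
  assume t: "0 \<le> t"
  have "{\<omega>\<in>space (F t). 0 \<le> X t \<omega>} \<in> sets (F t)" "{\<omega>\<in>space (F t). X t \<omega> < 0} \<in> sets (F t)"
    by (intro borel_measurable_le borel_measurable_less borel_measurable_const X_measurable_F t order_refl)+
  then show "{\<omega>\<in>space M. 0 \<le> X t \<omega>} \<in> sets (F t)" "{\<omega>\<in>space M. X t \<omega> < 0} \<in> sets (F t)"
    using t by simp_all
qed

lemma increment_event_in_F:
  assumes "0 \<le> s" "s \<le> t" "t \<le> u" "A \<in> sets borel"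
  shows "{\<omega>\<in>space M. L t \<omega> - L s \<omega> \<in> A} \<in> sets (F u)"
proof -
  have u: "0 \<le> u" using assms by simp
  have "(\<lambda>\<omega>. L t \<omega> - L s \<omega>) -` A \<inter> space (F u) \<in> sets (F u)"
    by (rule measurable_sets[OF increment_measurable_F assms(4)]) (use assms in linarith)+
  moreover have "(\<lambda>\<omega>. L t \<omega> - L s \<omega>) -` A \<inter> space (F u) = {\<omega>\<in>space M. L t \<omega> - L s \<omega> \<in> A}"
    using u by auto
  ultimately show ?thesis by simp
qed

lemma stay_in_F: "\<tau> \<ge> 0 \<Longrightarrow> stay \<tau> a k \<in> sets (F (real k * \<tau>))"
proof (induction k)
  case 0
  then show ?case using sets.top[of "F 0"] by simp
next
  case (Suc k)
  let ?t = "real k * \<tau>"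
  have t: "0 \<le> ?t" "?t \<le> ?t + \<tau>" using Suc.prems by auto
  have e: "real (Suc k) * \<tau> = ?t + \<tau>" by (simp add: algebra_simps)
  have up: "A \<in> sets (F (?t + \<tau>))" if "A \<in> sets (F ?t)" for A using mono[OF t] that by blast
  show ?case unfolding e stay.simps
    by (intro sets.Un sets.Int up Suc.IH[OF Suc.prems] X_halfspaces_in_F increment_event_in_F t order_refl) simp_all
qed

lemma prob_stay:
  assumes \<tau>: "\<tau> \<ge> 0" and p: "\<And>\<sigma>. \<bar>\<sigma>\<bar> = 1 \<Longrightarrow> p \<le> prob {\<omega>\<in>space M. a \<le> \<sigma> * L \<tau> \<omega>}"
  shows "prob (stay \<tau> a k) \<le> (1 - p) ^ k"
proof (induction k)
  case 0
  then show ?case by (simp add: prob_space)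
next
  case (Suc k)
  let ?t = "real k * \<tau>"
  have t: "0 \<le> ?t" "?t \<le> ?t + \<tau>" using \<tau> by auto
  let ?P = "stay \<tau> a k \<inter> {\<omega>\<in>space M. 0 \<le> X ?t \<omega>}" let ?N = "stay \<tau> a k \<inter> {\<omega>\<in>space M. X ?t \<omega> < 0}"
  have PF: "?P \<in> sets (F ?t)" and NF: "?N \<in> sets (F ?t)"
    by (intro sets.Int stay_in_F[OF \<tau>] X_halfspaces_in_F t)+
  have PM: "?P \<in> events" and NM: "?N \<in> events" using PF NF t(1) by (blast intro: sets_F_D)+
  have Lm: "{\<omega>\<in>space M. L \<tau> \<omega> \<in> A} \<in> events" if "A \<in> sets borel" for A
    using measurable_sets[OF L_measurable[OF \<tau>] that] by (simp add: vimage_def Int_def conj_commute)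
  have p1: "prob {\<omega>\<in>space M. L \<tau> \<omega> \<in> {..<a}} \<le> 1 - p"
  proof -
    have "prob {\<omega>\<in>space M. L \<tau> \<omega> \<in> {..<a}} = prob (space M - {\<omega>\<in>space M. L \<tau> \<omega> \<in> {a..}})"
      by (rule arg_cong[where f = prob]) auto
    also have "\<dots> = 1 - prob {\<omega>\<in>space M. L \<tau> \<omega> \<in> {a..}}" by (intro prob_compl Lm) simp
    finally show ?thesis using p[of 1] by simp
  qed
  have p2: "prob {\<omega>\<in>space M. L \<tau> \<omega> \<in> {- a<..}} \<le> 1 - p"
  proof -
    have "prob {\<omega>\<in>space M. L \<tau> \<omega> \<in> {- a<..}} = prob (space M - {\<omega>\<in>space M. L \<tau> \<omega> \<in> {..- a}})"
      by (rule arg_cong[where f = prob]) auto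
    also have "\<dots> = 1 - prob {\<omega>\<in>space M. L \<tau> \<omega> \<in> {..- a}}" by (intro prob_compl Lm) simp
    also have "{\<omega>\<in>space M. L \<tau> \<omega> \<in> {..- a}} = {\<omega>\<in>space M. a \<le> (- 1) * L \<tau> \<omega>}" by auto
    finally show ?thesis using p[of "- 1"] by simp
  qed
  have inc1: "{\<omega>\<in>space M. L (?t + \<tau>) \<omega> - L ?t \<omega> \<in> A} \<in> events" if "A \<in> sets borel" for A
    by (rule sets_F_D[OF increment_event_in_F[OF t order_refl that]]) (use t in linarith)
  have "prob (stay \<tau> a (Suc k)) \<le> prob (?P \<inter> {\<omega>\<in>space M. L (?t + \<tau>) \<omega> - L ?t \<omega> \<in> {..<a}}) + prob (?N \<inter> {\<omega>\<in>space M. L (?t + \<tau>) \<omega> - L ?t \<omega> \<in> {- a<..}})"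
    unfolding stay.simps by (intro measure_Un_le sets.Int[OF PM inc1] sets.Int[OF NM inc1]) simp_all
  also have "\<dots> = prob ?P * prob {\<omega>\<in>space M. L \<tau> \<omega> \<in> {..<a}} + prob ?N * prob {\<omega>\<in>space M. L \<tau> \<omega> \<in> {- a<..}}"
    using prob_increment[OF t PF, of "{..<a}"] prob_increment[OF t NF, of "{- a<..}"] by simp
  also have "\<dots> \<le> prob ?P * (1 - p) + prob ?N * (1 - p)"
    using p1 p2 by (intro add_mono mult_left_mono) simp_all
  also have "\<dots> = (prob ?P + prob ?N) * (1 - p)" by (simp add: algebra_simps)
  also have "prob ?P + prob ?N = prob (?P \<union> ?N)"
    by (rule finite_measure_Union[symmetric, OF PM NM]) auto
  also have "?P \<union> ?N = stay \<tau> a k"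
  proof -
    have "stay \<tau> a k \<subseteq> space M" using sets.sets_into_space[OF stay_in_F[OF \<tau>, of a k]] by (simp only: space_F[OF t(1)])
    then show ?thesis by auto
  qed
  also have "prob (stay \<tau> a k) * (1 - p) \<le> (1 - p) ^ k * (1 - p)"
  proof (rule mult_right_mono[OF Suc])
    have "p \<le> 1" by (rule order_trans[OF p[of 1] prob_le_1]) simp
    then show "0 \<le> 1 - p" by simp
  qed
  finally show ?case by (simp add: mult.commute)
qed

lemma survival_prob_le:
  assumes \<tau>: "\<tau> \<ge> 0" and C: "\<And>v. \<bar>v\<bar> \<le> 1 \<Longrightarrow> \<bar>deriv U v\<bar> \<le> C"
    and p: "\<And>\<sigma>. \<bar>\<sigma>\<bar> = 1 \<Longrightarrow> p \<le> prob {\<omega>\<in>space M. (1 + C * \<tau>) / \<epsilon> \<le> \<sigma> * L \<tau> \<omega>}"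
    and t: "real k * \<tau> \<le> t"
  shows "survival_prob M X t \<le> (1 - p) ^ k"
proof -
  let ?a = "(1 + C * \<tau>) / \<epsilon>"
  have t0: "0 \<le> t" using \<tau> t by (meson mult_nonneg_nonneg of_nat_0_le_iff order_trans)
  have "prob {\<omega>\<in>space M. exit_time X \<omega> > ereal t} \<le> prob (stay \<tau> ?a k)"
  proof (rule finite_measure_mono_AE)
    show "stay \<tau> ?a k \<in> events" using \<tau> by (intro sets_F_D[OF stay_in_F]) simp_all
    show "AE \<omega> in M. \<omega> \<in> {\<omega>\<in>space M. exit_time X \<omega> > ereal t} \<longrightarrow> \<omega> \<in> stay \<tau> ?a k"
      using AE_regular
    proof eventually_elim
      case (elim \<omega>)
      have cX: "cadlag (\<lambda>t. X t \<omega>)" and sp: "\<omega> \<in> space M" using elim by (auto simp: regular_def)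
      show ?case
      proof
        assume "\<omega> \<in> {\<omega>\<in>space M. exit_time X \<omega> > ereal t}"
        then have in1: "\<bar>X s \<omega>\<bar> < 1" if "0 \<le> s" "s \<le> t" for s
          using exit_time_gt_iff[where X = X, OF cX t0] that by simp
        have "\<omega> \<in> stay \<tau> ?a j" if "j \<le> k" for j
          using that
        proof (induction j)
          case 0 then show ?case using sp by simp
        next
          case (Suc j)
          let ?s = "real j * \<tau>"
          have s: "0 \<le> ?s" "?s \<le> ?s + \<tau>" using \<tau> by auto
          have "?s + \<tau> = real (Suc j) * \<tau>" by (simp add: algebra_simps)
          also have "\<dots> \<le> real k * \<tau>" using Suc.prems \<tau> by (intro mult_right_mono) auto
          finally have st: "?s + \<tau> \<le> t" using t by simp
          have lip: "\<bar>X (?s + \<tau>) \<omega> - X ?s \<omega> - (\<epsilon> * L (?s + \<tau>) \<omega> - \<epsilon> * L ?s \<omega>)\<bar> \<le> C * (?s + \<tau> - ?s)"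
            by (rule regular_lipschitz[OF elim _ C s order_refl]) (use in1 st in auto)
          define \<Delta> where "\<Delta> = L (?s + \<tau>) \<omega> - L ?s \<omega>"
          have "\<bar>X (?s + \<tau>) \<omega> - X ?s \<omega> - \<epsilon> * \<Delta>\<bar> \<le> C * \<tau>" using lip by (simp add: \<Delta>_def right_diff_distrib)
          moreover have "\<bar>X (?s + \<tau>) \<omega>\<bar> < 1" using in1 s st by simp
          ultimately have "X ?s \<omega> + \<epsilon> * \<Delta> < 1 + C * \<tau>" "- (1 + C * \<tau>) < X ?s \<omega> + \<epsilon> * \<Delta>" by linarith+
          moreover have "\<epsilon> * \<Delta> < 1 + C * \<tau> \<longleftrightarrow> \<Delta> < ?a" using eps by (simp add: pos_less_divide_eq mult.commute)
          moreover have "- (1 + C * \<tau>) < \<epsilon> * \<Delta> \<longleftrightarrow> - ?a < \<Delta>" using eps by (simp add: minus_divide_left pos_divide_less_eq mult.commute)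
          ultimately have "(0 \<le> X ?s \<omega> \<longrightarrow> \<Delta> < ?a) \<and> (X ?s \<omega> < 0 \<longrightarrow> - ?a < \<Delta>)" by linarith
          moreover have "\<omega> \<in> stay \<tau> ?a j" using Suc by simp
          ultimately show ?case using sp unfolding stay.simps \<Delta>_def by (cases "0 \<le> X ?s \<omega>") simp_all
        qed
        then show "\<omega> \<in> stay \<tau> ?a k" by blast
      qed
    qed
  qed
  also have "\<dots> \<le> (1 - p) ^ k" by (rule prob_stay[OF \<tau> p])
  finally show ?thesis by (simp add: survival_prob_def)
qed

end

text \<open>A block consists of \<open>N\<close> grid steps of length \<open>h\<close>; \<kappa> is
  the tolerance for oscillations within a step. \<theta> and \<theta>' are the exponential orders
  for grid increments and for oscillations. The condition
  \<open>c * \<theta> - \<Psi> (\<epsilon> * \<theta>) \<ge> 1\<close> says that the drift beats the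
  noise: large increments over a lag lose a factor \<open>exp (- 1)\<close> per unit of
  time.\<close>

locale block_scheme = exit_problem M F \<nu> \<alpha> L d \<mu> U \<epsilon> x X
  for M :: "'a measure" and F :: "real \<Rightarrow> 'a measure" and \<nu> :: "real measure" and \<alpha> :: real
    and L :: "real \<Rightarrow> 'a \<Rightarrow> real" and d \<mu> :: real and U :: "real \<Rightarrow> real" and \<epsilon> x :: real and X :: "real \<Rightarrow> 'a \<Rightarrow> real" +
  fixes C c \<eta> \<rho> a \<kappa> h \<theta> \<theta>' :: real and N :: nat
  assumes C: "C \<ge> 0" "\<And>v. \<bar>v\<bar> \<le> \<rho> \<Longrightarrow> \<bar>deriv U v\<bar> \<le> C"
    and c: "c > 0" "\<And>v. \<eta> \<le> v \<Longrightarrow> v \<le> \<rho> \<Longrightarrow> c \<le> deriv U v" "\<And>v. \<eta> \<le> v \<Longrightarrow> v \<le> \<rho> \<Longrightarrow> deriv U (- v) \<le> - c"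
    and xa: "\<bar>x\<bar> \<le> a" "a < \<rho>" "\<rho> \<le> 1" and \<kappa>: "\<kappa> > 0" and h: "0 < h" "h \<le> 1" "h \<in> \<rat>"
    and \<theta>: "\<theta> \<ge> 0" "c * \<theta> - \<Psi> (\<epsilon> * \<theta>) \<ge> 1" and \<theta>': "\<theta>' \<ge> 0"
begin

definition slack :: real where "slack = 3 * \<kappa> + c * h"

definition bad_increment :: "real \<Rightarrow> real \<Rightarrow> nat \<Rightarrow> nat \<Rightarrow> real \<Rightarrow> 'a set" where
  "bad_increment u \<sigma> i j g =
     {\<omega>\<in>space M. (g + c * (real (j - i) * h)) / \<epsilon> \<le> \<sigma> * (L (u + real j * h) \<omega> - L (u + real i * h) \<omega>)}"

lemma bad_increment_in_F:
  assumes "0 \<le> u" "i \<le> j" "j \<le> N"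
  shows "bad_increment u \<sigma> i j g \<in> sets (F (u + real N * h))"
proof -
  have ij: "0 \<le> u + real i * h" "u + real i * h \<le> u + real j * h" "u + real j * h \<le> u + real N * h"
    using assms h by (auto intro: mult_right_mono)
  have "bad_increment u \<sigma> i j g = {\<omega>\<in>space M. L (u + real j * h) \<omega> - L (u + real i * h) \<omega> \<in> {v. (g + c * (real (j - i) * h)) / \<epsilon> \<le> \<sigma> * v}}"
    unfolding bad_increment_def by simp
  also have "\<dots> \<in> sets (F (u + real N * h))" by (rule increment_event_in_F[OF ij]) measurable
  finally show ?thesis .
qed

text \<open>The Chernoff bound of order \<open>\<epsilon> * \<theta>\<close>: for lag
  \<open>D\<close> the exponent is \<open>- \<theta> * g - D * (c * \<theta> - \<Psi> (\<epsilon> *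
  \<theta>))\<close>, and the bracket is at least 1.\<close>

lemma prob_bad_increment:
  assumes u: "0 \<le> u" "i \<le> j" and G: "G \<in> sets (F u)" and \<sigma>: "\<bar>\<sigma>\<bar> = 1"
  shows "prob (G \<inter> bad_increment u \<sigma> i j g) \<le> prob G * (exp (- \<theta> * g) * exp (- (real (j - i) * h)))"
proof -
  let ?D = "real (j - i) * h"
  have D: "(u + real j * h) - (u + real i * h) = ?D" using u(2) by (simp add: of_nat_diff algebra_simps)
  have D0: "?D \<ge> 0" using h by simp
  have "prob (G \<inter> bad_increment u \<sigma> i j g) \<le> prob G * exp (- (\<epsilon> * \<theta>) * ((g + c * ?D) / \<epsilon>) + ((u + real j * h) - (u + real i * h)) * \<Psi> (\<epsilon> * \<theta>))"
    unfolding bad_increment_def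
  proof (rule increment_tail_le[OF u(1) _ _ _ G _ \<sigma>])
    show "u \<le> u + real i * h" using h by simp
    show "u + real i * h \<le> u + real j * h" using u h by (simp add: mult_right_mono)
    show "(u + real j * h) - (u + real i * h) \<in> \<rat>" unfolding D using h by simp
    show "\<epsilon> * \<theta> \<ge> 0" using eps \<theta> by simp
  qed
  also have "- (\<epsilon> * \<theta>) * ((g + c * ?D) / \<epsilon>) + ((u + real j * h) - (u + real i * h)) * \<Psi> (\<epsilon> * \<theta>) = - \<theta> * g - ?D * (c * \<theta> - \<Psi> (\<epsilon> * \<theta>))"
    unfolding D using eps by (simp add: field_simps)
  also have "prob G * exp (- \<theta> * g - ?D * (c * \<theta> - \<Psi> (\<epsilon> * \<theta>))) \<le> prob G * exp (- \<theta> * g - ?D)"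
    using mult_left_mono[OF \<theta>(2) D0] by (intro mult_left_mono) simp_all
  also have "exp (- \<theta> * g - ?D) = exp (- \<theta> * g) * exp (- ?D)" by (simp add: exp_diff exp_minus divide_inverse)
  finally show ?thesis .
qed

text \<open>The four families are the grid conditions \<open>B2\<close> to \<open>B5\<close> of
  \<open>block_confinement\<close>, with levels \<open>g\<close>. They are parametrised by the lag,
  so that summing probabilities gives geometric series; only the first family has a free starting
  point and hence a factor of order \<open>N\<close>.\<close>

definition bad_index :: "(nat \<times> nat \<times> real) set" where
  "bad_index = (\<lambda>(i, k). (i, i + k, \<rho> - \<eta> - slack)) ` {(i, k). i + k \<le> N} \<union> (\<lambda>j. (0, j, \<rho> - a - slack)) ` {..N} \<union>
     (\<lambda>k. (N - k, N, a - \<eta> - slack)) ` {..N} \<union> {(0, N, - slack)}"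

lemma finite_index: "finite {(i, k). i + k \<le> N}"
  by (rule finite_subset[of _ "{..N} \<times> {..N}"]) auto

lemma bad_index: "finite bad_index" "(i, j, g) \<in> bad_index \<Longrightarrow> i \<le> j \<and> j \<le> N"
  unfolding bad_index_def using finite_index by auto

definition bad :: "real \<Rightarrow> 'a set" where
  "bad u = (\<Union>i<N. oscillation (u + real i * h) h (\<kappa> / \<epsilon>)) \<union>
     (\<Union>(i, j, g)\<in>bad_index. bad_increment u 1 i j g \<union> bad_increment u (- 1) i j g)"

lemma bad_in_F: "0 \<le> u \<Longrightarrow> bad u \<in> sets (F (u + real N * h))"
proof -
  assume u: "0 \<le> u"
  have o: "oscillation (u + real i * h) h (\<kappa> / \<epsilon>) \<in> sets (F (u + real N * h))" if "i < N" for i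
  proof (rule oscillation_in_F)
    have "real i * h + h = real (Suc i) * h" by (simp add: algebra_simps)
    also have "\<dots> \<le> real N * h" using that h by (intro mult_right_mono) auto
    finally show "u + real i * h + h \<le> u + real N * h" by simp
  qed (use u h in auto)
  have b: "(case p of (i, j, g) \<Rightarrow> bad_increment u 1 i j g \<union> bad_increment u (- 1) i j g) \<in> sets (F (u + real N * h))"
    if "p \<in> bad_index" for p
  proof (cases p)
    case (fields i j g)
    then show ?thesis using bad_index(2)[of i j g] that u by (simp only: prod.case) (intro sets.Un bad_increment_in_F, simp_all)
  qed
  show ?thesis unfolding bad_def by (intro sets.Un sets.finite_UN o b bad_index(1)) auto
qed

text \<open>The union bound for one block. In the last term the level is negative, so smallness
  comes only from the length \<open>real N * h\<close> of the block.\<close>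

definition bad_bound :: real where
  "bad_bound = real N * (2 * exp (- \<theta>' * (\<kappa> / \<epsilon>) + h * \<Psi> \<theta>')) +
     2 * (exp (- \<theta> * (\<rho> - \<eta> - slack)) * (real (Suc N) * (2 / h)) + exp (- \<theta> * (\<rho> - a - slack)) * (2 / h) +
          exp (- \<theta> * (a - \<eta> - slack)) * (2 / h) + exp (\<theta> * slack) * exp (- (real N * h)))"

lemma sum_bad_index:
  "(\<Sum>(i, j, g)\<in>bad_index. exp (- \<theta> * g) * exp (- (real (j - i) * h))) \<le>
     exp (- \<theta> * (\<rho> - \<eta> - slack)) * (real (Suc N) * (2 / h)) + exp (- \<theta> * (\<rho> - a - slack)) * (2 / h) +
          exp (- \<theta> * (a - \<eta> - slack)) * (2 / h) + exp (\<theta> * slack) * exp (- (real N * h))"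
proof -
  define f where "f = (\<lambda>(i::nat, j::nat, g::real). exp (- \<theta> * g) * exp (- (real (j - i) * h)))"
  have f0: "f p \<ge> 0" for p by (simp add: f_def split: prod.split)
  \<comment> \<open>Distinct descriptions may give the same index triple; as the summands are
    nonnegative, counting with repetition only enlarges the sum.\<close>
  have Un: "sum f (A \<union> B) \<le> sum f A + sum f B" if "finite A" "finite B" for A B
    using sum.union_inter[OF that, of f] sum_nonneg[of "A \<inter> B" f] f0 by simp
  have img: "sum f (g ` A) \<le> sum (f \<circ> g) A" if "finite A" for g :: "'x \<Rightarrow> nat \<times> nat \<times> real" and A
    using sum_image_le[OF that, of f g] f0 by simp
  let ?A = "(\<lambda>(i, k). (i, i + k, \<rho> - \<eta> - slack)) ` {(i, k). i + k \<le> N}"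
  let ?B = "(\<lambda>j. (0::nat, j, \<rho> - a - slack)) ` {..N}"
  let ?C = "(\<lambda>k. (N - k, N, a - \<eta> - slack)) ` {..N}"
  let ?D = "{(0::nat, N, - slack)}"
  have "sum f ?A \<le> (\<Sum>(i, k)\<in>{(i, k). i + k \<le> N}. exp (- \<theta> * (\<rho> - \<eta> - slack)) * exp (- (real k * h)))"
    by (rule order_trans[OF img[OF finite_index]]) (simp add: f_def comp_def split_beta')
  also have "\<dots> \<le> (\<Sum>(i, k)\<in>{..N} \<times> {..N}. exp (- \<theta> * (\<rho> - \<eta> - slack)) * exp (- (real k * h)))"
    by (rule sum_mono2) auto
  also have "\<dots> = real (Suc N) * (exp (- \<theta> * (\<rho> - \<eta> - slack)) * (\<Sum>k\<le>N. exp (- (real k * h))))"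
    by (simp add: sum.cartesian_product[symmetric] sum_distrib_left)
  also have "\<dots> \<le> real (Suc N) * (exp (- \<theta> * (\<rho> - \<eta> - slack)) * (2 / h))"
    using sum_exp_geometric_le[OF h(1,2)] by (intro mult_left_mono) simp_all
  finally have A: "sum f ?A \<le> exp (- \<theta> * (\<rho> - \<eta> - slack)) * (real (Suc N) * (2 / h))" by (simp only: mult.left_commute)
  have "sum f ?B \<le> (\<Sum>k\<le>N. exp (- \<theta> * (\<rho> - a - slack)) * exp (- (real k * h)))"
    by (rule order_trans[OF img]) (simp_all add: f_def comp_def)
  also have "\<dots> \<le> exp (- \<theta> * (\<rho> - a - slack)) * (2 / h)"
    unfolding sum_distrib_left[symmetric] using sum_exp_geometric_le[OF h(1,2)] by (intro mult_left_mono) simp_all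
  finally have B: "sum f ?B \<le> exp (- \<theta> * (\<rho> - a - slack)) * (2 / h)" .
  have "sum f ?C \<le> (\<Sum>k\<le>N. exp (- \<theta> * (a - \<eta> - slack)) * exp (- (real k * h)))"
    by (rule order_trans[OF img]) (auto simp: f_def comp_def intro!: sum_mono)
  also have "\<dots> \<le> exp (- \<theta> * (a - \<eta> - slack)) * (2 / h)"
    unfolding sum_distrib_left[symmetric] using sum_exp_geometric_le[OF h(1,2)] by (intro mult_left_mono) simp_all
  finally have C: "sum f ?C \<le> exp (- \<theta> * (a - \<eta> - slack)) * (2 / h)" .
  have D: "sum f ?D = exp (\<theta> * slack) * exp (- (real N * h))" by (simp add: f_def)
  have fin: "finite ?A" "finite ?B" "finite ?C" "finite ?D" using finite_index by simp_all
  have "sum f bad_index \<le> sum f (?A \<union> ?B \<union> ?C) + sum f ?D" unfolding bad_index_def using fin by (intro Un) simp_all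
  also have "sum f (?A \<union> ?B \<union> ?C) \<le> sum f (?A \<union> ?B) + sum f ?C" using fin by (intro Un) simp_all
  also have "sum f (?A \<union> ?B) \<le> sum f ?A + sum f ?B" using fin by (intro Un) simp_all
  finally show ?thesis unfolding f_def[symmetric] using A B C D by linarith
qed

lemma prob_bad:
  assumes u: "0 \<le> u" and G: "G \<in> sets (F u)"
  shows "prob (G \<inter> bad u) \<le> prob G * bad_bound"
proof -
  have GM: "G \<in> events" by (rule sets_F_D[OF G u])
  have uN: "0 \<le> u + real N * h" using u h by simp
  have oM: "oscillation (u + real i * h) h (\<kappa> / \<epsilon>) \<in> events" for i
    using u h by (intro sets_F_D[OF oscillation_in_F[OF _ _ order_refl]]) auto
  have bM: "bad_increment u \<sigma> i j g \<in> events" if "(i, j, g) \<in> bad_index" for i j g \<sigma>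
    using bad_index(2)[OF that] u by (intro sets_F_D[OF bad_increment_in_F uN]) auto
  let ?O = "\<Union>i<N. G \<inter> oscillation (u + real i * h) h (\<kappa> / \<epsilon>)"
  let ?I = "\<lambda>\<sigma>. \<Union>p\<in>bad_index. G \<inter> (case p of (i, j, g) \<Rightarrow> bad_increment u \<sigma> i j g)"
  have IM: "G \<inter> (case p of (i, j, g) \<Rightarrow> bad_increment u \<sigma> i j g) \<in> events" if "p \<in> bad_index" for p \<sigma>
  proof (cases p)
    case (fields i j g)
    then show ?thesis using bM[of i j g \<sigma>] GM that by auto
  qed
  have O: "prob ?O \<le> prob G * (real N * (2 * exp (- \<theta>' * (\<kappa> / \<epsilon>) + h * \<Psi> \<theta>')))"
  proof -
    have "prob ?O \<le> (\<Sum>i<N. prob (G \<inter> oscillation (u + real i * h) h (\<kappa> / \<epsilon>)))"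
      by (rule measure_UNION_le) (use GM oM in auto)
    also have "\<dots> \<le> (\<Sum>i<N. prob G * (2 * exp (- \<theta>' * (\<kappa> / \<epsilon>) + h * \<Psi> \<theta>')))"
    proof (rule sum_mono)
      fix i
      have ui: "0 \<le> u + real i * h" "u \<le> u + real i * h" using u h by auto
      have "G \<in> sets (F (u + real i * h))" using mono[OF u ui(2)] G by blast
      from prob_oscillation_le[OF ui(1) h(1,3) this \<theta>', of "\<kappa> / \<epsilon>"]
      show "prob (G \<inter> oscillation (u + real i * h) h (\<kappa> / \<epsilon>)) \<le> prob G * (2 * exp (- \<theta>' * (\<kappa> / \<epsilon>) + h * \<Psi> \<theta>'))" .
    qed
    also have "\<dots> = prob G * (real N * (2 * exp (- \<theta>' * (\<kappa> / \<epsilon>) + h * \<Psi> \<theta>')))" by simp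
    finally show ?thesis .
  qed
  have I: "prob (?I \<sigma>) \<le> prob G * (\<Sum>(i, j, g)\<in>bad_index. exp (- \<theta> * g) * exp (- (real (j - i) * h)))" if \<sigma>: "\<bar>\<sigma>\<bar> = 1" for \<sigma>
  proof -
    have "prob (?I \<sigma>) \<le> (\<Sum>p\<in>bad_index. prob (G \<inter> (case p of (i, j, g) \<Rightarrow> bad_increment u \<sigma> i j g)))"
      by (rule measure_UNION_le) (use bad_index(1) IM in auto)
    also have "\<dots> \<le> (\<Sum>p\<in>bad_index. prob G * (case p of (i, j, g) \<Rightarrow> exp (- \<theta> * g) * exp (- (real (j - i) * h))))"
    proof (rule sum_mono)
      fix p assume p: "p \<in> bad_index"
      show "prob (G \<inter> (case p of (i, j, g) \<Rightarrow> bad_increment u \<sigma> i j g)) \<le> prob G * (case p of (i, j, g) \<Rightarrow> exp (- \<theta> * g) * exp (- (real (j - i) * h)))"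
      proof (cases p)
        case (fields i j g)
        then show ?thesis using prob_bad_increment[OF u _ G \<sigma>, of i j g] bad_index(2)[of i j g] p by simp
      qed
    qed
    also have "\<dots> = prob G * (\<Sum>(i, j, g)\<in>bad_index. exp (- \<theta> * g) * exp (- (real (j - i) * h)))"
      by (simp only: sum_distrib_left)
    finally show ?thesis .
  qed
  have ev: "?O \<in> events" "?I 1 \<in> events" "?I (- 1) \<in> events"
    using GM oM IM bad_index(1) by (intro sets.finite_UN; auto)+
  have "G \<inter> bad u \<subseteq> ?O \<union> (?I 1 \<union> ?I (- 1))" unfolding bad_def by fastforce
  then have "prob (G \<inter> bad u) \<le> prob (?O \<union> (?I 1 \<union> ?I (- 1)))" using ev by (intro finite_measure_mono) auto
  also have "\<dots> \<le> prob ?O + prob (?I 1 \<union> ?I (- 1))" using ev by (intro measure_Un_le) auto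
  also have "prob (?I 1 \<union> ?I (- 1)) \<le> prob (?I 1) + prob (?I (- 1))" using ev by (intro measure_Un_le) auto
  also have "prob ?O + (prob (?I 1) + prob (?I (- 1))) \<le> prob G * bad_bound"
  proof -
    let ?S = "\<Sum>(i, j, g)\<in>bad_index. exp (- \<theta> * g) * exp (- (real (j - i) * h))"
    have "prob ?O + (prob (?I 1) + prob (?I (- 1))) \<le> prob G * (real N * (2 * exp (- \<theta>' * (\<kappa> / \<epsilon>) + h * \<Psi> \<theta>'))) + (prob G * ?S + prob G * ?S)"
      using O I[of 1] I[of "- 1"] by (intro add_mono) simp_all
    also have "\<dots> = prob G * (real N * (2 * exp (- \<theta>' * (\<kappa> / \<epsilon>) + h * \<Psi> \<theta>')) + 2 * ?S)" by (simp only: distrib_left)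
    also have "\<dots> \<le> prob G * bad_bound"
      unfolding bad_bound_def using sum_bad_index by (intro mult_left_mono add_left_mono) simp_all
    finally show ?thesis .
  qed
  finally show ?thesis by linarith
qed

text \<open>An event about \<open>L\<close> alone, which makes the blocks independent of their past.
  That \<open>X\<close> is indeed confined on it is a separate, pathwise statement.\<close>

primrec confined :: "nat \<Rightarrow> 'a set" where
  "confined 0 = space M"
| "confined (Suc k) = confined k - bad (real k * (real N * h))"

lemma confined_in_F: "confined k \<in> sets (F (real k * (real N * h)))"
proof (induction k)
  case 0
  then show ?case using sets.top[of "F 0"] by simp
next
  case (Suc k)
  let ?t = "real k * (real N * h)"
  have t: "0 \<le> ?t" "?t \<le> ?t + real N * h" using h by auto
  have e: "real (Suc k) * (real N * h) = ?t + real N * h" by (simp add: algebra_simps)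
  have "confined k \<in> sets (F (?t + real N * h))" using mono[OF t] Suc by blast
  then show ?case unfolding e confined.simps using bad_in_F[OF t(1)] by (rule sets.Diff)
qed

lemma prob_confined:
  assumes "bad_bound \<le> 1"
  shows "(1 - bad_bound) ^ k \<le> prob (confined k)"
proof (induction k)
  case 0
  then show ?case by (simp add: prob_space)
next
  case (Suc k)
  let ?t = "real k * (real N * h)"
  have t: "0 \<le> ?t" "0 \<le> ?t + real N * h" using h by auto
  have ev: "confined k \<in> events" "bad ?t \<in> events"
    using sets_F_D[OF confined_in_F t(1)] sets_F_D[OF bad_in_F[OF t(1)] t(2)] by auto
  have "(1 - bad_bound) ^ Suc k \<le> prob (confined k) * (1 - bad_bound)"
    unfolding power_Suc2 using assms by (intro mult_right_mono[OF Suc]) simp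
  also have "\<dots> \<le> prob (confined k) - prob (confined k \<inter> bad ?t)"
    using prob_bad[OF t(1) confined_in_F] by (simp add: right_diff_distrib)
  also have "\<dots> = prob (confined k - confined k \<inter> bad ?t)"
    using ev by (intro finite_measure_Diff[symmetric]) auto
  also have "confined k - confined k \<inter> bad ?t = confined (Suc k)" by auto
  finally show ?case .
qed

lemma confined_path:
  assumes r: "regular \<omega>" and w: "\<omega> \<in> confined k"
  shows "(\<forall>r. 0 \<le> r \<longrightarrow> r < real k * (real N * h) \<longrightarrow> \<bar>X r \<omega>\<bar> < \<rho>) \<and> \<bar>X (real k * (real N * h)) \<omega>\<bar> \<le> a"
  using w
proof (induction k)
  case 0
  then show ?case using regular_start[OF r] xa by simp
next
  case (Suc k)
  let ?u = "real k * (real N * h)" let ?l = "\<lambda>t. \<epsilon> * L t \<omega>"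
  have u: "0 \<le> ?u" using h by simp
  have cX: "cadlag (\<lambda>t. X t \<omega>)" and cL: "cadlag (\<lambda>t. L t \<omega>)" and sp: "\<omega> \<in> space M" using r by (auto simp: regular_def)
  have IH: "\<And>r. 0 \<le> r \<Longrightarrow> r < ?u \<Longrightarrow> \<bar>X r \<omega>\<bar> < \<rho>" "\<bar>X ?u \<omega>\<bar> \<le> a" using Suc by auto
  have nb: "\<omega> \<notin> bad ?u" using Suc.prems by simp
  have inc: "\<sigma> * (?l (?u + real j * h) - ?l (?u + real i * h)) - c * (real (j - i) * h) \<le> g"
    if "(i, j, g) \<in> bad_index" "\<bar>\<sigma>\<bar> = 1" for i j g \<sigma>
  proof -
    have "\<omega> \<notin> bad_increment ?u 1 i j g" "\<omega> \<notin> bad_increment ?u (- 1) i j g" using nb that(1) unfolding bad_def by blast+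
    moreover have "\<sigma> = 1 \<or> \<sigma> = - 1" using that(2) by linarith
    ultimately have "\<omega> \<notin> bad_increment ?u \<sigma> i j g" by auto
    then have "\<sigma> * (L (?u + real j * h) \<omega> - L (?u + real i * h) \<omega>) < (g + c * (real (j - i) * h)) / \<epsilon>"
      using sp by (simp add: bad_increment_def not_le)
    then have "\<sigma> * (L (?u + real j * h) \<omega> - L (?u + real i * h) \<omega>) * \<epsilon> < g + c * (real (j - i) * h)"
      using eps by (simp only: pos_less_divide_eq)
    moreover have "\<sigma> * (?l (?u + real j * h) - ?l (?u + real i * h)) = \<sigma> * (L (?u + real j * h) \<omega> - L (?u + real i * h) \<omega>) * \<epsilon>"
      by (simp add: algebra_simps)
    ultimately show ?thesis by linarith
  qed
  have idx: "i \<le> j \<Longrightarrow> j \<le> N \<Longrightarrow> (i, j, \<rho> - \<eta> - slack) \<in> bad_index" "j \<le> N \<Longrightarrow> (0, j, \<rho> - a - slack) \<in> bad_index"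
    "i \<le> N \<Longrightarrow> (i, N, a - \<eta> - slack) \<in> bad_index" "(0, N, - slack) \<in> bad_index" for i j
  proof -
    show "(i, j, \<rho> - \<eta> - slack) \<in> bad_index" if "i \<le> j" "j \<le> N"
      unfolding bad_index_def by (intro UnI1 image_eqI[of _ _ "(i, j - i)"]) (use that in auto)
    show "(0, j, \<rho> - a - slack) \<in> bad_index" if "j \<le> N"
      unfolding bad_index_def using that by blast
    show "(i, N, a - \<eta> - slack) \<in> bad_index" if "i \<le> N"
      unfolding bad_index_def by (rule UnI1, rule UnI2, rule image_eqI[of _ _ "N - i"]) (use that in auto)
    show "(0, N, - slack) \<in> bad_index" unfolding bad_index_def by blast
  qed
  have osc: "\<forall>i<N. \<forall>r\<in>{0..h}. \<bar>?l (?u + real i * h + r) - ?l (?u + real i * h)\<bar> \<le> \<kappa>"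
  proof (intro allI impI ballI)
    fix i r assume i: "i < N" "r \<in> {0..h}"
    have "\<omega> \<notin> oscillation (?u + real i * h) h (\<kappa> / \<epsilon>)" using nb i(1) unfolding bad_def by blast
    moreover have "0 \<le> ?u + real i * h" using u h by simp
    ultimately have "\<bar>L (?u + real i * h + r) \<omega> - L (?u + real i * h) \<omega>\<bar> \<le> \<kappa> / \<epsilon>"
      using i(2) by (intro oscillation_bound[OF cL sp]) auto
    then have "\<bar>L (?u + real i * h + r) \<omega> - L (?u + real i * h) \<omega>\<bar> * \<epsilon> \<le> \<kappa>" using eps by (simp only: pos_le_divide_eq)
    moreover have "\<bar>?l (?u + real i * h + r) - ?l (?u + real i * h)\<bar> = \<bar>L (?u + real i * h + r) \<omega> - L (?u + real i * h) \<omega>\<bar> * \<epsilon>"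
      using eps by (simp add: right_diff_distrib[symmetric] abs_mult mult.commute)
    ultimately show "\<bar>?l (?u + real i * h + r) - ?l (?u + real i * h)\<bar> \<le> \<kappa>" by simp
  qed
  have D: "drift_bounds (\<lambda>t. X t \<omega>) ?l R C c \<eta>" if "\<And>r. 0 \<le> r \<Longrightarrow> r < R \<Longrightarrow> \<bar>X r \<omega>\<bar> < \<rho>" for R
    by (rule regular_drift_bounds[OF r _ C(2) c(2,3)]) (use that in \<open>auto intro: less_imp_le\<close>)
  have B3: "\<sigma> * (?l (?u + real j * h) - ?l ?u) - c * (real j * h) \<le> \<rho> - a - (3 * \<kappa> + c * h)" if "j \<le> N" "\<bar>\<sigma>\<bar> = 1" for j \<sigma>
    using inc[OF idx(2)[OF that(1)] that(2)] by (simp add: slack_def)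
  have B5: "\<sigma> * (?l (?u + real N * h) - ?l ?u) - c * (real N * h) \<le> - (3 * \<kappa> + c * h)" if "\<bar>\<sigma>\<bar> = 1" for \<sigma>
    using inc[OF idx(4) that] by (simp add: slack_def)
  have B: "\<And>r. 0 \<le> r \<Longrightarrow> r \<le> ?u + real N * h \<Longrightarrow> \<bar>X r \<omega>\<bar> < \<rho>" "\<bar>X (?u + real N * h) \<omega>\<bar> \<le> a"
    using block_confinement[where x = "\<lambda>t. X t \<omega>" and l = ?l, OF cX D C(1) c(1) h(1) u \<kappa> xa(2) osc inc[OF idx(1), unfolded slack_def] B3 inc[OF idx(3), unfolded slack_def] B5 IH(2) IH(1)]
    by blast+
  have e: "real (Suc k) * (real N * h) = ?u + real N * h" by (simp add: algebra_simps)
  show ?case unfolding e using B by (auto intro: less_imp_le)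
qed

lemma survival_prob_ge:
  assumes A: "bad_bound \<le> 1" and t: "0 \<le> t" "t < real k * (real N * h)"
  shows "(1 - bad_bound) ^ k \<le> survival_prob M X t"
proof -
  have "prob (confined k) \<le> prob {\<omega>\<in>space M. exit_time X \<omega> > ereal t}"
  proof (rule finite_measure_mono_AE)
    show "{\<omega>\<in>space M. exit_time X \<omega> > ereal t} \<in> events" by (rule survival_event[OF t(1)])
    show "AE \<omega> in M. \<omega> \<in> confined k \<longrightarrow> \<omega> \<in> {\<omega>\<in>space M. exit_time X \<omega> > ereal t}"
      using AE_regular
    proof eventually_elim
      case (elim \<omega>)
      have cX: "cadlag (\<lambda>t. X t \<omega>)" and sp: "\<omega> \<in> space M" using elim by (auto simp: regular_def)
      show ?case
      proof
        assume "\<omega> \<in> confined k"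
        then have lt: "\<bar>X r \<omega>\<bar> < \<rho>" if "0 \<le> r" "r < real k * (real N * h)" for r using confined_path[OF elim] that by blast
        have "\<bar>X s \<omega>\<bar> < 1" if "0 \<le> s" "s \<le> t" for s using lt[OF that(1)] that(2) t xa(3) by linarith
        then have "exit_time X \<omega> > ereal t" using exit_time_gt_iff[where X = X, OF cX t(1)] by blast
        then show "\<omega> \<in> {\<omega>\<in>space M. exit_time X \<omega> > ereal t}" using sp by simp
      qed
    qed
  qed
  then show ?thesis using prob_confined[OF A, of k] by (simp add: survival_prob_def)
qed

end

section \<open>Small noise asymptotics\<close>

text \<open>For \<open>A \<le> 1 / 2\<close> one has \<open>1 - A \<ge> exp (- (2 * A))\<close>. The
  separate factor \<open>1 - A\<close> pays for the block that contains \<open>t\<close>.\<close>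

lemma power_lower_exp:
  fixes A S t :: real
  assumes A: "0 \<le> A" "A \<le> 1 / 2" and S: "S > 0" and t: "t \<ge> 0"
  shows "(1 - A) * exp (- (2 * A * (t / S))) \<le> (1 - A) ^ Suc (nat \<lfloor>t / S\<rfloor>)"
proof -
  let ?k = "nat \<lfloor>t / S\<rfloor>"
  have k: "real ?k \<le> t / S" using S t by simp
  have "A * A \<le> A * (1 / 2)" using A by (intro mult_left_mono) auto
  then have "- (2 * A) \<le> - A - 2 * A\<^sup>2" by (simp add: power2_eq_square)
  also have "\<dots> \<le> ln (1 - A)" using A by (intro ln_one_minus_pos_lower_bound)
  finally have "exp (- (2 * A)) \<le> exp (ln (1 - A))" by (simp only: exp_le_cancel_iff)
  also have "\<dots> = 1 - A" using A by (intro exp_ln) linarith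
  finally have "exp (- (2 * A)) \<le> 1 - A" .
  then have "exp (- (2 * A)) ^ ?k \<le> (1 - A) ^ ?k" by (rule power_mono) simp
  moreover have "exp (- (2 * A * (t / S))) \<le> exp (- (2 * A)) ^ ?k"
    using mult_left_mono[OF k, of "2 * A"] A by (simp add: exp_of_nat_mult[symmetric] mult.commute)
  ultimately have "(1 - A) * exp (- (2 * A * (t / S))) \<le> (1 - A) * (1 - A) ^ ?k"
    using A by (intro mult_left_mono) auto
  then show ?thesis by simp
qed

section \<open>The exponential scale of the exit rate\<close>

context light_tailed_levy_measure
begin

definition exit_rate :: "real \<Rightarrow> real" where
  "exit_rate \<epsilon> = d_const \<alpha> * (\<bar>ln \<epsilon>\<bar> / (\<epsilon> * quantile \<nu> \<epsilon>))"

lemma D_rate_powr: "D_rate \<nu> \<alpha> \<epsilon> powr r = exp (- (r * exit_rate \<epsilon>))"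
  by (simp add: D_rate_def exit_rate_def powr_def)

lemma eps_quantile_tendsto: "((\<lambda>\<epsilon>. \<epsilon> * quantile \<nu> \<epsilon>) \<longlongrightarrow> 0) (at_right 0)"
proof (rule tendsto_sandwich)
  show "\<forall>\<^sub>F \<epsilon> in at_right 0. 0 \<le> \<epsilon> * quantile \<nu> \<epsilon>"
    using eventually_quantile_setup[of 1] by eventually_elim simp
  have "\<forall>\<^sub>F \<epsilon> in at_right 0. 1 \<le> \<bar>ln \<epsilon>\<bar> / quantile \<nu> \<epsilon>"
    using log_over_quantile_at_top by (simp add: filterlim_at_top)
  then show "\<forall>\<^sub>F \<epsilon> in at_right 0. \<epsilon> * quantile \<nu> \<epsilon> \<le> \<epsilon> * \<bar>ln \<epsilon>\<bar>"
    using eventually_quantile_setup[of 1]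
  proof eventually_elim
    case (elim \<epsilon>)
    then have q: "0 < quantile \<nu> \<epsilon>" by simp
    have "1 * quantile \<nu> \<epsilon> \<le> \<bar>ln \<epsilon>\<bar>" using elim(1) unfolding pos_le_divide_eq[OF q] .
    then have "quantile \<nu> \<epsilon> \<le> \<bar>ln \<epsilon>\<bar>" by (simp only: mult_1)
    then show ?case using elim by (intro mult_left_mono) auto
  qed
  show "((\<lambda>\<epsilon>. \<epsilon> * \<bar>ln \<epsilon>\<bar>) \<longlongrightarrow> 0) (at_right (0::real))" by real_asymp
qed simp

text \<open>As \<open>\<epsilon> * quantile \<nu> \<epsilon>\<close> tends to 0, every power of
  \<open>1 / \<epsilon>\<close> is absorbed by an arbitrarily small multiple of
  \<open>exit_rate\<close> in the exponent.\<close>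

lemma log_negligible:
  assumes \<gamma>: "\<gamma> > 0"
  shows "\<forall>\<^sub>F \<epsilon> in at_right 0. K * \<bar>ln \<epsilon>\<bar> \<le> \<gamma> * exit_rate \<epsilon>"
proof -
  have "\<forall>\<^sub>F \<epsilon> in at_right 0. \<epsilon> * quantile \<nu> \<epsilon> < \<gamma> * d_const \<alpha> / (\<bar>K\<bar> + 1)"
    using \<gamma> d_const_pos by (intro order_tendstoD(2)[OF eps_quantile_tendsto]) simp
  then show ?thesis using eventually_quantile_setup[of 1]
  proof eventually_elim
    case (elim \<epsilon>)
    let ?z = "\<epsilon> * quantile \<nu> \<epsilon>"
    have z: "?z > 0" using elim by simp
    have "?z * (\<bar>K\<bar> + 1) < \<gamma> * d_const \<alpha>" using elim(1) by (simp add: pos_less_divide_eq)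
    moreover have "K * ?z \<le> ?z * (\<bar>K\<bar> + 1)" using z by (simp add: distrib_left mult.commute) (smt (verit) mult_right_mono abs_ge_self)
    ultimately have "K \<le> \<gamma> * d_const \<alpha> / ?z" using z by (simp add: pos_le_divide_eq)
    then have "K * \<bar>ln \<epsilon>\<bar> \<le> \<gamma> * d_const \<alpha> / ?z * \<bar>ln \<epsilon>\<bar>" by (intro mult_right_mono) auto
    then show ?case by (simp add: exit_rate_def)
  qed
qed

lemma exit_rate_at_top: "filterlim exit_rate at_top (at_right 0)"
proof (rule filterlim_at_top_mono)
  show "filterlim (\<lambda>\<epsilon>::real. \<bar>ln \<epsilon>\<bar>) at_top (at_right 0)" by real_asymp
  show "\<forall>\<^sub>F \<epsilon> in at_right 0. \<bar>ln \<epsilon>\<bar> \<le> exit_rate \<epsilon>" using log_negligible[of 1 1] by simp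
qed

lemma eventually_exit_rate: "\<forall>\<^sub>F r in at_top. P r \<Longrightarrow> \<forall>\<^sub>F \<epsilon> in at_right 0. P (exit_rate \<epsilon>)"
  by (rule eventually_compose_filterlim[OF _ exit_rate_at_top])

text \<open>The optimal size of a single jump, in units of the quantile: about \<open>1 / (\<epsilon> * c * quantile \<nu> \<epsilon>)\<close>
  such jumps within bounded time are the cheapest way to travel a unit distance.\<close>

definition optimal_jump :: real where
  "optimal_jump = (\<alpha> - 1) powr (- (1 / \<alpha>))"

lemma optimal_jump:
  "optimal_jump > 0" "optimal_jump powr \<alpha> = 1 / (\<alpha> - 1)" "\<alpha> / ((\<alpha> - 1) * optimal_jump) = d_const \<alpha>"
proof -
  show "optimal_jump > 0" using alpha by (simp add: optimal_jump_def)
  have "- (1 / \<alpha>) * \<alpha> = - 1" using alpha by simp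
  then show "optimal_jump powr \<alpha> = 1 / (\<alpha> - 1)"
    unfolding optimal_jump_def powr_powr using alpha by (simp add: powr_minus_divide)
  show "\<alpha> / ((\<alpha> - 1) * optimal_jump) = d_const \<alpha>"
  proof -
    have "(\<alpha> - 1) * optimal_jump = (\<alpha> - 1) powr (1 + - (1 / \<alpha>))"
      unfolding optimal_jump_def using alpha by (intro powr_mult_base) simp
    moreover have "d_const \<alpha> = \<alpha> * (\<alpha> - 1) powr (- (1 + - (1 / \<alpha>)))" by (simp add: d_const_def)
    ultimately show ?thesis using powr_minus_divide[of "\<alpha> - 1" "1 - 1 / \<alpha>"] by simp
  qed
qed

end

context light_tailed_levy_process
begin

lemma large_deviation_lower_bound:
  assumes \<delta>: "\<delta> > 0" and C: "C \<ge> 0"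
  shows "\<exists>m\<ge>1. \<forall>\<^sub>F \<epsilon> in at_right 0. \<forall>\<sigma>. \<bar>\<sigma>\<bar> = 1 \<longrightarrow>
     exp (- ((1 + \<delta>) * exit_rate \<epsilon>)) \<le> prob {\<omega>\<in>space M. (1 + C * (1 / real m)) / \<epsilon> \<le> \<sigma> * L (1 / real m) \<omega>}"
proof -
  \<comment> \<open>The relative error allowed in each approximation. The accumulated factor
    \<open>(1 + g) ^ 3 * (1 + 2 * g)\<close> is at most \<open>1 + 30 * g\<close>, hence at most
    \<open>1 + \<delta>\<close>.\<close>
  define g where "g = min 1 (\<delta> / 15) / 2"
  have g: "g > 0" "2 * g \<le> 1" "30 * g \<le> \<delta>" using \<delta> by (auto simp: g_def min_def)
  have g4: "(1 + g) ^ 3 * (1 + 2 * g) \<le> 1 + \<delta>"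
  proof -
    have gg: "g * g \<le> 1 * g" "g * (g * g) \<le> 1 * (g * g)" using g by (intro mult_right_mono; simp)+
    have "(1 + g) ^ 3 = 1 + 3 * g + 3 * (g * g) + g * (g * g)" by (simp add: power3_eq_cube algebra_simps)
    then have "(1 + g) ^ 3 \<le> 1 + 7 * g" using gg by linarith
    then have "(1 + g) ^ 3 * (1 + 2 * g) \<le> (1 + 7 * g) * (1 + 2 * g)" using g by (intro mult_right_mono) auto
    also have "\<dots> = 1 + 9 * g + 14 * (g * g)" by (simp add: algebra_simps)
    also have "\<dots> \<le> 1 + 30 * g" using gg g by linarith
    finally have "(1 + g) ^ 3 * (1 + 2 * g) \<le> 1 + 30 * g" .
    then show ?thesis using g by simp
  qed
  \<comment> \<open>The time horizon \<open>1 / m\<close> is so short that the drift undoes at most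
    \<open>g\<close> of the distance.\<close>
  define m where "m = Suc (nat \<lceil>C / g\<rceil>)"
  have m: "m \<ge> 1" by (simp add: m_def)
  have "C / g \<le> real m" unfolding m_def by linarith
  then have mC: "C * (1 / real m) \<le> g" using g m by (simp add: field_simps)
  \<comment> \<open>The part of each jump that the remainder of the increment and the weak limit may
    consume.\<close>
  define M1 where "M1 = tail_shift d \<mu> + 1"
  define c where "c = optimal_jump"
  note c = optimal_jump[folded c_def]
  have "\<forall>\<^sub>F \<epsilon> in at_right 0. log_tail \<nu> (c * quantile \<nu> \<epsilon>) / \<bar>ln \<epsilon>\<bar> < c powr \<alpha> + g"
    using g by (intro order_tendstoD(2)[OF log_tail_quantile[OF c(1)]]) simp
  moreover have "\<forall>\<^sub>F \<epsilon> in at_right 0. \<epsilon> * quantile \<nu> \<epsilon> < g / c"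
    using g c by (intro order_tendstoD(2)[OF eps_quantile_tendsto]) simp
  ultimately have "\<forall>\<^sub>F \<epsilon> in at_right 0. \<forall>\<sigma>. \<bar>\<sigma>\<bar> = 1 \<longrightarrow>
     exp (- ((1 + \<delta>) * exit_rate \<epsilon>)) \<le> prob {\<omega>\<in>space M. (1 + C * (1 / real m)) / \<epsilon> \<le> \<sigma> * L (1 / real m) \<omega>}"
    using eventually_quantile_setup[of "ln (4 * real m) / g + \<bar>(1 + g) / g * M1\<bar> / c + 8 / c + 1"]
  proof eventually_elim
    case (elim \<epsilon>)
    let ?q = "quantile \<nu> \<epsilon>" and ?l = "\<bar>ln \<epsilon>\<bar>"
    define y where "y = c * ?q"
    have e: "0 < \<epsilon>" "\<epsilon> < 1" using elim by auto
    have nn: "ln (4 * real m) / g \<ge> 0" "\<bar>(1 + g) / g * M1\<bar> / c \<ge> 0" "8 / c \<ge> 0" using g c m by auto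
    have Z: "ln (4 * real m) / g \<le> ?l" "1 \<le> ?l" "\<bar>(1 + g) / g * M1\<bar> / c \<le> ?q" "8 / c \<le> ?q" "1 \<le> ?q"
      using elim nn by linarith+
    have y8: "8 \<le> y" using Z(4)[unfolded pos_divide_le_eq[OF c(1)]] by (simp only: y_def mult.commute)
    have "\<bar>(1 + g) / g * M1\<bar> \<le> y" using Z(3)[unfolded pos_divide_le_eq[OF c(1)]] by (simp only: y_def mult.commute)
    then have "(1 + g) / g * M1 \<le> y" by linarith
    then have "(1 + g) * M1 / g \<le> y" by simp
    then have "(1 + g) * M1 \<le> g * y" unfolding pos_divide_le_eq[OF g(1)] by (simp only: mult.commute)
    then have yg: "y \<le> (y - M1) * (1 + g)" by (simp add: algebra_simps)
    have g1: "0 < 1 + g" using g by simp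
    have yM: "y / (1 + g) \<le> y - M1" unfolding pos_divide_le_eq[OF g1] by (rule yg)
    have yM0: "y - M1 > 0" using yM y8 g by (smt (verit) divide_pos_pos)
    have fy: "log_tail \<nu> y \<le> (1 / (\<alpha> - 1) + g) * ?l"
    proof -
      have "log_tail \<nu> (c * ?q) / ?l \<le> 1 / (\<alpha> - 1) + g" using elim(1) c(2) by simp
      then show ?thesis using Z(2) by (simp add: y_def pos_divide_le_eq)
    qed
    have fy0: "log_tail \<nu> y > 0" using y8 by (intro log_tail_pos) simp
    have ey: "0 < \<epsilon> * y" "\<epsilon> * y \<le> g"
    proof -
      show "0 < \<epsilon> * y" using e y8 by simp
      have "\<epsilon> * ?q * c \<le> g" using elim(2) c by (simp add: pos_less_divide_eq)
      then show "\<epsilon> * y \<le> g" by (simp add: y_def mult_ac)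
    qed
    \<comment> \<open>The distance \<open>L\<close> has to travel, and the number of increments of
      size \<open>y - M1\<close> that cover it.\<close>
    define b where "b = (1 + C * (1 / real m)) / \<epsilon>"
    define n where "n = nat \<lceil>b / (y - M1)\<rceil>"
    have b0: "b > 0" using C e by (simp add: b_def add_pos_nonneg)
    have n0: "n \<ge> 1" using b0 yM0 by (simp add: n_def Suc_le_eq)
    have nb: "b \<le> real n * (y - M1)"
    proof -
      have "b / (y - M1) \<le> real n" unfolding n_def by linarith
      then show ?thesis using yM0 by (simp add: pos_divide_le_eq)
    qed
    have n_le: "real n \<le> (1 + g) ^ 3 / (\<epsilon> * y)"
    proof -
      have "b / (y - M1) \<ge> 0" using b0 yM0 by simp
      then have r0: "real n \<le> b / (y - M1) + 1" unfolding n_def by linarith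
      have "b / (y - M1) \<le> b / (y / (1 + g))" using yM b0 y8 g by (intro divide_left_mono mult_pos_pos yM0) auto
      also have "\<dots> \<le> ((1 + g) / \<epsilon>) / (y / (1 + g))" unfolding b_def using mC e y8 g by (intro divide_right_mono) auto
      also have "\<dots> = (1 + g)\<^sup>2 / (\<epsilon> * y)" by (simp add: power2_eq_square)
      finally have r1: "b / (y - M1) \<le> (1 + g)\<^sup>2 / (\<epsilon> * y)" .
      have r2: "1 \<le> (1 + g)\<^sup>2 * g / (\<epsilon> * y)"
      proof -
        have "1 * (\<epsilon> * y) \<le> (1 + g)\<^sup>2 * g" using ey g by (intro mult_mono) (auto simp: power2_eq_square algebra_simps)
        then show ?thesis using ey(1) by (simp add: pos_le_divide_eq)
      qed
      have "real n \<le> (1 + g)\<^sup>2 / (\<epsilon> * y) + (1 + g)\<^sup>2 * g / (\<epsilon> * y)" using r0 r1 r2 by linarith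
      also have "\<dots> = (1 + g) ^ 3 / (\<epsilon> * y)"
        by (simp add: add_divide_distrib[symmetric] power3_eq_cube power2_eq_square algebra_simps)
      finally show ?thesis .
    qed
    have ln_n: "ln (real n) \<le> ?l"
    proof -
      have "(1 + g) ^ 3 \<le> 2 ^ 3" using g by (intro power_mono) auto
      then have "(1 + g) ^ 3 / (\<epsilon> * y) \<le> y / (\<epsilon> * y)" using y8 ey by (intro divide_right_mono) auto
      also have "\<dots> = 1 / \<epsilon>" using y8 by simp
      finally have "real n \<le> 1 / \<epsilon>" using n_le by simp
      then have "ln (real n) \<le> ln (1 / \<epsilon>)" using n0 by (intro ln_mono) auto
      then show ?thesis using e by (simp add: ln_div)
    qed
    \<comment> \<open>A time piece of length \<open>1 / (m * n)\<close> contributes a probability of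
      at least the tail divided by \<open>4 * m * n\<close>. Since
      \<open>n \<le> 1 / \<epsilon>\<close>, the entropy \<open>ln n\<close> adds one
      \<open>\<bar>ln \<epsilon>\<bar>\<close> to the \<open>1 / (\<alpha> - 1)\<close> of the tail
      at the optimal size, giving \<open>\<alpha> / (\<alpha> - 1)\<close> per jump.\<close>
    have cost: "real n * (log_tail \<nu> y + ln (4 * (real m * real n))) \<le> (1 + \<delta>) * exit_rate \<epsilon>"
    proof -
      have "ln (4 * (real m * real n)) = ln (4 * real m) + ln (real n)" using m n0 by (simp add: ln_mult mult.assoc[symmetric])
      also have "ln (4 * real m) \<le> g * ?l" using Z(1) g by (simp add: pos_divide_le_eq mult.commute)
      finally have "log_tail \<nu> y + ln (4 * (real m * real n)) \<le> (1 / (\<alpha> - 1) + g) * ?l + (g * ?l + ?l)" using fy ln_n by linarith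
      also have "\<dots> = (\<alpha> / (\<alpha> - 1) + 2 * g) * ?l" using alpha by (simp add: field_simps)
      also have "\<dots> \<le> (\<alpha> / (\<alpha> - 1) * (1 + 2 * g)) * ?l"
      proof (rule mult_right_mono)
        have "1 \<le> \<alpha> / (\<alpha> - 1)" using alpha by simp
        then have "1 * (2 * g) \<le> \<alpha> / (\<alpha> - 1) * (2 * g)" using g by (intro mult_right_mono) auto
        then show "\<alpha> / (\<alpha> - 1) + 2 * g \<le> \<alpha> / (\<alpha> - 1) * (1 + 2 * g)" by (simp add: distrib_left)
      qed simp
      finally have 1: "log_tail \<nu> y + ln (4 * (real m * real n)) \<le> (\<alpha> / (\<alpha> - 1) * (1 + 2 * g)) * ?l" .
      have "0 \<le> ln (4 * (real m * real n))"
      proof -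
        have "1 \<le> real m * real n" using m n0 by (metis mult_1 mult_mono of_nat_0_le_iff of_nat_1 of_nat_le_iff zero_le_one)
        then show ?thesis by simp
      qed
      then have "real n * (log_tail \<nu> y + ln (4 * (real m * real n))) \<le> (1 + g) ^ 3 / (\<epsilon> * y) * ((\<alpha> / (\<alpha> - 1) * (1 + 2 * g)) * ?l)"
        using n_le 1 fy0 ey g by (intro mult_mono) auto
      also have "\<dots> = ((1 + g) ^ 3 * (1 + 2 * g)) * (\<alpha> / ((\<alpha> - 1) * c) * (?l / (\<epsilon> * ?q)))"
        by (simp add: y_def mult_ac)
      also have "\<dots> = ((1 + g) ^ 3 * (1 + 2 * g)) * exit_rate \<epsilon>" unfolding c(3) exit_rate_def ..
      also have "\<dots> \<le> (1 + \<delta>) * exit_rate \<epsilon>"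
      proof (rule mult_right_mono[OF g4])
        show "exit_rate \<epsilon> \<ge> 0" unfolding exit_rate_def using d_const_pos e Z(5)
          by (intro mult_nonneg_nonneg divide_nonneg_nonneg) auto
      qed
      finally show ?thesis .
    qed
    show ?case
    proof (intro allI impI)
      fix \<sigma> :: real assume \<sigma>: "\<bar>\<sigma>\<bar> = 1"
      define T where "T = measure \<nu> {y..}"
      have T: "T = exp (- log_tail \<nu> y)" "0 < T" "T \<le> 1" using tail_eq_exp[of y] y8 fy0 by (auto simp: T_def)
      have mn: "1 \<le> real (m * n)" using m n0 by (metis Suc_le_eq Suc_pred' mult_eq_0_iff nat_less_le of_nat_1 of_nat_le_iff of_nat_mult zero_less_Suc One_nat_def mult_pos_pos)
      \<comment> \<open>The mean number of large jumps in one time piece. One factor 1/2 is lost in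
        \<open>1 - exp (- z)\<close>, another in the remainder; hence \<open>z / 4\<close>.\<close>
      define z where "z = 1 / real (m * n) * T"
      have z: "0 \<le> z" "z \<le> 1"
      proof -
        show "0 \<le> z" unfolding z_def using T(2) by (intro mult_nonneg_nonneg) auto
        have "T / real (m * n) \<le> 1 / 1" using T(2,3) mn by (intro frac_le) auto
        then show "z \<le> 1" by (simp add: z_def)
      qed
      have "z / 2 \<le> 1 - exp (- z)"
      proof -
        have "exp (- z) \<le> 1 / (1 + z)" using exp_ge_add_one_self[of z] z by (simp add: exp_minus field_simps)
        also have "\<dots> \<le> 1 - z / 2"
        proof -
          have "1 \<le> (1 - z / 2) * (1 + z)" using z mult_left_le[of z z] by (simp add: algebra_simps)
          then show ?thesis using z by (simp add: pos_divide_le_eq)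
        qed
        finally show ?thesis by simp
      qed
      then have "z / 4 \<le> (1 - exp (- (1 / real (m * n)) * measure \<nu> {y..})) / 2" by (simp add: z_def T_def)
      also have "\<dots> \<le> prob {\<omega>\<in>space M. \<sigma> * L (1 / real (m * n)) \<omega> \<ge> y - tail_shift d \<mu> - 1}"
        using m n0 y8 by (intro L_tail_ge \<sigma>) (auto simp: Suc_le_eq)
      also have "y - tail_shift d \<mu> - 1 = y - M1" by (simp add: M1_def)
      finally have q0: "z / 4 \<le> prob {\<omega>\<in>space M. \<sigma> * L (1 / real (m * n)) \<omega> \<ge> y - M1}" .
      have "exp (- ((1 + \<delta>) * exit_rate \<epsilon>)) \<le> exp (- (real n * (log_tail \<nu> y + ln (4 * (real m * real n)))))"
        using cost by simp
      also have "\<dots> = (exp (- log_tail \<nu> y) * exp (- ln (4 * (real m * real n)))) ^ n"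
        by (simp add: exp_of_nat_mult[symmetric] exp_add[symmetric] algebra_simps)
      also have "exp (- ln (4 * (real m * real n))) = 1 / (4 * (real m * real n))"
        using m n0 by (simp add: exp_minus inverse_eq_divide)
      also have "exp (- log_tail \<nu> y) * (1 / (4 * (real m * real n))) = z / 4" by (simp add: z_def T(1))
      also have "(z / 4) ^ n \<le> prob {\<omega>\<in>space M. \<sigma> * L (1 / real (m * n)) \<omega> \<ge> y - M1} ^ n"
        using q0 z by (intro power_mono) auto
      also have "\<dots> \<le> prob {\<omega>\<in>space M. \<sigma> * L (real n * (1 / real (m * n))) \<omega> \<ge> real n * (y - M1)}"
        by (rule tail_of_sum_ge) simp
      also have "real n * (1 / real (m * n)) = 1 / real m" using n0 by simp
      also have "prob {\<omega>\<in>space M. \<sigma> * L (1 / real m) \<omega> \<ge> real n * (y - M1)} \<le> prob {\<omega>\<in>space M. b \<le> \<sigma> * L (1 / real m) \<omega>}"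
      proof (rule finite_measure_mono)
        show "{\<omega>\<in>space M. b \<le> \<sigma> * L (1 / real m) \<omega>} \<in> events"
          by (intro borel_measurable_le borel_measurable_times borel_measurable_const L_measurable) simp
      qed (use nb in auto)
      finally show "exp (- ((1 + \<delta>) * exit_rate \<epsilon>)) \<le> prob {\<omega>\<in>space M. (1 + C * (1 / real m)) / \<epsilon> \<le> \<sigma> * L (1 / real m) \<omega>}"
        by (simp add: b_def)
    qed
  qed
  then show ?thesis using m by blast
qed

end

section \<open>Survival estimates with a vanishing error in the exponent\<close>

locale exit_family = light_tailed_levy_process M F \<nu> \<alpha> L d \<mu>
  for M :: "'a measure" and F :: "real \<Rightarrow> 'a measure" and \<nu> :: "real measure" and \<alpha> :: real
    and L :: "real \<Rightarrow> 'a \<Rightarrow> real" and d \<mu> :: real +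
  fixes U :: "real \<Rightarrow> real" and X :: "real \<Rightarrow> real \<Rightarrow> real \<Rightarrow> 'a \<Rightarrow> real"
  assumes U: "potential U" and solution: "\<And>\<epsilon> x. \<epsilon> > 0 \<Longrightarrow> strong_solution M F U L \<epsilon> x (X \<epsilon> x)"
begin

lemma exit_problem: "\<epsilon> > 0 \<Longrightarrow> exit_problem M F \<nu> \<alpha> L d \<mu> U \<epsilon> x (X \<epsilon> x)"
  by (intro exit_problem.intro exit_problem_axioms.intro light_tailed_levy_process_axioms U solution)

lemma survival_upper:
  assumes \<delta>: "\<delta> > 0"
  shows "\<forall>\<^sub>F \<epsilon> in at_right 0. \<forall>x t. t \<ge> 0 \<longrightarrow>
     survival_prob M (X \<epsilon> x) t \<le> (1 + \<delta>) * exp (- exp (- ((1 + \<delta>) * exit_rate \<epsilon>)) * t)"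
proof -
  obtain C where C: "C \<ge> 0" "\<And>v. \<bar>v\<bar> \<le> 1 \<Longrightarrow> \<bar>deriv U v\<bar> \<le> C" using potential_drift_bounded[OF U] by auto
  obtain m where m: "m \<ge> 1" and ev: "\<forall>\<^sub>F \<epsilon> in at_right 0. \<forall>\<sigma>. \<bar>\<sigma>\<bar> = 1 \<longrightarrow>
     exp (- ((1 + \<delta>) * exit_rate \<epsilon>)) \<le> prob {\<omega>\<in>space M. (1 + C * (1 / real m)) / \<epsilon> \<le> \<sigma> * L (1 / real m) \<omega>}"
    using large_deviation_lower_bound[OF \<delta> C(1)] by blast
  have "((\<lambda>r. exp (- ((1 + \<delta>) * r))) \<longlongrightarrow> 0) at_top" using \<delta> by real_asymp
  then have "\<forall>\<^sub>F r in at_top. exp (- ((1 + \<delta>) * r)) < ln (1 + \<delta>)" using \<delta> by (intro order_tendstoD) auto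
  from eventually_exit_rate[OF this] ev eventually_quantile_setup[of 1] show ?thesis
  proof eventually_elim
    case (elim \<epsilon>)
    define p where "p = exp (- ((1 + \<delta>) * exit_rate \<epsilon>))"
    have p: "0 < p" "p \<le> ln (1 + \<delta>)" using elim by (auto simp: p_def)
    show ?case
    proof (intro allI impI)
      fix x t :: real assume t: "t \<ge> 0"
      interpret exit_problem M F \<nu> \<alpha> L d \<mu> U \<epsilon> x "X \<epsilon> x" using elim by (intro exit_problem) auto
      have pp: "p \<le> prob {\<omega>\<in>space M. (1 + C * (1 / real m)) / \<epsilon> \<le> \<sigma> * L (1 / real m) \<omega>}" if "\<bar>\<sigma>\<bar> = 1" for \<sigma>
        using elim(2) that by (simp add: p_def)
      have p1: "p \<le> 1" by (rule order_trans[OF pp[of 1] prob_le_1]) simp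
      define k where "k = nat \<lfloor>t * real m\<rfloor>"
      have k: "real k \<le> t * real m" "t * real m - 1 \<le> real k" using t by (auto simp: k_def)
      have "survival_prob M (X \<epsilon> x) t \<le> (1 - p) ^ k"
        using k(1) m by (intro survival_prob_le[OF _ C(2) pp]) (auto simp: field_simps)
      also have "\<dots> \<le> exp (- p) ^ k" using p1 exp_ge_add_one_self[of "- p"] by (intro power_mono) auto
      also have "\<dots> = exp (- (p * real k))" by (simp add: exp_of_nat_mult[symmetric] mult.commute)
      \<comment> \<open>As \<open>m \<ge> 1\<close>, a unit of time contains at least one period.
        The incomplete last period costs \<open>exp p\<close>, which is at most
        \<open>1 + \<delta>\<close> for small \<epsilon>.\<close>
      also have "\<dots> \<le> exp (p + - p * t)"
      proof -
        have "t * 1 \<le> t * real m" using t m by (intro mult_left_mono) auto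
        then have "p * (t - 1) \<le> p * real k" using k p by (intro mult_left_mono) auto
        then show ?thesis by (simp add: algebra_simps)
      qed
      also have "\<dots> = exp p * exp (- p * t)" by (rule exp_add)
      also have "\<dots> \<le> (1 + \<delta>) * exp (- p * t)"
      proof (rule mult_right_mono)
        have "exp p \<le> exp (ln (1 + \<delta>))" using p(2) by simp
        then show "exp p \<le> 1 + \<delta>" using \<delta> by simp
      qed simp
      finally show "survival_prob M (X \<epsilon> x) t \<le> (1 + \<delta>) * exp (- exp (- ((1 + \<delta>) * exit_rate \<epsilon>)) * t)" by (simp add: p_def)
    qed
  qed
qed

lemma survival_lower:
  assumes \<delta>: "0 < \<delta>" "\<delta> \<le> 1 / 2"
  shows "\<forall>\<^sub>F \<epsilon> in at_right 0. \<forall>x t. \<bar>x\<bar> \<le> 1 - \<delta> \<longrightarrow> t \<ge> 0 \<longrightarrow>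
     (1 - \<delta>) * exp (- exp (- ((1 - \<delta>) * exit_rate \<epsilon>)) * t) \<le> survival_prob M (X \<epsilon> x) t"
proof -
  \<comment> \<open>The unit in which errors in the exponent are counted; it also serves as the
    inner level \<eta> and as the tolerance \<kappa>. The losses below add up to fewer than 40
    units.\<close>
  define e where "e = \<delta> / 40"
  \<comment> \<open>The drift may vanish at \<open>1\<close>, so the path is confined below a smaller level \<open>\<rho>\<close>.\<close>
  define \<rho> where "\<rho> = 1 - \<delta> / 2"
  define a where "a = 1 - \<delta>"
  have e: "e > 0" "e \<le> 1 / 80" using \<delta> by (auto simp: e_def)
  have \<rho>: "e \<le> \<rho>" "\<rho> < 1" "a < \<rho>" using \<delta> by (auto simp: e_def \<rho>_def a_def)
  obtain C where C: "C \<ge> 0" "\<And>v. \<bar>v\<bar> \<le> 1 \<Longrightarrow> \<bar>deriv U v\<bar> \<le> C" using potential_drift_bounded[OF U] by auto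
  obtain c where c: "c > 0" "\<And>v. e \<le> v \<Longrightarrow> v \<le> \<rho> \<Longrightarrow> c \<le> deriv U v" "\<And>v. e \<le> v \<Longrightarrow> v \<le> \<rho> \<Longrightarrow> deriv U (- v) \<le> - c"
    using potential_drift_inward[OF U e(1) \<rho>(1,2)] by blast
  let ?d = "d_const \<alpha>"
  note d0 = d_const_pos
  \<comment> \<open>The order of exponential moments, slightly below the critical one. A further
    margin, \<open>\<delta> / 16\<close>, keeps the exponent \<open>B\<^sub>0\<close> below 1, so
    the Laplace exponent is at most \<open>1 / \<epsilon>\<close>, while the drift term is at least
    \<open>2 / \<epsilon>\<close>.\<close>
  define A0 where "A0 = (1 - \<delta> / 8) * ?d"
  have A0: "A0 > 0" using \<delta> d0 by (simp add: A0_def)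
  have E1: "\<forall>\<^sub>F \<epsilon> in at_right 0. \<Psi> (A0 * (\<bar>ln \<epsilon>\<bar> / quantile \<nu> \<epsilon>)) \<le> \<epsilon> powr (- 1)"
  proof (rule laplace_bound_asymp)
    show "A0 < (1 - \<delta> / 16) * ?d" using \<delta> d0 by (simp add: A0_def)
    show "1 - \<delta> / 16 < 1" using \<delta> by simp
    fix c' :: real assume "c' \<ge> 0"
    have "(1 - \<delta> / 16) * (?d * c') \<le> (1 - \<delta> / 16) * (c' powr \<alpha> + 1)"
      using d_const_le[OF \<open>c' \<ge> 0\<close>] \<delta> by (intro mult_left_mono) auto
    also have "\<dots> \<le> c' powr \<alpha> + (1 - \<delta> / 16)" using \<delta> by (simp add: algebra_simps)
    finally show "(1 - \<delta> / 16) * ?d * c' \<le> c' powr \<alpha> + (1 - \<delta> / 16)" by (simp add: mult.assoc)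
  qed (use A0 d_nonneg in auto)
  \<comment> \<open>Chosen so that an oscillation of size \<open>e / \<epsilon>\<close> costs twice
    the exit rate. The price is a Laplace exponent of some power
    \<open>\<epsilon> powr (- B1)\<close>, neutralised by a grid step of order
    \<open>\<epsilon> powr B1\<close>.\<close>
  define A1 where "A1 = 2 * ?d / e"
  have A1: "A1 > 0" using d0 e by (simp add: A1_def)
  obtain B where B: "\<And>c. c \<ge> 0 \<Longrightarrow> (A1 + 1) * c \<le> c powr \<alpha> + B" using power_dominates_linear[of "A1 + 1"] by blast
  have B0: "B \<ge> 0" using B[of 0] by simp
  define B1 where "B1 = B + 1"
  have E2: "\<forall>\<^sub>F \<epsilon> in at_right 0. \<Psi> (A1 * (\<bar>ln \<epsilon>\<bar> / quantile \<nu> \<epsilon>)) \<le> \<epsilon> powr (- B1)"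
    using A1 B d_nonneg by (intro laplace_bound_asymp[where A = "A1 + 1" and B\<^sub>0 = B]) (auto simp: B1_def)
  have E3: "\<forall>\<^sub>F \<epsilon> in at_right 0. 2 / (c * A0) \<le> \<bar>ln \<epsilon>\<bar> / quantile \<nu> \<epsilon>"
    using log_over_quantile_at_top by (simp add: filterlim_at_top)
  have E4: "\<forall>\<^sub>F \<epsilon> in at_right 0. c / e + 1 \<le> (\<epsilon>::real) powr (- B1)"
  proof -
    have "B1 > 0" using B0 by (simp add: B1_def)
    then have "filterlim (\<lambda>\<epsilon>::real. \<epsilon> powr (- B1)) at_top (at_right 0)" by real_asymp
    then show ?thesis by (simp add: filterlim_at_top)
  qed
  have E5: "\<forall>\<^sub>F \<epsilon> in at_right 0. (B1 + 1) * \<bar>ln \<epsilon>\<bar> \<le> e * exit_rate \<epsilon>" by (rule log_negligible[OF e(1)])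
  have E6: "\<forall>\<^sub>F \<epsilon> in at_right 0. 38 * exp (- (8 * e * exit_rate \<epsilon>)) < \<delta> / 2"
  proof (rule eventually_exit_rate)
    have "((\<lambda>r. 38 * exp (- (8 * e * r))) \<longlongrightarrow> 0) at_top" using e by real_asymp
    then show "\<forall>\<^sub>F r in at_top. 38 * exp (- (8 * e * r)) < \<delta> / 2" using \<delta> by (intro order_tendstoD) auto
  qed
  have E7: "\<forall>\<^sub>F \<epsilon> in at_right 0. 2 * exit_rate \<epsilon> \<le> exp (exit_rate \<epsilon> / 2)"
  proof (rule eventually_exit_rate)
    show "\<forall>\<^sub>F r::real in at_top. 2 * r \<le> exp (r / 2)" by real_asymp
  qed
  from E1 E2 E3 E4 E5 E6 E7 eventually_quantile_setup[of 1] show ?thesis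
  proof eventually_elim
    case (elim \<epsilon>)
    let ?q = "quantile \<nu> \<epsilon>" and ?l = "\<bar>ln \<epsilon>\<bar>" and ?r = "exit_rate \<epsilon>"
    have eps: "0 < \<epsilon>" "\<epsilon> < 1" "1 \<le> ?q" "1 \<le> ?l" using elim by auto
    have r0: "?r \<ge> 0" unfolding exit_rate_def using d0 eps by (intro mult_nonneg_nonneg divide_nonneg_nonneg) auto
    define \<theta> where "\<theta> = A0 * (?l / ?q) / \<epsilon>"
    define \<theta>' where "\<theta>' = A1 * (?l / ?q)"
    have \<theta>_eq: "\<theta> = (1 - \<delta> / 8) * ?r" by (simp add: \<theta>_def A0_def exit_rate_def mult_ac)
    have \<epsilon>\<theta>: "\<epsilon> * \<theta> = A0 * (?l / ?q)" using eps by (simp add: \<theta>_def)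
    have \<theta>'_eq: "\<theta>' * (e / \<epsilon>) = 2 * ?r" using e by (simp add: \<theta>'_def A1_def exit_rate_def mult_ac)
    have \<theta>: "\<theta> \<ge> 0" "\<theta> \<le> ?r" using \<delta> r0 by (auto simp: \<theta>_eq intro: mult_left_le_one_le)
    have \<theta>'0: "\<theta>' \<ge> 0" using A1 eps unfolding \<theta>'_def by (intro mult_nonneg_nonneg divide_nonneg_nonneg) auto
    have drift: "c * \<theta> - \<Psi> (\<epsilon> * \<theta>) \<ge> 1"
    proof -
      have "2 \<le> c * (A0 * (?l / ?q))" using elim(3) c(1) A0 by (simp add: pos_divide_le_eq mult_ac)
      then have "2 / \<epsilon> \<le> c * (A0 * (?l / ?q)) / \<epsilon>" using eps by (intro divide_right_mono) auto
      then have "2 / \<epsilon> \<le> c * \<theta>" by (simp add: \<theta>_def)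
      moreover have "\<Psi> (\<epsilon> * \<theta>) \<le> 1 / \<epsilon>" using elim(1) eps unfolding \<epsilon>\<theta> by (simp add: powr_minus_divide)
      moreover have "1 \<le> 1 / \<epsilon>" using eps by simp
      moreover have "2 / \<epsilon> = 1 / \<epsilon> + 1 / \<epsilon>" by simp
      ultimately show ?thesis by linarith
    qed
    \<comment> \<open>Grid points per unit of time: enough to make
      \<open>h * \<Psi> \<theta>' \<le> 1\<close> and \<open>c * h \<le> e\<close>, yet only
      polynomially many in \<open>1 / \<epsilon>\<close>, hence at most
      \<open>exp (e * exit_rate \<epsilon>)\<close>.\<close>
    define m where "m = nat \<lceil>\<epsilon> powr (- B1)\<rceil>"
    have ce: "c / e > 0" using c e by simp
    have m: "\<epsilon> powr (- B1) \<le> real m" unfolding m_def by linarith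
    have m1: "1 \<le> real m" "c / e \<le> real m" using m elim(4) ce by linarith+
    have m_le: "real m \<le> exp (e * ?r)"
    proof -
      have "real m \<le> \<epsilon> powr (- B1) + 1" using elim(4) ce unfolding m_def by linarith
      also have "\<dots> \<le> 2 * \<epsilon> powr (- B1)" using elim(4) ce by linarith
      also have "\<dots> = 2 * exp (B1 * ?l)" using eps by (simp add: powr_def)
      also have "\<dots> \<le> exp 1 * exp (B1 * ?l)" using exp_ge_add_one_self[of 1] by (intro mult_right_mono) auto
      also have "\<dots> \<le> exp ?l * exp (B1 * ?l)" using eps by (intro mult_right_mono) auto
      also have "\<dots> = exp ((B1 + 1) * ?l)" by (simp add: exp_add[symmetric] algebra_simps)
      also have "\<dots> \<le> exp (e * ?r)" using elim(5) by simp
      finally show ?thesis .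
    qed
    define h where "h = 1 / real m"
    have h: "0 < h" "h \<le> 1" "h \<in> \<rat>" using m1 by (auto simp: h_def)
    have ch: "c * h \<le> e" using m1 e by (simp add: h_def field_simps)
    have h\<Psi>: "h * \<Psi> \<theta>' \<le> 1" using elim(2) m m1 unfolding \<theta>'_def h_def by (simp add: field_simps)
    \<comment> \<open>The block length, rounded up to an integer so that it is a multiple of the
      grid step.\<close>
    define S where "S = nat \<lceil>exp ((1 - \<delta>) * ?r)\<rceil>"
    have x1: "1 \<le> exp ((1 - \<delta>) * ?r)" using \<delta> r0 by simp
    have S: "exp ((1 - \<delta>) * ?r) \<le> real S" "real S \<le> 2 * exp ((1 - \<delta>) * ?r)" "1 \<le> real S" using x1 unfolding S_def by linarith+
    define N where "N = S * m"
    have Nh: "real N * h = real S" using m1 by (simp add: N_def h_def)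
    show ?case
    proof (intro allI impI)
      fix x t :: real assume x: "\<bar>x\<bar> \<le> 1 - \<delta>" and t: "t \<ge> 0"
      interpret P: exit_problem M F \<nu> \<alpha> L d \<mu> U \<epsilon> x "X \<epsilon> x" using eps by (intro exit_problem)
      interpret P: block_scheme M F \<nu> \<alpha> L d \<mu> U \<epsilon> x "X \<epsilon> x" C c e \<rho> a e h \<theta> \<theta>' N
      proof (unfold_locales)
        show "\<bar>deriv U v\<bar> \<le> C" if "\<bar>v\<bar> \<le> \<rho>" for v using C(2)[of v] that \<rho> by simp
        show "\<bar>x\<bar> \<le> a" using x by (simp add: a_def)
        show "\<rho> \<le> 1" using \<rho> by simp
      qed (use C(1) c e h \<theta> drift \<theta>'0 \<rho> in simp_all)
      have sl: "P.slack \<le> 4 * e" using ch by (simp add: P.slack_def)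
      have sl0: "P.slack \<le> 1" using sl e by simp
      let ?E = "exp (- (8 * e * ?r))"
      have N1: "real (Suc N) \<le> 4 * exp ((1 - \<delta>) * ?r + e * ?r)"
      proof -
        have "1 \<le> real N" using S(3) m1(1) mult_mono[of 1 "real S" 1 "real m"] by (simp add: N_def)
        then have "real (Suc N) \<le> 2 * (real S * real m)" by (simp add: N_def)
        also have "\<dots> \<le> 2 * (2 * exp ((1 - \<delta>) * ?r) * exp (e * ?r))" using S m_le m1 by (intro mult_left_mono mult_mono) auto
        finally show ?thesis by (simp add: exp_add)
      qed
      have h2: "2 / h \<le> 2 * exp (e * ?r)" using m_le by (simp add: h_def)
      have er: "0 \<le> e * ?r" using e r0 by simp
      have T1: "real N * (2 * exp (- \<theta>' * (e / \<epsilon>) + h * \<Psi> \<theta>')) \<le> 24 * ?E"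
      proof -
        have "- \<theta>' * (e / \<epsilon>) + h * \<Psi> \<theta>' \<le> - (2 * ?r) + 1" using \<theta>'_eq h\<Psi> by simp
        then have "exp (- \<theta>' * (e / \<epsilon>) + h * \<Psi> \<theta>') \<le> exp (- (2 * ?r)) * exp 1" by (simp add: exp_add[symmetric])
        also have "\<dots> \<le> exp (- (2 * ?r)) * 3" using exp_le by (intro mult_left_mono) auto
        finally have "real N * (2 * exp (- \<theta>' * (e / \<epsilon>) + h * \<Psi> \<theta>')) \<le> (4 * exp ((1 - \<delta>) * ?r + e * ?r)) * (2 * (exp (- (2 * ?r)) * 3))"
          using N1 by (intro mult_mono) auto
        also have "\<dots> = 24 * exp ((1 - \<delta>) * ?r + e * ?r - 2 * ?r)" by (simp add: exp_diff exp_minus divide_inverse)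
        also have "\<dots> \<le> 24 * ?E"
        proof -
          have "(1 - \<delta> + e - 2 + 8 * e) * ?r \<le> 0" using r0 e \<delta> by (intro mult_nonpos_nonneg) auto
          then show ?thesis by (simp add: algebra_simps)
        qed
        finally show ?thesis .
      qed
      \<comment> \<open>The decisive term. In units of the exit rate the exponents are
        \<open>- (1 - 30 * e)\<close> from the Chernoff bound, \<open>1 - 40 * e\<close> from the
        block length and \<open>2 * e\<close> from the grid, in total
        \<open>- 8 * e\<close>.\<close>
      have T2: "exp (- \<theta> * (\<rho> - e - P.slack)) * (real (Suc N) * (2 / h)) \<le> 8 * ?E"
      proof -
        have "(1 - 25 * e) \<le> \<rho> - e - P.slack" using sl by (simp add: \<rho>_def e_def)
        then have "\<theta> * (1 - 25 * e) \<le> \<theta> * (\<rho> - e - P.slack)" using \<theta> by (intro mult_left_mono)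
        moreover have "(1 - 30 * e) * ?r \<le> \<theta> * (1 - 25 * e)"
        proof -
          have "1 - 30 * e \<le> (1 - 5 * e) * (1 - 25 * e)" by (simp add: algebra_simps)
          then have "(1 - 30 * e) * ?r \<le> (1 - 5 * e) * (1 - 25 * e) * ?r" using r0 by (rule mult_right_mono)
          also have "\<dots> = \<theta> * (1 - 25 * e)" by (simp add: \<theta>_eq e_def)
          finally show ?thesis .
        qed
        ultimately have "exp (- \<theta> * (\<rho> - e - P.slack)) \<le> exp (- ((1 - 30 * e) * ?r))" by simp
        then have "exp (- \<theta> * (\<rho> - e - P.slack)) * (real (Suc N) * (2 / h)) \<le> exp (- ((1 - 30 * e) * ?r)) * ((4 * exp ((1 - \<delta>) * ?r + e * ?r)) * (2 * exp (e * ?r)))"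
          using N1 h2 h by (intro mult_mono) auto
        also have "\<dots> = 8 * exp (- ((1 - 30 * e) * ?r) + ((1 - \<delta>) * ?r + e * ?r) + e * ?r)"
        proof -
          have q: "u * ((4 * v) * (2 * w)) = 8 * (u * v * w)" for u v w :: real by simp
          show ?thesis by (simp only: q exp_add mult.assoc)
        qed
        also have "- ((1 - 30 * e) * ?r) + ((1 - \<delta>) * ?r + e * ?r) + e * ?r = - (8 * e * ?r)" by (simp add: e_def algebra_simps)
        finally show ?thesis .
      qed
      have T34: "exp (- \<theta> * g) * (2 / h) \<le> 2 * ?E" if g: "10 * e \<le> g" for g
      proof -
        have "9 * e * ?r \<le> \<theta> * (10 * e)"
        proof -
          have "9 / 10 \<le> 1 - \<delta> / 8" using \<delta> by simp
          then have "9 / 10 * ?r \<le> \<theta>" unfolding \<theta>_eq using r0 by (rule mult_right_mono)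
          then have "9 / 10 * ?r * (10 * e) \<le> \<theta> * (10 * e)" using e by (intro mult_right_mono) auto
          then show ?thesis by (simp add: mult_ac)
        qed
        also have "\<dots> \<le> \<theta> * g" using g \<theta> by (intro mult_left_mono)
        finally have "exp (- \<theta> * g) * (2 / h) \<le> exp (- (9 * e * ?r)) * (2 * exp (e * ?r))"
          using h2 h by (intro mult_mono) auto
        also have "\<dots> = 2 * exp (- (9 * e * ?r) + e * ?r)" by (simp only: exp_add mult.left_commute)
        also have "- (9 * e * ?r) + e * ?r = - (8 * e * ?r)" by (simp add: algebra_simps)
        finally show ?thesis .
      qed
      \<comment> \<open>The block length is at least \<open>exp (exit_rate \<epsilon> / 2)\<close>,
        which exceeds twice the exit rate; this outweighs \<open>\<theta> * P.slack\<close>, at most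
        one exit rate.\<close>
      have T5: "exp (\<theta> * P.slack) * exp (- (real N * h)) \<le> ?E"
      proof -
        have sl_nn: "0 \<le> P.slack" using e c h by (simp add: P.slack_def)
        have "\<theta> * P.slack \<le> ?r * 1" using \<theta> sl0 sl_nn r0 by (intro mult_mono) auto
        moreover have "exp (?r / 2) \<le> exp ((1 - \<delta>) * ?r)" using \<delta> r0 mult_right_mono[of "1 / 2" "1 - \<delta>" ?r] by simp
        ultimately have "\<theta> * P.slack - real N * h \<le> - ?r" using S(1) elim(7) unfolding Nh by linarith
        also have "\<dots> \<le> - (8 * e * ?r)" using e r0 mult_right_mono[of "8 * e" 1 ?r] by simp
        finally show ?thesis by (simp add: exp_add[symmetric])
      qed
      have "10 * e \<le> \<rho> - a - P.slack" using sl e by (simp add: \<rho>_def a_def e_def)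
      note T3 = T34[OF this]
      have "10 * e \<le> a - e - P.slack" using sl e \<delta> by (simp add: a_def e_def)
      note T4 = T34[OF this]
      have "P.bad_bound \<le> 24 * ?E + 2 * (8 * ?E + 2 * ?E + 2 * ?E + ?E)"
        unfolding P.bad_bound_def using T1 T2 T3 T4 T5 by (intro add_mono mult_left_mono) simp_all
      also have "\<dots> \<le> 2 * (38 * ?E)" by simp
      also have "\<dots> \<le> \<delta>" using elim(6) by simp
      finally have bb: "P.bad_bound \<le> \<delta>" .
      have bb0: "P.bad_bound \<ge> 0" unfolding P.bad_bound_def using h by (intro add_nonneg_nonneg mult_nonneg_nonneg) auto
      let ?k = "nat \<lfloor>t / real S\<rfloor>"
      have St: "t < real (Suc ?k) * (real N * h)"
      proof -
        have "t / real S < real (Suc ?k)" using t S(3) by simp linarith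
        then show ?thesis unfolding Nh using S(3) by (simp add: pos_divide_less_eq)
      qed
      have "(1 - \<delta>) * exp (- exp (- ((1 - \<delta>) * ?r)) * t) \<le> (1 - P.bad_bound) * exp (- (2 * P.bad_bound * (t / real S)))"
      proof (rule mult_mono)
        have "2 * P.bad_bound * (t / real S) \<le> 1 * (t / real S)" using bb \<delta> t S(3) by (intro mult_right_mono) auto
        also have "\<dots> \<le> t / exp ((1 - \<delta>) * ?r)" using S t by (simp add: frac_le)
        also have "\<dots> = exp (- ((1 - \<delta>) * ?r)) * t" by (simp add: exp_minus divide_inverse mult.commute)
        finally show "exp (- exp (- ((1 - \<delta>) * ?r)) * t) \<le> exp (- (2 * P.bad_bound * (t / real S)))" by simp
      qed (use bb \<delta> in auto)
      also have "\<dots> \<le> (1 - P.bad_bound) ^ Suc ?k"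
        using bb bb0 \<delta> S(3) t by (intro power_lower_exp) auto
      also have "\<dots> \<le> survival_prob M (X \<epsilon> x) t"
        using bb \<delta> by (intro P.survival_prob_ge t St) simp
      finally show "(1 - \<delta>) * exp (- exp (- ((1 - \<delta>) * ?r)) * t) \<le> survival_prob M (X \<epsilon> x) t" .
    qed
  qed
qed

end

section \<open>The mean exit time\<close>

context exit_problem
begin

lemma mean_exit_time_ge:
  assumes t: "t \<ge> 0"
  shows "ennreal (t * survival_prob M X t) \<le> mean_exit_time M X"
proof -
  let ?S = "{\<omega>\<in>space M. exit_time X \<omega> > ereal t}"
  have "ennreal (t * survival_prob M X t) = ennreal t * emeasure M ?S"
    using t by (simp add: survival_prob_def emeasure_eq_measure ennreal_mult)
  also have "\<dots> = (\<integral>\<^sup>+ \<omega>. ennreal t * indicator ?S \<omega> \<partial>M)"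
    using survival_event[OF t] by (intro nn_integral_cmult_indicator[symmetric])
  also have "\<dots> \<le> mean_exit_time M X"
    unfolding mean_exit_time_def
  proof (rule nn_integral_mono)
    fix \<omega>
    show "ennreal t * indicator ?S \<omega> \<le> e2ennreal (exit_time X \<omega>)"
    proof (cases "\<omega> \<in> ?S")
      case True
      then have "e2ennreal (ereal t) \<le> e2ennreal (exit_time X \<omega>)" by (intro e2ennreal_mono less_imp_le) simp
      then show ?thesis using True by (simp add: e2ennreal_ereal)
    qed simp
  qed
  finally show ?thesis .
qed

text \<open>The exit time is at most the number of integers \<open>k \<ge> 0\<close> below it. This
  bounds the mean by the sum of the survival probabilities at integer times, a geometric
  series.\<close>

lemma mean_exit_time_le:
  assumes K: "K \<ge> 0" and r: "0 < r" "r \<le> 1"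
    and s: "\<And>t. t \<ge> 0 \<Longrightarrow> survival_prob M X t \<le> K * exp (- r * t)"
  shows "mean_exit_time M X \<le> ennreal (2 * K / r)"
proof -
  let ?S = "\<lambda>k::nat. {\<omega>\<in>space M. exit_time X \<omega> > ereal (real k)}"
  have "mean_exit_time M X \<le> (\<integral>\<^sup>+ \<omega>. (\<Sum>k. indicator (?S k) \<omega>) \<partial>M)"
    unfolding mean_exit_time_def
  proof (rule nn_integral_mono)
    fix \<omega> assume w: "\<omega> \<in> space M"
    have low: "ennreal (real (Suc n)) \<le> (\<Sum>k. indicator (?S k) \<omega>)" if "ereal (real n) < exit_time X \<omega>" for n
    proof -
      have "\<omega> \<in> ?S k" if "k \<le> n" for k
      proof -
        have "ereal (real k) \<le> ereal (real n)" using that by simp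
        from le_less_trans[OF this \<open>ereal (real n) < exit_time X \<omega>\<close>] show ?thesis using w by simp
      qed
      then have "indicator (?S k) \<omega> = (1 :: ennreal)" if "k \<le> n" for k using that by (simp only: indicator_simps)
      then have "(\<Sum>k<Suc n. indicator (?S k) \<omega> :: ennreal) = (\<Sum>k<Suc n. 1)"
        by (intro sum.cong refl) (simp only: lessThan_iff less_Suc_eq_le)
      then have "ennreal (real (Suc n)) = (\<Sum>k<Suc n. indicator (?S k) \<omega>)" by (simp add: ennreal_of_nat_eq_real_of_nat)
      also have "\<dots> \<le> (\<Sum>k. indicator (?S k) \<omega>)" by (rule sum_le_suminf) auto
      finally show ?thesis .
    qed
    show "e2ennreal (exit_time X \<omega>) \<le> (\<Sum>k. indicator (?S k) \<omega>)"
    proof (cases "exit_time X \<omega>")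
      case (real v)
      show ?thesis
      proof (cases "v > 0")
        case True
        define n where "n = nat (\<lceil>v\<rceil> - 1)"
        have n: "real n < v" "v \<le> real (Suc n)" using True by (auto simp: n_def) linarith+
        have "e2ennreal (exit_time X \<omega>) = ennreal v" by (simp add: real e2ennreal_ereal)
        also have "\<dots> \<le> ennreal (real (Suc n))" using n(2) by (rule ennreal_leI)
        also have "\<dots> \<le> (\<Sum>k. indicator (?S k) \<omega>)" using n(1) by (intro low) (simp add: real)
        finally show ?thesis .
      next
        case False
        then have "e2ennreal (exit_time X \<omega>) = 0" by (simp add: real e2ennreal_ereal ennreal_neg)
        then show ?thesis by simp
      qed
    next
      case PInf
      have "(\<Sum>k. indicator (?S k) \<omega>) = (\<top>::ennreal)"
      proof (rule ccontr)
        assume "(\<Sum>k. indicator (?S k) \<omega>) \<noteq> (\<top>::ennreal)"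
        then obtain z where z: "z \<ge> 0" "(\<Sum>k. indicator (?S k) \<omega>) = ennreal z" by (cases "\<Sum>k. indicator (?S k) \<omega> :: ennreal") auto
        have "real (Suc n) \<le> z" for n
        proof -
          have "ennreal (real (Suc n)) \<le> ennreal z" using low[of n] unfolding z(2) by (simp only: PInf less_ereal.simps)
          then show ?thesis using z(1) by (simp only: ennreal_le_iff)
        qed
        from this[of "nat \<lceil>z\<rceil>"] show False by linarith
      qed
      then show ?thesis by simp
    next
      case MInf
      then show ?thesis using exit_time_nonneg[of X \<omega>] by simp
    qed
  qed
  also have "\<dots> = (\<Sum>k. emeasure M (?S k))"
    using survival_event by (subst nn_integral_suminf) auto
  also have "\<dots> \<le> (\<Sum>k. ennreal (K * exp (- r) ^ k))"
  proof (rule suminf_le)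
    fix k
    have "emeasure M (?S k) = ennreal (survival_prob M X (real k))" by (simp add: survival_prob_def emeasure_eq_measure)
    also have "\<dots> \<le> ennreal (K * exp (- r * real k))" by (intro ennreal_leI s) simp
    also have "exp (- r * real k) = exp (- r) ^ k" by (simp add: exp_of_nat_mult[symmetric] mult.commute)
    finally show "emeasure M (?S k) \<le> ennreal (K * exp (- r) ^ k)" .
  qed auto
  also have "\<dots> = ennreal (K * (1 / (1 - exp (- r))))"
  proof -
    have "(\<lambda>k. K * exp (- r) ^ k) sums (K * (1 / (1 - exp (- r))))" using r by (intro sums_mult geometric_sums) auto
    then show ?thesis using K by (subst suminf_ennreal2) (auto simp: sums_iff)
  qed
  also have "\<dots> \<le> ennreal (2 * K / r)"
  proof (rule ennreal_leI)
    have "exp (- r) \<le> 1 / (1 + r)" using exp_ge_add_one_self[of r] r by (simp add: exp_minus field_simps)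
    also have "\<dots> \<le> 1 - r / 2"
    proof -
      have "1 \<le> (1 - r / 2) * (1 + r)" using r mult_left_le[of r r] by (simp add: algebra_simps)
      then show ?thesis using r by (simp add: pos_divide_le_eq)
    qed
    finally have "K * (1 / (1 - exp (- r))) \<le> K * (1 / (r / 2))" using r K by (intro mult_left_mono divide_left_mono mult_pos_pos) auto
    then show "K * (1 / (1 - exp (- r))) \<le> 2 * K / r" by (simp add: mult.commute)
  qed
  finally show ?thesis .
qed

end

lemma ln_ext_bounds:
  assumes "ennreal p \<le> y" "y \<le> ennreal q" "0 < p"
  shows "ereal (ln p) \<le> ln_ext y" "ln_ext y \<le> ereal (ln q)"
proof -
  have y: "y \<noteq> \<top>" using assms(2) by (metis ennreal_neq_top top.extremum_uniqueI)
  then obtain v where v: "v \<ge> 0" "y = ennreal v" by (cases y) auto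
  have pv: "p \<le> v" using assms(1,3) v by (simp add: ennreal_le_iff)
  have "q \<ge> 0"
  proof (rule ccontr)
    assume "\<not> q \<ge> 0"
    then have "ennreal q = 0" by (simp add: ennreal_neg)
    then show False using assms(2) v pv assms(3) by simp
  qed
  then have vq: "v \<le> q" using assms(2) v by (simp add: ennreal_le_iff)
  have "ln_ext y = ereal (ln v)" using v pv assms(3) by (simp add: ln_ext_def)
  then show "ereal (ln p) \<le> ln_ext y" "ln_ext y \<le> ereal (ln q)" using pv vq assms(3) by simp_all
qed

context exit_family
begin

lemma log_mean_exit_time:
  assumes \<delta>: "0 < \<delta>" "\<delta> \<le> 1 / 2" and x: "\<bar>x\<bar> \<le> 1 - \<delta>"
  shows "\<forall>\<^sub>F \<epsilon> in at_right 0. ereal ((1 - 2 * \<delta>) * exit_rate \<epsilon>) \<le> ln_ext (mean_exit_time M (X \<epsilon> x)) \<and>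
     ln_ext (mean_exit_time M (X \<epsilon> x)) \<le> ereal ((1 + 2 * \<delta>) * exit_rate \<epsilon>)"
proof -
  have "\<forall>\<^sub>F r in at_top. \<bar>ln (1 - \<delta>)\<bar> + 1 + \<bar>ln (2 * (1 + \<delta>))\<bar> \<le> \<delta> * r"
    using \<delta> by real_asymp
  from eventually_exit_rate[OF this] survival_upper[OF \<delta>(1)] survival_lower[OF \<delta>] eventually_quantile_setup[of 1]
  show ?thesis
  proof eventually_elim
    case (elim \<epsilon>)
    let ?r = "exit_rate \<epsilon>"
    interpret P: exit_problem M F \<nu> \<alpha> L d \<mu> U \<epsilon> x "X \<epsilon> x" using elim by (intro exit_problem) auto
    have small: "\<bar>ln (1 - \<delta>)\<bar> + 1 + \<bar>ln (2 * (1 + \<delta>))\<bar> \<le> \<delta> * ?r" by (rule elim(1))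
    have r0: "?r \<ge> 0"
    proof (rule ccontr)
      assume "\<not> ?r \<ge> 0"
      then have "\<delta> * ?r \<le> 0" using \<delta> by (intro mult_nonneg_nonpos) auto
      then show False using small by linarith
    qed
    \<comment> \<open>Markov's inequality at time \<open>exp ((1 - \<delta>) * ?r)\<close>, where
      the exponent in the survival bound equals -1. The constant
      \<open>(1 - \<delta>) * exp (- 1)\<close> disappears in the second \<delta> of
      \<open>1 - 2 * \<delta>\<close>.\<close>
    define p where "p = exp ((1 - \<delta>) * ?r) * ((1 - \<delta>) * exp (- 1))"
    have p: "p > 0" using \<delta> by (simp add: p_def)
    have "ennreal p \<le> ennreal (exp ((1 - \<delta>) * ?r) * survival_prob M (X \<epsilon> x) (exp ((1 - \<delta>) * ?r)))"
    proof (rule ennreal_leI)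
      have "(1 - \<delta>) * exp (- exp (- ((1 - \<delta>) * ?r)) * exp ((1 - \<delta>) * ?r)) \<le> survival_prob M (X \<epsilon> x) (exp ((1 - \<delta>) * ?r))"
        using elim(3) x by simp
      moreover have "- exp (- ((1 - \<delta>) * ?r)) * exp ((1 - \<delta>) * ?r) = - 1" by (simp add: exp_add[symmetric])
      ultimately show "p \<le> exp ((1 - \<delta>) * ?r) * survival_prob M (X \<epsilon> x) (exp ((1 - \<delta>) * ?r))"
        unfolding p_def by (intro mult_left_mono) simp_all
    qed
    also have "\<dots> \<le> mean_exit_time M (X \<epsilon> x)" by (rule P.mean_exit_time_ge) simp
    finally have lo: "ennreal p \<le> mean_exit_time M (X \<epsilon> x)" .
    define q where "q = 2 * (1 + \<delta>) / exp (- ((1 + \<delta>) * ?r))"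
    have hi: "mean_exit_time M (X \<epsilon> x) \<le> ennreal q"
      unfolding q_def using elim(2) \<delta> r0 by (intro P.mean_exit_time_le) simp_all
    have "ln p = (1 - \<delta>) * ?r + ln (1 - \<delta>) - 1" using \<delta> by (simp add: p_def ln_mult)
    then have lp: "(1 - 2 * \<delta>) * ?r \<le> ln p" using small by (simp add: algebra_simps)
    have "ln q = ln (2 * (1 + \<delta>)) + (1 + \<delta>) * ?r" using \<delta> by (simp add: q_def ln_div)
    then have lq: "ln q \<le> (1 + 2 * \<delta>) * ?r" using small by (simp add: algebra_simps)
    show ?case
    proof
      have "ereal ((1 - 2 * \<delta>) * ?r) \<le> ereal (ln p)" using lp by simp
      then show "ereal ((1 - 2 * \<delta>) * ?r) \<le> ln_ext (mean_exit_time M (X \<epsilon> x))" using ln_ext_bounds(1)[OF lo hi p] by (rule order_trans)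
      have "ereal (ln q) \<le> ereal ((1 + 2 * \<delta>) * ?r)" using lq by simp
      with ln_ext_bounds(2)[OF lo hi p] show "ln_ext (mean_exit_time M (X \<epsilon> x)) \<le> ereal ((1 + 2 * \<delta>) * ?r)" by (rule order_trans)
    qed
  qed
qed

lemma normalized_log_mean_tendsto:
  assumes x: "\<bar>x\<bar> < 1"
  shows "((\<lambda>\<epsilon>. ereal (inverse (d_const \<alpha>)) *
      (ereal (\<epsilon> * quantile \<nu> \<epsilon> / \<bar>ln \<epsilon>\<bar>) * ln_ext (mean_exit_time M (X \<epsilon> x)))) \<longlongrightarrow> 1) (at_right 0)"
    (is "(?f \<longlongrightarrow> 1) _")
proof -
  have bounds: "\<forall>\<^sub>F \<epsilon> in at_right 0. ereal (1 - 2 * \<delta>) \<le> ?f \<epsilon> \<and> ?f \<epsilon> \<le> ereal (1 + 2 * \<delta>)"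
    if \<delta>: "0 < \<delta>" "\<delta> \<le> 1 / 2" "\<bar>x\<bar> \<le> 1 - \<delta>" for \<delta>
    using log_mean_exit_time[OF \<delta>] eventually_quantile_setup[of 1]
  proof eventually_elim
    case (elim \<epsilon>)
    define k where "k = inverse (d_const \<alpha>) * (\<epsilon> * quantile \<nu> \<epsilon> / \<bar>ln \<epsilon>\<bar>)"
    have pos: "0 < \<epsilon>" "0 < quantile \<nu> \<epsilon>" "0 < \<bar>ln \<epsilon>\<bar>" using elim(2) by auto
    have k: "k > 0" unfolding k_def using d_const_pos pos by (intro mult_pos_pos divide_pos_pos) auto
    \<comment> \<open>The normalisation in the claim is the reciprocal of the exit rate, so the
      two-sided bounds on the logarithm turn into bounds by constants.\<close>
    have kr: "k * exit_rate \<epsilon> = 1" unfolding k_def exit_rate_def using d_const_pos pos by (simp add: divide_simps)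
    have f: "?f \<epsilon> = ereal k * ln_ext (mean_exit_time M (X \<epsilon> x))" by (simp add: k_def mult.assoc[symmetric])
    have "ereal k * ereal ((1 - 2 * \<delta>) * exit_rate \<epsilon>) \<le> ?f \<epsilon>" unfolding f using elim k by (intro ereal_mult_left_mono) auto
    moreover have "?f \<epsilon> \<le> ereal k * ereal ((1 + 2 * \<delta>) * exit_rate \<epsilon>)" unfolding f using elim k by (intro ereal_mult_left_mono) auto
    moreover have "k * (v * exit_rate \<epsilon>) = v" for v using kr by (simp add: mult.left_commute)
    ultimately show ?case by simp
  qed
  define \<delta>' where "\<delta>' = min (1 / 2) (1 - \<bar>x\<bar>)"
  have \<delta>': "0 < \<delta>'" "\<delta>' \<le> 1 / 2" "\<bar>x\<bar> \<le> 1 - \<delta>'" using x unfolding \<delta>'_def by linarith+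
  show ?thesis
  proof (rule order_tendstoI)
    fix a :: ereal assume a: "a < 1"
    then obtain b where b: "a < ereal b" "ereal b < 1" using ereal_dense2 by blast
    define \<delta> where "\<delta> = min \<delta>' ((1 - b) / 2)"
    have \<delta>: "0 < \<delta>" "\<delta> \<le> 1 / 2" "\<bar>x\<bar> \<le> 1 - \<delta>" "b \<le> 1 - 2 * \<delta>"
    proof -
      have "b < 1" using b(2) by simp
      then show "0 < \<delta>" using \<delta>' by (simp add: \<delta>_def)
      have "\<delta> \<le> \<delta>'" "\<delta> \<le> (1 - b) / 2" unfolding \<delta>_def by (rule min.cobounded1, rule min.cobounded2)
      then show "\<delta> \<le> 1 / 2" "\<bar>x\<bar> \<le> 1 - \<delta>" "b \<le> 1 - 2 * \<delta>" using \<delta>' by (auto simp: field_simps)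
    qed
    from bounds[OF \<delta>(1-3)] show "\<forall>\<^sub>F \<epsilon> in at_right 0. a < ?f \<epsilon>"
    proof eventually_elim
      case (elim \<epsilon>)
      have "ereal b \<le> ereal (1 - 2 * \<delta>)" using \<delta>(4) by simp
      then show ?case using elim b(1) by (meson less_le_trans)
    qed
  next
    fix a :: ereal assume a: "a > 1"
    then obtain b where b: "1 < ereal b" "ereal b < a" using ereal_dense2 by blast
    define \<delta> where "\<delta> = min \<delta>' ((b - 1) / 2)"
    have \<delta>: "0 < \<delta>" "\<delta> \<le> 1 / 2" "\<bar>x\<bar> \<le> 1 - \<delta>" "1 + 2 * \<delta> \<le> b"
    proof -
      have "1 < b" using b(1) by simp
      then show "0 < \<delta>" using \<delta>' by (simp add: \<delta>_def)
      have "\<delta> \<le> \<delta>'" "\<delta> \<le> (b - 1) / 2" unfolding \<delta>_def by (rule min.cobounded1, rule min.cobounded2)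
      then show "\<delta> \<le> 1 / 2" "\<bar>x\<bar> \<le> 1 - \<delta>" "1 + 2 * \<delta> \<le> b" using \<delta>' by (auto simp: field_simps)
    qed
    from bounds[OF \<delta>(1-3)] show "\<forall>\<^sub>F \<epsilon> in at_right 0. ?f \<epsilon> < a"
    proof eventually_elim
      case (elim \<epsilon>)
      have "ereal (1 + 2 * \<delta>) \<le> ereal b" using \<delta>(4) by simp
      then show ?case using elim b(2) by (meson le_less_trans)
    qed
  qed
qed

section \<open>Assembling the uniform estimates\<close>

lemma survival_prob_bounds: "0 \<le> survival_prob M Y t" "survival_prob M Y t \<le> 1"
  by (simp_all add: survival_prob_def)

text \<open>The lower bound is available for \<delta> at most 1/2; a larger \<delta> is replaced by
  1/2, since the claim weakens as \<delta> grows once the exit rate is nonnegative. The starting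
  point 0 belongs to both index sets and links the infimum to the supremum.\<close>

lemma survival_estimates:
  assumes \<delta>: "\<delta> > 0"
  shows "\<exists>\<epsilon>\<^sub>0>0. \<forall>\<epsilon>. 0 < \<epsilon> \<and> \<epsilon> \<le> \<epsilon>\<^sub>0 \<longrightarrow> (\<forall>t\<ge>0.
        (\<delta> \<le> 1 \<longrightarrow>
           (1 - \<delta>) * exp (- (D_rate \<nu> \<alpha> \<epsilon> powr (1 - \<delta>)) * t)
             \<le> (INF x\<in>{x. \<bar>x\<bar> \<le> 1 - \<delta>}. survival_prob M (X \<epsilon> x) t) \<and>
           (INF x\<in>{x. \<bar>x\<bar> \<le> 1 - \<delta>}. survival_prob M (X \<epsilon> x) t)
             \<le> (SUP x\<in>{x. \<bar>x\<bar> \<le> 1}. survival_prob M (X \<epsilon> x) t)) \<and>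
        (SUP x\<in>{x. \<bar>x\<bar> \<le> 1}. survival_prob M (X \<epsilon> x) t)
          \<le> (1 + \<delta>) * exp (- (D_rate \<nu> \<alpha> \<epsilon> powr (1 + \<delta>)) * t))"
proof -
  define \<delta>' where "\<delta>' = min \<delta> (1 / 2)"
  have \<delta>': "0 < \<delta>'" "\<delta>' \<le> 1 / 2" "\<delta>' \<le> \<delta>" using \<delta> by (auto simp: \<delta>'_def)
  have "\<forall>\<^sub>F \<epsilon> in at_right 0. 0 \<le> exit_rate \<epsilon>" by (rule eventually_exit_rate[OF eventually_ge_at_top])
  with survival_upper[OF \<delta>] survival_lower[OF \<delta>'(1,2)]
  have "\<forall>\<^sub>F \<epsilon> in at_right 0. \<forall>t\<ge>0.
        (\<delta> \<le> 1 \<longrightarrow>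
           (1 - \<delta>) * exp (- (D_rate \<nu> \<alpha> \<epsilon> powr (1 - \<delta>)) * t)
             \<le> (INF x\<in>{x. \<bar>x\<bar> \<le> 1 - \<delta>}. survival_prob M (X \<epsilon> x) t) \<and>
           (INF x\<in>{x. \<bar>x\<bar> \<le> 1 - \<delta>}. survival_prob M (X \<epsilon> x) t)
             \<le> (SUP x\<in>{x. \<bar>x\<bar> \<le> 1}. survival_prob M (X \<epsilon> x) t)) \<and>
        (SUP x\<in>{x. \<bar>x\<bar> \<le> 1}. survival_prob M (X \<epsilon> x) t)
          \<le> (1 + \<delta>) * exp (- (D_rate \<nu> \<alpha> \<epsilon> powr (1 + \<delta>)) * t)"
  proof eventually_elim
    case (elim \<epsilon>)
    let ?r = "exit_rate \<epsilon>"
    show ?case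
    proof (intro allI impI conjI)
      fix t :: real assume t: "t \<ge> 0"
      let ?s = "\<lambda>x. survival_prob M (X \<epsilon> x) t"
      have zero: "(0::real) \<in> {x. \<bar>x\<bar> \<le> 1}" by simp
      show "(SUP x\<in>{x. \<bar>x\<bar> \<le> 1}. ?s x) \<le> (1 + \<delta>) * exp (- (D_rate \<nu> \<alpha> \<epsilon> powr (1 + \<delta>)) * t)"
      proof (rule cSUP_least)
        show "{x::real. \<bar>x\<bar> \<le> 1} \<noteq> {}" using zero by blast
        fix x :: real
        show "?s x \<le> (1 + \<delta>) * exp (- (D_rate \<nu> \<alpha> \<epsilon> powr (1 + \<delta>)) * t)"
          unfolding D_rate_powr using elim(1) t by simp
      qed
      assume \<delta>1: "\<delta> \<le> 1"
      have zero': "(0::real) \<in> {x. \<bar>x\<bar> \<le> 1 - \<delta>}" using \<delta>1 by simp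
      have "bdd_below (?s ` {x. \<bar>x\<bar> \<le> 1 - \<delta>})" by (rule bdd_belowI2[of _ 0]) (rule survival_prob_bounds)
      then have "(INF x\<in>{x. \<bar>x\<bar> \<le> 1 - \<delta>}. ?s x) \<le> ?s 0" by (rule cINF_lower) (rule zero')
      also have "bdd_above (?s ` {x. \<bar>x\<bar> \<le> 1})" by (rule bdd_aboveI2[of _ _ 1]) (rule survival_prob_bounds)
      then have "?s 0 \<le> (SUP x\<in>{x. \<bar>x\<bar> \<le> 1}. ?s x)" by (rule cSUP_upper[OF zero])
      finally show "(INF x\<in>{x. \<bar>x\<bar> \<le> 1 - \<delta>}. ?s x) \<le> (SUP x\<in>{x. \<bar>x\<bar> \<le> 1}. ?s x)" .
      show "(1 - \<delta>) * exp (- (D_rate \<nu> \<alpha> \<epsilon> powr (1 - \<delta>)) * t) \<le> (INF x\<in>{x. \<bar>x\<bar> \<le> 1 - \<delta>}. ?s x)"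
      proof (rule cINF_greatest)
        show "{x::real. \<bar>x\<bar> \<le> 1 - \<delta>} \<noteq> {}" using zero' by blast
        fix x :: real assume x: "x \<in> {x. \<bar>x\<bar> \<le> 1 - \<delta>}"
        have "(1 - \<delta>) * exp (- exp (- ((1 - \<delta>) * ?r)) * t) \<le> (1 - \<delta>') * exp (- exp (- ((1 - \<delta>') * ?r)) * t)"
        proof (rule mult_mono)
          have "(1 - \<delta>) * ?r \<le> (1 - \<delta>') * ?r" using \<delta>' elim(3) by (intro mult_right_mono) auto
          then have "exp (- ((1 - \<delta>') * ?r)) * t \<le> exp (- ((1 - \<delta>) * ?r)) * t" using t by (intro mult_right_mono) auto
          then show "exp (- exp (- ((1 - \<delta>) * ?r)) * t) \<le> exp (- exp (- ((1 - \<delta>') * ?r)) * t)" by simp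
        qed (use \<delta>' in auto)
        also have "\<dots> \<le> ?s x" using elim(2) x t \<delta>' by simp
        finally show "(1 - \<delta>) * exp (- (D_rate \<nu> \<alpha> \<epsilon> powr (1 - \<delta>)) * t) \<le> ?s x" unfolding D_rate_powr .
      qed
    qed
  qed
  then obtain b where b: "b > 0" and *: "\<And>\<epsilon>. 0 < \<epsilon> \<Longrightarrow> \<epsilon> < b \<Longrightarrow> \<forall>t\<ge>0.
        (\<delta> \<le> 1 \<longrightarrow>
           (1 - \<delta>) * exp (- (D_rate \<nu> \<alpha> \<epsilon> powr (1 - \<delta>)) * t)
             \<le> (INF x\<in>{x. \<bar>x\<bar> \<le> 1 - \<delta>}. survival_prob M (X \<epsilon> x) t) \<and>
           (INF x\<in>{x. \<bar>x\<bar> \<le> 1 - \<delta>}. survival_prob M (X \<epsilon> x) t)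
             \<le> (SUP x\<in>{x. \<bar>x\<bar> \<le> 1}. survival_prob M (X \<epsilon> x) t)) \<and>
        (SUP x\<in>{x. \<bar>x\<bar> \<le> 1}. survival_prob M (X \<epsilon> x) t)
          \<le> (1 + \<delta>) * exp (- (D_rate \<nu> \<alpha> \<epsilon> powr (1 + \<delta>)) * t)"
    unfolding eventually_at_right_field by blast
  show ?thesis
  \<comment> \<open>The eventual statement covers \<epsilon> strictly below \<open>b\<close>, the
    claim includes the endpoint; hence half.\<close>
  proof (intro exI[of _ "b / 2"] conjI allI impI)
    show "b / 2 > 0" using b by simp
    fix \<epsilon> :: real assume "0 < \<epsilon> \<and> \<epsilon> \<le> b / 2"
    then have "0 < \<epsilon>" "\<epsilon> < b" using b by auto
    from *[OF this] show "\<And>t. 0 \<le> t \<Longrightarrow> \<delta> \<le> 1 \<Longrightarrow> (1 - \<delta>) * exp (- (D_rate \<nu> \<alpha> \<epsilon> powr (1 - \<delta>)) * t)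
             \<le> (INF x\<in>{x. \<bar>x\<bar> \<le> 1 - \<delta>}. survival_prob M (X \<epsilon> x) t)"
      "\<And>t. 0 \<le> t \<Longrightarrow> \<delta> \<le> 1 \<Longrightarrow> (INF x\<in>{x. \<bar>x\<bar> \<le> 1 - \<delta>}. survival_prob M (X \<epsilon> x) t)
             \<le> (SUP x\<in>{x. \<bar>x\<bar> \<le> 1}. survival_prob M (X \<epsilon> x) t)"
      "\<And>t. 0 \<le> t \<Longrightarrow> (SUP x\<in>{x. \<bar>x\<bar> \<le> 1}. survival_prob M (X \<epsilon> x) t)
          \<le> (1 + \<delta>) * exp (- (D_rate \<nu> \<alpha> \<epsilon> powr (1 + \<delta>)) * t)" by blast+
  qed
qed

end

theorem theorem2p2:
  fixes M :: "'a measure" and F :: "real \<Rightarrow> 'a measure"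
    and U :: "real \<Rightarrow> real" and L :: "real \<Rightarrow> 'a \<Rightarrow> real"
    and d \<mu> \<alpha> :: real and \<nu> :: "real measure"
    and X :: "real \<Rightarrow> real \<Rightarrow> real \<Rightarrow> 'a \<Rightarrow> real"
  assumes "usual_filtered_prob_space M F"
    and "\<alpha> > 1"
    and "potential U"
    and "L1 M F L d \<nu> \<mu>"
    and "L2 \<nu> \<alpha>"
    and "\<And>\<epsilon> x. \<epsilon> > 0 \<Longrightarrow> strong_solution M F U L \<epsilon> x (X \<epsilon> x)"
  shows
    "(\<forall>\<delta>>0. \<exists>\<epsilon>\<^sub>0>0. \<forall>\<epsilon>. 0 < \<epsilon> \<and> \<epsilon> \<le> \<epsilon>\<^sub>0 \<longrightarrow> (\<forall>t\<ge>0.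
        (\<delta> \<le> 1 \<longrightarrow>
           (1 - \<delta>) * exp (- (D_rate \<nu> \<alpha> \<epsilon> powr (1 - \<delta>)) * t)
             \<le> (INF x\<in>{x. \<bar>x\<bar> \<le> 1 - \<delta>}. survival_prob M (X \<epsilon> x) t) \<and>
           (INF x\<in>{x. \<bar>x\<bar> \<le> 1 - \<delta>}. survival_prob M (X \<epsilon> x) t)
             \<le> (SUP x\<in>{x. \<bar>x\<bar> \<le> 1}. survival_prob M (X \<epsilon> x) t)) \<and>
        (SUP x\<in>{x. \<bar>x\<bar> \<le> 1}. survival_prob M (X \<epsilon> x) t)
          \<le> (1 + \<delta>) * exp (- (D_rate \<nu> \<alpha> \<epsilon> powr (1 + \<delta>)) * t)))
     \<and> (\<forall>x. \<bar>x\<bar> < 1 \<longrightarrow>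
        ((\<lambda>\<epsilon>. ereal (inverse (d_const \<alpha>)) *
               (ereal (\<epsilon> * quantile \<nu> \<epsilon> / \<bar>ln \<epsilon>\<bar>) * ln_ext (mean_exit_time M (X \<epsilon> x))))
          \<longlongrightarrow> 1) (at_right 0))"
proof -
  have "levy_measure \<nu>" "symmetric_measure \<nu>" using assms(4) unfolding L1_def by blast+
  then have "light_tailed_levy_measure \<nu> \<alpha>" using assms(2,5) by (intro light_tailed_levy_measure.intro)
  then interpret exit_family M F \<nu> \<alpha> L d \<mu> U X
    using assms
    by (intro exit_family.intro exit_family_axioms.intro light_tailed_levy_process.intro light_tailed_levy_process_axioms.intro)
  show ?thesis
    by (intro conjI allI impI survival_estimates normalized_log_mean_tendsto)
qed

end
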